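(* Let $G$ be a finite group, $V$ a finite-dimensional complex representation of $G$, $u\in G$ a central element of order $2$ acting by $-1$ on $V$, and $B\in S^2V$. Suppose $(S^2V)^G=0$. Then there are only finitely many $\mathrm{Aut}(G,V)$-orbits in $S^2V$ that contain an element $B'$ such that the Hopf algebra $A(G,V,u,B)^*$ is twist equivalent to the Hopf algebra $A(G,V,u,B')^*$.
   Context: The ground field is $\mathbb{C}$. $S^2V$ denotes the space of symmetric tensors in $V\otimes V$. $\mathrm{Aut}(G,V)$ is the group of all pairs $(\phi,\eta)$ where $\phi:G\to G$ is an automorphism and $\eta:V\to\phi^*(V)$ is an isomorphism of $G$-representations ($\phi^*(V)$ is $V$ with $g$ acting as $\phi(g)$); it acts on $S^2V$ by $(\phi,\eta)\cdot B=(\eta\otimes\eta)(B)$. A twist for a finite-dimensional Hopf algebra $H$ is an invertible $F\in H\otimes H$ with $(\Delta\otimes\mathrm{id})(F)(F\otimes1)=(\mathrm{id}\otimes\Delta)(F)(1\otimes F)$; $H^F$ is the Hopf algebra with the same algebra structure and counit and coproduct $F^{-1}\Delta(\cdot)F$. Two Hopf algebras $H_1,H_2$ are twist equivalent if $H_2\cong H_1^F$ as Hopf algebras for some twist $F$ for $H_1$. $H^*$ is the dual Hopf algebra. Definition of $A(G,V,u,B)$. Let $\mathbb{C}[G\ltimes V]:=\mathbb{C}[G]\ltimes\Lambda V$ be the Hopf superalgebra generated by $G$ (even) and $V$ (odd), with $gvg^{-1}=g\cdot v$, $vw=-wv$, $\Delta(g)=g\otimes g$, $\Delta(v)=v\otimes1+1\otimes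 v$, $\varepsilon(g)=1$, $\varepsilon(v)=0$ (tensor products of superalgebras have the super multiplication). Let $J:=e^B\in\Lambda V\otimes\Lambda V\subset\mathbb{C}[G\ltimes V]^{\otimes2}$. The twisted Hopf superalgebra $\mathbb{C}[G\ltimes V]^J$ has the same multiplication and counit, and coproduct $\Delta^J(x)=J^{-1}\Delta(x)J$. For $x$ homogeneous of parity $p(x)$ write $\Delta^J(x)=\Delta^J_0(x)+\Delta^J_1(x)$, where the second tensor factor of $\Delta^J_0(x)$ is even and that of $\Delta_1^J(x)$ is odd. Then $A(G,V,u,B)$ is the ordinary Hopf algebra which, as an algebra with counit, is $\mathbb{C}[G]\ltimes\Lambda V$ (grading forgotten), with coproduct $\widetilde{\Delta^J}(x)=\Delta^J_0(x)-(-1)^{p(x)}(u\otimes1)\Delta^J_1(x)$. *)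

theory Defs
  imports Complex_Main
    "HOL-Algebra.Group_Action"
    "HOL-Algebra.Multiplicative_Group"
    "Jordan_Normal_Form.Matrix"
begin

section \<open>Finite-dimensional algebras and Hopf algebras\<close>

text \<open>
  A finite-dimensional algebra or Hopf algebra is given by a finite basis \<open>e i\<close>, \<open>i \<in> idx\<close>, and by
  its structure constants:
    \<open>e i * e j = (\<Sum>k. mulc i j k *: e k)\<close>,  \<open>1 = (\<Sum>k. unitc k *: e k)\<close>,
    \<open>\<Delta> (e i) = (\<Sum>j k. comulc i j k *: e j \<otimes> e k)\<close>,  \<open>\<epsilon> (e i) = counitc i\<close>.
  Elements are coordinate functions in \<open>idx \<rightarrow>\<^sub>E UNIV\<close>, and elements of a tensor product are
  coordinate functions on the product of the index sets.  Values of the structure constants at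
  indices outside \<open>idx\<close> are never used.  An antipode is not part of the data: it is uniquely
  determined by the rest and is preserved by every bialgebra homomorphism.
\<close>

record 'i alg =
  idx :: "'i set"
  mulc :: "'i \<Rightarrow> 'i \<Rightarrow> 'i \<Rightarrow> complex"
  unitc :: "'i \<Rightarrow> complex"

record 'i hopf = "'i alg" +
  comulc :: "'i \<Rightarrow> 'i \<Rightarrow> 'i \<Rightarrow> complex"
  counitc :: "'i \<Rightarrow> complex"

definition elems :: "('i, 'm) alg_scheme \<Rightarrow> ('i \<Rightarrow> complex) monoid" where
  "elems A = \<lparr>carrier = idx A \<rightarrow>\<^sub>E UNIV,
     monoid.mult = (\<lambda>a b. \<lambda>k\<in>idx A. \<Sum>i\<in>idx A. \<Sum>j\<in>idx A. a i * b j * mulc A i j k),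
     one = (\<lambda>k\<in>idx A. unitc A k)\<rparr>"

definition basis :: "('i, 'm) alg_scheme \<Rightarrow> 'i \<Rightarrow> ('i \<Rightarrow> complex)" where
  "basis A i = (\<lambda>k\<in>idx A. if k = i then 1 else 0)"

definition tensor_alg :: "('i, 'm) alg_scheme \<Rightarrow> ('j, 'n) alg_scheme \<Rightarrow> ('i \<times> 'j) alg" where
  "tensor_alg A A' = \<lparr>idx = idx A \<times> idx A',
     mulc = (\<lambda>(i, i') (j, j') (k, k'). mulc A i j k * mulc A' i' j' k'),
     unitc = (\<lambda>(k, k'). unitc A k * unitc A' k')\<rparr>"

definition comul :: "('i, 'm) hopf_scheme \<Rightarrow> ('i \<Rightarrow> complex) \<Rightarrow> ('i \<times> 'i \<Rightarrow> complex)" where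
  "comul H a = (\<lambda>(j, k)\<in>idx H \<times> idx H. \<Sum>i\<in>idx H. a i * comulc H i j k)"

definition counit :: "('i, 'm) hopf_scheme \<Rightarrow> ('i \<Rightarrow> complex) \<Rightarrow> complex" where
  "counit H a = (\<Sum>i\<in>idx H. a i * counitc H i)"

definition tensor_map :: "('i, 'm) alg_scheme \<Rightarrow> ('j, 'n) alg_scheme \<Rightarrow>
    (('i \<Rightarrow> complex) \<Rightarrow> ('j \<Rightarrow> complex)) \<Rightarrow> ('i \<times> 'i \<Rightarrow> complex) \<Rightarrow> ('j \<times> 'j \<Rightarrow> complex)"
  \<comment> \<open>\<open>f \<otimes> f\<close> for a linear map \<open>f : A \<rightarrow> A'\<close>\<close> where
  "tensor_map A A' f t = (\<lambda>(k, l)\<in>idx A' \<times> idx A'.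
     \<Sum>i\<in>idx A. \<Sum>j\<in>idx A. t (i, j) * f (basis A i) k * f (basis A j) l)"

definition hopf_iso :: "('i, 'm) hopf_scheme \<Rightarrow> ('j, 'n) hopf_scheme \<Rightarrow>
    (('i \<Rightarrow> complex) \<Rightarrow> ('j \<Rightarrow> complex)) \<Rightarrow> bool" where
  "hopf_iso H H' f \<longleftrightarrow>
     f \<in> iso (elems H) (elems H') \<and>
     f \<one>\<^bsub>elems H\<^esub> = \<one>\<^bsub>elems H'\<^esub> \<and>
     (\<forall>a\<in>carrier (elems H). \<forall>b\<in>carrier (elems H). \<forall>c.
        f (\<lambda>i\<in>idx H. a i + c * b i) = (\<lambda>j\<in>idx H'. f a j + c * f b j)) \<and>
     (\<forall>a\<in>carrier (elems H). comul H' (f a) = tensor_map H H' f (comul H a)) \<and>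
     (\<forall>a\<in>carrier (elems H). counit H' (f a) = counit H a)"

definition dual_hopf :: "('i, 'm) hopf_scheme \<Rightarrow> 'i hopf"
  \<comment> \<open>in the dual basis\<close> where
  "dual_hopf H = \<lparr>idx = idx H,
     mulc = (\<lambda>i j k. comulc H k i j), unitc = counitc H,
     comulc = (\<lambda>i j k. mulc H j k i), counitc = unitc H\<rparr>"

section \<open>Twists\<close>

definition hopf_twist :: "('i, 'm) hopf_scheme \<Rightarrow> ('i \<times> 'i \<Rightarrow> complex) \<Rightarrow> bool"
  \<comment> \<open>the four factors are \<open>(\<Delta> \<otimes> id) F\<close>, \<open>F \<otimes> 1\<close>, \<open>(id \<otimes> \<Delta>) F\<close> and \<open>1 \<otimes> F\<close>\<close> where
  "hopf_twist H F \<longleftrightarrow>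
     F \<in> Units (elems (tensor_alg H H)) \<and>
     (let I = idx H; I3 = I \<times> I \<times> I; H3 = elems (tensor_alg H (tensor_alg H H)) in
       (\<lambda>(a, b, c)\<in>I3. \<Sum>i\<in>I. F (i, c) * comulc H i a b)
         \<otimes>\<^bsub>H3\<^esub> (\<lambda>(a, b, c)\<in>I3. F (a, b) * unitc H c) =
       (\<lambda>(a, b, c)\<in>I3. \<Sum>i\<in>I. F (a, i) * comulc H i b c)
         \<otimes>\<^bsub>H3\<^esub> (\<lambda>(a, b, c)\<in>I3. unitc H a * F (b, c)))"

definition twisted_hopf :: "('i, 'm) hopf_scheme \<Rightarrow> ('i \<times> 'i \<Rightarrow> complex) \<Rightarrow> 'i hopf" where
  "twisted_hopf H F = (let H2 = elems (tensor_alg H H) in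
     \<lparr>idx = idx H, mulc = mulc H, unitc = unitc H,
      comulc = (\<lambda>i j k. (inv\<^bsub>H2\<^esub> F \<otimes>\<^bsub>H2\<^esub> comul H (basis H i) \<otimes>\<^bsub>H2\<^esub> F) (j, k)),
      counitc = counitc H\<rparr>)"

definition twist_equivalent :: "('i, 'm) hopf_scheme \<Rightarrow> ('j, 'n) hopf_scheme \<Rightarrow> bool" where
  "twist_equivalent H H' \<longleftrightarrow>
     (\<exists>F f. hopf_twist H F \<and> hopf_iso H' (twisted_hopf H F) f)"

section \<open>Representations, symmetric tensors and the group \<open>Aut(G,V)\<close>\<close>

text \<open>
  The representation space is \<open>V = \<complex>\<^sup>n\<close> (with \<open>n = 0\<close> allowed).  An element of \<open>V \<otimes> V\<close> is written
  as the \<open>n \<times> n\<close> matrix of its coordinates in the basis \<open>e i \<otimes> e j\<close>; then \<open>M \<otimes> M\<close> acts by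
  \<open>B \<mapsto> M B M\<^sup>T\<close>.
\<close>

abbreviation GL :: "nat \<Rightarrow> complex mat monoid" where
  "GL n \<equiv> units_of (ring_mat TYPE(complex) n ())"

definition representation :: "('g, 'x) monoid_scheme \<Rightarrow> nat \<Rightarrow> ('g \<Rightarrow> complex mat) \<Rightarrow> bool" where
  "representation G n \<rho> \<longleftrightarrow> \<rho> \<in> hom G (GL n)"

definition tensor_square :: "complex mat \<Rightarrow> complex mat \<Rightarrow> complex mat" where
  "tensor_square M B = M * B * transpose_mat M"

definition S2 :: "nat \<Rightarrow> complex mat set" where
  "S2 n = {B \<in> carrier_mat n n. transpose_mat B = B}"

definition S2_invariants ::
    "('g, 'x) monoid_scheme \<Rightarrow> nat \<Rightarrow> ('g \<Rightarrow> complex mat) \<Rightarrow> complex mat set" where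
  "S2_invariants G n \<rho> = {B \<in> S2 n. \<forall>g\<in>carrier G. tensor_square (\<rho> g) B = B}"

definition Aut_rep :: "('g, 'x) monoid_scheme \<Rightarrow> nat \<Rightarrow> ('g \<Rightarrow> complex mat) \<Rightarrow>
    (('g \<Rightarrow> 'g) \<times> complex mat) monoid" where
  "Aut_rep G n \<rho> = (AutoGroup G \<times>\<times> GL n)
     \<lparr>carrier := {(\<phi>, \<eta>). \<phi> \<in> auto G \<and> \<eta> \<in> carrier (GL n) \<and>
        (\<forall>g\<in>carrier G. \<eta> * \<rho> g = \<rho> (\<phi> g) * \<eta>)}\<rparr>"

definition Aut_rep_action ::
    "nat \<Rightarrow> (('g \<Rightarrow> 'g) \<times> complex mat) \<Rightarrow> (complex mat \<Rightarrow> complex mat)" where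
  "Aut_rep_action n = (\<lambda>(\<phi>, \<eta>). \<lambda>B\<in>S2 n. tensor_square \<eta> B)"

section \<open>The Hopf superalgebra \<open>\<complex>[G \<ltimes> V]\<close>\<close>

definition list_prod :: "('a, 'b) monoid_scheme \<Rightarrow> 'a list \<Rightarrow> 'a" where
  "list_prod M xs = foldr (monoid.mult M) xs \<one>\<^bsub>M\<^esub>"

definition ext_alg :: "nat \<Rightarrow> nat set alg"
  \<comment> \<open>The exterior algebra of \<open>\<complex>\<^sup>n\<close>; the basis element indexed by \<open>S\<close> is
     \<open>e s\<^sub>1 \<and> \<dots> \<and> e s\<^sub>k\<close> with \<open>S = {s\<^sub>1 < \<dots> < s\<^sub>k}\<close>.\<close> where
  "ext_alg n = \<lparr>idx = Pow {..<n},
     mulc = (\<lambda>S T U. if S \<inter> T = {} \<and> U = S \<union> T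
               then (-1) ^ card {(s, t). s \<in> S \<and> t \<in> T \<and> t < s} else 0),
     unitc = (\<lambda>S. if S = {} then 1 else 0)\<rparr>"

definition ext_act :: "nat \<Rightarrow> complex mat \<Rightarrow> nat set \<Rightarrow> (nat set \<Rightarrow> complex)"
  \<comment> \<open>\<open>M e s\<^sub>1 \<and> \<dots> \<and> M e s\<^sub>k\<close>\<close> where
  "ext_act n M S = list_prod (elems (ext_alg n))
     (map (\<lambda>s. \<lambda>U\<in>Pow {..<n}. \<Sum>r<n. if U = {r} then M $$ (r, s) else 0)
       (sorted_list_of_set S))"

record 'i super_hopf = "'i hopf" +
  parity :: "'i \<Rightarrow> nat"

definition super_tensor :: "('i, 'm) super_hopf_scheme \<Rightarrow> ('i \<times> 'i) alg" where
  "super_tensor A = \<lparr>idx = idx A \<times> idx A,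
     mulc = (\<lambda>(i, i') (j, j') (k, k').
        (-1) ^ (parity A i' * parity A j) * mulc A i j k * mulc A i' j' k'),
     unitc = (\<lambda>(k, k'). unitc A k * unitc A k')\<rparr>"

text \<open>
  The index \<open>(g, S)\<close> stands for the basis element \<open>g (e s\<^sub>1 \<and> \<dots> \<and> e s\<^sub>k)\<close>.  Since
  \<open>v h = h (h\<inverse> v)\<close>, the product is \<open>(g x) (h y) = (g h) ((h\<inverse> x) \<and> y)\<close> for \<open>x\<close>, \<open>y\<close> in the
  exterior algebra.  The coproduct is multiplicative, so the image of this basis element is
  \<open>(g \<otimes> g) (e s\<^sub>1 \<otimes> 1 + 1 \<otimes> e s\<^sub>1) \<dots> (e s\<^sub>k \<otimes> 1 + 1 \<otimes> e s\<^sub>k)\<close>; it is computed in the super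
  tensor square, which depends only on the fields fixed in \<open>group_ext_alg\<close>.
\<close>

definition group_ext_alg :: "('g, 'x) monoid_scheme \<Rightarrow> nat \<Rightarrow> ('g \<Rightarrow> complex mat) \<Rightarrow>
    ('g \<times> nat set) super_hopf"
  \<comment> \<open>without coproduct\<close> where
  "group_ext_alg G n \<rho> = \<lparr>idx = carrier G \<times> Pow {..<n},
     mulc = (\<lambda>(g, S) (h, T) (k, U). if k = g \<otimes>\<^bsub>G\<^esub> h
        then (ext_act n (\<rho> (inv\<^bsub>G\<^esub> h)) S \<otimes>\<^bsub>elems (ext_alg n)\<^esub> basis (ext_alg n) T) U else 0),
     unitc = (\<lambda>(g, S). if g = \<one>\<^bsub>G\<^esub> \<and> S = {} then 1 else 0),
     comulc = (\<lambda>_ _ _. 0),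
     counitc = (\<lambda>(g, S). if S = {} then 1 else 0),
     parity = (\<lambda>(g, S). card S mod 2)\<rparr>"

definition group_ext :: "('g, 'x) monoid_scheme \<Rightarrow> nat \<Rightarrow> ('g \<Rightarrow> complex mat) \<Rightarrow>
    ('g \<times> nat set) super_hopf" where
  "group_ext G n \<rho> = (let A = group_ext_alg G n \<rho>; A2 = super_tensor A in
     A\<lparr>comulc := (\<lambda>(g, S) j k.
        list_prod (elems A2)
          (basis A2 ((g, {}), (g, {})) #
           map (\<lambda>s. \<lambda>p\<in>idx A2. basis A2 ((\<one>\<^bsub>G\<^esub>, {s}), (\<one>\<^bsub>G\<^esub>, {})) p
                                + basis A2 ((\<one>\<^bsub>G\<^esub>, {}), (\<one>\<^bsub>G\<^esub>, {s})) p)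
             (sorted_list_of_set S)) (j, k))\<rparr>)"

section \<open>The Hopf algebra \<open>A(G,V,u,B)\<close>\<close>

definition alg_exp :: "('i, 'm) alg_scheme \<Rightarrow> ('i \<Rightarrow> complex) \<Rightarrow> ('i \<Rightarrow> complex)" where
  "alg_exp A a = (\<lambda>k\<in>idx A. \<Sum>m::nat. (a [^]\<^bsub>elems A\<^esub> m) k / fact m)"

definition J_twist :: "('g, 'x) monoid_scheme \<Rightarrow> nat \<Rightarrow> ('g \<Rightarrow> complex mat) \<Rightarrow> complex mat \<Rightarrow>
    (('g \<times> nat set) \<times> ('g \<times> nat set) \<Rightarrow> complex)" where
  "J_twist G n \<rho> B = (let A2 = super_tensor (group_ext G n \<rho>) in
     alg_exp A2 (\<lambda>p\<in>idx A2. \<Sum>r<n. \<Sum>s<n.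
        B $$ (r, s) * basis A2 ((\<one>\<^bsub>G\<^esub>, {r}), (\<one>\<^bsub>G\<^esub>, {s})) p))"

definition comul_J :: "('g, 'x) monoid_scheme \<Rightarrow> nat \<Rightarrow> ('g \<Rightarrow> complex mat) \<Rightarrow> complex mat \<Rightarrow>
    ('g \<times> nat set \<Rightarrow> complex) \<Rightarrow> (('g \<times> nat set) \<times> ('g \<times> nat set) \<Rightarrow> complex)" where
  "comul_J G n \<rho> B a = (let A = group_ext G n \<rho>; A2 = elems (super_tensor A); J = J_twist G n \<rho> B in
     inv\<^bsub>A2\<^esub> J \<otimes>\<^bsub>A2\<^esub> comul A a \<otimes>\<^bsub>A2\<^esub> J)"

definition hopf_A :: "('g, 'x) monoid_scheme \<Rightarrow> nat \<Rightarrow> ('g \<Rightarrow> complex mat) \<Rightarrow> 'g \<Rightarrow> complex mat \<Rightarrow>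
    ('g \<times> nat set) hopf"
  \<comment> \<open>The factor \<open>u \<otimes> 1\<close> is multiplied in the ordinary (not super) tensor square; \<open>\<Delta>0\<close> and \<open>\<Delta>1\<close>
     are the parts of \<open>comul_J\<close> with even and odd second tensor factor.\<close> where
  "hopf_A G n \<rho> u B = (let A = group_ext G n \<rho>; A2 = tensor_alg A A;
       \<Delta>0 = (\<lambda>x. \<lambda>(y, z)\<in>idx A2. if even (parity A z) then comul_J G n \<rho> B (basis A x) (y, z) else 0);
       \<Delta>1 = (\<lambda>x. \<lambda>(y, z)\<in>idx A2. if odd (parity A z) then comul_J G n \<rho> B (basis A x) (y, z) else 0)
     in \<lparr>idx = idx A, mulc = mulc A, unitc = unitc A,
         comulc = (\<lambda>x y z. \<Delta>0 x (y, z) - (-1) ^ parity A x *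
            (basis A2 ((u, {}), (\<one>\<^bsub>G\<^esub>, {})) \<otimes>\<^bsub>elems A2\<^esub> \<Delta>1 x) (y, z)),
         counitc = counitc A\<rparr>)"

end

theory Submission
  imports Defs "HOL-Library.Function_Algebras" "Jordan_Normal_Form.Determinant"
begin

text \<open>
  Work in the dual Hopf algebra, whose product \<open>star B\<close> is a twisted convolution of functions on
  \<open>G \<times> Pow {..<n}\<close>.  It is graded by the cosets of \<open>{1, u}\<close> in \<open>G\<close>, and the block of \<open>g\<close> is a Clifford
  algebra for the form \<open>B - g\<inverse> B g\<^sup>-\<^sup>T\<close>.  A twist \<open>F\<close> and an isomorphism \<open>f\<close> are only used through
  the slices of \<open>F\<close> at \<open>1\<close>, \<open>u\<close> and \<open>e r\<close>: the twist equation and the compatibility of \<open>f\<close> with the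
  coproducts turn into relations between these slices and translations, and the relations force \<open>f\<close> to
  permute the blocks, say \<open>h \<mapsto> g\<close>, and to be affine on their generators.

  In terms of matrices one obtains a symplectic \<open>2n \<times> 2n\<close> matrix \<open>x\<close> which carries the graph of \<open>B\<close> to
  the graph of \<open>B'\<close> and satisfies \<open>x (g \<oplus> g\<^sup>-\<^sup>T) = \<plusminus> (h \<oplus> h\<^sup>-\<^sup>T) x\<close>.  There are finitely many
  possibilities for the set of triples \<open>(g, h, \<plusminus>)\<close>.  If two matrices share this set, their quotient
  \<open>Z\<close> with blocks \<open>a, c, b, d\<close> commutes with \<open>G\<close>.  As \<open>(S\<^sup>2 V)\<^sup>G = 0\<close>, invariant bilinear forms on \<open>V\<close> and
  on its dual are antisymmetric, so \<open>c b\<close> is a central idempotent of \<open>End\<^sub>G V\<close>.  Commuting idempotents of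
  a fixed size form a finite set, and when the idempotents of two solutions agree, the quotient is block
  triangular and moves one \<open>B'\<close> to the other by an element of \<open>GL\<^sub>G V\<close>.
\<close>

section \<open>Algebras given by structure constants\<close>

text \<open>Associativity of the dual product, that is coassociativity of the twisted coproduct, is
  not given with \<open>hopf_A\<close> and has to be derived. To this end, multiplication by
  \<open>u\<close> and by vectors is transposed to operators on functions. The dual product is
  determined by its values at the group elements and by a skew Leibniz rule, so identities between
  products are proved by differentiating them. The slices of \<open>F\<close> at \<open>1\<close>,
  \<open>u\<close> and \<open>e r\<close> carry enough because \<open>u\<close> acts by
  \<open>-1\<close>: the form \<open>B - g^-1 B g^-T\<close> vanishes for \<open>g = 1\<close> and
  \<open>g = u\<close>, hence evaluation at \<open>1\<close> and \<open>u\<close> is a character and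
  evaluation at \<open>e r\<close> a skew derivation of the dual algebra, whatever \<open>B\<close>
  is. The symplectic matrix is built from the same values: it is scaled by a square root of
  \<open>F(u, u)\<close>, and its lower left block comes from the symmetrised
  \<open>F(e r, e q)\<close>. The condition on \<open>S^2 V\<close> acts through a repeated trick:
  an equivariant endomorphism times an invariant antisymmetric form is again invariant, hence
  antisymmetric, so the endomorphism can be moved across the form. This is what makes
  \<open>c b\<close> central and idempotent.\<close>

definition scl :: "complex => ('i => complex) => ('i => complex)" where
  "scl c a = (\<lambda>i. c * a i)"

definition sng :: "'i => ('i => complex)" where
  "sng i = (\<lambda>k. if k = i then 1 else 0)"

definition linop :: "(('i => complex) => ('j => complex)) => bool" where
  "linop T \<longleftrightarrow> (\<forall>x y. T (x + y) = T x + T y) \<and> (\<forall>c x. T (scl c x) = scl c (T x))"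

text \<open>Vectors are total functions vanishing off the index set rather than the extensional
  functions of \<open>elems\<close>: sums, scalars and \<open>0\<close> are then the pointwise ones,
  and linearity needs no carrier conditions.\<close>

definition supp_on :: "'i set => ('i => complex) => bool" where
  "supp_on I a \<longleftrightarrow> (\<forall>i. i \<notin> I --> a i = 0)"

lemma scl_apply: "scl c a i = c * a i"
  by (simp add: scl_def)

lemma scl_1 [simp]: "scl 1 a = a" and scl_0 [simp]: "scl 0 a = 0" and scl_zero [simp]: "scl c 0 = 0"
  by (auto simp: scl_def)

lemma scl_scl [simp]: "scl c (scl d a) = scl (c * d) a"
  by (auto simp: scl_def)

lemma scl_minus_1: "scl (-1) a = - a"
  by (auto simp: scl_def)

lemma scl_add: "scl c (a + b) = scl c a + scl c b" and scl_add_left: "scl (c + d) a = scl c a + scl d a"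
  and scl_minus: "scl c (- a) = - scl c a" and scl_minus_left: "scl (- c) a = - scl c a"
  and scl_diff: "scl c (a - b) = scl c a - scl c b"
  by (auto simp: scl_def algebra_simps)

lemma sum_apply: "(\<Sum>i\<in>A. f i) x = (\<Sum>i\<in>A. f i x :: complex)"
  by (induction A rule: infinite_finite_induct) auto

lemma scl_sum: "scl c (\<Sum>i\<in>A. f i) = (\<Sum>i\<in>A. scl c (f i))"
  by (rule ext) (simp add: scl_apply sum_apply sum_distrib_left)

lemma scl_sum_left: "scl (\<Sum>i\<in>A. c i) x = (\<Sum>i\<in>A. scl (c i) x)"
  by (rule ext) (simp add: scl_apply sum_apply sum_distrib_right)

lemma linopI: "(\<And>x y. T (x + y) = T x + T y) ==> (\<And>c x. T (scl c x) = scl c (T x)) ==> linop T"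
  by (auto simp: linop_def)

lemma linop_add: "linop T ==> T (x + y) = T x + T y"
  and linop_scl: "linop T ==> T (scl c x) = scl c (T x)"
  by (auto simp: linop_def)

lemma linop_0: "linop T ==> T 0 = 0"
  using linop_scl[of T 0 0] by simp

lemma linop_minus: "linop T ==> T (- x) = - T x"
  using linop_scl[of T "-1" x] by (simp add: scl_minus_1)

lemma linop_diff: "linop T ==> T (x - y) = T x - T y"
  using linop_add[of T x "- y"] linop_minus[of T y] by simp

lemma linop_sum: "linop T ==> T (\<Sum>i\<in>A. f i) = (\<Sum>i\<in>A. T (f i))"
  by (induction A rule: infinite_finite_induct) (auto simp: linop_0 linop_add)

lemma linop_comp: "linop S ==> linop T ==> linop (\<lambda>x. S (T x))"
  by (auto simp: linop_def)

lemma supp_expand: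
  assumes "finite I" "supp_on I a"
  shows "a = (\<Sum>i\<in>I. scl (a i) (sng i))"
proof
  fix k
  have "(\<Sum>i\<in>I. scl (a i) (sng i)) k = (\<Sum>i\<in>I. if i = k then a i else 0)"
    unfolding sum_apply by (intro sum.cong) (auto simp: sng_def scl_apply)
  also have "\<dots> = a k" using assms by (auto simp: sum.delta supp_on_def)
  finally show "a k = (\<Sum>i\<in>I. scl (a i) (sng i)) k" by simp
qed

text \<open>Identities that are linear in an argument are checked on basis vectors through this
  rule; multilinear ones apply it once per argument.\<close>

lemma linop_eqI:
  assumes "finite I" "supp_on I a" "linop S" "linop T" "\<And>i. i \<in> I ==> S (sng i) = T (sng i)"
  shows "S a = T a"
  apply (subst (1 2) supp_expand[OF assms(1,2)])
  using assms(3-5) by (simp add: linop_sum linop_scl)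

lemma supp_on_add: "supp_on I a ==> supp_on I b ==> supp_on I (a + b)"
  and supp_on_scl: "supp_on I a ==> supp_on I (scl c a)"
  and supp_on_minus: "supp_on I a ==> supp_on I (- a)"
  and supp_on_diff: "supp_on I a ==> supp_on I b ==> supp_on I (a - b)"
  and supp_on_0: "supp_on I 0"
  and supp_on_sng: "i \<in> I ==> supp_on I (sng i)"
  by (auto simp: supp_on_def sng_def scl_apply)

lemma supp_on_sum: "(\<And>i. i \<in> A ==> supp_on I (f i)) ==> supp_on I (\<Sum>i\<in>A. f i)"
  by (auto simp: supp_on_def sum_apply intro!: sum.neutral)

lemmas supp_on_intros = supp_on_add supp_on_scl supp_on_minus supp_on_diff supp_on_0 supp_on_sng supp_on_sum

text \<open>Values of the arguments off \<open>idx A\<close> are ignored and the result is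
  \<open>0\<close> there, so the product can be fed with restricted and with zero-extended
  representatives alike.\<close>

definition mulf :: "('i, 'm) alg_scheme => ('i => complex) => ('i => complex) => ('i => complex)" where
  "mulf A a b = (\<lambda>k. if k \<in> idx A then \<Sum>i\<in>idx A. \<Sum>j\<in>idx A. a i * b j * mulc A i j k else 0)"

definition zext :: "'i set => ('i => complex) => ('i => complex)" where
  "zext I x = (\<lambda>k. if k \<in> I then x k else 0)"

lemma supp_zext [simp, intro]: "supp_on I (zext I x)"
  by (auto simp: supp_on_def zext_def)

lemma zext_supp: "supp_on I x ==> zext I x = x"
  by (auto simp: supp_on_def zext_def)

lemma zext_restrict [simp]: "zext I (restrict x I) = zext I x"
  by (auto simp: zext_def)

lemma supp_mulf [simp, intro]: "supp_on (idx A) (mulf A a b)"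
  by (auto simp: supp_on_def mulf_def)

lemma mulf_add_left: "mulf A (a + b) c = mulf A a c + mulf A b c"
  and mulf_add_right: "mulf A c (a + b) = mulf A c a + mulf A c b"
  by (auto simp: mulf_def algebra_simps sum.distrib)

lemma mulf_scl_left: "mulf A (scl r a) c = scl r (mulf A a c)"
  and mulf_scl_right: "mulf A c (scl r a) = scl r (mulf A c a)"
  by (rule ext; simp add: mulf_def scl_apply algebra_simps sum_distrib_left)+

lemma linop_mulf_left: "linop (\<lambda>a. mulf A a c)" and linop_mulf_right: "linop (mulf A c)"
  by (auto simp: linop_def mulf_add_left mulf_add_right mulf_scl_left mulf_scl_right)

lemmas mulf_sum_left = linop_sum[OF linop_mulf_left]
lemmas mulf_sum_right = linop_sum[OF linop_mulf_right]
lemmas mulf_minus_left = linop_minus[OF linop_mulf_left]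
lemmas mulf_minus_right = linop_minus[OF linop_mulf_right]
lemmas mulf_0_left [simp] = linop_0[OF linop_mulf_left]
lemmas mulf_0_right [simp] = linop_0[OF linop_mulf_right]

lemma mulf_cong_idx: "(\<And>i. i \<in> idx A ==> a i = a' i) ==> (\<And>i. i \<in> idx A ==> b i = b' i) ==>
    mulf A a b = mulf A a' b'"
  by (auto simp: mulf_def intro!: sum.cong)

lemma mulf_sng:
  assumes "finite (idx A)" "i \<in> idx A" "j \<in> idx A"
  shows "mulf A (sng i) (sng j) = zext (idx A) (mulc A i j)"
proof
  fix k
  have "(\<Sum>i'\<in>idx A. \<Sum>j'\<in>idx A. sng i i' * sng j j' * mulc A i' j' k) =
      (\<Sum>i'\<in>idx A. if i' = i then (\<Sum>j'\<in>idx A. if j' = j then mulc A i j k else 0) else 0)"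
    by (intro sum.cong) (auto simp: sng_def intro!: sum.cong sum.neutral)
  also have "\<dots> = mulc A i j k" using assms by (simp add: sum.delta)
  finally show "mulf A (sng i) (sng j) k = zext (idx A) (mulc A i j) k"
    by (simp add: mulf_def zext_def)
qed

definition assoc_alg :: "('i, 'm) alg_scheme => bool" where
  "assoc_alg A \<longleftrightarrow> (\<forall>a b c. mulf A (mulf A a b) c = mulf A a (mulf A b c))"

definition unital_alg :: "('i, 'm) alg_scheme => bool" where
  "unital_alg A \<longleftrightarrow> (\<forall>a. supp_on (idx A) a -->
     mulf A (zext (idx A) (unitc A)) a = a \<and> mulf A a (zext (idx A) (unitc A)) = a)"

lemma assoc_algI:
  assumes "finite (idx A)"
    and "\<And>i j k. i \<in> idx A ==> j \<in> idx A ==> k \<in> idx A ==>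
      mulf A (mulf A (sng i) (sng j)) (sng k) = mulf A (sng i) (mulf A (sng j) (sng k))"
  shows "assoc_alg A"
  unfolding assoc_alg_def
proof (intro allI)
  fix a b c
  let ?z = "zext (idx A)"
  \<comment> \<open>The product does not see values off the index set, so all arguments may be
    replaced by supported ones and expanded in the basis.\<close>
  have z: "mulf A a b = mulf A (?z a) (?z b)" for a b
    by (rule mulf_cong_idx) (auto simp: zext_def)
  have m: "?z (mulf A a b) = mulf A a b" for a b by (simp add: zext_supp)
  have l: "linop (\<lambda>a. mulf A (mulf A a b) c)" "linop (\<lambda>a. mulf A a (mulf A b c))"
      "linop (\<lambda>b. mulf A (mulf A a b) c)" "linop (\<lambda>b. mulf A a (mulf A b c))"
      "linop (\<lambda>c. mulf A (mulf A a b) c)" "linop (\<lambda>c. mulf A a (mulf A b c))" for a b c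
    by (auto simp: linop_def mulf_add_left mulf_add_right mulf_scl_left mulf_scl_right)
  have s: "supp_on (idx A) (?z x)" for x by simp
  have 1: "mulf A (mulf A (sng i) (sng j)) (?z c) = mulf A (sng i) (mulf A (sng j) (?z c))"
    if "i \<in> idx A" "j \<in> idx A" for i j
    by (rule linop_eqI[OF assms(1) s l(5,6)]) (use that assms(2) in auto)
  have 2: "mulf A (mulf A (sng i) (?z b)) (?z c) = mulf A (sng i) (mulf A (?z b) (?z c))"
    if "i \<in> idx A" for i
    by (rule linop_eqI[OF assms(1) s l(3,4)]) (use that 1 in auto)
  have 3: "mulf A (mulf A (?z a) (?z b)) (?z c) = mulf A (?z a) (mulf A (?z b) (?z c))"
    by (rule linop_eqI[OF assms(1) s l(1,2)]) (use 2 in auto)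
  then show "mulf A (mulf A a b) c = mulf A a (mulf A b c)"
    by (metis z m)
qed

subsection \<open>Comparison with the monoid of elements\<close>

lemma elems_carrier: "carrier (elems A) = idx A \<rightarrow>\<^sub>E UNIV"
  by (simp add: elems_def)

lemma restrict_in_elems [simp]: "restrict a (idx A) \<in> carrier (elems A)"
  by (auto simp: elems_carrier)

lemma elems_mult: "a \<otimes>\<^bsub>elems A\<^esub> b = restrict (mulf A a b) (idx A)"
  by (rule ext) (simp add: elems_def mulf_def)

lemma elems_one: "\<one>\<^bsub>elems A\<^esub> = restrict (unitc A) (idx A)"
  by (simp add: elems_def)

lemma restrict_zext [simp]: "restrict (zext I a) I = restrict a I"
  by (auto simp: zext_def)

lemma restrict_mulf_restrict [simp]:
  "mulf A (restrict a (idx A)) b = mulf A a b" "mulf A a (restrict b (idx A)) = mulf A a b"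
  "mulf A (zext (idx A) a) b = mulf A a b" "mulf A a (zext (idx A) b) = mulf A a b"
  by (rule mulf_cong_idx; simp add: zext_def)+

lemma zext_mult: "zext (idx A) (a \<otimes>\<^bsub>elems A\<^esub> b) = mulf A (zext (idx A) a) (zext (idx A) b)"
  by (simp add: elems_mult zext_supp)

lemma elems_eqI: "a \<in> carrier (elems A) ==> b \<in> carrier (elems A) ==>
    zext (idx A) a = zext (idx A) b ==> a = b"
  unfolding elems_carrier zext_def by (rule PiE_ext) (auto dest!: fun_cong split: if_splits)

lemma restrict_carrier: "a \<in> carrier (elems A) ==> restrict a (idx A) = a"
  by (auto simp: elems_carrier)

lemma monoid_elems:
  assumes "assoc_alg A" "unital_alg A"
  shows "monoid (elems A)"
proof (rule monoidI)
  fix x y z assume c: "x \<in> carrier (elems A)" "y \<in> carrier (elems A)" "z \<in> carrier (elems A)"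
  show "x \<otimes>\<^bsub>elems A\<^esub> y \<in> carrier (elems A)" by (simp add: elems_mult)
  show "x \<otimes>\<^bsub>elems A\<^esub> y \<otimes>\<^bsub>elems A\<^esub> z = x \<otimes>\<^bsub>elems A\<^esub> (y \<otimes>\<^bsub>elems A\<^esub> z)"
    using assms(1) by (simp add: elems_mult assoc_alg_def)
next
  fix x assume x: "x \<in> carrier (elems A)"
  have "mulf A (unitc A) x = mulf A (zext (idx A) (unitc A)) (zext (idx A) x)" "mulf A x (unitc A) = mulf A (zext (idx A) x) (zext (idx A) (unitc A))" by simp_all
  then have "mulf A (unitc A) x = zext (idx A) x" "mulf A x (unitc A) = zext (idx A) x"
    using assms(2) by (simp_all add: unital_alg_def del: restrict_mulf_restrict)
  then show "\<one>\<^bsub>elems A\<^esub> \<otimes>\<^bsub>elems A\<^esub> x = x" "x \<otimes>\<^bsub>elems A\<^esub> \<one>\<^bsub>elems A\<^esub> = x"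
    using x by (simp_all add: elems_mult elems_one restrict_carrier)
qed (simp add: elems_one)

lemma zext_list_prod:
  "zext (idx A) (list_prod (elems A) xs) =
    foldr (\<lambda>x. mulf A (zext (idx A) x)) xs (zext (idx A) (unitc A))"
proof (induction xs)
  case (Cons x xs)
  then show ?case by (simp add: list_prod_def zext_mult del: restrict_mulf_restrict)
qed (simp only: list_prod_def foldr.simps id_apply elems_one zext_restrict)

section \<open>Anticommuting operators\<close>

text \<open>Needed twice: for left multiplication by the columns of a matrix in the exterior
  algebra, and for the operators \<open>DD\<close>, where the sorted product over \<open>S\<close>
  is the transposed coproduct of a basis element.\<close>

locale anticommuting =
  fixes T :: "nat => ('i => complex) => ('i => complex)"
  assumes lin: "linop (T s)" and anti: "T s (T t x) = - T t (T s x)"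
begin

lemma square_zero: "T s (T s x) = 0"
proof -
  have "T s (T s x) = - T s (T s x)" by (rule anti)
  then show ?thesis by (auto simp: fun_eq_iff)
qed

text \<open>Sorting \<open>s\<close> into the list passes it over exactly the entries below
  \<open>s\<close>, and each passage costs a sign.\<close>

lemma foldr_insort:
  assumes "sorted xs" "distinct xs" "s \<notin> set xs"
  shows "T s (foldr T xs x) = scl ((-1) ^ card {t \<in> set xs. t < s}) (foldr T (insort s xs) x)"
  using assms
proof (induction xs)
  case (Cons a xs)
  show ?case
  proof (cases "s \<le> a")
    case True
    then have "{t \<in> set (a # xs). t < s} = {}" using Cons.prems by auto
    then have "card {t \<in> set (a # xs). t < s} = 0" by (simp only: card.empty)
    moreover have "insort s (a # xs) = s # a # xs" using True by simp
    ultimately show ?thesis by (simp only: power_0 scl_1 foldr.simps o_apply)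
  next
    case False
    have e: "{t \<in> set (a # xs). t < s} = insert a {t \<in> set xs. t < s}" using False by auto
    have c: "card {t \<in> set (a # xs). t < s} = Suc (card {t \<in> set xs. t < s})"
      unfolding e using Cons.prems by (subst card_insert_disjoint) auto
    have "T s (foldr T (a # xs) x) = - T a (T s (foldr T xs x))" by (simp add: anti[of s a])
    also have "\<dots> = - scl ((-1) ^ card {t \<in> set xs. t < s}) (T a (foldr T (insort s xs) x))"
      using Cons by (simp add: linop_scl[OF lin])
    also have "\<dots> = scl ((-1) ^ card {t \<in> set (a # xs). t < s}) (foldr T (insort s (a # xs)) x)"
      unfolding c using False by (simp add: scl_minus_left)
    finally show ?thesis .
  qed
qed simp

lemma foldr_mem: "s \<in> set xs ==> T s (foldr T xs x) = 0"
proof (induction xs)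
  case (Cons a xs)
  show ?case
  proof (cases "s = a")
    case False
    then have "T s (foldr T xs x) = 0" using Cons by auto
    then show ?thesis using anti[of s a "foldr T xs x"] by (simp add: linop_0[OF lin])
  qed (simp add: square_zero)
qed simp

definition asc :: "nat set => ('i => complex) => ('i => complex)" where
  "asc S = foldr T (sorted_list_of_set S)"

lemma asc_empty [simp]: "asc {} x = x"
  by (simp add: asc_def)

lemma asc_left:
  assumes "finite S"
  shows "T s (asc S x) = (if s \<in> S then 0 else scl ((-1) ^ card {t \<in> S. t < s}) (asc (insert s S) x))"
  using foldr_insort[of "sorted_list_of_set S" s x] foldr_mem[of s "sorted_list_of_set S" x] assms
  by (simp add: asc_def sorted_list_of_set.fold_insort_key.insert)

lemma asc_insert_min:
  assumes "finite S" "\<And>t. t \<in> S ==> s < t"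
  shows "asc (insert s S) x = T s (asc S x)"
proof -
  have "{t \<in> S. t < s} = {}" "s \<notin> S" using assms(2) by force+
  then have "card {t \<in> S. t < s} = 0" "s \<notin> S" by auto
  then show ?thesis using asc_left[OF assms(1), of s x] by (simp only: power_0 scl_1 if_False)
qed

lemma foldr_commute: "T s (foldr T xs x) = scl ((-1) ^ length xs) (foldr T xs (T s x))"
proof (induction xs)
  case (Cons a xs)
  have "T s (foldr T (a # xs) x) = - T a (T s (foldr T xs x))" by (simp add: anti[of s a])
  also have "\<dots> = - scl ((-1) ^ length xs) (T a (foldr T xs (T s x)))"
    unfolding Cons.IH by (simp only: linop_scl[OF lin])
  also have "\<dots> = scl ((-1) ^ length (a # xs)) (foldr T (a # xs) (T s x))"
    by (simp add: scl_minus_left)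
  finally show ?case .
qed simp

text \<open>Moving \<open>T s\<close> from the inner to the outer end passes all
  \<open>card S\<close> operators; sorting it in from there gives the rest of the sign. The operator
  \<open>Dr\<close> below is defined with exactly this sign.\<close>

lemma asc_right:
  assumes "finite S"
  shows "asc S (T s x) = (if s \<in> S then 0 else scl ((-1) ^ (card S + card {t \<in> S. t < s})) (asc (insert s S) x))"
proof -
  have "asc S (T s x) = scl ((-1) ^ card S) (T s (asc S x))"
    using foldr_commute[of s "sorted_list_of_set S" x] assms by (simp add: asc_def power_mult_distrib[symmetric] )
  then show ?thesis using asc_left[OF assms] by (simp add: power_add)
qed

end

section \<open>The exterior algebra\<close>

abbreviation WG :: "nat => (nat set => complex) => (nat set => complex) => (nat set => complex)" where
  "WG n \<equiv> mulf (ext_alg n)"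

lemma idx_ext [simp]: "idx (ext_alg n) = Pow {..<n}"
  by (simp add: ext_alg_def)

text \<open>The inversions of the shuffle that sorts \<open>S\<close> followed by \<open>T\<close>.
  Additivity over disjoint unions in each argument is what makes the wedge product
  associative.\<close>

definition inv_no :: "nat set => nat set => nat" where
  "inv_no S T = card {(s, t). s \<in> S \<and> t \<in> T \<and> t < s}"

lemma finite_inv_no: "finite S ==> finite T ==> finite {(s, t). s \<in> S \<and> t \<in> T \<and> (t::nat) < s}"
  by (rule finite_subset[of _ "S \<times> T"]) auto

lemma inv_no_Un_left:
  assumes "finite S" "finite T" "finite U" "S \<inter> T = {}"
  shows "inv_no (S \<union> T) U = inv_no S U + inv_no T U"
  unfolding inv_no_def
  by (subst card_Un_disjoint[symmetric]) (use assms in \<open>auto intro!: arg_cong[where f=card] finite_inv_no\<close>)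

lemma inv_no_Un_right:
  assumes "finite S" "finite T" "finite U" "T \<inter> U = {}"
  shows "inv_no S (T \<union> U) = inv_no S T + inv_no S U"
  unfolding inv_no_def
  by (subst card_Un_disjoint[symmetric]) (use assms in \<open>auto intro!: arg_cong[where f=card] finite_inv_no\<close>)

lemma inv_no_sing_left: "inv_no {s} T = card {t \<in> T. t < s}"
  unfolding inv_no_def by (rule bij_betw_same_card[of snd]) (auto simp: bij_betw_def inj_on_def image_iff)

lemma inv_no_sing_right: "inv_no S {t} = card {s \<in> S. t < s}"
  unfolding inv_no_def by (rule bij_betw_same_card[of fst]) (auto simp: bij_betw_def inj_on_def image_iff)

lemma WG_sng:
  assumes "S \<subseteq> {..<n}" "T \<subseteq> {..<n}"
  shows "WG n (sng S) (sng T) = (if S \<inter> T = {} then scl ((-1) ^ inv_no S T) (sng (S \<union> T)) else 0)"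
  using assms by (subst mulf_sng) (auto simp: zext_def ext_alg_def sng_def fun_eq_iff inv_no_def scl_apply)

lemma assoc_ext: "assoc_alg (ext_alg n)"
proof (rule assoc_algI)
  fix S T U assume "S \<in> idx (ext_alg n)" "T \<in> idx (ext_alg n)" "U \<in> idx (ext_alg n)"
  then have s: "S \<subseteq> {..<n}" "T \<subseteq> {..<n}" "U \<subseteq> {..<n}" by auto
  then have f: "finite S" "finite T" "finite U" by (auto intro: finite_subset)
  have "WG n (WG n (sng S) (sng T)) (sng U) = (if S \<inter> T = {} \<and> S \<inter> U = {} \<and> T \<inter> U = {} then
      scl ((-1) ^ (inv_no S T + inv_no S U + inv_no T U)) (sng (S \<union> T \<union> U)) else 0)"
    using s f by (auto simp: WG_sng mulf_scl_left inv_no_Un_left power_add Int_Un_distrib2 algebra_simps)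
  also have "\<dots> = WG n (sng S) (WG n (sng T) (sng U))"
    using s f by (auto simp: WG_sng mulf_scl_right inv_no_Un_right power_add Int_Un_distrib algebra_simps Un_assoc)
  finally show "WG n (WG n (sng S) (sng T)) (sng U) = WG n (sng S) (WG n (sng T) (sng U))" .
qed simp

lemma WG_assoc: "WG n (WG n a b) c = WG n a (WG n b c)"
  using assoc_ext by (simp add: assoc_alg_def)

lemma unit_ext: "zext (Pow {..<n}) (unitc (ext_alg n)) = sng {}"
  by (auto simp: ext_alg_def zext_def sng_def)

lemma inv_no_empty [simp]: "inv_no {} T = 0" "inv_no S {} = 0"
  by (auto simp: inv_no_def)

lemma WG_one_left: "supp_on (Pow {..<n}) a ==> WG n (sng {}) a = a"
proof -
  assume s: "supp_on (Pow {..<n}) a"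
  have "linop (\<lambda>x :: nat set => complex. x)" by (simp add: linop_def)
  from linop_eqI[OF _ s linop_mulf_right[of "ext_alg n" "sng {}"] this] show ?thesis by (auto simp: WG_sng)
qed

lemma WG_one_right: "supp_on (Pow {..<n}) a ==> WG n a (sng {}) = a"
proof -
  assume s: "supp_on (Pow {..<n}) a"
  have "linop (\<lambda>x :: nat set => complex. x)" by (simp add: linop_def)
  from linop_eqI[OF _ s linop_mulf_left[of "ext_alg n" "sng {}"] this] show ?thesis by (auto simp: WG_sng)
qed

subsection \<open>The action of matrices\<close>

definition colv :: "nat => complex mat => nat => (nat set => complex)" where
  "colv n M s = (\<Sum>r<n. scl (M $$ (r, s)) (sng {r}))"

lemma supp_colv [simp]: "supp_on (Pow {..<n}) (colv n M s)"
  unfolding colv_def by (intro supp_on_intros) auto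

definition extm :: "nat => complex mat => nat set => (nat set => complex)" where
  "extm n M S = zext (Pow {..<n}) (ext_act n M S)"

lemma WG_sing_anti: "r < n ==> q < n ==> WG n (sng {r}) (sng {q}) = - WG n (sng {q}) (sng {r})"
proof -
  assume rq: "r < n" "q < n"
  have i: "inv_no {a} {b} = (if b < a then 1 else 0)" for a b
  proof -
    have "{t \<in> {b}. t < a} = (if b < a then {b} else {})" by auto
    then show ?thesis by (simp add: inv_no_sing_left)
  qed
  consider "r = q" | "r < q" | "q < r" by linarith
  then show ?thesis
    using rq by cases (auto simp: WG_sng i scl_minus_1 insert_commute)
qed

lemma WG_colv_anti: "WG n (colv n M s) (colv n M' t) = - WG n (colv n M' t) (colv n M s)"
proof -
  have "WG n (colv n M s) (colv n M' t) = (\<Sum>r<n. \<Sum>q<n. scl (M $$ (r, s) * M' $$ (q, t)) (WG n (sng {r}) (sng {q})))"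
    unfolding colv_def mulf_sum_left mulf_sum_right mulf_scl_left mulf_scl_right scl_sum scl_scl
    by (subst sum.swap) (simp only: mult.commute)
  also have "\<dots> = - (\<Sum>r<n. \<Sum>q<n. scl (M' $$ (q, t) * M $$ (r, s)) (WG n (sng {q}) (sng {r})))"
  proof -
    have "scl (M $$ (r, s) * M' $$ (q, t)) (WG n (sng {r}) (sng {q})) =
        - scl (M' $$ (q, t) * M $$ (r, s)) (WG n (sng {q}) (sng {r}))" if "r \<in> {..<n}" "q \<in> {..<n}" for r q
      using that by (simp add: WG_sing_anti[of r n q] scl_minus mult.commute)
    then have "(\<Sum>r<n. \<Sum>q<n. scl (M $$ (r, s) * M' $$ (q, t)) (WG n (sng {r}) (sng {q}))) =
        (\<Sum>r<n. \<Sum>q<n. - scl (M' $$ (q, t) * M $$ (r, s)) (WG n (sng {q}) (sng {r})))"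
      by (intro sum.cong refl)
    then show ?thesis by (simp only: sum_negf)
  qed
  also have "(\<Sum>r<n. \<Sum>q<n. scl (M' $$ (q, t) * M $$ (r, s)) (WG n (sng {q}) (sng {r}))) =
      WG n (colv n M' t) (colv n M s)"
    unfolding colv_def mulf_sum_left mulf_sum_right mulf_scl_left mulf_scl_right scl_sum scl_scl
    by (simp only: mult.commute)
  finally show ?thesis .
qed

text \<open>The wedge of the images of basis vectors under \<open>M\<close> becomes a sorted product
  of operators applied to the unit, so the sign rules of \<open>asc\<close> apply uniformly in
  \<open>M\<close>.\<close>

interpretation colv: anticommuting "\<lambda>s. WG n (colv n M s)" for n M
proof
  fix n M s t x
  have "WG n (WG n (colv n M s) (colv n M t)) x = WG n (- WG n (colv n M t) (colv n M s)) x"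
    by (subst WG_colv_anti) (rule refl)
  then show "WG n (colv n M s) (WG n (colv n M t) x) = - WG n (colv n M t) (WG n (colv n M s) x)"
    by (simp only: WG_assoc mulf_minus_left)
qed (rule linop_mulf_right)

lemma extm_asc: "extm n M S = colv.asc n M S (sng {})"
proof -
  have z: "zext (Pow {..<n}) (\<lambda>U\<in>Pow {..<n}. \<Sum>r<n. if U = {r} then M $$ (r, s) else 0) = colv n M s" for s
  proof
    fix U
    have "(\<Sum>r<n. if U = {r} then M $$ (r, s) else 0) = colv n M s U" for U
      unfolding colv_def sum_apply by (intro sum.cong) (auto simp: sng_def scl_apply)
    moreover have "U \<notin> Pow {..<n} ==> colv n M s U = 0" using supp_colv[of n M s] by (auto simp: supp_on_def)
    ultimately show "zext (Pow {..<n}) (\<lambda>U\<in>Pow {..<n}. \<Sum>r<n. if U = {r} then M $$ (r, s) else 0) U = colv n M s U"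
      by (auto simp: zext_def)
  qed
  show ?thesis
    using zext_list_prod[of "ext_alg n"] unfolding extm_def ext_act_def colv.asc_def
    by (simp add: foldr_map o_def z unit_ext del: zext_restrict)
qed

lemma supp_colv_foldr: "supp_on (Pow {..<n}) (foldr (\<lambda>s. WG n (colv n M s)) xs (sng {}))"
  using supp_mulf[of "ext_alg n"] by (cases xs) (auto intro: supp_on_sng)

lemma supp_extm [simp]: "supp_on (Pow {..<n}) (extm n M S)"
  by (simp add: extm_def)

lemma WG_colv_foldr: "WG n (foldr (\<lambda>s. WG n (colv n M s)) xs (sng {})) y =
   (if xs = [] then WG n (sng {}) y else foldr (\<lambda>s. WG n (colv n M s)) xs y)"
proof (induction xs)
  case (Cons a xs)
  have "WG n (colv n M a) (WG n (sng {}) y) = WG n (colv n M a) y"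
    by (simp add: WG_assoc[symmetric] WG_one_right)
  then show ?case using Cons by (auto simp: WG_assoc)
qed simp

lemma WG_extm: "supp_on (Pow {..<n}) y ==> WG n (extm n M S) y = colv.asc n M S y"
  unfolding extm_asc colv.asc_def by (simp add: WG_colv_foldr WG_one_left)

text \<open>The sign is the one of the basis vectors themselves and does not involve
  \<open>M\<close>; for this reason \<open>extl\<close> is multiplicative.\<close>

lemma colv_asc_asc:
  assumes "finite S" "finite T"
  shows "colv.asc n M S (colv.asc n M T x) =
    (if S \<inter> T = {} then scl ((-1) ^ inv_no S T) (colv.asc n M (S \<union> T) x) else 0)"
  using assms(1)
proof (induction S rule: finite_linorder_min_induct)
  case (insert s S)
  have sS: "s \<notin> S" using insert(2) by auto
  have m: "colv.asc n M (insert s S) y = WG n (colv n M s) (colv.asc n M S y)" for y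
    using colv.asc_insert_min[OF insert(1)] insert(2) by simp
  show ?case
  proof (cases "insert s S \<inter> T = {}")
    case True
    have "{t \<in> S \<union> T. t < s} = {t \<in> T. t < s}" using insert(2) by auto
    moreover have "inv_no (insert s S) T = inv_no {s} T + inv_no S T"
      using inv_no_Un_left[of "{s}" S T] insert(1,2) assms(2) by auto
    ultimately show ?thesis using True insert assms(2) sS
      by (simp add: m linop_scl[OF colv.lin] colv.asc_left inv_no_sing_left power_add mult.commute)
  next
    case False
    then show ?thesis using insert assms(2)
      by (auto simp: m linop_scl[OF colv.lin] linop_0[OF colv.lin] colv.asc_left)
  qed
qed (simp add: inv_no_def)

definition extl :: "nat => complex mat => (nat set => complex) => (nat set => complex)" where
  "extl n M x = (\<Sum>S\<in>Pow {..<n}. scl (x S) (extm n M S))"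

lemma linop_extl: "linop (extl n M)"
  by (auto simp: linop_def extl_def scl_add_left sum.distrib scl_sum scl_apply)

lemma supp_extl [simp]: "supp_on (Pow {..<n}) (extl n M x)"
  unfolding extl_def by (intro supp_on_intros) auto

lemma extl_sng: "S \<subseteq> {..<n} ==> extl n M (sng S) = extm n M S"
proof -
  assume S: "S \<subseteq> {..<n}"
  have "extl n M (sng S) = (\<Sum>T\<in>Pow {..<n}. if T = S then extm n M S else 0)"
    unfolding extl_def by (intro sum.cong) (auto simp: sng_def)
  then show ?thesis using S by (simp add: sum.delta)
qed

lemma extl_mult:
  assumes "supp_on (Pow {..<n}) x" "supp_on (Pow {..<n}) y"
  shows "extl n M (WG n x y) = WG n (extl n M x) (extl n M y)"
proof -
  have l: "linop (\<lambda>x. extl n M (WG n x y))" "linop (\<lambda>x. WG n (extl n M x) (extl n M y))"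
    "linop (\<lambda>y. extl n M (WG n x y))" "linop (\<lambda>y. WG n (extl n M x) (extl n M y))" for x y
    by (auto simp: linop_def mulf_add_left mulf_add_right mulf_scl_left mulf_scl_right
        linop_add[OF linop_extl] linop_scl[OF linop_extl])
  have b: "extl n M (WG n (sng S) (sng T)) = WG n (extl n M (sng S)) (extl n M (sng T))"
    if s: "S \<subseteq> {..<n}" "T \<subseteq> {..<n}" for S T
  proof -
    have f: "finite S" "finite T" using s by (auto intro: finite_subset)
    show ?thesis using s f
      by (simp add: WG_sng extl_sng WG_extm linop_scl[OF linop_extl] linop_0[OF linop_extl])
         (simp add: extm_asc colv_asc_asc)
  qed
  show ?thesis
    apply (rule linop_eqI[OF _ assms(1) l(1,2)], simp)
    apply (rule linop_eqI[OF _ assms(2) l(3,4)], simp)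
    by (simp add: b)
qed

lemma extm_sing: "s < n ==> extm n M {s} = colv n M s"
  by (simp add: extm_asc colv.asc_def WG_one_right)

lemma extm_empty: "extm n M {} = sng {}"
  by (simp add: extm_asc)

lemma extl_colv:
  assumes "M \<in> carrier_mat n n" "N \<in> carrier_mat n n" "s < n"
  shows "extl n M (colv n N s) = colv n (M * N) s"
proof -
  have "extl n M (colv n N s) = (\<Sum>r<n. scl (N $$ (r, s)) (colv n M r))"
    unfolding colv_def[of n N] by (simp add: linop_sum[OF linop_extl] linop_scl[OF linop_extl] extl_sng extm_sing)
  also have "\<dots> = (\<Sum>q<n. scl (\<Sum>r<n. N $$ (r, s) * M $$ (q, r)) (sng {q}))"
    unfolding colv_def scl_sum scl_sum_left by (subst sum.swap) simp
  also have "\<dots> = colv n (M * N) s"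
    unfolding colv_def using assms
    by (intro sum.cong refl arg_cong2[where f=scl])
       (auto simp: scalar_prod_def lessThan_atLeast0 mult.commute intro!: sum.cong)
  finally show ?thesis .
qed

lemma extl_extl:
  assumes M: "M \<in> carrier_mat n n" "N \<in> carrier_mat n n" and x: "supp_on (Pow {..<n}) x"
  shows "extl n M (extl n N x) = extl n (M * N) x"
proof -
  have "extl n M (extm n N S) = extm n (M * N) S" if "S \<subseteq> {..<n}" for S
  proof -
    have "extl n M (foldr (\<lambda>s. WG n (colv n N s)) xs (sng {})) = foldr (\<lambda>s. WG n (colv n (M * N) s)) xs (sng {})"
      if "set xs \<subseteq> {..<n}" for xs
      using that
    proof (induction xs)
      case (Cons a xs)
      have a: "a < n" using Cons.prems by auto
      have "extl n M (foldr (\<lambda>s. WG n (colv n N s)) (a # xs) (sng {})) =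
          extl n M (WG n (colv n N a) (foldr (\<lambda>s. WG n (colv n N s)) xs (sng {})))" by (simp only: foldr.simps o_apply)
      also have "\<dots> = WG n (colv n (M * N) a) (extl n M (foldr (\<lambda>s. WG n (colv n N s)) xs (sng {})))"
        by (simp only: extl_mult[OF supp_colv supp_colv_foldr] extl_colv[OF M a])
      finally show ?case using Cons by (simp only: foldr.simps o_apply) auto
    next
      case Nil
      show ?case by (simp only: foldr.simps id_apply extl_sng extm_empty empty_subsetI)
    qed
    from this[of "sorted_list_of_set S"] show ?thesis
      using that finite_subset[OF that] by (simp only: extm_asc colv.asc_def) auto
  qed
  then have "extl n M (extl n N (sng S)) = extl n (M * N) (sng S)" if "S \<in> Pow {..<n}" for S
    using that by (simp only: extl_sng Pow_iff)
  moreover have "linop (\<lambda>x. extl n M (extl n N x))" by (rule linop_comp[OF linop_extl linop_extl])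
  ultimately show ?thesis
    using linop_eqI[OF _ x _ linop_extl[of n "M * N"], of "\<lambda>x. extl n M (extl n N x)"] by simp
qed

lemma colv_one: "s < n ==> colv n (1\<^sub>m n) s = sng {s}"
proof -
  assume "s < n"
  then have "colv n (1\<^sub>m n) s = (\<Sum>r<n. if r = s then sng {s} else 0)"
    unfolding colv_def by (intro sum.cong) auto
  then show ?thesis using \<open>s < n\<close> by (simp add: sum.delta)
qed

lemma extm_one:
  assumes "S \<subseteq> {..<n}"
  shows "extm n (1\<^sub>m n) S = sng S"
proof -
  have f: "finite S" using assms by (rule finite_subset) simp
  from f assms show ?thesis unfolding extm_asc
  proof (induction S rule: finite_linorder_min_induct)
    case (insert s S)
    have e: "card {t \<in> S. t < s} = 0" using insert(2) by (auto simp: card_eq_0_iff)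
    have "colv.asc n (1\<^sub>m n) (insert s S) (sng {}) = WG n (colv n (1\<^sub>m n) s) (colv.asc n (1\<^sub>m n) S (sng {}))"
      using colv.asc_insert_min[OF insert(1)] insert(2) by simp
    also have "\<dots> = WG n (sng {s}) (sng S)" using insert by (simp add: colv_one)
    also have "\<dots> = sng (insert s S)" 
    proof -
      have "inv_no {s} S = 0" "{s} \<inter> S = {}" using e insert(2) by (auto simp: inv_no_sing_left)
      then show ?thesis using insert.prems by (simp add: WG_sng)
    qed
    finally show ?case .
  qed simp
qed

lemma extl_one: "supp_on (Pow {..<n}) x ==> extl n (1\<^sub>m n) x = x"
proof -
  assume s: "supp_on (Pow {..<n}) x"
  have "linop (\<lambda>x :: nat set => complex. x)" by (simp add: linop_def)
  from linop_eqI[OF _ s linop_extl this] show ?thesis by (auto simp: extl_sng extm_one)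
qed

declare plus_fun_apply [simp del] zero_fun_apply [simp del] minus_apply [simp del] uminus_apply [simp del]

section \<open>The algebra \<open>\<complex>[G \<ltimes> V]\<close>\<close>

locale grep = group G for G (structure) +
  fixes n :: nat and \<rho> :: "'a => complex mat"
  assumes fin: "finite (carrier G)" and rep: "representation G n \<rho>"
begin

lemma rho_carrier [simp]: "g \<in> carrier G ==> \<rho> g \<in> carrier_mat n n"
  using rep unfolding representation_def hom_def units_of_def Units_def
  by (auto simp: ring_mat_def)

lemma rho_mult: "g \<in> carrier G ==> h \<in> carrier G ==> \<rho> (g \<otimes> h) = \<rho> g * \<rho> h"
  using rep unfolding representation_def hom_def by (auto simp: units_of_def ring_mat_def)

lemma rho_one: "\<rho> \<one> = 1\<^sub>m n"
proof -
  interpret R: ring "ring_mat TYPE(complex) n ()" by (rule ring_mat)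
  interpret GLg: group "GL n" by (rule R.units_group)
  have "group_hom G (GL n) \<rho>"
    using rep GLg.is_group is_group by (auto simp: group_hom_def group_hom_axioms_def representation_def)
  then have "\<rho> \<one> = \<one>\<^bsub>GL n\<^esub>" by (rule group_hom.hom_one)
  then show ?thesis by (simp add: units_of_def ring_mat_def)
qed

abbreviation "AA \<equiv> group_ext_alg G n \<rho>"

definition Idx :: "('a \<times> nat set) set" where "Idx = carrier G \<times> Pow {..<n}"

lemma idx_AA [simp]: "idx AA = Idx"
  by (simp add: group_ext_alg_def Idx_def)

lemma finite_Idx [simp]: "finite Idx"
  using fin by (simp add: Idx_def)

text \<open>The element \<open>g x\<close> with \<open>x\<close> in the exterior algebra. In this
  form the structure constants collapse to the single rule \<open>mulAA_put\<close>.\<close>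

definition put :: "'a => (nat set => complex) => ('a \<times> nat set => complex)" where
  "put g x = (\<lambda>(k, U). if k = g then x U else 0)"

lemma linop_put: "linop (put g)"
  by (auto simp: linop_def put_def scl_def plus_fun_apply fun_eq_iff)

lemma put_sng: "put g (sng S) = sng (g, S)"
  by (auto simp: put_def sng_def)

lemma mulAA_sng:
  assumes "g \<in> carrier G" "h \<in> carrier G" "S \<subseteq> {..<n}" "T \<subseteq> {..<n}"
  shows "mulf AA (sng (g, S)) (sng (h, T)) = put (g \<otimes> h) (WG n (extm n (\<rho> (inv h)) S) (sng T))"
proof -
  have b: "basis (ext_alg n) T = restrict (sng T) (Pow {..<n})"
    by (auto simp: basis_def sng_def)
  have "WG n (ext_act n (\<rho> (inv h)) S) (basis (ext_alg n) T) = WG n (extm n (\<rho> (inv h)) S) (sng T)"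
    unfolding extm_def b by (rule mulf_cong_idx) (auto simp: zext_def)
  moreover have "U \<notin> Pow {..<n} ==> WG n x y U = 0" for x y U
    using supp_mulf[of "ext_alg n" x y] by (auto simp: supp_on_def)
  moreover have "mulc AA (g, S) (h, T) (k, U) = (if k = g \<otimes> h then
      (ext_act n (\<rho> (inv h)) S \<otimes>\<^bsub>elems (ext_alg n)\<^esub> basis (ext_alg n) T) U else 0)" for k U
    by (simp add: group_ext_alg_def)
  ultimately show ?thesis
    using assms by (subst mulf_sng) (auto simp: zext_def put_def fun_eq_iff elems_mult Idx_def fin)
qed

lemma mulAA_put:
  assumes "g \<in> carrier G" "h \<in> carrier G" "supp_on (Pow {..<n}) x" "supp_on (Pow {..<n}) y"
  shows "mulf AA (put g x) (put h y) = put (g \<otimes> h) (WG n (extl n (\<rho> (inv h)) x) y)"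
proof -
  have l: "linop (\<lambda>x. mulf AA (put g x) (put h y))" "linop (\<lambda>x. put (g \<otimes> h) (WG n (extl n (\<rho> (inv h)) x) y))"
    "linop (\<lambda>y. mulf AA (put g x) (put h y))" "linop (\<lambda>y. put (g \<otimes> h) (WG n (extl n (\<rho> (inv h)) x) y))" for x y
    unfolding linop_def
    by (simp_all add: mulf_add_left mulf_add_right mulf_scl_left mulf_scl_right
        linop_add[OF linop_extl] linop_scl[OF linop_extl] linop_add[OF linop_put] linop_scl[OF linop_put])
  show ?thesis
    apply (rule linop_eqI[OF _ assms(3) l(1,2)], simp)
    apply (rule linop_eqI[OF _ assms(4) l(3,4)], simp)
    using assms by (simp add: put_sng mulAA_sng extl_sng)
qed

text \<open>Both bracketings are brought to the form \<open>put\<close>; they agree because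
  \<open>extl\<close> is multiplicative in the vector argument and in the matrix.\<close>

lemma assoc_AA: "assoc_alg AA"
proof (rule assoc_algI)
  fix i j k assume "i \<in> idx AA" "j \<in> idx AA" "k \<in> idx AA"
  then obtain g S h T l U where e: "i = (g, S)" "j = (h, T)" "k = (l, U)"
    and c [simp]: "g \<in> carrier G" "h \<in> carrier G" "l \<in> carrier G"
    and s: "S \<subseteq> {..<n}" "T \<subseteq> {..<n}" "U \<subseteq> {..<n}" by (auto simp: Idx_def)
  have sp: "supp_on (Pow {..<n}) (sng S)" "supp_on (Pow {..<n}) (sng T)" "supp_on (Pow {..<n}) (sng U)"
    "\<And>x y. supp_on (Pow {..<n}) (WG n x y)"
    using s supp_mulf[of "ext_alg n"] by (auto intro: supp_on_sng)
  have 1: "mulf AA (mulf AA (sng i) (sng j)) (sng k) = put (g \<otimes> h \<otimes> l)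
     (WG n (extl n (\<rho> (inv l)) (WG n (extl n (\<rho> (inv h)) (sng S)) (sng T))) (sng U))"
    unfolding e put_sng[symmetric] by (simp add: mulAA_put sp)
  have 2: "mulf AA (sng i) (mulf AA (sng j) (sng k)) = put (g \<otimes> (h \<otimes> l))
     (WG n (extl n (\<rho> (inv (h \<otimes> l))) (sng S)) (WG n (extl n (\<rho> (inv l)) (sng T)) (sng U)))"
    unfolding e put_sng[symmetric] by (simp add: mulAA_put sp)
  have 3: "extl n (\<rho> (inv l)) (WG n (extl n (\<rho> (inv h)) (sng S)) (sng T)) =
      WG n (extl n (\<rho> (inv l)) (extl n (\<rho> (inv h)) (sng S))) (extl n (\<rho> (inv l)) (sng T))"
    by (rule extl_mult) (simp_all add: sp)
  have 4: "extl n (\<rho> (inv l)) (extl n (\<rho> (inv h)) (sng S)) = extl n (\<rho> (inv (h \<otimes> l))) (sng S)"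
    by (simp add: extl_extl sp inv_mult_group rho_mult)
  show "mulf AA (mulf AA (sng i) (sng j)) (sng k) = mulf AA (sng i) (mulf AA (sng j) (sng k))"
    unfolding 1 2 3 4 WG_assoc m_assoc[OF c] by (rule refl)
qed simp

definition gam :: "'a => ('a \<times> nat set => complex)" where "gam g = sng (g, {})"
definition vec1 :: "nat => ('a \<times> nat set => complex)" where "vec1 s = sng (\<one>, {s})"

lemma unit_AA: "zext Idx (unitc AA) = gam \<one>"
  by (auto simp: zext_def gam_def sng_def group_ext_alg_def Idx_def fun_eq_iff)

lemma unital_AA: "unital_alg AA"
  unfolding unital_alg_def idx_AA unit_AA
proof (intro allI impI conjI)
  fix a assume a: "supp_on Idx a"
  have id: "linop (\<lambda>x :: 'a \<times> nat set => complex. x)" by (simp add: linop_def)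
  have sp: "supp_on (Pow {..<n}) (sng {})" by (intro supp_on_sng) simp
  show "mulf AA (gam \<one>) a = a"
  proof (rule linop_eqI[OF finite_Idx a linop_mulf_right id])
    fix i assume "i \<in> Idx"
    then obtain g S where e: "i = (g, S)" "g \<in> carrier G" "S \<subseteq> {..<n}" by (auto simp: Idx_def)
    then have s: "supp_on (Pow {..<n}) (sng S)" by (intro supp_on_sng) simp
    show "mulf AA (gam \<one>) (sng i) = sng i"
      unfolding e gam_def put_sng[symmetric] using e
      by (simp add: mulAA_put[OF _ _ sp s] extl_sng extm_empty WG_one_left[OF s])
  qed
  show "mulf AA a (gam \<one>) = a"
  proof (rule linop_eqI[OF finite_Idx a linop_mulf_left id])
    fix i assume "i \<in> Idx"
    then obtain g S where e: "i = (g, S)" "g \<in> carrier G" "S \<subseteq> {..<n}" by (auto simp: Idx_def)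
    then have s: "supp_on (Pow {..<n}) (sng S)" by (intro supp_on_sng) simp
    show "mulf AA (sng i) (gam \<one>) = sng i"
      unfolding e gam_def put_sng[symmetric] using e
      by (simp add: mulAA_put[OF _ _ s sp] rho_one extl_one[OF s] WG_one_right[OF s])
  qed
qed

abbreviation "mA \<equiv> mulf AA"

lemma mA_assoc: "mA (mA a b) c = mA a (mA b c)"
  using assoc_AA by (simp add: assoc_alg_def)

lemma mA_one: "supp_on Idx a ==> mA (gam \<one>) a = a" "supp_on Idx a ==> mA a (gam \<one>) = a"
  using unital_AA by (auto simp: unital_alg_def unit_AA)

lemma gam_vec1: "g \<in> carrier G ==> S \<subseteq> {..<n} ==> mA (gam g) (sng (\<one>, S)) = sng (g, S)"
  unfolding gam_def put_sng[symmetric]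
  by (subst mulAA_put) (auto simp: rho_one extl_sng extm_empty intro!: supp_on_sng WG_one_left arg_cong[where f="put g"])

lemma gam_gam: "g \<in> carrier G ==> h \<in> carrier G ==> mA (gam g) (gam h) = gam (g \<otimes> h)"
  unfolding gam_def put_sng[symmetric]
  by (subst mulAA_put) (auto simp: extl_sng extm_empty intro!: supp_on_sng WG_one_left arg_cong[where f="put (g \<otimes> h)"])

lemma sng_vec1: "g \<in> carrier G ==> S \<subseteq> {..<n} ==> s < n ==> mA (sng (g, S)) (vec1 s) =
    (if s \<in> S then 0 else scl ((-1) ^ card {t \<in> S. s < t}) (sng (g, insert s S)))"
  unfolding vec1_def put_sng[symmetric]
  by (subst mulAA_put)
     (auto simp: rho_one extl_one supp_on_sng WG_sng inv_no_sing_right linop_0[OF linop_put] linop_scl[OF linop_put])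

lemma vec1_sng: "g \<in> carrier G ==> S \<subseteq> {..<n} ==> s < n ==> mA (vec1 s) (sng (g, S)) =
    (\<Sum>r<n. scl (\<rho> (inv g) $$ (r, s)) (if r \<in> S then 0 else scl ((-1) ^ card {t \<in> S. t < r}) (sng (g, insert r S))))"
proof -
  assume a: "g \<in> carrier G" "S \<subseteq> {..<n}" "s < n"
  then have sp: "supp_on (Pow {..<n}) (sng S)" "supp_on (Pow {..<n}) (sng {s})" by (auto intro: supp_on_sng)
  have "mA (vec1 s) (sng (g, S)) = put g (WG n (colv n (\<rho> (inv g)) s) (sng S))"
    unfolding vec1_def put_sng[symmetric] using a by (subst mulAA_put) (auto simp: sp extl_sng extm_sing)
  also have "\<dots> = (\<Sum>r<n. scl (\<rho> (inv g) $$ (r, s)) (put g (WG n (sng {r}) (sng S))))"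
    unfolding colv_def mulf_sum_left mulf_scl_left linop_sum[OF linop_put] linop_scl[OF linop_put] by (rule refl)
  also have "\<dots> = (\<Sum>r<n. scl (\<rho> (inv g) $$ (r, s)) (if r \<in> S then 0 else scl ((-1) ^ card {t \<in> S. t < r}) (sng (g, insert r S))))"
    using a by (intro sum.cong refl)
      (auto simp: WG_sng inv_no_sing_left linop_0[OF linop_put] linop_scl[OF linop_put] put_sng)
  finally show ?thesis .
qed

lemma vec1_anti: "s < n ==> t < n ==> mA (vec1 s) (vec1 t) = - mA (vec1 t) (vec1 s)"
proof -
  have "mA (vec1 s) (vec1 t) = put \<one> (WG n (sng {s}) (sng {t}))" if "s < n" "t < n" for s t
    unfolding vec1_def put_sng[symmetric] using that
    by (subst mulAA_put) (auto simp: rho_one extl_one supp_on_sng)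
  then show "s < n ==> t < n ==> mA (vec1 s) (vec1 t) = - mA (vec1 t) (vec1 s)"
    using WG_sing_anti[of s n t] by (simp add: linop_minus[OF linop_put])
qed

lemma vec1_gam: "g \<in> carrier G ==> s < n ==>
   mA (vec1 s) (gam g) = mA (gam g) (\<Sum>r<n. scl (\<rho> (inv g) $$ (r, s)) (vec1 r))"
  unfolding mulf_sum_right mulf_scl_right gam_def
  using vec1_sng[of g "{}" s] gam_vec1[of g "{r}" for r]
  by (auto simp: vec1_def gam_def intro!: sum.cong)

end

section \<open>Super tensor squares\<close>

definition tens :: "('i => complex) => ('j => complex) => ('i \<times> 'j => complex)" where
  "tens a b = (\<lambda>(i, j). a i * b j)"

lemma tens_sng: "tens (sng i) (sng j) = sng (i, j)"
  by (auto simp: tens_def sng_def)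

lemma linop_tens_left: "linop (\<lambda>a. tens a b)" and linop_tens_right: "linop (tens a)"
  by (auto simp: linop_def tens_def scl_def algebra_simps plus_fun_apply fun_eq_iff)

lemmas tens_sum_left = linop_sum[OF linop_tens_left]
  and tens_sum_right = linop_sum[OF linop_tens_right]
  and tens_scl_left = linop_scl[OF linop_tens_left]
  and tens_scl_right = linop_scl[OF linop_tens_right]
  and tens_minus_left = linop_minus[OF linop_tens_left]
  and tens_minus_right = linop_minus[OF linop_tens_right]
  and tens_0_left = linop_0[OF linop_tens_left]
  and tens_0_right = linop_0[OF linop_tens_right]

lemma supp_tens: "supp_on I a ==> supp_on J b ==> supp_on (I \<times> J) (tens a b)"
  by (auto simp: supp_on_def tens_def)

definition homg :: "('i => nat) => nat => ('i => complex) => bool" where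
  "homg par d a \<longleftrightarrow> (\<forall>i. a i ~= 0 --> even (par i) = even d)"

lemma idx_super [simp]: "idx (super_tensor A) = idx A \<times> idx A"
  by (simp add: super_tensor_def)

lemma mulf_super:
  assumes "homg (parity A) p y" "homg (parity A) q z"
  shows "mulf (super_tensor A) (tens x y) (tens z w) = scl ((-1) ^ (p * q)) (tens (mulf A x z) (mulf A y w))"
proof
  fix kk :: "'a \<times> 'a"
  obtain k k' where kk: "kk = (k, k')" by force
  have sg: "y i' * z j * (-1) ^ (parity A i' * parity A j) = y i' * z j * (-1 :: complex) ^ (p * q)" for i' j
    using assms unfolding homg_def by (cases "y i' = 0 \<or> z j = 0") (auto simp: minus_one_power_iff)
  let ?I = "idx A"
  have "(\<Sum>ii\<in>?I \<times> ?I. \<Sum>jj\<in>?I \<times> ?I. tens x y ii * tens z w jj * mulc (super_tensor A) ii jj (k, k')) =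
     (\<Sum>i\<in>?I. \<Sum>i'\<in>?I. \<Sum>j\<in>?I. \<Sum>j'\<in>?I. x i * y i' * (z j * w j') *
        ((-1) ^ (parity A i' * parity A j) * mulc A i j k * mulc A i' j' k'))"
    unfolding sum.cartesian_product' by (simp add: tens_def super_tensor_def)
  also have "\<dots> = (\<Sum>i\<in>?I. \<Sum>i'\<in>?I. \<Sum>j\<in>?I. \<Sum>j'\<in>?I. (-1) ^ (p * q) * ((x i * z j * mulc A i j k) * (y i' * w j' * mulc A i' j' k')))"
  proof (intro sum.cong refl)
    fix i i' j j'
    have "x i * y i' * (z j * w j') * ((-1) ^ (parity A i' * parity A j) * mulc A i j k * mulc A i' j' k') =
      (y i' * z j * (-1) ^ (parity A i' * parity A j)) * (x i * w j' * mulc A i j k * mulc A i' j' k')" by simp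
    also have "\<dots> = (-1) ^ (p * q) * ((x i * z j * mulc A i j k) * (y i' * w j' * mulc A i' j' k'))"
      unfolding sg by simp
    finally show "x i * y i' * (z j * w j') * ((-1) ^ (parity A i' * parity A j) * mulc A i j k * mulc A i' j' k') =
      (-1) ^ (p * q) * ((x i * z j * mulc A i j k) * (y i' * w j' * mulc A i' j' k'))" .
  qed
  also have "\<dots> = (-1) ^ (p * q) * ((\<Sum>i\<in>?I. \<Sum>j\<in>?I. x i * z j * mulc A i j k) * (\<Sum>i'\<in>?I. \<Sum>j'\<in>?I. y i' * w j' * mulc A i' j' k'))"
  proof -
    have "(\<Sum>i\<in>?I. \<Sum>i'\<in>?I. \<Sum>j\<in>?I. \<Sum>j'\<in>?I. c * (f i j * h i' j')) = c * ((\<Sum>i\<in>?I. \<Sum>j\<in>?I. f i j) * (\<Sum>i'\<in>?I. \<Sum>j'\<in>?I. h i' j'))"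
      for c :: complex and f h
    proof -
      have P: "(\<Sum>i\<in>?I. \<Sum>j\<in>?I. c * (p i * q j)) = c * (sum p ?I * sum q ?I)" for p q
        by (subst sum_product) (simp only: sum_distrib_left)
      show ?thesis unfolding P by (rule refl)
    qed
    then show ?thesis .
  qed
  finally show "mulf (super_tensor A) (tens x y) (tens z w) kk = scl ((-1) ^ (p * q)) (tens (mulf A x z) (mulf A y w)) kk"
    unfolding kk by (simp add: mulf_def scl_apply tens_def)
qed

lemma homg_sng: "homg par (par i) (sng i)"
  by (simp add: homg_def sng_def)

text \<open>The sign exponents \<open>p(a') p(b) + (p(a') + p(b')) p(c)\<close> and
  \<open>p(b') p(c) + p(a') (p(b) + p(c))\<close> are equal. The grading of the product enters to
  know the parities of \<open>a' b'\<close> and of \<open>b c\<close>.\<close>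

lemma assoc_super:
  assumes "finite (idx A)" "assoc_alg A"
    and hom: "\<And>i j. i \<in> idx A ==> j \<in> idx A ==> homg (parity A) (parity A i + parity A j) (mulf A (sng i) (sng j))"
  shows "assoc_alg (super_tensor A)"
proof (rule assoc_algI)
  show "finite (idx (super_tensor A))" using assms by simp
  fix i j k assume "i \<in> idx (super_tensor A)" "j \<in> idx (super_tensor A)" "k \<in> idx (super_tensor A)"
  then obtain a a' b b' c c' where e: "i = (a, a')" "j = (b, b')" "k = (c, c')"
    and m: "a \<in> idx A" "a' \<in> idx A" "b \<in> idx A" "b' \<in> idx A" "c \<in> idx A" "c' \<in> idx A" by auto
  have as: "mulf A (mulf A x y) z = mulf A x (mulf A y z)" for x y z
    using assms(2) by (simp add: assoc_alg_def)
  let ?p = "parity A"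
  have 1: "mulf (super_tensor A) (mulf (super_tensor A) (sng i) (sng j)) (sng k) =
     scl ((-1) ^ (?p a' * ?p b) * (-1) ^ ((?p a' + ?p b') * ?p c))
      (tens (mulf A (mulf A (sng a) (sng b)) (sng c)) (mulf A (mulf A (sng a') (sng b')) (sng c')))"
    unfolding e tens_sng[symmetric]
    by (simp add: mulf_super[OF homg_sng homg_sng] mulf_scl_left mulf_super[OF hom homg_sng] m)
  have 2: "mulf (super_tensor A) (sng i) (mulf (super_tensor A) (sng j) (sng k)) =
     scl ((-1) ^ (?p b' * ?p c) * (-1) ^ (?p a' * (?p b + ?p c)))
      (tens (mulf A (sng a) (mulf A (sng b) (sng c))) (mulf A (sng a') (mulf A (sng b') (sng c'))))"
    unfolding e tens_sng[symmetric]
    by (simp add: mulf_super[OF homg_sng homg_sng] mulf_scl_right mulf_super[OF homg_sng hom] m)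
  show "mulf (super_tensor A) (mulf (super_tensor A) (sng i) (sng j)) (sng k) =
      mulf (super_tensor A) (sng i) (mulf (super_tensor A) (sng j) (sng k))"
    unfolding 1 2 as by (simp add: power_add[symmetric] algebra_simps)
qed

lemma tens_unit: "zext (idx A \<times> idx A) (unitc (super_tensor A)) = tens (zext (idx A) (unitc A)) (zext (idx A) (unitc A))"
  by (auto simp: zext_def super_tensor_def tens_def)

lemma unital_super:
  assumes "finite (idx A)" "unital_alg A" "homg (parity A) 0 (zext (idx A) (unitc A))"
  shows "unital_alg (super_tensor A)"
  unfolding unital_alg_def idx_super tens_unit
proof (intro allI impI)
  fix a assume a: "supp_on (idx A \<times> idx A) a"
  let ?u = "zext (idx A) (unitc A)"
  have id: "linop (\<lambda>x :: 'a \<times> 'a => complex. x)" by (simp add: linop_def)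
  have f: "finite (idx A \<times> idx A)" using assms(1) by simp
  have u: "mulf A ?u (sng i) = sng i" "mulf A (sng i) ?u = sng i" if "i \<in> idx A" for i
    using assms(2) supp_on_sng[OF that] by (simp_all add: unital_alg_def del: restrict_mulf_restrict)
  show "mulf (super_tensor A) (tens ?u ?u) a = a \<and> mulf (super_tensor A) a (tens ?u ?u) = a"
  proof
    show "mulf (super_tensor A) (tens ?u ?u) a = a"
    proof (rule linop_eqI[OF f a linop_mulf_right id])
      fix i assume "i \<in> idx A \<times> idx A"
      then obtain j k where e: "i = (j, k)" "j \<in> idx A" "k \<in> idx A" by auto
      have "mulf (super_tensor A) (tens ?u ?u) (tens (sng j) (sng k)) = tens (sng j) (sng k)"
        using u e by (subst mulf_super[OF assms(3) homg_sng]) (simp del: restrict_mulf_restrict)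
      then show "mulf (super_tensor A) (tens ?u ?u) (sng i) = sng i" by (simp add: tens_sng e)
    qed
    show "mulf (super_tensor A) a (tens ?u ?u) = a"
    proof (rule linop_eqI[OF f a linop_mulf_left id])
      fix i assume "i \<in> idx A \<times> idx A"
      then obtain j k where e: "i = (j, k)" "j \<in> idx A" "k \<in> idx A" by auto
      have "mulf (super_tensor A) (tens (sng j) (sng k)) (tens ?u ?u) = tens (sng j) (sng k)"
        using u e by (subst mulf_super[OF homg_sng assms(3)]) (simp del: restrict_mulf_restrict)
      then show "mulf (super_tensor A) (sng i) (tens ?u ?u) = sng i" by (simp add: tens_sng e)
    qed
  qed
qed

section \<open>Exponentials of commuting square-zero elements\<close>

locale ualg =
  fixes A :: "('i, 'm) alg_scheme" and one :: "'i => complex"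
  assumes fin_idx: "finite (idx A)" and asc: "assoc_alg A" and uni: "unital_alg A"
    and one_def: "one = zext (idx A) (unitc A)"
begin

abbreviation "m \<equiv> mulf A"

lemma as: "m (m a b) c = m a (m b c)"
  using asc by (simp add: assoc_alg_def)

lemma one_left: "supp_on (idx A) a ==> m one a = a" and one_right: "supp_on (idx A) a ==> m a one = a"
  using uni by (simp_all add: unital_alg_def one_def del: restrict_mulf_restrict)

lemma supp_one: "supp_on (idx A) one"
  by (simp add: one_def)

primrec pw :: "('i => complex) => nat => ('i => complex)" where
  "pw a 0 = one" | "pw a (Suc k) = m (pw a k) a"

lemma supp_pw: "supp_on (idx A) (pw a k)"
  by (cases k) (auto simp: supp_one)

definition nilp :: "('i => complex) => bool" where
  "nilp a \<longleftrightarrow> (\<exists>N. \<forall>k\<ge>N. pw a k = 0)"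

text \<open>Zero-extended version of \<open>alg_exp\<close>. It is evaluated on \<open>nilp\<close>
  elements, where \<open>Ex_fin\<close> makes the series a finite sum.\<close>

definition Ex :: "('i => complex) => ('i => complex)" where
  "Ex a = (\<lambda>i. \<Sum>k. pw a k i / fact k)"

lemma zext_pow: "zext (idx A) (restrict a (idx A) [^]\<^bsub>elems A\<^esub> k) = pw a k"
proof (induction k)
  case 0
  interpret M: monoid "elems A" by (rule monoid_elems[OF asc uni])
  show ?case by (simp only: M.nat_pow_0 elems_one zext_restrict pw.simps one_def[symmetric])
next
  case (Suc k)
  interpret M: monoid "elems A" by (rule monoid_elems[OF asc uni])
  show ?case using Suc by (simp add: zext_mult del: restrict_mulf_restrict restrict_apply) simp
qed

lemma zext_alg_exp: "zext (idx A) (alg_exp A (restrict a (idx A))) = Ex a"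
proof
  fix i
  have "pw a k i = 0" if "i \<notin> idx A" for k
    using supp_pw[of a k] that by (auto simp: supp_on_def)
  moreover have "(restrict a (idx A) [^]\<^bsub>elems A\<^esub> k) i = pw a k i" if "i \<in> idx A" for k :: nat
  proof -
    have "zext (idx A) (restrict a (idx A) [^]\<^bsub>elems A\<^esub> k) i = pw a k i" by (simp only: zext_pow)
    then show ?thesis by (simp only: zext_def that if_True)
  qed
  ultimately show "zext (idx A) (alg_exp A (restrict a (idx A))) i = Ex a i"
    by (auto simp: zext_def alg_exp_def Ex_def)
qed

lemma Ex_fin:
  assumes "\<And>k. k \<ge> N ==> pw a k = 0"
  shows "Ex a = (\<Sum>k<N. scl (1 / fact k) (pw a k))"
proof
  fix i
  have "(\<Sum>k. pw a k i / fact k) = (\<Sum>k<N. pw a k i / fact k)"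
    by (rule suminf_finite) (auto simp: assms not_less zero_fun_apply)
  then show "Ex a i = (\<Sum>k<N. scl (1 / fact k) (pw a k)) i"
    by (simp add: Ex_def sum_apply scl_apply)
qed

lemma pw_commute: "m a x = m x a ==> supp_on (idx A) x ==> m (pw a k) x = m x (pw a k)"
proof (induction k)
  case (Suc k)
  have "m (pw a (Suc k)) x = m (pw a k) (m a x)" by (simp add: as)
  also have "\<dots> = m (m (pw a k) x) a" by (simp only: Suc.prems(1) as)
  also have "\<dots> = m x (pw a (Suc k))" using Suc by (simp add: as)
  finally show ?case .
qed (simp add: one_left one_right)

text \<open>The binomial formula breaks off after two terms because \<open>x\<close> commutes with
  \<open>a\<close> and squares to zero.\<close>

lemma pw_add:
  assumes "m a x = m x a" "m x x = 0" "supp_on (idx A) x" "supp_on (idx A) a"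
  shows "pw (x + a) (Suc k) = pw a (Suc k) + scl (of_nat (Suc k)) (m x (pw a k))"
proof (induction k)
  case 0
  have "m one (x + a) = x + a" by (intro one_left supp_on_intros assms)
  then show ?case by (simp add: one_left one_right assms add.commute)
next
  case (Suc k)
  have 1: "m (pw a (Suc k)) x = m x (pw a (Suc k))" by (rule pw_commute[OF assms(1,3)])
  have 2: "m (m x (pw a k)) x = 0"
    by (simp add: as pw_commute[OF assms(1,3)]) (simp add: as[symmetric] assms(2))
  have "pw (x + a) (Suc (Suc k)) = m (pw a (Suc k) + scl (of_nat (Suc k)) (m x (pw a k))) (x + a)"
    by (subst pw.simps(2)) (simp only: Suc)
  also have "\<dots> = m x (pw a (Suc k)) + pw a (Suc (Suc k)) + scl (of_nat (Suc k)) (m x (pw a (Suc k)))"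
    unfolding mulf_add_left mulf_add_right mulf_scl_left 1 2 as[of x "pw a k" a] pw.simps(2)[of a "Suc k", symmetric]
      pw.simps(2)[of a k, symmetric] scl_zero by (simp only: add_0_right add.assoc)
  also have "\<dots> = pw a (Suc (Suc k)) + scl (of_nat (Suc (Suc k))) (m x (pw a (Suc k)))"
    unfolding of_nat_Suc[of "Suc k"] scl_add_left scl_1 by (simp only: ac_simps)
  finally show ?case .
qed

text \<open>Splitting off one square-zero summand at a time turns the exponential of a sum into a
  product of linear factors.\<close>

lemma Ex_add:
  assumes "m a x = m x a" "m x x = 0" "supp_on (idx A) x" "supp_on (idx A) a" "nilp a"
  shows "nilp (x + a)" "Ex (x + a) = m (one + x) (Ex a)"
proof -
  from assms(5) obtain N where N: "\<And>k. k \<ge> N ==> pw a k = 0" by (auto simp: nilp_def)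
  have N': "pw (x + a) k = 0" if "k \<ge> Suc N" for k
  proof -
    from that obtain j where j: "k = Suc j" "j \<ge> N" by (cases k) auto
    show ?thesis unfolding j pw_add[OF assms(1-4)] N[OF j(2)] N[of "Suc j", OF le_SucI[OF j(2)]] by simp
  qed
  then show "nilp (x + a)" by (auto simp: nilp_def)
  have E: "Ex a = (\<Sum>k<N. scl (1 / fact k) (pw a k))" by (rule Ex_fin[OF N])
  have E': "Ex a = (\<Sum>k<Suc N. scl (1 / fact k) (pw a k))" by (rule Ex_fin) (simp add: N)
  have "Ex (x + a) = (\<Sum>k<Suc N. scl (1 / fact k) (pw (x + a) k))" by (rule Ex_fin[OF N'])
  also have "\<dots> = one + (\<Sum>k<N. scl (1 / fact (Suc k)) (pw (x + a) (Suc k)))"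
    by (subst sum.lessThan_Suc_shift) simp
  also have "(\<Sum>k<N. scl (1 / fact (Suc k)) (pw (x + a) (Suc k))) =
     (\<Sum>k<N. scl (1 / fact (Suc k)) (pw a (Suc k)) + scl (1 / fact k) (m x (pw a k)))"
  proof (intro sum.cong refl)
    fix k
    have f: "1 / fact (Suc k) * of_nat (Suc k) = (1 / fact k :: complex)"
      by (simp add: fact_Suc del: of_nat_Suc)
    show "scl (1 / fact (Suc k)) (pw (x + a) (Suc k)) = scl (1 / fact (Suc k)) (pw a (Suc k)) + scl (1 / fact k) (m x (pw a k))"
      by (simp only: pw_add[OF assms(1-4)] scl_add scl_scl f)
  qed
  also have "one + \<dots> = (one + (\<Sum>k<N. scl (1 / fact (Suc k)) (pw a (Suc k)))) + m x (\<Sum>k<N. scl (1 / fact k) (pw a k))"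
    by (simp only: sum.distrib mulf_sum_right mulf_scl_right add.assoc)
  also have "one + (\<Sum>k<N. scl (1 / fact (Suc k)) (pw a (Suc k))) = Ex a"
    unfolding E' by (subst sum.lessThan_Suc_shift) simp
  also have "(\<Sum>k<N. scl (1 / fact k) (pw a k)) = Ex a" by (rule E[symmetric])
  also have "Ex a + m x (Ex a) = m (one + x) (Ex a)"
  proof -
    have "supp_on (idx A) (Ex a)" unfolding E by (intro supp_on_intros supp_pw)
    then show ?thesis by (simp add: mulf_add_left one_left)
  qed
  finally show "Ex (x + a) = m (one + x) (Ex a)" .
qed

lemma nilp_0: "nilp 0"
  unfolding nilp_def by (rule exI[of _ 1]) (auto simp: Suc_le_eq gr0_conv_Suc)

lemma Ex_0: "Ex 0 = one"
proof -
  have "pw 0 k = 0" if "k \<ge> 1" for k using that by (cases k) auto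
  from Ex_fin[of 1 0, OF this] show ?thesis by simp
qed

text \<open>By \<open>Ex_Pi\<close> this is the exponential of the sum of the
  \<open>c p x p\<close>. As a product over a list, its inverse and its commutation rules become
  inductions.\<close>

definition Pi :: "('p => complex) => ('p => 'i => complex) => 'p list => ('i => complex)" where
  "Pi c x ps = foldr (\<lambda>p. m (one + scl (c p) (x p))) ps one"

lemma supp_Pi: "supp_on (idx A) (Pi c x ps)"
  by (cases ps) (auto simp: Pi_def supp_one)

lemma Pi_Cons: "Pi c x (p # ps) = m (one + scl (c p) (x p)) (Pi c x ps)"
  by (simp add: Pi_def)

lemma Pi_Nil: "Pi c x [] = one"
  by (simp add: Pi_def)

lemma Pi_commute:
  assumes "\<And>p. p \<in> set ps ==> m y (x p) = m (x p) y" "supp_on (idx A) y"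
  shows "m y (Pi c x ps) = m (Pi c x ps) y"
  using assms(1)
proof (induction ps)
  case (Cons p ps)
  have 1: "m y (one + scl (c p) (x p)) = m (one + scl (c p) (x p)) y"
    using Cons.prems assms(2) by (simp add: mulf_add_right mulf_add_left mulf_scl_left mulf_scl_right one_left one_right)
  have "m y (Pi c x (p # ps)) = m (one + scl (c p) (x p)) (m y (Pi c x ps))"
    unfolding Pi_Cons as[symmetric] 1 by (rule refl)
  also have "\<dots> = m (Pi c x (p # ps)) y" using Cons by (simp add: Pi_Cons as)
  finally show ?case .
qed (simp add: Pi_Nil one_left one_right assms)

context
  fixes x :: "'p => 'i => complex"
  assumes comm: "\<And>p q. m (x p) (x q) = m (x q) (x p)" and sq: "\<And>p. m (x p) (x p) = 0"
    and sx: "\<And>p. supp_on (idx A) (x p)"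
begin

lemma Ex_Pi: "nilp (sum_list (map (\<lambda>p. scl (c p) (x p)) ps))" "Ex (sum_list (map (\<lambda>p. scl (c p) (x p)) ps)) = Pi c x ps"
proof (induction ps)
  case Nil
  case 1 show ?case by (simp only: list.map sum_list.Nil nilp_0)
  case 2 show ?case by (simp only: list.map sum_list.Nil Ex_0 Pi_Nil)
next
  case (Cons p ps)
  let ?a = "sum_list (map (\<lambda>p. scl (c p) (x p)) ps)"
  have "m ?a (scl (c p) (x p)) = m (scl (c p) (x p)) ?a"
    by (induction ps) (auto simp: mulf_add_left mulf_add_right mulf_scl_left mulf_scl_right comm[of p] mult.commute scl_add)
  moreover have "supp_on (idx A) ?a" by (induction ps) (auto intro!: supp_on_intros sx)
  moreover have "m (scl (c p) (x p)) (scl (c p) (x p)) = 0" by (simp add: mulf_scl_left mulf_scl_right sq)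
  moreover have "supp_on (idx A) (scl (c p) (x p))" by (intro supp_on_intros sx)
  ultimately have *: "nilp (scl (c p) (x p) + ?a)" "Ex (scl (c p) (x p) + ?a) = m (one + scl (c p) (x p)) (Ex ?a)"
    using Ex_add[of ?a "scl (c p) (x p)"] Cons by auto
  case 1 show ?case using * by simp
  case 2 show ?case using * Cons by (simp add: Pi_Cons)
qed

text \<open>As \<open>x x = 0\<close>, the product \<open>(1 + c x)(1 + d x)\<close> is
  \<open>1 + (c + d) x\<close>. With \<open>d = - c\<close> this provides the inverse of
  \<open>J\<close>.\<close>

lemma Pi_mult: "m (Pi c x ps) (Pi d x ps) = Pi (\<lambda>p. c p + d p) x ps"
proof (induction ps)
  case (Cons p ps)
  let ?u = "one + scl (c p) (x p)" let ?v = "one + scl (d p) (x p)"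
  have v: "supp_on (idx A) ?v" "supp_on (idx A) (scl (c p) (x p))" "supp_on (idx A) (scl (d p) (x p))" by (auto intro!: supp_on_intros supp_one sx)
  have k: "m ?v (Pi c x ps) = m (Pi c x ps) ?v"
    by (rule Pi_commute) (auto simp: mulf_add_right mulf_add_left mulf_scl_left mulf_scl_right one_left one_right sx comm v)
  have "m (Pi c x (p # ps)) (Pi d x (p # ps)) = m ?u (m (m (Pi c x ps) ?v) (Pi d x ps))"
    by (simp add: Pi_Cons as)
  also have "\<dots> = m (m ?u ?v) (m (Pi c x ps) (Pi d x ps))" by (simp add: k[symmetric] as)
  also have "m ?u ?v = one + scl (c p + d p) (x p)"
  proof -
    have "m ?u ?v = m one one + m one (scl (d p) (x p)) + (m (scl (c p) (x p)) one + scl (c p * d p) (m (x p) (x p)))"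
      by (simp only: mulf_add_left mulf_add_right mulf_scl_left mulf_scl_right scl_scl scl_add mult.commute add.assoc add.left_commute)
    also have "\<dots> = one + scl (c p + d p) (x p)"
      unfolding sq one_left[OF supp_one] one_left[OF v(3)] one_right[OF v(2)] scl_add_left scl_zero by (simp only: add_0_right add_0_left ac_simps)
    finally show ?thesis .
  qed
  finally show ?case unfolding Cons Pi_Cons .
qed (simp add: Pi_Nil one_left supp_one)

lemma Pi_zero: "Pi (\<lambda>p. 0) x ps = one"
  by (induction ps) (auto simp: Pi_Cons Pi_Nil one_left supp_one)

end

lemma pw_intertwine: "supp_on (idx A) y ==> m a y = m y b ==> m (pw a k) y = m y (pw b k)"
proof (induction k)
  case (Suc k)
  then show ?case by (simp add: as) (simp add: as[symmetric])
qed (simp add: one_left one_right)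

text \<open>Used with \<open>y = gg g\<close>: moving \<open>J\<close> past a group element replaces
  its exponent by the conjugate form.\<close>

lemma Ex_intertwine:
  assumes "supp_on (idx A) y" "m a y = m y b" "nilp a" "nilp b"
  shows "m (Ex a) y = m y (Ex b)"
proof -
  from assms(3,4) obtain N M where N: "\<And>k. k \<ge> N ==> pw a k = 0" and M: "\<And>k. k \<ge> M ==> pw b k = 0"
    by (auto simp: nilp_def)
  have "Ex a = (\<Sum>k<max N M. scl (1 / fact k) (pw a k))" "Ex b = (\<Sum>k<max N M. scl (1 / fact k) (pw b k))"
    by (rule Ex_fin, simp add: N M)+
  then show ?thesis
    by (simp add: mulf_sum_left mulf_sum_right mulf_scl_left mulf_scl_right pw_intertwine[OF assms(1,2)])
qed

end

section \<open>The coproduct of \<open>A(G,V,u,B)\<close>\<close>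

text \<open>The pairing of functions with tensors along which multiplications are transposed to
  operators on functions.\<close>

definition dot :: "'i set => ('i => complex) => ('i => complex) => complex" where
  "dot I v t = (\<Sum>i\<in>I. t i * v i)"

lemma dot_add: "dot I v (s + t) = dot I v s + dot I v t" and dot_scl: "dot I v (scl c t) = c * dot I v t"
  by (simp_all add: dot_def plus_fun_apply scl_apply algebra_simps sum.distrib sum_distrib_left)

lemma dot_add_left: "dot I (v + w) t = dot I v t + dot I w t" and dot_scl_left: "dot I (scl c v) t = c * dot I v t"
  by (simp_all add: dot_def plus_fun_apply scl_apply algebra_simps sum.distrib sum_distrib_left)

lemma dot_0: "dot I v 0 = 0"
  by (simp add: dot_def zero_fun_apply)

lemma dot_sum: "dot I v (\<Sum>a\<in>A. f a) = (\<Sum>a\<in>A. dot I v (f a))"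
  by (induction A rule: infinite_finite_induct) (simp_all add: dot_0 dot_add)

lemma dot_sng: "finite I ==> i \<in> I ==> dot I v (sng i) = v i"
proof -
  assume "finite I" "i \<in> I"
  moreover have "(\<Sum>j\<in>I. sng i j * v j) = (\<Sum>j\<in>I. if j = i then v i else 0)"
    by (intro sum.cong) (auto simp: sng_def)
  ultimately show ?thesis by (simp add: dot_def)
qed

lemma dot_transpose:
  assumes "finite I" "supp_on I t" "linop T" "\<And>i. i \<in> I ==> dot J v (T (sng i)) = v' i"
  shows "dot J v (T t) = dot I v' t"
proof -
  have "T t = (\<Sum>i\<in>I. scl (t i) (T (sng i)))"
    by (subst supp_expand[OF assms(1,2)]) (simp add: linop_sum[OF assms(3)] linop_scl[OF assms(3)])
  then have "dot J v (T t) = (\<Sum>i\<in>I. t i * dot J v (T (sng i)))" by (simp add: dot_sum dot_scl)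
  then show ?thesis using assms(4) by (simp add: dot_def)
qed

locale grepu = grep G n \<rho> for G :: "('a, 'x) monoid_scheme" (structure) and n and \<rho> +
  fixes u :: 'a
  assumes u_in [simp]: "u \<in> carrier G" and u_central: "g \<in> carrier G ==> u \<otimes> g = g \<otimes> u"
    and ord_u: "ord u = 2" and rho_u: "\<rho> u = - 1\<^sub>m n"
begin

lemma u_u [simp]: "u \<otimes> u = \<one>"
  using pow_ord_eq_1[OF u_in] by (simp add: ord_u numeral_2_eq_2)

lemma u_neq_one [simp]: "u ~= \<one>"
  using ord_u ord_eq_1[OF u_in] by auto

lemma inv_u [simp]: "inv u = u"
  by (rule inv_equality) simp_all

lemma mul_u_u [simp]: "g \<in> carrier G ==> g \<otimes> u \<otimes> u = g"
  by (simp add: m_assoc)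

lemma u_pow: "u [^] (k :: nat) = (if even k then \<one> else u)"
  by (induction k) auto

abbreviation "A2 \<equiv> super_tensor AA"
abbreviation "M2 \<equiv> mulf A2"
abbreviation "I2 \<equiv> Idx \<times> Idx"

lemma parity_AA [simp]: "parity AA (g, S) = card S mod 2"
  by (simp add: group_ext_alg_def)

lemma basis_sng: "basis A i = restrict (sng i) (idx A)"
  by (auto simp: basis_def sng_def)

lemma mulf_nonzero: "mulf A a b k ~= 0 ==> \<exists>i\<in>idx A. \<exists>j\<in>idx A. a i ~= 0 \<and> b j ~= 0 \<and> mulc A i j k ~= 0"
proof (rule ccontr)
  assume "mulf A a b k ~= 0" "\<not> (\<exists>i\<in>idx A. \<exists>j\<in>idx A. a i ~= 0 \<and> b j ~= 0 \<and> mulc A i j k ~= 0)"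
  moreover from this(2) have "(\<Sum>i\<in>idx A. \<Sum>j\<in>idx A. a i * b j * mulc A i j k) = 0"
    by (intro sum.neutral ballI) auto
  ultimately show False by (auto simp: mulf_def split: if_splits)
qed

lemma WG_deg:
  assumes "\<And>U. x U ~= 0 ==> card U = d" "\<And>U. y U ~= 0 ==> card U = e" "WG n x y U ~= 0"
  shows "card U = d + e"
proof -
  obtain S T where "S \<in> Pow {..<n}" "T \<in> Pow {..<n}" "x S ~= 0" "y T ~= 0" "mulc (ext_alg n) S T U ~= 0"
    using mulf_nonzero[OF assms(3)] by auto
  moreover from this have "S \<inter> T = {}" "U = S \<union> T" by (auto simp: ext_alg_def split: if_splits)
  ultimately show ?thesis using assms(1,2) by (auto simp: card_Un_disjoint finite_subset)
qed

lemma extm_deg: "finite S ==> extm n M S U ~= 0 ==> card U = card S"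
proof -
  have "foldr (\<lambda>s. WG n (colv n M s)) xs (sng {}) U ~= 0 ==> card U = length xs" for xs
  proof (induction xs arbitrary: U)
    case (Cons a xs)
    have "colv n M a U ~= 0 ==> card U = 1" for U
    proof (rule ccontr)
      assume "colv n M a U ~= 0" "card U ~= 1"
      moreover from this(2) have "(\<Sum>r<n. scl (M $$ (r, a)) (sng {r}) U) = 0"
        by (intro sum.neutral) (auto simp: scl_apply sng_def)
      ultimately show False by (simp add: colv_def sum_apply)
    qed
    from WG_deg[OF this Cons.IH] show ?case using Cons.prems by simp
  qed (auto simp: sng_def split: if_splits)
  then show "finite S ==> extm n M S U ~= 0 ==> card U = card S"
    by (simp add: extm_asc colv.asc_def)
qed

lemma homg_mA:
  assumes "i \<in> Idx" "j \<in> Idx"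
  shows "homg (parity AA) (parity AA i + parity AA j) (mA (sng i) (sng j))"
proof -
  obtain g S h T where e: "i = (g, S)" "j = (h, T)" "g \<in> carrier G" "h \<in> carrier G" "S \<subseteq> {..<n}" "T \<subseteq> {..<n}"
    using assms by (auto simp: Idx_def)
  have f: "finite S" "finite T" using e by (auto intro: finite_subset)
  show ?thesis
    unfolding homg_def
  proof (intro allI impI)
    fix kU assume a: "mA (sng i) (sng j) kU ~= 0"
    obtain k U where kU: "kU = (k, U)" by force
    have "WG n (extm n (\<rho> (inv h)) S) (sng T) U ~= 0"
      using a e unfolding kU by (simp add: mulAA_sng put_def split: if_splits)
    then have "card U = card S + card T"
      by (rule WG_deg[rotated 2]) (use extm_deg f in \<open>auto simp: sng_def split: if_splits\<close>)
    then show "even (parity AA kU) = even (parity AA i + parity AA j)"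
      by (simp add: kU e)
  qed
qed

lemma homg_gam: "homg (parity AA) 0 (gam g)" and homg_vec1: "homg (parity AA) 1 (vec1 s)"
  by (auto simp: homg_def gam_def vec1_def sng_def)

definition one2 :: "('a \<times> nat set) \<times> ('a \<times> nat set) => complex" where
  "one2 = tens (gam \<one>) (gam \<one>)"

sublocale A2: ualg A2 one2
proof
  show "finite (idx A2)" by simp
  show "assoc_alg A2" by (rule assoc_super) (auto simp: assoc_AA homg_mA)
  show "unital_alg A2" by (rule unital_super) (auto simp: unital_AA unit_AA homg_gam)
  show "one2 = zext (idx A2) (unitc A2)" using tens_unit[of AA] by (simp add: one2_def unit_AA)
qed

lemma super_group_ext: "super_tensor (group_ext G n \<rho>) = A2"
  by (simp add: super_tensor_def group_ext_def Let_def)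

definition av where "av s = tens (vec1 s) (gam \<one>)"
definition bv where "bv s = tens (gam \<one>) (vec1 s)"
definition gg where "gg g = tens (gam g) (gam g)"
definition dl where "dl s = av s + bv s"
text \<open>The value \<open>0\<close> out of range lets the commutation rules hold for all index
  pairs, as the context of \<open>Ex_Pi\<close> demands.\<close>

definition XX where "XX = (\<lambda>(r, s). if r < n \<and> s < n then tens (vec1 r) (vec1 s) else 0)"

lemma supp_vec1: "s < n ==> supp_on Idx (vec1 s)"
  unfolding vec1_def by (intro supp_on_sng) (auto simp: Idx_def)

lemma supp_gam: "g \<in> carrier G ==> supp_on Idx (gam g)"
  unfolding gam_def by (intro supp_on_sng) (auto simp: Idx_def)

lemma supp_XX: "supp_on I2 (XX p)"
  by (cases p) (auto simp: XX_def supp_vec1 intro!: supp_tens supp_on_intros)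

lemma supp_av: "s < n ==> supp_on I2 (av s)" and supp_bv: "s < n ==> supp_on I2 (bv s)"
  by (auto simp: av_def bv_def intro!: supp_tens supp_vec1 supp_gam)

lemma supp_dl: "s < n ==> supp_on I2 (dl s)"
  by (auto simp: dl_def intro!: supp_on_intros supp_av supp_bv)

lemma XX_av_bv: "r < n ==> s < n ==> XX (r, s) = M2 (av r) (bv s)"
  unfolding av_def bv_def XX_def
  by (subst mulf_super[OF homg_gam homg_gam]) (simp add: mA_one supp_vec1)

text \<open>Reordering gives one sign in each tensor factor, and these cancel; the Koszul sign is
  the same on both sides.\<close>

lemma XX_comm: "M2 (XX p) (XX q) = M2 (XX q) (XX p)"
proof -
  obtain a b c d where e: "p = (a, b)" "q = (c, d)" by force
  show ?thesis
  proof (cases "a < n \<and> b < n \<and> c < n \<and> d < n")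
    case True
    then show ?thesis
      by (simp add: e XX_def mulf_super[OF homg_vec1 homg_vec1] vec1_anti[of c a] vec1_anti[of d b] tens_minus_left tens_minus_right)
  qed (auto simp: e XX_def)
qed

lemma XX_sq: "M2 (XX p) (XX p) = 0"
proof -
  obtain a b where e: "p = (a, b)" by force
  have "mA (vec1 a) (vec1 a) = 0" if "a < n"
    using vec1_anti[OF that that] by (auto simp: fun_eq_iff uminus_apply zero_fun_apply)
  then show ?thesis by (auto simp: e XX_def mulf_super[OF homg_vec1 homg_vec1] tens_0_left)
qed

text \<open>An odd vector passes the even element \<open>XX p\<close>: the Koszul sign cancels the
  sign of the exterior product. Hence \<open>J\<close> commutes with the coproducts of vectors, and
  only group elements feel the twist.\<close>

lemma XX_dl: "s < n ==> M2 (dl s) (XX p) = M2 (XX p) (dl s)"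
proof -
  assume s: "s < n"
  obtain a b where e: "p = (a, b)" by force
  have "M2 (av s) (XX p) = M2 (XX p) (av s)" "M2 (bv s) (XX p) = M2 (XX p) (bv s)"
    using s vec1_anti[of s a] vec1_anti[of s b]
    by (auto simp: e XX_def av_def bv_def mulf_super[OF homg_vec1 homg_vec1] mulf_super[OF homg_vec1 homg_gam]
        mulf_super[OF homg_gam homg_vec1] mA_one supp_vec1 tens_minus_left tens_minus_right scl_minus_1)
  then show ?thesis by (simp add: dl_def mulf_add_left mulf_add_right)
qed

definition prs :: "(nat \<times> nat) list" where "prs = List.product [0..<n] [0..<n]"

definition Xm :: "complex mat => _" where
  "Xm M = (\<Sum>r<n. \<Sum>s<n. scl (M $$ (r, s)) (XX (r, s)))"

lemma Xm_list: "Xm M = sum_list (map (\<lambda>p. scl (M $$ p) (XX p)) prs)"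
  unfolding prs_def Xm_def by (subst sum_list_distinct_conv_sum_set)
    (auto simp: distinct_product lessThan_atLeast0 sum.cartesian_product')

definition PI :: "(nat \<times> nat => complex) => _" where "PI c = A2.Pi c XX prs"

lemma supp_XX': "supp_on (idx A2) (XX p)" using supp_XX by simp

lemmas Ex_PI = A2.Ex_Pi[of XX, OF XX_comm XX_sq supp_XX', of _ prs, folded PI_def]

lemma Ex_Xm: "A2.nilp (Xm M)" "A2.Ex (Xm M) = PI (\<lambda>p. M $$ p)"
  unfolding Xm_list by (rule Ex_PI)+

lemma PI_mult: "M2 (PI c) (PI d) = PI (\<lambda>p. c p + d p)"
  unfolding PI_def by (rule A2.Pi_mult[OF XX_comm XX_sq supp_XX'])

lemma PI_zero: "PI (\<lambda>p. 0) = one2"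
  unfolding PI_def by (rule A2.Pi_zero[OF XX_comm XX_sq supp_XX'])

lemma supp_PI: "supp_on I2 (PI c)"
  unfolding PI_def using A2.supp_Pi by simp

definition PIB :: "complex mat => _" where "PIB M = PI (\<lambda>p. M $$ p)"

lemma PI_cong: "(\<And>r s. r < n ==> s < n ==> c (r, s) = d (r, s)) ==> PI c = PI d"
  unfolding PI_def A2.Pi_def
  by (rule foldr_cong) (auto simp: prs_def)

text \<open>The summands of the exponent commute and square to zero, so the exponential series is
  the finite product \<open>PI\<close>.\<close>

lemma zext_J: "zext I2 (J_twist G n \<rho> B) = PIB B"
proof -
  have XX: "XX (r, s) = sng ((\<one>, {r}), (\<one>, {s}))" if "r < n" "s < n" for r s
    using that by (simp add: XX_def vec1_def tens_sng)
  have "(\<lambda>p\<in>idx A2. \<Sum>r<n. \<Sum>s<n. B $$ (r, s) * basis A2 ((\<one>, {r}), (\<one>, {s})) p) = restrict (Xm B) (idx A2)"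
    unfolding Xm_def sum_apply scl_apply basis_sng
    by (intro restrict_ext sum.cong refl) (simp add: XX)
  then show ?thesis
    using A2.zext_alg_exp[of "Xm B"] by (simp add: J_twist_def super_group_ext Ex_Xm PIB_def)
qed

lemma J_carrier: "J_twist G n \<rho> B \<in> carrier (elems A2)"
  by (auto simp: J_twist_def super_group_ext Let_def alg_exp_def elems_carrier)

lemma monoid_A2: "monoid (elems A2)"
  by (rule monoid_elems[OF A2.asc A2.uni])

lemma zext_inv_J:
  assumes B: "B \<in> carrier_mat n n"
  shows "zext I2 (inv\<^bsub>elems A2\<^esub> (J_twist G n \<rho> B)) = PIB (- B)"
proof -
  interpret M: monoid "elems A2" by (rule monoid_A2)
  let ?J' = "restrict (PIB (- B)) (idx A2)"
  have c: "J_twist G n \<rho> B \<in> carrier (elems A2)" "?J' \<in> carrier (elems A2)"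
    using J_carrier by (auto simp: elems_carrier)
  have m: "M2 (PIB B) (PIB (- B)) = one2" "M2 (PIB (- B)) (PIB B) = one2"
    unfolding PIB_def PI_mult PI_zero[symmetric] using B by (auto intro!: PI_cong)
  have z: "zext (idx A2) ?J' = PIB (- B)" "zext (idx A2) (J_twist G n \<rho> B) = PIB B"
    using supp_PI zext_J by (simp_all add: PIB_def zext_supp)
  have o: "zext (idx A2) \<one>\<^bsub>elems A2\<^esub> = one2" by (simp only: elems_one zext_restrict A2.one_def)
  have "J_twist G n \<rho> B \<otimes>\<^bsub>elems A2\<^esub> ?J' = \<one>\<^bsub>elems A2\<^esub>"
    by (rule elems_eqI[of _ A2]) (use c in \<open>simp_all only: M.m_closed M.one_closed zext_mult z m o\<close>)
  moreover have "?J' \<otimes>\<^bsub>elems A2\<^esub> J_twist G n \<rho> B = \<one>\<^bsub>elems A2\<^esub>"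
    by (rule elems_eqI[of _ A2]) (use c in \<open>simp_all only: M.m_closed M.one_closed zext_mult z m o\<close>)
  ultimately have "?J' = inv\<^bsub>elems A2\<^esub> (J_twist G n \<rho> B)"
    using M.inv_unique' c by auto
  then show ?thesis using z by simp
qed

definition FF :: "nat set => _" where "FF S = foldr (\<lambda>s. M2 (dl s)) (sorted_list_of_set S) one2"

lemma supp_gg: "g \<in> carrier G ==> supp_on I2 (gg g)"
  by (auto simp: gg_def intro!: supp_tens supp_gam)

lemma zext_comul:
  assumes "g \<in> carrier G" "S \<subseteq> {..<n}"
  shows "zext I2 (comul (group_ext G n \<rho>) (basis (group_ext G n \<rho>) (g, S))) = M2 (gg g) (FF S)"
proof -
  let ?A = "group_ext G n \<rho>"
  have I: "idx ?A = Idx" by (simp add: group_ext_def Let_def)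
  have gS: "(g, S) \<in> Idx" using assms by (auto simp: Idx_def)
  have f: "finite S" using assms(2) by (rule finite_subset) simp
  let ?L = "list_prod (elems A2) (basis A2 ((g, {}), (g, {})) #
           map (\<lambda>s. \<lambda>p\<in>idx A2. basis A2 ((\<one>, {s}), (\<one>, {})) p + basis A2 ((\<one>, {}), (\<one>, {s})) p)
             (sorted_list_of_set S))"
  have "(\<Sum>i\<in>Idx. basis ?A (g, S) i * comulc ?A i j k) = comulc ?A (g, S) j k" for j k
  proof -
    have "(\<Sum>i\<in>Idx. basis ?A (g, S) i * comulc ?A i j k) = (\<Sum>i\<in>Idx. if i = (g, S) then comulc ?A (g, S) j k else 0)"
      by (intro sum.cong) (auto simp: basis_def I)
    then show ?thesis using gS by simp
  qed
  then have "zext I2 (comul ?A (basis ?A (g, S))) = zext I2 (\<lambda>(j, k). comulc ?A (g, S) j k)"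
    by (auto simp: zext_def comul_def I)
  also have "\<dots> = zext (idx A2) ?L"
    by (auto simp: zext_def group_ext_def Let_def)
  also have "\<dots> = M2 (zext (idx A2) (basis A2 ((g, {}), (g, {})))) (FF S)"
  proof -
    have "zext (idx A2) (\<lambda>p\<in>idx A2. basis A2 ((\<one>, {s}), (\<one>, {})) p + basis A2 ((\<one>, {}), (\<one>, {s})) p) = dl s" if "s \<in> S" for s
    proof -
      have "zext (idx A2) (\<lambda>p\<in>idx A2. basis A2 ((\<one>, {s}), (\<one>, {})) p + basis A2 ((\<one>, {}), (\<one>, {s})) p) = zext I2 (dl s)"
        unfolding dl_def av_def bv_def vec1_def gam_def tens_sng basis_sng
        by (rule ext) (simp add: zext_def plus_fun_apply)
      then show ?thesis using supp_dl that assms(2) by (simp add: zext_supp subset_eq)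
    qed
    then have "foldr (\<lambda>x. M2 (zext (idx A2) x)) (map (\<lambda>s. \<lambda>p\<in>idx A2. basis A2 ((\<one>, {s}), (\<one>, {})) p + basis A2 ((\<one>, {}), (\<one>, {s})) p)
             (sorted_list_of_set S)) one2 = FF S"
      unfolding FF_def foldr_map using f by (intro foldr_cong) auto
    then show ?thesis unfolding zext_list_prod A2.one_def[symmetric] by simp
  qed
  also have "zext (idx A2) (basis A2 ((g, {}), (g, {}))) = gg g"
    using supp_gg[OF assms(1)] unfolding basis_sng gg_def gam_def tens_sng by (simp add: zext_supp)
  finally show ?thesis .
qed

lemma PI_FF: "S \<subseteq> {..<n} ==> M2 (FF S) (PI c) = M2 (PI c) (FF S)"
proof -
  assume S: "S \<subseteq> {..<n}"
  have d: "M2 (dl s) (PI c) = M2 (PI c) (dl s)" if "s < n" for s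
    unfolding PI_def by (rule A2.Pi_commute) (use XX_dl[OF that] supp_dl[OF that] in auto)
  have "M2 (foldr (\<lambda>s. M2 (dl s)) xs one2) (PI c) = M2 (PI c) (foldr (\<lambda>s. M2 (dl s)) xs one2)" if "set xs \<subseteq> {..<n}" for xs
    using that
  proof (induction xs)
    case Nil
    then show ?case using supp_PI by (simp add: A2.one_left A2.one_right)
  next
    case (Cons s xs)
    then show ?case by (simp add: A2.as) (simp add: A2.as[symmetric] d)
  qed
  then show ?thesis using S finite_subset[OF S] by (simp add: FF_def)
qed

definition conjB :: "complex mat => 'a => complex mat" where
  "conjB B g = \<rho> (inv g) * B * transpose_mat (\<rho> (inv g))"

lemma conjB_entry:
  assumes "B \<in> carrier_mat n n" "g \<in> carrier G" "k < n" "l < n"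
  shows "conjB B g $$ (k, l) = (\<Sum>r<n. \<Sum>s<n. B $$ (r, s) * (\<rho> (inv g) $$ (k, r) * \<rho> (inv g) $$ (l, s)))"
proof -
  have c: "\<rho> (inv g) \<in> carrier_mat n n" using assms by simp
  have "conjB B g $$ (k, l) = (\<Sum>s<n. (\<Sum>r<n. \<rho> (inv g) $$ (k, r) * B $$ (r, s)) * \<rho> (inv g) $$ (l, s))"
    using assms c carrier_matD[OF c] by (simp add: conjB_def scalar_prod_def lessThan_atLeast0)
  also have "\<dots> = (\<Sum>r<n. \<Sum>s<n. B $$ (r, s) * (\<rho> (inv g) $$ (k, r) * \<rho> (inv g) $$ (l, s)))"
    by (subst sum.swap) (simp add: sum_distrib_left sum_distrib_right algebra_simps)
  finally show ?thesis .
qed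

lemma Xm_gg:
  assumes "B \<in> carrier_mat n n" "g \<in> carrier G"
  shows "M2 (Xm B) (gg g) = M2 (gg g) (Xm (conjB B g))"
proof -
  let ?R = "\<rho> (inv g)"
  have 1: "M2 (XX (r, s)) (gg g) = (\<Sum>k<n. \<Sum>l<n. scl (?R $$ (k, r) * ?R $$ (l, s)) (M2 (gg g) (XX (k, l))))"
    if "r < n" "s < n" for r s
  proof -
    have "M2 (XX (r, s)) (gg g) = tens (mA (vec1 r) (gam g)) (mA (vec1 s) (gam g))"
      using that by (simp add: XX_def gg_def mulf_super[OF homg_vec1 homg_gam])
    also have "\<dots> = (\<Sum>k<n. \<Sum>l<n. scl (?R $$ (k, r) * ?R $$ (l, s)) (tens (mA (gam g) (vec1 k)) (mA (gam g) (vec1 l))))"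
      unfolding vec1_gam[OF assms(2) that(1)] vec1_gam[OF assms(2) that(2)] mulf_sum_right mulf_scl_right
        tens_sum_left tens_scl_left unfolding tens_sum_right tens_scl_right scl_sum scl_scl ..
    also have "\<dots> = (\<Sum>k<n. \<Sum>l<n. scl (?R $$ (k, r) * ?R $$ (l, s)) (M2 (gg g) (XX (k, l))))"
      by (intro sum.cong refl) (simp add: XX_def gg_def mulf_super[OF homg_gam homg_vec1])
    finally show ?thesis .
  qed
  have "M2 (Xm B) (gg g) = (\<Sum>r<n. \<Sum>s<n. \<Sum>k<n. \<Sum>l<n. scl (B $$ (r, s) * (?R $$ (k, r) * ?R $$ (l, s))) (M2 (gg g) (XX (k, l))))"
    unfolding Xm_def mulf_sum_left mulf_scl_left by (intro sum.cong refl) (simp add: 1 scl_sum)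
  also have "\<dots> = (\<Sum>k<n. \<Sum>l<n. \<Sum>r<n. \<Sum>s<n. scl (B $$ (r, s) * (?R $$ (k, r) * ?R $$ (l, s))) (M2 (gg g) (XX (k, l))))"
  proof -
    have "(\<Sum>r<n. \<Sum>s<n. \<Sum>k<n. \<Sum>l<n. f r s k l) = (\<Sum>k<n. \<Sum>l<n. \<Sum>r<n. \<Sum>s<n. f r s k l)" for f :: "nat => nat => nat => nat => ('a \<times> nat set) \<times> ('a \<times> nat set) => complex"
      unfolding sum.cartesian_product by (rule sum.reindex_bij_witness[of _ "\<lambda>(k, l, r, s). (r, s, k, l)" "\<lambda>(r, s, k, l). (k, l, r, s)"]) auto
    then show ?thesis .
  qed
  also have "\<dots> = M2 (gg g) (Xm (conjB B g))"
    unfolding Xm_def mulf_sum_right mulf_scl_right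
    by (intro sum.cong refl) (simp add: conjB_entry[OF assms] scl_sum_left)
  finally show ?thesis .
qed

lemma PIB_gg:
  assumes "B \<in> carrier_mat n n" "g \<in> carrier G"
  shows "M2 (PIB B) (gg g) = M2 (gg g) (PIB (conjB B g))"
  unfolding PIB_def Ex_Xm(2)[symmetric]
  by (rule A2.Ex_intertwine) (use supp_gg Xm_gg assms Ex_Xm(1) in auto)

text \<open>The exponent that survives when \<open>J\<close> is moved past \<open>g\<close>. It will
  be the form of the Clifford algebra on the block of \<open>g\<close>.\<close>

definition bet :: "complex mat => 'a => nat \<times> nat => complex" where
  "bet B g p = B $$ p - conjB B g $$ p"

text \<open>Since \<open>J\<close> commutes with \<open>FF S\<close>, only the conjugation of
  \<open>g \<otimes> g\<close> by \<open>J\<close> matters; the exponent of the left factor is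
  conjugated by \<open>g\<close> and then added to the one of the right factor.\<close>

lemma zext_comul_J:
  assumes "B \<in> carrier_mat n n" "g \<in> carrier G" "S \<subseteq> {..<n}"
  shows "zext I2 (comul_J G n \<rho> B (basis (group_ext G n \<rho>) (g, S))) = M2 (gg g) (M2 (PI (bet B g)) (FF S))"
proof -
  have z: "zext I2 (a \<otimes>\<^bsub>elems A2\<^esub> b) = M2 (zext I2 a) (zext I2 b)" for a b
    using zext_mult[of A2 a b] by simp
  have C: "conjB B g \<in> carrier_mat n n" for B
    using carrier_matD[OF rho_carrier[OF inv_closed[OF assms(2)]]] by (intro carrier_matI) (simp_all add: conjB_def)
  have m: "M2 (PIB (- B)) (gg g) = M2 (gg g) (PI (\<lambda>p. - conjB B g $$ p))"
  proof -
    have "conjB (- B) g = - conjB B g"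
      using assms C[of "- B"] C[of B] by (intro eq_matI) (auto simp: conjB_entry sum_negf)
    then have "PIB (conjB (- B) g) = PI (\<lambda>p. - conjB B g $$ p)"
      using carrier_matD[OF C[of B]] unfolding PIB_def by (intro PI_cong) simp
    then show ?thesis using PIB_gg[of "- B" g] assms by simp
  qed
  have "zext I2 (comul_J G n \<rho> B (basis (group_ext G n \<rho>) (g, S))) = M2 (M2 (PIB (- B)) (M2 (gg g) (FF S))) (PIB B)"
    unfolding comul_J_def super_group_ext Let_def z zext_inv_J[OF assms(1)] zext_J zext_comul[OF assms(2,3)] ..
  also have "\<dots> = M2 (gg g) (M2 (M2 (PI (\<lambda>p. - conjB B g $$ p)) (PIB B)) (FF S))"
    unfolding A2.as[symmetric] m unfolding A2.as PIB_def PI_FF[OF assms(3)] ..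
  also have "M2 (PI (\<lambda>p. - conjB B g $$ p)) (PIB B) = PI (bet B g)"
    unfolding PIB_def PI_mult by (intro PI_cong) (simp add: bet_def)
  finally show ?thesis .
qed

end

section \<open>Local linear operators\<close>

text \<open>Elements of the tensor square are arbitrary functions on a product type that may be
  infinite, where operators in different variables need not commute just because they are linear.
  Finite dependence makes each coordinate a finite sum and repairs this, see
  \<open>op12_comm\<close>.\<close>

definition fdep :: "(('i => complex) => ('j => complex)) => bool" where
  "fdep D \<longleftrightarrow> linop D \<and> (\<forall>p. \<exists>F. finite F \<and> (\<forall>a b. (\<forall>i\<in>F. a i = b i) --> D a p = D b p))"

lemma fdep_linop: "fdep D ==> linop D"
  by (simp add: fdep_def)

lemma fdepI: "linop D ==> (\<And>p. \<exists>F. finite F \<and> (\<forall>a b. (\<forall>i\<in>F. a i = b i) --> D a p = D b p)) ==> fdep D"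
  by (simp add: fdep_def)

lemma fdep_ex: "fdep D ==> \<exists>F. finite F \<and> (\<forall>a b. (\<forall>i\<in>F. a i = b i) --> D a p = D b p)"
  by (simp add: fdep_def)

lemma fdep_expand:
  assumes "fdep D"
  shows "\<exists>F c. finite F \<and> (\<forall>a. D a p = (\<Sum>i\<in>F. a i * c i))"
proof -
  from fdep_ex[OF assms] obtain F where F: "finite F" "\<And>a b. (\<forall>i\<in>F. a i = b i) ==> D a p = D b p" by blast
  have "D a p = (\<Sum>i\<in>F. a i * D (sng i) p)" for a
  proof -
    have "(\<Sum>i\<in>F. scl (a i) (sng i)) j = a j" if "j \<in> F" for j
    proof -
      have "(\<Sum>i\<in>F. scl (a i) (sng i)) j = (\<Sum>i\<in>F. if i = j then a j else 0)"
        unfolding sum_apply by (intro sum.cong) (auto simp: scl_apply sng_def)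
      then show ?thesis using that F(1) by simp
    qed
    then have "D a p = D (\<Sum>i\<in>F. scl (a i) (sng i)) p" by (intro F(2)) auto
    then show ?thesis by (simp add: linop_sum[OF fdep_linop[OF assms]] linop_scl[OF fdep_linop[OF assms]] sum_apply scl_apply)
  qed
  then show ?thesis using F(1) by (intro exI conjI allI)
qed

definition op1 :: "(('i => complex) => ('k => complex)) => ('i \<times> 'j => complex) => ('k \<times> 'j => complex)" where
  "op1 D w = (\<lambda>(p, q). D (\<lambda>p. w (p, q)) p)"

definition op2 :: "(('j => complex) => ('k => complex)) => ('i \<times> 'j => complex) => ('i \<times> 'k => complex)" where
  "op2 D w = (\<lambda>(p, q). D (\<lambda>q. w (p, q)) q)"

lemma linop_op1: "linop D ==> linop (op1 D)"
proof -
  assume D: "linop D"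
  have e: "(\<lambda>p. (x + y) (p, q)) = (\<lambda>p. x (p, q)) + (\<lambda>p. y (p, q))" "(\<lambda>p. scl c x (p, q)) = scl c (\<lambda>p. x (p, q))"
    for x y :: "'i \<times> 'j => complex" and q c by (auto simp: plus_fun_apply scl_apply fun_eq_iff)
  show ?thesis
    by (rule linopI) (auto simp: op1_def e linop_add[OF D] linop_scl[OF D] fun_eq_iff, auto simp: plus_fun_apply scl_apply)
qed

lemma linop_op2: "linop D ==> linop (op2 D)"
proof -
  assume D: "linop D"
  have e: "(\<lambda>q. (x + y) (p, q)) = (\<lambda>q. x (p, q)) + (\<lambda>q. y (p, q))" "(\<lambda>q. scl c x (p, q)) = scl c (\<lambda>q. x (p, q))"
    for x y :: "'i \<times> 'j => complex" and p c by (auto simp: plus_fun_apply scl_apply fun_eq_iff)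
  show ?thesis
    by (rule linopI) (auto simp: op2_def e linop_add[OF D] linop_scl[OF D] fun_eq_iff, auto simp: plus_fun_apply scl_apply)
qed

text \<open>Transpose of right multiplication by the vector \<open>s\<close>. For finite
  \<open>S\<close> without \<open>s\<close> the sign equals
  \<open>(-1) ^ card {t \<in> S. s < t}\<close> (see \<open>sign_gt\<close>); it is written as in
  \<open>asc_right\<close>. The value \<open>0\<close> at infinite \<open>S\<close> lets the
  anticommutation law hold without side conditions.\<close>

definition Dr :: "nat => ('a \<times> nat set => complex) => ('a \<times> nat set => complex)" where
  "Dr s a = (\<lambda>(g, S). if s \<in> S \<or> infinite S then 0 else (-1) ^ (card S + card {t \<in> S. t < s}) * a (g, insert s S))"

context grepu
begin

text \<open>Transpose of right multiplication by \<open>u\<close>; the sign comes from moving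
  \<open>u\<close> past \<open>card S\<close> vectors. Outside \<open>carrier G\<close> the group
  element is left alone, so that the square is the identity on all functions.\<close>

definition taur :: "('a \<times> nat set => complex) => ('a \<times> nat set => complex)" where
  "taur a = (\<lambda>(g, S). (-1) ^ card S * a (if g \<in> carrier G then g \<otimes> u else g, S))"

text \<open>Transposed passage from the super coproduct to the coproduct of
  \<open>A(G,V,u,B)\<close>: the factor \<open>u \<otimes> 1\<close> on the odd part and the sign
  \<open>-(-1)^p(x)\<close>. As the total parity of the tensor is \<open>p(x)\<close>, that sign is
  \<open>(-1) ^ (card T * card U)\<close> and depends on the tensor alone.\<close>

definition Psi :: "(('a \<times> nat set) \<times> ('a \<times> nat set) => complex) => (('a \<times> nat set) \<times> ('a \<times> nat set) => complex)" where
  "Psi w = (\<lambda>((k, T), (l, U)). (-1) ^ (card T * card U) * w ((k \<otimes> u [^] card U, T), (l, U)))"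

lemma finite_I2 [simp]: "finite I2" by simp

lemma card_lt_gt: "finite S ==> s \<notin> S ==> card {t \<in> S. s < t} + card {t \<in> S. t < s} = card S"
  for s :: nat
proof -
  assume a: "finite S" "s \<notin> S"
  have "{t \<in> S. s < t} \<union> {t \<in> S. t < s} = S" using a(2) by (auto, metis nat_neq_iff)
  moreover have "card ({t \<in> S. s < t} \<union> {t \<in> S. t < s}) = card {t \<in> S. s < t} + card {t \<in> S. t < s}"
    by (rule card_Un_disjoint) (use a(1) in auto)
  ultimately show ?thesis by simp
qed

lemma sign_gt:
  fixes s :: nat
  assumes "finite S" "s \<notin> S"
  shows "(-1 :: complex) ^ card {t \<in> S. s < t} = (-1) ^ (card S + card {t \<in> S. t < s})"
proof -
  have "even (card {t \<in> S. s < t}) = even (card S + card {t \<in> S. t < s})"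
    unfolding card_lt_gt[OF assms, symmetric] even_add by blast
  then show ?thesis by (simp only: minus_one_power_iff)
qed

lemma mA_gam1: "i \<in> Idx ==> mA (sng i) (gam \<one>) = sng i"
  by (simp add: mA_one supp_on_sng)

lemma dot_av:
  assumes "supp_on I2 t" "s < n"
  shows "dot I2 (Psi w) (M2 t (av s)) = dot I2 (Psi (op1 (Dr s) w)) t"
proof (rule dot_transpose[OF _ assms(1) linop_mulf_left])
  fix i assume "i \<in> I2"
  then obtain k T l U where e: "i = ((k, T), (l, U))" and m: "k \<in> carrier G" "l \<in> carrier G" "T \<subseteq> {..<n}" "U \<subseteq> {..<n}"
    by (auto simp: Idx_def)
  have fi: "finite T" "finite U" using m by (auto intro: finite_subset)
  have lU: "(l, U) \<in> Idx" using m by (simp add: Idx_def)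
  have 1: "M2 (sng i) (av s) = scl ((-1) ^ (card U)) (tens (mA (sng (k, T)) (vec1 s)) (sng (l, U)))"
    unfolding e tens_sng[of "(k, T)" "(l, U)", symmetric] av_def
    by (subst mulf_super[OF homg_sng homg_vec1]) (simp add: mA_gam1[OF lU] minus_one_power_iff)
  show "dot I2 (Psi w) (M2 (sng i) (av s)) = Psi (op1 (Dr s) w) i"
  proof (cases "s \<in> T")
    case True
    then show ?thesis using m assms(2) unfolding 1
      by (simp add: e sng_vec1 tens_0_left dot_0 Psi_def op1_def Dr_def)
  next
    case False
    have "((k, insert s T), (l, U)) \<in> I2" using m assms(2) by (auto simp: Idx_def)
    then have "dot I2 (Psi w) (M2 (sng i) (av s)) = (-1) ^ card U * ((-1) ^ card {t \<in> T. s < t} * Psi w ((k, insert s T), (l, U)))"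
      using False m assms(2) unfolding 1 by (simp add: sng_vec1 tens_scl_left tens_sng dot_scl dot_sng)
    also have "\<dots> = Psi (op1 (Dr s) w) i"
      using False fi by (simp add: e Psi_def op1_def Dr_def sign_gt power_add card_insert_if add_mult_distrib)
    finally show ?thesis .
  qed
qed simp

text \<open>Under \<open>Psi\<close> the super sign turns into the translation \<open>taur\<close>
  in the first variable, in accordance with the coproduct
  \<open>v \<otimes> 1 + u \<otimes> v\<close> of vectors in the ordinary Hopf algebra.\<close>

lemma dot_bv:
  assumes "supp_on I2 t" "s < n"
  shows "dot I2 (Psi w) (M2 t (bv s)) = dot I2 (Psi (op1 taur (op2 (Dr s) w))) t"
proof (rule dot_transpose[OF _ assms(1) linop_mulf_left])
  fix i assume "i \<in> I2"
  then obtain k T l U where e: "i = ((k, T), (l, U))" and m: "k \<in> carrier G" "l \<in> carrier G" "T \<subseteq> {..<n}" "U \<subseteq> {..<n}"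
    by (auto simp: Idx_def)
  have fi: "finite T" "finite U" using m by (auto intro: finite_subset)
  have kT: "(k, T) \<in> Idx" using m by (simp add: Idx_def)
  have 1: "M2 (sng i) (bv s) = tens (sng (k, T)) (mA (sng (l, U)) (vec1 s))"
    unfolding e tens_sng[of "(k, T)" "(l, U)", symmetric] bv_def
    by (subst mulf_super[OF homg_sng homg_gam]) (simp add: mA_gam1[OF kT])
  show "dot I2 (Psi w) (M2 (sng i) (bv s)) = Psi (op1 taur (op2 (Dr s) w)) i"
  proof (cases "s \<in> U")
    case True
    then show ?thesis using m assms(2) unfolding 1
      by (simp add: e sng_vec1 tens_0_right dot_0 Psi_def op1_def op2_def Dr_def taur_def)
  next
    case False
    have "((k, T), (l, insert s U)) \<in> I2" using m assms(2) by (auto simp: Idx_def)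
    then have "dot I2 (Psi w) (M2 (sng i) (bv s)) = (-1) ^ card {t \<in> U. s < t} * Psi w ((k, T), (l, insert s U))"
      using False m assms(2) unfolding 1 by (simp add: sng_vec1 tens_scl_right tens_sng dot_scl dot_sng)
    also have "\<dots> = Psi (op1 taur (op2 (Dr s) w)) i"
      using False fi m by (simp add: e Psi_def op1_def op2_def Dr_def taur_def sign_gt power_add card_insert_if u_pow)
    finally show ?thesis .
  qed
qed simp

definition XO :: "nat \<times> nat => (('a \<times> nat set) \<times> ('a \<times> nat set) => complex) => (('a \<times> nat set) \<times> ('a \<times> nat set) => complex)" where
  "XO = (\<lambda>(r, s) w. op1 (Dr r) (op1 taur (op2 (Dr s) w)))"

definition DD :: "nat => (('a \<times> nat set) \<times> ('a \<times> nat set) => complex) => (('a \<times> nat set) \<times> ('a \<times> nat set) => complex)" where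
  "DD s w = op1 (Dr s) w + op1 taur (op2 (Dr s) w)"

lemma linop_Dr: "linop (Dr s)" and linop_taur: "linop taur"
  by (auto simp: linop_def Dr_def taur_def plus_fun_apply scl_apply fun_eq_iff algebra_simps)

lemma linop_XO: "linop (XO p)"
  by (cases p) (simp add: XO_def linop_comp[OF linop_op1[OF linop_Dr] linop_comp[OF linop_op1[OF linop_taur] linop_op2[OF linop_Dr]]])

lemma linop_DD: "linop (DD s)"
  unfolding linop_def DD_def
  by (simp add: linop_add[OF linop_op1[OF linop_Dr]] linop_add[OF linop_op2[OF linop_Dr]] linop_add[OF linop_op1[OF linop_taur]]
      linop_scl[OF linop_op1[OF linop_Dr]] linop_scl[OF linop_op2[OF linop_Dr]] linop_scl[OF linop_op1[OF linop_taur]] scl_add)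

lemma Psi_add: "Psi (v + w) = Psi v + Psi w" and Psi_scl: "Psi (scl c v) = scl c (Psi v)"
  by (auto simp: Psi_def plus_fun_apply scl_apply fun_eq_iff algebra_simps)

lemma dot_dl:
  assumes "supp_on I2 t" "s < n"
  shows "dot I2 (Psi w) (M2 t (dl s)) = dot I2 (Psi (DD s w)) t"
  unfolding dl_def DD_def mulf_add_right dot_add Psi_add dot_add_left dot_av[OF assms] dot_bv[OF assms] ..

lemma supp_M2: "supp_on I2 (M2 s t)"
  using supp_mulf[of A2] by simp

lemma dot_XX:
  assumes "supp_on I2 t" "r < n" "s < n"
  shows "dot I2 (Psi w) (M2 t (XX (r, s))) = dot I2 (Psi (XO (r, s) w)) t"
  unfolding XX_av_bv[OF assms(2,3)] A2.as[symmetric] dot_bv[OF supp_M2 assms(3)] dot_av[OF assms(1,2)] XO_def by simp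

definition XE :: "(nat \<times> nat => complex) => _" where
  "XE c w = foldr (\<lambda>p v. v + scl (c p) (XO p v)) prs w"

lemma dot_PI:
  assumes "supp_on I2 t"
  shows "dot I2 (Psi w) (M2 t (PI c)) = dot I2 (Psi (XE c w)) t"
proof -
  have "dot I2 (Psi w) (M2 t (A2.Pi c XX ps)) = dot I2 (Psi (foldr (\<lambda>p v. v + scl (c p) (XO p v)) ps w)) t"
    if "set ps \<subseteq> {..<n} \<times> {..<n}" "supp_on I2 t" for ps t
    using that
  proof (induction ps arbitrary: t)
    case Nil
    then show ?case by (simp add: A2.Pi_Nil A2.one_right)
  next
    case (Cons p ps)
    then obtain r s where p: "p = (r, s)" "r < n" "s < n" by auto
    let ?v = "foldr (\<lambda>p v. v + scl (c p) (XO p v)) ps w"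
    have "dot I2 (Psi w) (M2 t (A2.Pi c XX (p # ps))) = dot I2 (Psi ?v) (M2 t (one2 + scl (c p) (XX p)))"
      using Cons by (simp add: A2.Pi_Cons A2.as[symmetric] supp_M2)
    also have "\<dots> = dot I2 (Psi ?v) t + c p * dot I2 (Psi ?v) (M2 t (XX p))"
      using Cons.prems by (simp add: mulf_add_right mulf_scl_right dot_add dot_scl A2.one_right)
    also have "\<dots> = dot I2 (Psi (?v + scl (c p) (XO p ?v))) t"
      using Cons.prems p by (simp add: dot_XX Psi_add Psi_scl dot_add_left dot_scl_left)
    finally show ?case by simp
  qed
  from this[of prs t] show ?thesis
    using assms unfolding PI_def XE_def by (simp add: prs_def[THEN arg_cong[of _ _ set]] lessThan_atLeast0)
qed

lemma dot_FF:
  assumes "supp_on I2 t" "S \<subseteq> {..<n}"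
  shows "dot I2 (Psi w) (M2 t (FF S)) = dot I2 (Psi (foldr DD (sorted_list_of_set S) w)) t"
proof -
  have "dot I2 (Psi w) (M2 t (foldr (\<lambda>s. M2 (dl s)) xs one2)) = dot I2 (Psi (foldr DD xs w)) t"
    if "set xs \<subseteq> {..<n}" "supp_on I2 t" for xs t
    using that
  proof (induction xs arbitrary: t)
    case Nil
    then show ?case by (simp add: A2.one_right)
  next
    case (Cons s xs)
    then show ?case by (simp add: A2.as[symmetric] supp_M2 dot_dl)
  qed
  then show ?thesis using assms finite_subset[OF assms(2)] by (simp add: FF_def)
qed

text \<open>The sign in the coproduct refers to the parity of \<open>x\<close>, whereas
  \<open>Psi\<close> sees only the two tensor factors; homogeneity of the twisted coproduct links
  the two.\<close>

definition tpar :: "nat => (('a \<times> nat set) \<times> ('a \<times> nat set) => complex) => bool" where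
  "tpar d t \<longleftrightarrow> (\<forall>k T l U. t ((k, T), (l, U)) ~= 0 --> even (card T + card U) = even d)"

lemma mA_par: assumes "i \<in> Idx" "j \<in> Idx" "mulc AA i j k ~= 0" "k \<in> Idx"
  shows "even (parity AA k) = even (parity AA i + parity AA j)"
proof -
  have "mA (sng i) (sng j) k ~= 0" using assms by (subst mulf_sng) (auto simp: zext_def)
  then show ?thesis using homg_mA[OF assms(1,2)] unfolding homg_def by blast
qed

lemma tpar_M2:
  assumes "tpar d s" "tpar e t"
  shows "tpar (d + e) (M2 s t)"
  unfolding tpar_def
proof (intro allI impI)
  fix k T l U assume nz: "M2 s t ((k, T), (l, U)) ~= 0"
  then have kl: "(k, T) \<in> Idx" "(l, U) \<in> Idx" by (auto simp: mulf_def split: if_splits)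
  from mulf_nonzero[OF nz] obtain i i' j j' where
    m: "i \<in> Idx" "i' \<in> Idx" "j \<in> Idx" "j' \<in> Idx" and nz: "s (i, i') ~= 0" "t (j, j') ~= 0"
    "mulc A2 (i, i') (j, j') ((k, T), (l, U)) ~= 0" by auto
  then have c: "mulc AA i j (k, T) ~= 0" "mulc AA i' j' (l, U) ~= 0" by (auto simp: super_tensor_def)
  obtain i1 i2 i1' i2' j1 j2 j1' j2' where e: "i = (i1, i2)" "i' = (i1', i2')" "j = (j1, j2)" "j' = (j1', j2')"
    by (metis surj_pair)
  have "even (card i2 + card i2') = even d" "even (card j2 + card j2') = even e"
    using assms nz unfolding tpar_def e by blast+
  then show "even (card T + card U) = even (d + e)"
    using mA_par[OF m(1,3) c(1) kl(1)] mA_par[OF m(2,4) c(2) kl(2)] unfolding e by (simp; presburger)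
qed

lemma tpar_simple: "tpar 0 (gg g)" "tpar 0 one2" "tpar 1 (dl s)" "tpar 0 (XX p)"
proof -
  have a: "tpar 1 (av s)" "tpar 1 (bv s)" for s
    by (simp_all add: tpar_def av_def bv_def gam_def vec1_def tens_sng) (simp_all add: sng_def)
  show "tpar 0 (gg g)" "tpar 0 one2"
    by (simp_all add: tpar_def gg_def one2_def gam_def vec1_def tens_sng) (simp_all add: sng_def)
  show "tpar 1 (dl s)" using a[of s] unfolding tpar_def dl_def plus_fun_apply by (metis add.right_neutral)
  show "tpar 0 (XX p)"
    by (cases p) (simp add: tpar_def XX_def vec1_def tens_sng, simp add: sng_def zero_fun_apply)
qed

lemma tpar_PI: "tpar 0 (PI c)"
proof -
  have "tpar 0 (one2 + scl x (XX p))" for x p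
    using tpar_simple(2) tpar_simple(4)[of p] unfolding tpar_def plus_fun_apply scl_apply by (metis add.right_neutral mult_zero_right)
  then have "tpar 0 (A2.Pi c XX ps)" for ps
    using tpar_M2[of 0 _ 0] by (induction ps) (auto simp: A2.Pi_Nil A2.Pi_Cons tpar_simple)
  then show ?thesis by (simp add: PI_def)
qed

lemma tpar_FF: "finite S ==> tpar (card S) (FF S)"
proof -
  have "tpar (length xs) (foldr (\<lambda>s. M2 (dl s)) xs one2)" for xs
    using tpar_M2[OF tpar_simple(3)] by (induction xs) (auto simp: tpar_simple)
  from this[of "sorted_list_of_set S"] show "finite S ==> tpar (card S) (FF S)" by (simp add: FF_def)
qed

abbreviation "HA B \<equiv> hopf_A G n \<rho> u B"

lemma hopf_A_simps: "idx (HA B) = Idx" "mulc (HA B) = mulc AA" "unitc (HA B) = unitc AA" "counitc (HA B) = counitc AA"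
  by (simp_all add: hopf_A_def Let_def group_ext_def)

lemma idx_tensor [simp]: "idx (tensor_alg A A') = idx A \<times> idx A'"
  by (simp add: tensor_alg_def)

lemma gamu_left:
  assumes "supp_on I2 t"
  shows "mulf (tensor_alg (group_ext G n \<rho>) (group_ext G n \<rho>)) (sng ((u, {}), (\<one>, {}))) t ((k, T), (l, U)) =
    (if k \<in> carrier G then t ((u \<otimes> k, T), (l, U)) else 0)"
proof -
  let ?T = "tensor_alg (group_ext G n \<rho>) (group_ext G n \<rho>)"
  have I: "idx (group_ext G n \<rho>) = Idx" and mc: "mulc (group_ext G n \<rho>) = mulc AA" by (simp_all add: group_ext_def Let_def)
  have ui: "(u, {}) \<in> Idx" "(\<one>, {}) \<in> Idx" by (auto simp: Idx_def)
  have s: "mulf ?T (sng ((u, {}), (\<one>, {}))) (sng (i, j)) = tens (mA (gam u) (sng i)) (sng j)" if "i \<in> Idx" "j \<in> Idx" for i j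
  proof -
    have 1: "mA (gam \<one>) (sng j) = sng j" using that by (simp add: mA_one supp_on_sng)
    have "mulf ?T (sng ((u, {}), (\<one>, {}))) (sng (i, j)) = tens (mA (gam u) (sng i)) (mA (gam \<one>) (sng j))"
      unfolding gam_def using that ui
      by (subst (1 2 3) mulf_sng) (auto simp: I tensor_alg_def mc zext_def tens_def fun_eq_iff)
    then show ?thesis unfolding 1 .
  qed
  have g: "mA (gam u) (sng (k, T)) = sng (u \<otimes> k, T)" if "(k, T) \<in> Idx" for k T
    using that unfolding gam_def put_sng[symmetric]
    by (subst mulAA_put) (auto simp: Idx_def extl_sng extm_empty intro!: supp_on_sng WG_one_left arg_cong[where f="put (u \<otimes> k)"])
  have "linop (\<lambda>t. (\<lambda>((k, T), (l, U)). if k \<in> carrier G then t ((u \<otimes> k, T), (l, U)) else 0) :: ('a \<times> nat set) \<times> ('a \<times> nat set) => complex)"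
    by (auto simp: linop_def plus_fun_apply scl_apply fun_eq_iff)
  then have "mulf ?T (sng ((u, {}), (\<one>, {}))) t = (\<lambda>((k, T), (l, U)). if k \<in> carrier G then t ((u \<otimes> k, T), (l, U)) else 0)"
  proof (rule linop_eqI[OF finite_I2 assms linop_mulf_right])
    fix i assume "i \<in> I2"
    then obtain k T l U where e: "i = ((k, T), (l, U))" "(k, T) \<in> Idx" "(l, U) \<in> Idx" and k: "k \<in> carrier G" by (auto simp: Idx_def)
    have uk: "k' \<in> carrier G ==> u \<otimes> k' = k \<longleftrightarrow> k' = u \<otimes> k" for k'
      using k by (metis m_assoc u_in u_u l_one)
    show "mulf ?T (sng ((u, {}), (\<one>, {}))) (sng i) = (\<lambda>((k, T), (l, U)). if k \<in> carrier G then sng i ((u \<otimes> k, T), (l, U)) else 0)"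
      unfolding e(1) s[OF e(2,3)] g[OF e(2)] tens_sng using k by (auto simp: sng_def fun_eq_iff uk)
  qed
  then show ?thesis by simp
qed

text \<open>All factors to the right of \<open>gg g\<close> are transposed onto \<open>w\<close>,
  and pairing with the remaining basis tensor is evaluation at \<open>(g, {})\<close>. This closed
  form replaces the structure constants in what follows.\<close>

lemma comul_formula:
  assumes B: "B \<in> carrier_mat n n" and g: "g \<in> carrier G" and S: "S \<subseteq> {..<n}"
  shows "(\<Sum>p\<in>Idx. \<Sum>q\<in>Idx. w (p, q) * comulc (HA B) (g, S) p q) =
    XE (bet B g) (foldr DD (sorted_list_of_set S) w) ((g, {}), (g, {}))"
proof -
  let ?A = "group_ext G n \<rho>"
  let ?T = "tensor_alg ?A ?A"
  define t where "t = M2 (gg g) (M2 (PI (bet B g)) (FF S))"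
  have I: "idx ?A = Idx" and par: "parity ?A = parity AA" by (simp_all add: group_ext_def Let_def)
  have fS: "finite S" using S by (rule finite_subset) simp
  have st: "supp_on I2 t" by (simp add: t_def supp_M2)
  have tp: "tpar (card S) t"
    unfolding t_def using tpar_M2[OF tpar_simple(1) tpar_M2[OF tpar_PI tpar_FF[OF fS]]] by simp
  have tz: "comul_J G n \<rho> B (basis ?A (g, S)) p = t p" if "p \<in> I2" for p
    using zext_comul_J[OF assms] that unfolding t_def[symmetric] zext_def by (auto dest!: fun_cong[of _ _ p])
  define d0 where "d0 = (\<lambda>((k, T :: nat set), (l, U :: nat set)). if even (card U) then t ((k, T), (l, U)) else 0)"
  define d1 where "d1 = (\<lambda>((k, T :: nat set), (l, U :: nat set)). if odd (card U) then t ((k, T), (l, U)) else 0)"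
  have sd1: "supp_on I2 d1" using st by (auto simp: supp_on_def d1_def)
  have cm: "comulc (HA B) (g, S) (k, T) (l, U) = d0 ((k, T), (l, U)) - (-1) ^ card S * d1 ((u \<otimes> k, T), (l, U))"
    if kT: "(k, T) \<in> Idx" and lU: "(l, U) \<in> Idx" for k T l U
  proof -
    let ?D1 = "\<lambda>(y, z)\<in>idx ?T. if odd (parity ?A z) then comul_J G n \<rho> B (basis ?A (g, S)) (y, z) else 0"
    have z1: "zext I2 ?D1 = d1"
      using st by (auto simp: zext_def d1_def fun_eq_iff I par tz supp_on_def)
    have "(basis ?T ((u, {}), (\<one>, {})) \<otimes>\<^bsub>elems ?T\<^esub> ?D1) ((k, T), (l, U)) = mulf ?T (sng ((u, {}), (\<one>, {}))) ?D1 ((k, T), (l, U))"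
      unfolding elems_mult basis_sng restrict_mulf_restrict using that by (simp add: I)
    also have "\<dots> = mulf ?T (sng ((u, {}), (\<one>, {}))) d1 ((k, T), (l, U))"
      unfolding z1[symmetric] by (rule fun_cong[OF mulf_cong_idx]) (auto simp: zext_def I)
    also have "\<dots> = d1 ((u \<otimes> k, T), (l, U))"
      using that by (simp add: gamu_left[OF sd1] Idx_def)
    finally have "(basis ?T ((u, {}), (\<one>, {})) \<otimes>\<^bsub>elems ?T\<^esub> ?D1) ((k, T), (l, U)) = d1 ((u \<otimes> k, T), (l, U))" .
    then show ?thesis
      using that by (simp add: hopf_A_def Let_def I par tz d0_def minus_one_power_iff[of "card S mod 2"] minus_one_power_iff[of "card S"])
  qed
  have uu: "u \<otimes> (u \<otimes> k) = k" if "k \<in> carrier G" for k using that by (simp add: m_assoc[symmetric])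
  have "(\<Sum>p\<in>Idx. \<Sum>q\<in>Idx. w (p, q) * comulc (HA B) (g, S) p q) =
     (\<Sum>p\<in>Idx. \<Sum>q\<in>Idx. w (p, q) * d0 (p, q)) - (\<Sum>p\<in>Idx. \<Sum>q\<in>Idx. w (p, q) * ((-1) ^ card S * d1 ((u \<otimes> fst p, snd p), q)))"
    unfolding sum_subtractf[symmetric] right_diff_distrib[symmetric]
    by (intro sum.cong refl) (auto simp: cm)
  \<comment> \<open>Translating the first summation variable by \<open>u\<close> moves the factor
    \<open>u \<otimes> 1\<close> from the coproduct onto \<open>w\<close>.\<close>
  also have "(\<Sum>p\<in>Idx. \<Sum>q\<in>Idx. w (p, q) * ((-1) ^ card S * d1 ((u \<otimes> fst p, snd p), q))) =
     (\<Sum>p\<in>Idx. \<Sum>q\<in>Idx. w ((fst p \<otimes> u, snd p), q) * ((-1) ^ card S * d1 (p, q)))"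
    by (rule sum.reindex_bij_witness[of _ "\<lambda>p. (u \<otimes> fst p, snd p)" "\<lambda>p. (u \<otimes> fst p, snd p)"])
       (auto simp: Idx_def uu u_central[symmetric])
  also have "(\<Sum>p\<in>Idx. \<Sum>q\<in>Idx. w (p, q) * d0 (p, q)) - \<dots> = (\<Sum>p\<in>Idx. \<Sum>q\<in>Idx. t (p, q) * Psi w (p, q))"
    unfolding sum_subtractf[symmetric]
  proof (intro sum.cong refl)
    fix p q assume "p \<in> Idx" "q \<in> Idx"
    then obtain k T l U where e: "p = (k, T)" "q = (l, U)" "k \<in> carrier G" by (auto simp: Idx_def)
    show "w (p, q) * d0 (p, q) - w ((fst p \<otimes> u, snd p), q) * ((-1) ^ card S * d1 (p, q)) = t (p, q) * Psi w (p, q)"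
    proof (cases "t (p, q) = 0")
      case False
      \<comment> \<open>By homogeneity, \<open>- (-1) ^ card S\<close> equals
        \<open>(-1) ^ card T\<close> when \<open>card U\<close> is odd.\<close>
      then have "even (card T + card U) = even (card S)" using tp unfolding tpar_def e by blast
      then show ?thesis using e(3) by (auto simp: e d0_def d1_def Psi_def u_pow minus_one_power_iff)
    qed (simp add: e d0_def d1_def)
  qed
  also have "\<dots> = dot I2 (Psi w) t" by (simp add: dot_def sum.cartesian_product')
  also have "\<dots> = dot I2 (Psi (XE (bet B g) (foldr DD (sorted_list_of_set S) w))) (gg g)"
    unfolding t_def by (simp add: A2.as[symmetric] dot_FF[OF supp_M2 S] dot_PI[OF supp_gg[OF g]])
  also have "\<dots> = XE (bet B g) (foldr DD (sorted_list_of_set S) w) ((g, {}), (g, {}))"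
    using g unfolding gg_def gam_def tens_sng by (subst dot_sng) (auto simp: Idx_def Psi_def fin)
  finally show ?thesis .
qed

end

section \<open>The dual product\<close>

lemma fdep_op1:
  fixes D :: "('i => complex) => ('k => complex)"
  assumes D: "fdep D"
  shows "fdep (op1 D :: ('i \<times> 'j => complex) => _)"
proof (rule fdepI)
  show "linop (op1 D :: ('i \<times> 'j => complex) => _)" by (rule linop_op1[OF fdep_linop[OF D]])
  fix pq :: "'k \<times> 'j" obtain p q where e: "pq = (p, q)" by force
  from fdep_ex[OF D] obtain F where F: "finite F" "\<And>a b. (\<forall>i\<in>F. a i = b i) ==> D a p = D b p" by blast
  show "\<exists>F. finite F \<and> (\<forall>a b. (\<forall>i\<in>F. a i = b i) --> op1 D a pq = op1 D b pq)"
    by (rule exI[of _ "F \<times> {q}"]) (auto simp: F(1) op1_def e intro!: F(2))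
qed

lemma fdep_op2:
  fixes D :: "('j => complex) => ('k => complex)"
  assumes D: "fdep D"
  shows "fdep (op2 D :: ('i \<times> 'j => complex) => _)"
proof (rule fdepI)
  show "linop (op2 D :: ('i \<times> 'j => complex) => _)" by (rule linop_op2[OF fdep_linop[OF D]])
  fix pq :: "'i \<times> 'k" obtain p q where e: "pq = (p, q)" by force
  from fdep_ex[OF D] obtain F where F: "finite F" "\<And>a b. (\<forall>i\<in>F. a i = b i) ==> D a q = D b q" by blast
  show "\<exists>F. finite F \<and> (\<forall>a b. (\<forall>i\<in>F. a i = b i) --> op2 D a pq = op2 D b pq)"
    by (rule exI[of _ "{p} \<times> F"]) (auto simp: F(1) op2_def e intro!: F(2))
qed

text \<open>Each coordinate of \<open>D\<close> and of \<open>E\<close> is a finite sum by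
  \<open>fdep_expand\<close>, so the claim is an exchange of finite sums.\<close>

lemma op12_comm:
  fixes D :: "('a => complex) => ('c => complex)" and E :: "('b => complex) => ('d => complex)"
  assumes D: "fdep D" and E: "fdep E"
  shows "op2 E (op1 D w) = op1 D (op2 E w)"
proof (rule ext)
  fix pq :: "'c \<times> 'd"
  obtain p q where e: "pq = (p, q)" by force
  from fdep_expand[OF D, of p] obtain F c where F: "\<And>a. D a p = (\<Sum>i\<in>F. a i * c i)" by blast
  from fdep_expand[OF E, of q] obtain K d where K: "\<And>a. E a q = (\<Sum>i\<in>K. a i * d i)" by blast
  have "(\<Sum>j\<in>K. (\<Sum>i\<in>F. w (i, j) * c i) * d j) = (\<Sum>i\<in>F. (\<Sum>j\<in>K. w (i, j) * d j) * c i)"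
    by (simp add: sum_distrib_left sum_distrib_right algebra_simps) (rule sum.swap)
  then show "op2 E (op1 D w) pq = op1 D (op2 E w) pq" by (simp add: e op1_def op2_def F K)
qed

lemma op1_op1: "op1 D (op1 E w) = op1 (\<lambda>a. D (E a)) w"
  by (auto simp: op1_def)

lemma op2_op2: "op2 D (op2 E w) = op2 (\<lambda>a. D (E a)) w"
  by (auto simp: op2_def)

lemma op1_uminus: "op1 (\<lambda>a. - D a) w = - op1 D w"
  by (auto simp: op1_def uminus_apply fun_eq_iff)

lemma op2_uminus: "op2 (\<lambda>a. - D a) w = - op2 D w"
  by (auto simp: op2_def uminus_apply fun_eq_iff)

lemma op1_plus: "op1 (\<lambda>a. D a + E a) w = op1 D w + op1 E w"
  by (auto simp: op1_def plus_fun_apply fun_eq_iff)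

lemma op2_plus: "op2 (\<lambda>a. D a + E a) w = op2 D w + op2 E w"
  by (auto simp: op2_def plus_fun_apply fun_eq_iff)

lemma op1_scl: "op1 (\<lambda>a. scl c (D a)) w = scl c (op1 D w)"
  by (auto simp: op1_def scl_apply fun_eq_iff)

lemma op2_scl: "op2 (\<lambda>a. scl c (D a)) w = scl c (op2 D w)"
  by (auto simp: op2_def scl_apply fun_eq_iff)

lemma op1_id: "op1 (\<lambda>a. a) w = w"
  by (auto simp: op1_def)

lemma op2_id: "op2 (\<lambda>a. a) w = w"
  by (auto simp: op2_def)

text \<open>Ordered product of the operators \<open>1 + c p X p\<close>, the operator analogue of
  \<open>Pi\<close>; it plays the part of an exponential.\<close>

definition fo :: "('p => ('i => complex) => ('i => complex)) => ('p => complex) => 'p list => ('i => complex) => ('i => complex)" where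
  "fo X c ps w = foldr (\<lambda>p v. v + scl (c p) (X p v)) ps w"

lemma fo_Nil: "fo X c [] w = w" and fo_Cons: "fo X c (p # ps) w = fo X c ps w + scl (c p) (X p (fo X c ps w))"
  by (simp_all add: fo_def)

lemma fo_inter:
  assumes "linop T" "\<And>p v. X p (T v) = T (Y p v)"
  shows "fo X c ps (T w) = T (fo Y c ps w)"
  by (induction ps) (simp_all add: fo_Nil fo_Cons assms(2) linop_add[OF assms(1)] linop_scl[OF assms(1)])

lemma fo_op1: "op1 (fo X c ps) w = fo (\<lambda>p. op1 (X p)) c ps w"
proof (induction ps)
  case Nil
  have "fo X c [] = (\<lambda>a. a)" by (rule ext) (simp only: fo_Nil)
  then show ?case by (simp only: op1_id fo_Nil)
next
  case (Cons p ps)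
  have "fo X c (p # ps) = (\<lambda>a. fo X c ps a + scl (c p) (X p (fo X c ps a)))" by (rule ext) (simp only: fo_Cons)
  then show ?case by (simp only: op1_plus op1_scl op1_op1[of "X p" "fo X c ps" w, symmetric] fo_Cons Cons)
qed

lemma fo_op2: "op2 (fo X c ps) w = fo (\<lambda>p. op2 (X p)) c ps w"
proof (induction ps)
  case Nil
  have "fo X c [] = (\<lambda>a. a)" by (rule ext) (simp only: fo_Nil)
  then show ?case by (simp only: op2_id fo_Nil)
next
  case (Cons p ps)
  have "fo X c (p # ps) = (\<lambda>a. fo X c ps a + scl (c p) (X p (fo X c ps a)))" by (rule ext) (simp only: fo_Cons)
  then show ?case by (simp only: op2_plus op2_scl op2_op2[of "X p" "fo X c ps" w, symmetric] fo_Cons Cons)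
qed

lemma linop_fo: "(\<And>p. linop (X p)) ==> linop (fo X c ps)"
proof (induction ps)
  case (Cons p ps)
  from Cons(1)[OF Cons(2)] have "linop (fo X c ps)" .
  then show ?case using Cons(2)[of p]
    by (auto simp: linop_def fo_Cons linop_add[OF Cons(2)] linop_scl[OF Cons(2)] scl_add mult.commute)
qed (simp add: linop_def fo_Nil)

lemma fo_comm:
  assumes X: "\<And>p. linop (X p)" and Y: "\<And>p. linop (Y p)" and c: "\<And>p q v. X p (Y q v) = Y q (X p v)"
  shows "fo X c ps (fo Y d qs w) = fo Y d qs (fo X c ps w)"
proof -
  have "X p (fo Y d qs v) = fo Y d qs (X p v)" for p v
    by (rule fo_inter[symmetric]) (simp_all add: X c)
  then show ?thesis by (intro fo_inter linop_fo Y)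
qed

text \<open>The rule \<open>e^(X + Y) = e^X e^Y\<close>, factor by factor: the cross term of
  \<open>(1 + c X p)(1 + c Y p)\<close> vanishes because \<open>X p\<close> kills the image of
  \<open>Y p\<close>.\<close>

lemma fo_plus:
  assumes X: "\<And>p. linop (X p)" and Y: "\<And>p. linop (Y p)" and c: "\<And>p q v. X p (Y q v) = Y q (X p v)"
    and z: "\<And>p v. X p (Y p v) = 0"
  shows "fo (\<lambda>p v. X p v + Y p v) c ps w = fo X c ps (fo Y c ps w)"
proof (induction ps)
  case (Cons p ps)
  let ?v = "fo Y c ps w"
  have y: "fo X c ps (Y p v) = Y p (fo X c ps v)" for v
    by (rule fo_inter) (simp_all add: Y c)
  have "fo X c (p # ps) (fo Y c (p # ps) w) = fo X c ps ?v + scl (c p) (fo X c ps (Y p ?v)) +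
     scl (c p) (X p (fo X c ps ?v + scl (c p) (fo X c ps (Y p ?v))))"
    by (simp add: fo_Cons linop_add[OF linop_fo[OF X]] linop_scl[OF linop_fo[OF X]] linop_add[OF X] linop_scl[OF X] scl_add add_ac)
  also have "\<dots> = fo X c ps ?v + scl (c p) (X p (fo X c ps ?v) + Y p (fo X c ps ?v))"
    by (simp add: y linop_add[OF X] linop_scl[OF X] z scl_add add_ac)
  finally show ?case by (simp add: fo_Cons Cons)
qed (simp add: fo_Nil)

lemma Dr_anti: "Dr s (Dr t a) = - Dr t (Dr s a)"
proof
  fix x :: "'a \<times> nat set" obtain g S where x: "x = (g, S)" by force
  show "Dr s (Dr t a) x = (- Dr t (Dr s a)) x"
  proof (cases "s \<in> S \<or> t \<in> S \<or> infinite S \<or> s = t")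
    case True
    then show ?thesis by (auto simp: x Dr_def uminus_apply)
  next
    case False
    have e: "card {t'. (t' = a \<or> t' \<in> S) \<and> t' < b} = card {t' \<in> S. t' < b} + (if a < b then 1 else 0)" if "a \<notin> S" "finite S" for a b
    proof -
      have "{t'. (t' = a \<or> t' \<in> S) \<and> t' < b} = (if a < b then insert a {t' \<in> S. t' < b} else {t' \<in> S. t' < b})" by auto
      then show ?thesis using that by simp
    qed
    have "s < t \<or> t < s" using False by auto
    then show ?thesis using False
      by (auto simp: x Dr_def uminus_apply e power_add insert_commute)
  qed
qed

lemma fdep_Dr: "fdep (Dr s)"
proof (rule fdepI)
  show "linop (Dr s)" by (auto simp: linop_def Dr_def plus_fun_apply scl_apply fun_eq_iff algebra_simps)
  fix p :: "'a \<times> nat set"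
  show "\<exists>F. finite F \<and> (\<forall>a b. (\<forall>i\<in>F. a i = b i) --> Dr s a p = Dr s b p)"
    by (cases p, rule exI[of _ "{(fst p, insert s (snd p))}"]) (auto simp: Dr_def)
qed

context grepu
begin

definition taul :: "('a \<times> nat set => complex) => ('a \<times> nat set => complex)" where
  "taul a = (\<lambda>(g, S). a (if g \<in> carrier G then g \<otimes> u else g, S))"

text \<open>Transpose of left multiplication by the vector \<open>r\<close>. Moving it past
  \<open>g\<close> applies \<open>inv g\<close>, hence the matrix; the outer sign reduces the sign
  inside \<open>Dr\<close> to \<open>(-1) ^ card {t \<in> S. t < q}\<close>.\<close>

definition Dl :: "nat => ('a \<times> nat set => complex) => ('a \<times> nat set => complex)" where
  "Dl r a = (\<lambda>(g, S). if g \<in> carrier G then (-1) ^ card S * (\<Sum>q<n. \<rho> (inv g) $$ (q, r) * Dr q a (g, S)) else 0)"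

lemma fdep_taur: "fdep taur"
proof (rule fdepI[OF linop_taur])
  fix p :: "'a \<times> nat set"
  show "\<exists>F. finite F \<and> (\<forall>a b. (\<forall>i\<in>F. a i = b i) --> taur a p = taur b p)"
    by (cases p, rule exI[of _ "{(if fst p \<in> carrier G then fst p \<otimes> u else fst p, snd p)}"]) (auto simp: taur_def)
qed

lemma fdep_taul: "fdep taul"
proof (rule fdepI)
  show "linop taul" by (auto simp: linop_def taul_def plus_fun_apply scl_apply fun_eq_iff)
  fix p :: "'a \<times> nat set"
  show "\<exists>F. finite F \<and> (\<forall>a b. (\<forall>i\<in>F. a i = b i) --> taul a p = taul b p)"
    by (cases p, rule exI[of _ "{(if fst p \<in> carrier G then fst p \<otimes> u else fst p, snd p)}"]) (auto simp: taul_def)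
qed

lemma fdep_Dl: "fdep (Dl r)"
proof (rule fdepI)
  show "linop (Dl r)"
    by (auto simp: linop_def Dl_def linop_add[OF linop_Dr] linop_scl[OF linop_Dr] plus_fun_apply scl_apply fun_eq_iff
        algebra_simps sum.distrib sum_distrib_left)
  fix p :: "'a \<times> nat set"
  obtain g S where p: "p = (g, S)" by force
  show "\<exists>F. finite F \<and> (\<forall>a b. (\<forall>i\<in>F. a i = b i) --> Dl r a p = Dl r b p)"
    by (rule exI[of _ "(\<lambda>q. (g, insert q S)) ` {..<n}"]) (auto simp: p Dl_def Dr_def intro!: sum.cong arg_cong[where f="(*) _"])
qed

lemma Dr_taur: "Dr s (taur a) = - taur (Dr s a)"
  by (auto simp: fun_eq_iff Dr_def taur_def uminus_apply)

lemma taur_taur: "taur (taur a) = a"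
  by (auto simp: fun_eq_iff taur_def minus_one_power_iff)

lemma taul_taul: "taul (taul a) = a"
  by (auto simp: fun_eq_iff taul_def)

lemma taul_taur: "taul (taur a) = taur (taul a)"
  by (auto simp: fun_eq_iff taul_def taur_def)

lemma taul_Dr: "taul (Dr s a) = Dr s (taul a)"
  by (auto simp: fun_eq_iff taul_def Dr_def)

lemma taur_apply: "taur a (g, S) = (-1) ^ card S * a (if g \<in> carrier G then g \<otimes> u else g, S)"
  by (simp add: taur_def)

lemma taul_apply: "taul a (g, S) = a (if g \<in> carrier G then g \<otimes> u else g, S)"
  by (simp add: taul_def)

lemma rho_inv_gu: "g \<in> carrier G ==> q < n ==> r < n ==> \<rho> (inv (g \<otimes> u)) $$ (q, r) = - \<rho> (inv g) $$ (q, r)"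
proof -
  assume a: "g \<in> carrier G" "q < n" "r < n"
  have "\<rho> (inv (g \<otimes> u)) = (- 1\<^sub>m n) * \<rho> (inv g)"
    using a by (simp add: inv_mult_group rho_mult rho_u)
  also have "\<dots> = - \<rho> (inv g)" using rho_carrier[OF inv_closed[OF a(1)]] by (simp add: uminus_mult_left_mat[symmetric])
  finally show ?thesis using a carrier_matD[OF rho_carrier[OF inv_closed[OF a(1)]]] by simp
qed

text \<open>Transposed form of the fact that left and right multiplications commute.\<close>

lemma Dl_Dr: "Dl r (Dr s a) = Dr s (Dl r a)"
proof
  fix x :: "'a \<times> nat set"
  obtain g S where x: "x = (g, S)" by force
  have 1: "Dr q (Dr s a) (g, S) = - Dr s (Dr q a) (g, S)" for q
    by (subst Dr_anti) (simp add: uminus_apply)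
  show "Dl r (Dr s a) x = Dr s (Dl r a) x"
    unfolding x by (auto simp: Dl_def 1 sum_negf) (auto simp: Dr_def sum_distrib_left algebra_simps sum_negf intro!: sum.cong)
qed

lemma Dl_anti: "Dl r (Dl q a) = - Dl q (Dl r a)"
proof
  fix x :: "'a \<times> nat set"
  obtain g S where x: "x = (g, S)" by force
  have e: "Dl r (Dl q a) (g, S) = (\<Sum>k<n. \<Sum>l<n. \<rho> (inv g) $$ (k, r) * \<rho> (inv g) $$ (l, q) * Dr l (Dr k a) (g, S))"
    if g: "g \<in> carrier G" for r q
  proof -
    have "Dl r (Dl q a) (g, S) = (-1) ^ card S * (\<Sum>k<n. \<rho> (inv g) $$ (k, r) * Dl q (Dr k a) (g, S))"
      using g by (simp add: Dl_def[of r] Dl_Dr)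
    also have "\<dots> = (\<Sum>k<n. \<Sum>l<n. \<rho> (inv g) $$ (k, r) * \<rho> (inv g) $$ (l, q) * Dr l (Dr k a) (g, S))"
      using g by (simp add: Dl_def sum_distrib_left minus_one_power_iff mult.assoc)
    finally show ?thesis .
  qed
  have 1: "Dr k (Dr l a) (g, S) = - Dr l (Dr k a) (g, S)" for k l
    by (subst Dr_anti) (simp add: uminus_apply)
  show "Dl r (Dl q a) x = (- Dl q (Dl r a)) x"
  proof (cases "g \<in> carrier G")
    case True
    have "Dl q (Dl r a) (g, S) = (\<Sum>l<n. \<Sum>k<n. \<rho> (inv g) $$ (l, r) * \<rho> (inv g) $$ (k, q) * Dr l (Dr k a) (g, S))"
      unfolding e[OF True] by (subst sum.swap) (simp add: mult.commute)
    also have "\<dots> = - Dl r (Dl q a) (g, S)"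
      unfolding e[OF True] sum_negf[symmetric] by (intro sum.cong refl) (subst 1, simp)
    finally show ?thesis by (simp add: x uminus_apply)
  qed (simp add: x Dl_def uminus_apply)
qed

lemma Dl_taur: "Dl r (taur a) = taur (Dl r a)" if r: "r < n"
proof
  fix x :: "'a \<times> nat set"
  obtain g S where x: "x = (g, S)" by force
  show "Dl r (taur a) x = taur (Dl r a) x"
    using r by (auto simp: x Dl_def Dr_taur uminus_apply sum_negf taur_apply rho_inv_gu sum_distrib_left minus_one_power_iff)
qed

lemma Dl_taul: "Dl r (taul a) = - taul (Dl r a)" if r: "r < n"
proof
  fix x :: "'a \<times> nat set"
  obtain g S where x: "x = (g, S)" by force
  show "Dl r (taul a) x = (- taul (Dl r a)) x"
    using r by (simp add: x Dl_def taul_Dr[symmetric] uminus_apply taul_apply rho_inv_gu sum_negf)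
qed

text \<open>The mixed terms cancel because \<open>taur\<close> anticommutes with \<open>Dr\<close>,
  which is the Koszul sign of the super tensor square in transposed form.\<close>

interpretation DD: anticommuting DD
proof
  fix s t and w :: "('a \<times> nat set) \<times> ('a \<times> nat set) => complex"
  have 1: "op1 (Dr s) (op1 (Dr t) w) = - op1 (Dr t) (op1 (Dr s) w)" for s t and w :: "('a \<times> nat set) \<times> ('a \<times> nat set) => complex"
    unfolding op1_op1 by (subst Dr_anti) (simp add: op1_uminus)
  have 2: "op2 (Dr s) (op2 (Dr t) w) = - op2 (Dr t) (op2 (Dr s) w)" for s t and w :: "('a \<times> nat set) \<times> ('a \<times> nat set) => complex"
    unfolding op2_op2 by (subst Dr_anti) (simp add: op2_uminus)
  have 3: "op1 (Dr s) (op1 taur w) = - op1 taur (op1 (Dr s) w)" for s and w :: "('a \<times> nat set) \<times> ('a \<times> nat set) => complex"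
    unfolding op1_op1 by (subst Dr_taur) (simp add: op1_uminus)
  have 4: "op1 taur (op1 taur w) = w" for w :: "('a \<times> nat set) \<times> ('a \<times> nat set) => complex"
    by (simp add: op1_op1 taur_taur op1_id)
  show "DD s (DD t w) = - DD t (DD s w)"
    unfolding DD_def
    by (simp add: linop_add[OF linop_op1[OF linop_Dr]] linop_add[OF linop_op1[OF linop_taur]] linop_add[OF linop_op2[OF linop_Dr]]
        op12_comm[OF fdep_Dr fdep_Dr] op12_comm[OF fdep_taur fdep_Dr] 3 4 2[of s t] 1[of s t] linop_minus[OF linop_op2[OF linop_Dr]])
qed (rule linop_DD)

text \<open>The dual product on all functions of two variables, not only on \<open>tens a b\<close>;
  in this generality operators can be moved under it and it can be iterated through
  \<open>op1\<close> and \<open>op2\<close>.\<close>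

definition cm :: "complex mat => (('a \<times> nat set) \<times> ('a \<times> nat set) => complex) => ('a \<times> nat set => complex)" where
  "cm B w = (\<lambda>k. if k \<in> Idx then \<Sum>p\<in>Idx. \<Sum>q\<in>Idx. w (p, q) * comulc (HA B) k p q else 0)"

lemma cm_eq: "B \<in> carrier_mat n n ==> (g, S) \<in> Idx ==> cm B w (g, S) = XE (bet B g) (DD.asc S w) ((g, {}), (g, {}))"
  using comul_formula[of B g S w] by (simp add: cm_def Idx_def DD.asc_def)

lemma cm_outside: "k \<notin> Idx ==> cm B w k = 0"
  by (simp add: cm_def)

lemma supp_cm [simp]: "supp_on Idx (cm B w)"
  by (simp add: supp_on_def cm_def)

lemma fdep_cm: "fdep (cm B)"
proof (rule fdepI)
  show "linop (cm B)"
    by (auto simp: linop_def cm_def plus_fun_apply scl_apply fun_eq_iff algebra_simps sum.distrib sum_distrib_left)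
  show "\<exists>F. finite F \<and> (\<forall>a b. (\<forall>i\<in>F. a i = b i) --> cm B a p = cm B b p)" for p
    by (rule exI[of _ "Idx \<times> Idx"]) (auto simp: cm_def intro!: sum.cong)
qed

lemma linop_XE: "linop (XE c)"
  using linop_fo[of XO, OF linop_XO, of c prs] by (simp add: XE_def[abs_def] fo_def[abs_def])

lemma XE_fo: "XE c = fo XO c prs"
  by (simp add: XE_def[abs_def] fo_def[abs_def])

context
  fixes B :: "complex mat" assumes B: "B \<in> carrier_mat n n"
begin

text \<open>The sign of \<open>Dr\<close> is the one of \<open>asc_right\<close>, so one more factor
  \<open>DD s\<close> appears at the inner end. On pure tensors this is a skew Leibniz rule with
  \<open>taur\<close>.\<close>

lemma Dr_cm: "s < n ==> Dr s (cm B w) = cm B (DD s w)"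
proof
  fix x :: "'a \<times> nat set"
  assume s: "s < n"
  obtain g S where x: "x = (g, S)" by force
  show "Dr s (cm B w) x = cm B (DD s w) x"
  proof (cases "(g, S) \<in> Idx")
    case False
    then have "(g, insert s S) \<notin> Idx" by (auto simp: Idx_def)
    then show ?thesis using False by (simp add: x Dr_def cm_outside)
  next
    case True
    then have f: "finite S" and i: "(g, insert s S) \<in> Idx" using s by (auto simp: Idx_def intro: finite_subset)
    show ?thesis
      using f by (simp add: x Dr_def cm_eq[OF B True] cm_eq[OF B i] DD.asc_right linop_scl[OF linop_XE] linop_0[OF linop_XE] scl_apply zero_fun_apply)
  qed
qed

lemma asc_inter:
  assumes "linop T" "\<And>s v. DD s (T v) = T (DD s v)"
  shows "DD.asc S (T w) = T (DD.asc S w)"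
proof -
  have "foldr DD xs (T w) = T (foldr DD xs w)" for xs by (induction xs) (simp_all add: assms)
  then show ?thesis by (simp add: DD.asc_def)
qed

lemma asc_inter_minus:
  assumes "linop T" "\<And>s v. DD s (T v) = - T (DD s v)" "finite S"
  shows "DD.asc S (T w) = scl ((-1) ^ card S) (T (DD.asc S w))"
proof -
  have "foldr DD xs (T w) = scl ((-1) ^ length xs) (T (foldr DD xs w))" for xs
    by (induction xs) (simp_all add: assms linop_scl[OF linop_DD] scl_minus_left scl_minus)
  then show ?thesis using assms(3) by (simp add: DD.asc_def)
qed

lemma op1_ac:
  fixes w :: "('a \<times> nat set) \<times> ('a \<times> nat set) => complex"
  shows "op1 (Dr s) (op1 (Dr t) w) = - op1 (Dr t) (op1 (Dr s) w)"
    "op2 (Dr s) (op2 (Dr t) w) = - op2 (Dr t) (op2 (Dr s) w)"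
    "op1 (Dr s) (op1 taur w) = - op1 taur (op1 (Dr s) w)"
    "op2 (Dr s) (op2 taur w) = - op2 taur (op2 (Dr s) w)"
    "op1 taur (op1 taur w) = w" "op2 taur (op2 taur w) = w"
    "op1 taul (op1 taur w) = op1 taur (op1 taul w)" "op2 taul (op2 taur w) = op2 taur (op2 taul w)"
    "op1 taul (op1 (Dr s) w) = op1 (Dr s) (op1 taul w)" "op2 taul (op2 (Dr s) w) = op2 (Dr s) (op2 taul w)"
    "op1 (Dl r) (op1 (Dr s) w) = op1 (Dr s) (op1 (Dl r) w)" "op2 (Dl r) (op2 (Dr s) w) = op2 (Dr s) (op2 (Dl r) w)"
    "r < n ==> op1 (Dl r) (op1 taur w) = op1 taur (op1 (Dl r) w)" "r < n ==> op2 (Dl r) (op2 taur w) = op2 taur (op2 (Dl r) w)"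
  unfolding op1_op1 op2_op2
  by (subst Dr_anti, simp add: op1_uminus op2_uminus)+
     (simp_all add: Dr_taur op1_uminus op2_uminus taur_taur op1_id op2_id taul_taur taul_Dr Dl_Dr Dl_taur)

lemmas op12 = op12_comm[OF fdep_Dr fdep_Dr] op12_comm[OF fdep_taur fdep_Dr] op12_comm[OF fdep_Dr fdep_taur] op12_comm[OF fdep_taur fdep_taur]
  op12_comm[OF fdep_taul fdep_Dr] op12_comm[OF fdep_Dr fdep_taul] op12_comm[OF fdep_taul fdep_taur] op12_comm[OF fdep_taur fdep_taul]
  op12_comm[OF fdep_Dl fdep_Dr] op12_comm[OF fdep_Dl fdep_taur] op12_comm[OF fdep_Dr fdep_Dl] op12_comm[OF fdep_taur fdep_Dl]
  op12_comm[OF fdep_taul fdep_Dl] op12_comm[OF fdep_Dl fdep_taul] op12_comm[OF fdep_taul fdep_taul]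

lemmas lin12 = linop_add[OF linop_op1[OF linop_Dr]] linop_add[OF linop_op1[OF linop_taur]] linop_add[OF linop_op2[OF linop_Dr]]
  linop_add[OF linop_op2[OF linop_taur]] linop_minus[OF linop_op1[OF linop_Dr]] linop_minus[OF linop_op1[OF linop_taur]]
  linop_minus[OF linop_op2[OF linop_Dr]] linop_minus[OF linop_op2[OF linop_taur]]
  linop_add[OF linop_op1[OF fdep_linop[OF fdep_taul]]] linop_add[OF linop_op2[OF fdep_linop[OF fdep_taul]]]
  linop_minus[OF linop_op1[OF fdep_linop[OF fdep_taul]]] linop_minus[OF linop_op2[OF fdep_linop[OF fdep_taul]]]
  linop_add[OF linop_op1[OF fdep_linop[OF fdep_Dl]]] linop_add[OF linop_op2[OF fdep_linop[OF fdep_Dl]]]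
  linop_minus[OF linop_op1[OF fdep_linop[OF fdep_Dl]]] linop_minus[OF linop_op2[OF fdep_linop[OF fdep_Dl]]]

text \<open>\<open>u\<close> acts by \<open>-1\<close> in both arguments of the form, so the form
  depends only on the coset of \<open>g\<close> modulo \<open>u\<close>.\<close>

lemma bet_gu: "g \<in> carrier G ==> k < n ==> l < n ==> bet B (g \<otimes> u) (k, l) = bet B g (k, l)"
  by (simp add: bet_def conjB_entry[OF B] rho_inv_gu)

lemma XE_cong: "(\<And>r s. r < n ==> s < n ==> c (r, s) = d (r, s)) ==> XE c = XE d"
  unfolding XE_def[abs_def] by (intro ext foldr_cong) (auto simp: prs_def)

lemma taur_cm: "taur (cm B w) = cm B (op1 taur (op2 taur w))"
proof
  fix x :: "'a \<times> nat set"
  obtain g S where x: "x = (g, S)" by force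
  let ?T = "\<lambda>w. op1 taur (op2 taur w)"
  have lT: "linop ?T" by (rule linop_comp[OF linop_op1[OF linop_taur] linop_op2[OF linop_taur]])
  show "taur (cm B w) x = cm B (op1 taur (op2 taur w)) x"
  proof (cases "(g, S) \<in> Idx")
    case False
    then have "(if g \<in> carrier G then g \<otimes> u else g, S) \<notin> Idx" by (auto simp: Idx_def)
    then show ?thesis using False by (simp add: x taur_def cm_outside)
  next
    case True
    then have f: "finite S" and i: "(g \<otimes> u, S) \<in> Idx" and g: "g \<in> carrier G" by (auto simp: Idx_def intro: finite_subset)
    have b: "XE (bet B (g \<otimes> u)) = XE (bet B g)" by (rule XE_cong) (simp add: bet_gu g)
    have 1: "DD.asc S (?T w) = scl ((-1) ^ card S) (?T (DD.asc S w))"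
      by (rule asc_inter_minus[OF lT _ f]) (simp add: DD_def lin12 op12 op1_ac)
    have 2: "XE c (?T v) = ?T (XE c v)" for c v
      unfolding XE_fo by (rule fo_inter[OF lT]) (auto simp: XO_def lin12 op12 op1_ac)
    show ?thesis
      using g by (simp add: x taur_def cm_eq[OF B True] cm_eq[OF B i] 1 linop_scl[OF linop_XE] 2 scl_apply b)
        (simp add: op1_def op2_def taur_def)
  qed
qed

lemma taul_cm: "taul (cm B w) = cm B (op1 taul (op2 taul w))"
proof
  fix x :: "'a \<times> nat set"
  obtain g S where x: "x = (g, S)" by force
  let ?T = "\<lambda>w. op1 taul (op2 taul w)"
  have lT: "linop ?T" by (rule linop_comp[OF linop_op1[OF fdep_linop[OF fdep_taul]] linop_op2[OF fdep_linop[OF fdep_taul]]])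
  show "taul (cm B w) x = cm B (op1 taul (op2 taul w)) x"
  proof (cases "(g, S) \<in> Idx")
    case False
    then have "(if g \<in> carrier G then g \<otimes> u else g, S) \<notin> Idx" by (auto simp: Idx_def)
    then show ?thesis using False by (simp add: x taul_def cm_outside)
  next
    case True
    then have i: "(g \<otimes> u, S) \<in> Idx" and g: "g \<in> carrier G" by (auto simp: Idx_def)
    have b: "XE (bet B (g \<otimes> u)) = XE (bet B g)" by (rule XE_cong) (simp add: bet_gu g)
    have 1: "DD.asc S (?T w) = ?T (DD.asc S w)"
      by (rule asc_inter[OF lT]) (simp add: DD_def lin12 op12 op1_ac)
    have 2: "XE c (?T v) = ?T (XE c v)" for c v
      unfolding XE_fo by (rule fo_inter[OF lT]) (auto simp: XO_def lin12 op12 op1_ac)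
    show ?thesis
      using g by (simp add: x taul_def cm_eq[OF B True] cm_eq[OF B i] 1 2 b) (simp add: op1_def op2_def taul_def)
  qed
qed

text \<open>\<open>DD q\<close> commutes with the exponential, so the derivatives of the product can
  be evaluated at \<open>(g, {})\<close> in both variables; there \<open>Dl\<close> and
  \<open>Dr\<close> are linked by the matrix of \<open>inv g\<close>, the same for both
  variables.\<close>

lemma Dl_cm: "r < n ==> Dl r (cm B w) = cm B (op1 (Dl r) w + op1 taul (op2 (Dl r) w))"
proof
  fix x :: "'a \<times> nat set"
  assume r: "r < n"
  obtain g S where x: "x = (g, S)" by force
  let ?T = "\<lambda>w. op1 (Dl r) w + op1 taul (op2 (Dl r) w)"
  have lT: "linop ?T"
    using linop_op1[OF fdep_linop[OF fdep_Dl[of r]]] linop_comp[OF linop_op1[OF fdep_linop[OF fdep_taul]] linop_op2[OF fdep_linop[OF fdep_Dl[of r]]]]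
    by (auto simp: linop_def scl_add)
  show "Dl r (cm B w) x = cm B (?T w) x"
  proof (cases "(g, S) \<in> Idx")
    case False
    have "Dr q (cm B w) (g, S) = 0" if "q < n" for q using False that by (simp add: Dr_cm cm_outside)
    then show ?thesis using False by (simp add: x Dl_def cm_outside)
  next
    case True
    then have f: "finite S" and g: "g \<in> carrier G" by (auto simp: Idx_def intro: finite_subset)
    define v where "v = XE (bet B g) (DD.asc S w)"
    have 1: "DD.asc S (?T w) = ?T (DD.asc S w)"
      by (rule asc_inter[OF lT]) (simp add: DD_def lin12 op12 op1_ac r add_ac)
    have 2: "XE c (?T v) = ?T (XE c v)" for c v
      unfolding XE_fo by (rule fo_inter[OF lT]) (auto simp: XO_def lin12 op12 op1_ac r)
    have 3: "XE c (DD q v) = DD q (XE c v)" for c q v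
      unfolding XE_fo
    proof (rule fo_inter[OF linop_DD])
      fix p :: "nat \<times> nat" and v
      obtain a b where p: "p = (a, b)" by force
      show "XO p (DD q v) = DD q (XO p v)"
        by (simp add: p XO_def DD_def lin12 op12 op1_ac(3-)) (simp add: op1_ac(1)[of a q] op1_ac(2)[of b q] op1_ac(5) lin12 linop_diff[OF linop_op1[OF linop_taur]])
    qed
    have 4: "DD.asc S (DD q w) = scl ((-1) ^ card S) (DD q (DD.asc S w))" for q
      using DD.foldr_commute[of q "sorted_list_of_set S" w] f by (simp add: DD.asc_def power_mult_distrib[symmetric])
    have 5: "Dr q (cm B w) (g, S) = (-1) ^ card S * DD q v ((g, {}), (g, {}))" if "q < n" for q
      using that by (simp add: Dr_cm cm_eq[OF B True] 4 linop_scl[OF linop_XE] 3 scl_apply v_def)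
    have "Dl r (cm B w) (g, S) = (\<Sum>q<n. \<rho> (inv g) $$ (q, r) * DD q v ((g, {}), (g, {})))"
      using g by (simp add: Dl_def 5 sum_distrib_left minus_one_power_iff)
    also have "\<dots> = ?T v ((g, {}), (g, {}))"
      using g by (simp add: DD_def plus_fun_apply op1_def op2_def taur_def taul_def Dl_def sum.distrib algebra_simps)
    also have "\<dots> = cm B (?T w) (g, S)" by (simp add: cm_eq[OF B True] 1 2 v_def)
    finally show ?thesis by (simp add: x)
  qed
qed

end

end

context grepu
begin

subsection \<open>Coassociativity\<close>

type_synonym 'k fun3 = "('k \<times> 'k) \<times> 'k => complex"

abbreviation "d1 s \<equiv> op1 (op1 (Dr s))"
abbreviation "d2 s \<equiv> op1 (op2 (Dr s))"
abbreviation "d3 s \<equiv> op2 (Dr s)"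
abbreviation "t1 \<equiv> op1 (op1 taur)"
abbreviation "t2 \<equiv> op1 (op2 taur)"
abbreviation "t3 \<equiv> op2 taur"

definition X12 :: "nat \<times> nat => ('a \<times> nat set) fun3 => ('a \<times> nat set) fun3" where
  "X12 = (\<lambda>(r, s) w. d1 r (t1 (d2 s w)))"
text \<open>The additional \<open>t2\<close> is what \<open>op1_cm\<close> leaves in the middle
  factor when \<open>taur\<close> is applied to a product.\<close>

definition X13 :: "nat \<times> nat => ('a \<times> nat set) fun3 => ('a \<times> nat set) fun3" where
  "X13 = (\<lambda>(r, s) w. d1 r (t1 (t2 (d3 s w))))"
definition X23 :: "nat \<times> nat => ('a \<times> nat set) fun3 => ('a \<times> nat set) fun3" where
  "X23 = (\<lambda>(r, s) w. d2 r (t2 (d3 s w)))"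

lemmas fd = fdep_Dr fdep_taur fdep_op1[OF fdep_Dr] fdep_op2[OF fdep_Dr] fdep_op1[OF fdep_taur] fdep_op2[OF fdep_taur]

context
  fixes w :: "('a \<times> nat set) fun3"
begin

lemma r_comm:
  "d2 s (d1 r w) = d1 r (d2 s w)" "t2 (d1 r w) = d1 r (t2 w)" "d2 s (t1 w) = t1 (d2 s w)" "t2 (t1 w) = t1 (t2 w)"
  "d3 s (d1 r w) = d1 r (d3 s w)" "d3 s (t1 w) = t1 (d3 s w)" "d3 s (d2 r w) = d2 r (d3 s w)" "d3 s (t2 w) = t2 (d3 s w)"
  "t3 (d1 r w) = d1 r (t3 w)" "t3 (t1 w) = t1 (t3 w)" "t3 (d2 r w) = d2 r (t3 w)" "t3 (t2 w) = t2 (t3 w)"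
  by (simp_all only: op1_op1 op12_comm[OF fdep_Dr fdep_Dr] op12_comm[OF fdep_Dr fdep_taur] op12_comm[OF fdep_taur fdep_Dr]
     op12_comm[OF fdep_taur fdep_taur] op12_comm[OF fd(3) fdep_Dr] op12_comm[OF fd(4) fdep_Dr] op12_comm[OF fd(5) fdep_Dr] op12_comm[OF fd(6) fdep_Dr]
     op12_comm[OF fd(3) fdep_taur] op12_comm[OF fd(4) fdep_taur] op12_comm[OF fd(5) fdep_taur] op12_comm[OF fd(6) fdep_taur])

lemma r_same:
  "t1 (d1 r w) = - d1 r (t1 w)" "t2 (d2 r w) = - d2 r (t2 w)" "t3 (d3 r w) = - d3 r (t3 w)"
  "t1 (t1 w) = w" "t2 (t2 w) = w" "t3 (t3 w) = w"
  by (simp_all add: op1_op1 op2_op2 Dr_taur op1_uminus op2_uminus taur_taur op1_id op2_id)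

lemma r_anti:
  "d1 r (d1 s w) = - d1 s (d1 r w)" "d2 r (d2 s w) = - d2 s (d2 r w)" "d3 r (d3 s w) = - d3 s (d3 r w)"
proof -
  have e: "(\<lambda>a. Dr r (Dr s a)) = (\<lambda>a. - Dr s (Dr r (a :: 'a \<times> nat set => complex)))" by (rule ext) (rule Dr_anti)
  have u: "op1 (\<lambda>a. - D a) = (\<lambda>w. - op1 D w)" "op2 (\<lambda>a. - D a) = (\<lambda>w. - op2 D w)"
    for D :: "('a \<times> nat set => complex) => ('a \<times> nat set => complex)"
    by (rule ext, rule op1_uminus, rule ext, rule op2_uminus)
  show "d1 r (d1 s w) = - d1 s (d1 r w)" "d2 r (d2 s w) = - d2 s (d2 r w)" "d3 r (d3 s w) = - d3 s (d3 r w)"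
    by (simp_all only: op1_op1 op2_op2 e u op1_uminus)
qed

end

lemma selfneg: "x = - x ==> x = (0 :: 'k => complex)"
  by (auto simp: fun_eq_iff uminus_apply zero_fun_apply)

lemma r_zero: "d1 r (d1 r w) = 0" "d2 r (d2 r w) = 0" "d3 r (d3 r w) = 0" for w :: "('a \<times> nat set) fun3"
  using r_anti(1)[of r r w] r_anti(2)[of r r w] r_anti(3)[of r r w] by (auto intro: selfneg)

lemma lin3: "linop (d1 s)" "linop (d2 s)" "linop (d3 s)" "linop t1" "linop t2" "linop t3"
  by (intro linop_op1 linop_op2 linop_Dr linop_taur)+

lemmas lin3' = linop_minus[OF lin3(1)] linop_minus[OF lin3(2)] linop_minus[OF lin3(3)] linop_minus[OF lin3(4)] linop_minus[OF lin3(5)] linop_minus[OF lin3(6)]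
  linop_add[OF lin3(1)] linop_add[OF lin3(2)] linop_add[OF lin3(3)] linop_add[OF lin3(4)] linop_add[OF lin3(5)] linop_add[OF lin3(6)]
  linop_0[OF lin3(1)] linop_0[OF lin3(2)] linop_0[OF lin3(3)] linop_0[OF lin3(4)] linop_0[OF lin3(5)] linop_0[OF lin3(6)]

lemma linop_X: "linop (X12 p)" "linop (X13 p)" "linop (X23 p)"
  by (cases p; simp add: X12_def X13_def X23_def linop_comp lin3
      linop_comp[OF lin3(1) linop_comp[OF lin3(4) lin3(2)]] linop_comp[OF lin3(2) linop_comp[OF lin3(5) lin3(3)]]
      linop_comp[OF lin3(1) linop_comp[OF lin3(4) linop_comp[OF lin3(5) lin3(3)]]])+

lemma X_comm: "X12 p (X13 q w) = X13 q (X12 p w)" "X13 p (X23 q w) = X23 q (X13 p w)" "X12 p (X23 q w) = X23 q (X12 p w)"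
proof -
  obtain a b c d where e: "p = (a, b)" "q = (c, d)" by force
  show "X12 p (X13 q w) = X13 q (X12 p w)"
    by (simp add: e X12_def X13_def r_comm r_same lin3' r_anti(1)[of a c])
  show "X13 p (X23 q w) = X23 q (X13 p w)"
    by (simp add: e X13_def X23_def r_comm r_same lin3' r_anti(3)[of b d])
  show "X12 p (X23 q w) = X23 q (X12 p w)"
    by (simp add: e X12_def X23_def r_comm r_same lin3' r_anti(2)[of b c])
qed

lemma X_zero: "X12 p (X13 p w) = 0" "X13 p (X12 p w) = 0" "X13 p (X23 p w) = 0" "X23 p (X13 p w) = 0"
  by (cases p; simp add: X12_def X13_def X23_def r_comm r_same lin3' r_zero)+

definition asr :: "('a \<times> nat set) fun3 => (('a \<times> nat set) \<times> (('a \<times> nat set) \<times> ('a \<times> nat set)) => complex)" where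
  "asr w = (\<lambda>(x, y, z). w ((x, y), z))"

lemma linop_asr: "linop asr"
  by (auto simp: linop_def asr_def plus_fun_apply scl_apply fun_eq_iff)

lemma asr_ops: "op1 D (asr w) = asr (op1 (op1 D) w)" "op2 (op1 D) (asr w) = asr (op1 (op2 D) w)" "op2 (op2 D) (asr w) = asr (op2 D w)"
  by (auto simp: asr_def op1_def op2_def)

lemma op1_XO: "op1 (XO p) = X12 p"
proof
  fix w
  obtain r s where p: "p = (r, s)" by force
  have "XO p = (\<lambda>w. op1 (Dr r) (op1 taur (op2 (Dr s) w)))" by (rule ext) (simp add: p XO_def)
  then show "op1 (XO p) w = X12 p w"
    by (simp only: p X12_def prod.case op1_op1[of "op1 (Dr r)"] op1_op1[of "op1 taur"])
qed

lemma op2_XO: "op2 (XO p) (asr w) = asr (X23 p w)"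
proof -
  obtain r s where p: "p = (r, s)" by force
  have "op2 (XO p) (asr w) = op2 (op1 (Dr r)) (op2 (op1 taur) (op2 (op2 (Dr s)) (asr w)))"
    unfolding op2_op2[of "op1 (Dr r)"] op2_op2[of "op1 taur"] by (simp add: p XO_def op2_def)
  then show ?thesis by (simp add: asr_ops p X23_def)
qed

lemma Dr_max:
  assumes "finite S" "s \<notin> S"
  shows "a (g, insert s S) = (-1) ^ (card S + card {t \<in> S. t < s}) * Dr s a (g, S)"
  using assms by (simp add: Dr_def minus_one_power_iff)

context
  fixes B :: "complex mat" assumes B: "B \<in> carrier_mat n n"
begin

lemma op1_cm:
  "s < n ==> op1 (Dr s) (op1 (cm B) v) = op1 (cm B) (d1 s v + t1 (d2 s v))"
  "op1 taur (op1 (cm B) v) = op1 (cm B) (t1 (t2 v))"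
  "op2 (Dr s) (op1 (cm B) v) = op1 (cm B) (d3 s v)"
proof -
  have 1: "(\<lambda>w. Dr s (cm B w)) = (\<lambda>w. cm B (DD s w))" if "s < n" by (rule ext) (rule Dr_cm[OF B that])
  have 2: "(\<lambda>w. taur (cm B w)) = (\<lambda>w. cm B (op1 taur (op2 taur w)))" by (rule ext) (rule taur_cm[OF B])
  have 3: "DD s = (\<lambda>w. op1 (Dr s) w + op1 taur (op2 (Dr s) w))" by (rule ext) (rule DD_def)
  show "op1 (Dr s) (op1 (cm B) v) = op1 (cm B) (d1 s v + t1 (d2 s v))" if "s < n"
    unfolding op1_op1[of "Dr s"] 1[OF that] unfolding op1_op1[of "cm B" "DD s", symmetric]
    unfolding 3 op1_plus unfolding op1_op1[of "op1 taur" "op2 (Dr s)", symmetric] ..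
  show "op1 taur (op1 (cm B) v) = op1 (cm B) (t1 (t2 v))"
    unfolding op1_op1[of taur] 2 op1_op1[of "cm B", symmetric, of "\<lambda>w. op1 taur (op2 taur w)"] op1_op1[of "op1 taur" "op2 taur", symmetric] ..
  show "op2 (Dr s) (op1 (cm B) v) = op1 (cm B) (d3 s v)"
    by (rule op12_comm[OF fdep_cm fdep_Dr])
qed

lemma op2_cm:
  "s < n ==> op2 (Dr s) (op2 (cm B) v) = op2 (cm B) (op2 (op1 (Dr s)) v + op2 (op1 taur) (op2 (op2 (Dr s)) v))"
  "op2 taur (op2 (cm B) v) = op2 (cm B) (op2 (op1 taur) (op2 (op2 taur) v))"
  "op1 (Dr s) (op2 (cm B) v) = op2 (cm B) (op1 (Dr s) v)"
  "op1 taur (op2 (cm B) v) = op2 (cm B) (op1 taur v)"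
proof -
  have 1: "(\<lambda>w. Dr s (cm B w)) = (\<lambda>w. cm B (DD s w))" if "s < n" by (rule ext) (rule Dr_cm[OF B that])
  have 2: "(\<lambda>w. taur (cm B w)) = (\<lambda>w. cm B (op1 taur (op2 taur w)))" by (rule ext) (rule taur_cm[OF B])
  have 3: "DD s = (\<lambda>w. op1 (Dr s) w + op1 taur (op2 (Dr s) w))" by (rule ext) (rule DD_def)
  show "op2 (Dr s) (op2 (cm B) v) = op2 (cm B) (op2 (op1 (Dr s)) v + op2 (op1 taur) (op2 (op2 (Dr s)) v))" if "s < n"
    unfolding op2_op2[of "Dr s"] 1[OF that] unfolding op2_op2[of "cm B" "DD s", symmetric]
    unfolding 3 op2_plus unfolding op2_op2[of "op1 taur" "op2 (Dr s)", symmetric] ..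
  show "op2 taur (op2 (cm B) v) = op2 (cm B) (op2 (op1 taur) (op2 (op2 taur) v))"
    unfolding op2_op2[of taur] 2 op2_op2[of "cm B", symmetric, of "\<lambda>w. op1 taur (op2 taur w)"] op2_op2[of "op1 taur" "op2 taur", symmetric] ..
  show "op1 (Dr s) (op2 (cm B) v) = op2 (cm B) (op1 (Dr s) v)"
    by (rule op12_comm[OF fdep_Dr fdep_cm, symmetric])
  show "op1 taur (op2 (cm B) v) = op2 (cm B) (op1 taur v)"
    by (rule op12_comm[OF fdep_taur fdep_cm, symmetric])
qed

lemma lincm: "linop (op1 (cm B))" "linop (op2 (cm B))"
  by (intro linop_op1 linop_op2 fdep_linop[OF fdep_cm])+

lemma XO_op1_cm: "r < n ==> s < n ==> XO (r, s) (op1 (cm B) v) = op1 (cm B) (X13 (r, s) v + X23 (r, s) v)"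
  by (simp add: XO_def X13_def X23_def op1_cm r_comm r_same lin3')

lemma XO_op2_cm: "r < n ==> s < n ==> XO (r, s) (op2 (cm B) (asr v)) = op2 (cm B) (asr (X12 (r, s) v + X13 (r, s) v))"
  by (simp add: XO_def X12_def X13_def op2_cm op1_cm asr_ops linop_add[OF linop_asr, symmetric] lin3')

lemma fo_inter':
  assumes "linop T" "\<And>p v. p \<in> set ps ==> X p (T v) = T (Y p v)"
  shows "fo X c ps (T w) = T (fo Y c ps w)"
  using assms(2)
  by (induction ps) (simp_all add: fo_Nil fo_Cons linop_add[OF assms(1)] linop_scl[OF assms(1)])

lemma prs_mem: "p \<in> set prs \<longleftrightarrow> fst p < n \<and> snd p < n"
  by (cases p) (auto simp: prs_def)

text \<open>Both sides become the product of the exponentials of \<open>X12\<close>,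
  \<open>X13\<close> and \<open>X23\<close>: a coproduct in one factor splits the exponent into two
  families, which \<open>fo_plus\<close> separates, and the three families commute.\<close>

lemma coassoc_base:
  assumes g: "g \<in> carrier G"
  shows "cm B (op1 (cm B) w) (g, {}) = cm B (op2 (cm B) (asr w)) (g, {})"
proof -
  let ?c = "bet B g" let ?e = "(g, {}) :: 'a \<times> nat set"
  have gI: "(g, {}) \<in> Idx" using g by (simp add: Idx_def)
  have cmg: "cm B v ?e = XE ?c v (?e, ?e)" for v
    using comul_formula[OF B g, of "{}" v] gI by (simp add: cm_def)
  have "cm B (op1 (cm B) w) ?e = fo XO ?c prs (op1 (cm B) w) (?e, ?e)" unfolding cmg XE_fo ..
  also have "fo XO ?c prs (op1 (cm B) w) = op1 (cm B) (fo (\<lambda>p v. X13 p v + X23 p v) ?c prs w)"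
    by (rule fo_inter'[OF lincm(1)]) (auto simp: prs_mem XO_op1_cm)
  also have "fo (\<lambda>p v. X13 p v + X23 p v) ?c prs w = fo X13 ?c prs (fo X23 ?c prs w)"
    by (rule fo_plus) (simp_all add: linop_X X_comm X_zero)
  also have "op1 (cm B) (fo X13 ?c prs (fo X23 ?c prs w)) (?e, ?e) = op1 (fo XO ?c prs) (fo X13 ?c prs (fo X23 ?c prs w)) ((?e, ?e), ?e)"
    by (simp add: op1_def cmg XE_fo)
  also have "op1 (fo XO ?c prs) (fo X13 ?c prs (fo X23 ?c prs w)) = fo X12 ?c prs (fo X13 ?c prs (fo X23 ?c prs w))"
    unfolding fo_op1 op1_XO ..
  also have "\<dots> = fo X23 ?c prs (fo X12 ?c prs (fo X13 ?c prs w))"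
  proof -
    have "fo X13 ?c prs (fo X23 ?c prs w) = fo X23 ?c prs (fo X13 ?c prs w)"
      by (rule fo_comm) (simp_all add: linop_X X_comm)
    moreover have "fo X12 ?c prs (fo X23 ?c prs v) = fo X23 ?c prs (fo X12 ?c prs v)" for v
      by (rule fo_comm) (simp_all add: linop_X X_comm)
    ultimately show ?thesis by simp
  qed
  also have "fo X12 ?c prs (fo X13 ?c prs w) = fo (\<lambda>p v. X12 p v + X13 p v) ?c prs w"
    by (rule fo_plus[symmetric]) (simp_all add: linop_X X_comm X_zero)
  also have "fo X23 ?c prs \<dots> ((?e, ?e), ?e) = asr (fo X23 ?c prs (fo (\<lambda>p v. X12 p v + X13 p v) ?c prs w)) (?e, (?e, ?e))"
    by (simp add: asr_def)
  also have "asr (fo X23 ?c prs (fo (\<lambda>p v. X12 p v + X13 p v) ?c prs w)) = op2 (fo XO ?c prs) (asr (fo (\<lambda>p v. X12 p v + X13 p v) ?c prs w))"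
    unfolding fo_op2 
    by (rule fo_inter[where T=asr and X="\<lambda>p. op2 (XO p)" and Y=X23, symmetric]) (simp_all add: linop_asr op2_XO)
  also have "\<dots> (?e, (?e, ?e)) = op2 (cm B) (asr (fo (\<lambda>p v. X12 p v + X13 p v) ?c prs w)) (?e, ?e)"
    by (simp add: op2_def cmg XE_fo)
  also have "op2 (cm B) (asr (fo (\<lambda>p v. X12 p v + X13 p v) ?c prs w)) = fo XO ?c prs (op2 (cm B) (asr w))"
    by (rule fo_inter'[where T="\<lambda>v. op2 (cm B) (asr v)" and X=XO and Y="\<lambda>p v. X12 p v + X13 p v", symmetric])
      (auto simp: prs_mem XO_op2_cm intro: linop_comp[OF lincm(2) linop_asr])
  also have "\<dots> (?e, ?e) = cm B (op2 (cm B) (asr w)) ?e" unfolding cmg XE_fo ..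
  finally show ?thesis .
qed

text \<open>Both sides satisfy the same Leibniz rule under \<open>Dr s\<close>, so induction on
  \<open>S\<close> reduces the claim to \<open>coassoc_base\<close>.\<close>

lemma coassoc_cm: "cm B (op1 (cm B) w) = cm B (op2 (cm B) (asr w))"
proof
  fix x :: "'a \<times> nat set"
  obtain g S where x: "x = (g, S)" by force
  show "cm B (op1 (cm B) w) x = cm B (op2 (cm B) (asr w)) x"
  proof (cases "(g, S) \<in> Idx")
    case True
    then have g: "g \<in> carrier G" and S: "S \<subseteq> {..<n}" by (auto simp: Idx_def)
    have "finite S" using S by (rule finite_subset) simp
    then have "cm B (op1 (cm B) w) (g, S) = cm B (op2 (cm B) (asr w)) (g, S)" using S
    proof (induction S arbitrary: w rule: finite_induct)
      case empty
      show ?case by (rule coassoc_base[OF g])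
    next
      case (insert s S)
      then have s: "s < n" by auto
      let ?D = "\<lambda>w. d1 s w + t1 (d2 s w) + t1 (t2 (d3 s w))"
      have 1: "Dr s (cm B (op1 (cm B) w)) = cm B (op1 (cm B) (?D w))"
        unfolding Dr_cm[OF B s] DD_def by (simp add: op1_cm s linop_add[OF lincm(1)] add_ac)
      have 2: "Dr s (cm B (op2 (cm B) (asr w))) = cm B (op2 (cm B) (asr (?D w)))"
        unfolding Dr_cm[OF B s] DD_def
        by (simp add: op2_cm s linop_add[OF lincm(2)] linop_add[OF linop_asr] asr_ops linop_add[OF linop_op1[OF linop_taur]] add_ac)
      show ?case using insert by (simp add: Dr_max[OF insert(1,2)] 1 2)
    qed
    then show ?thesis by (simp add: x)
  qed (simp add: x cm_outside)
qed

end

end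

section \<open>The dual algebra and its blocks\<close>

context grepu
begin

definition star :: "complex mat => ('a \<times> nat set => complex) => ('a \<times> nat set => complex) => ('a \<times> nat set => complex)" where
  "star B a b = cm B (tens a b)"

definition eps :: "'a \<times> nat set => complex" where
  "eps = (\<lambda>(g, S). if g \<in> carrier G \<and> S = {} then 1 else 0)"

lemma mulf_dual: "mulf (dual_hopf (HA B)) a b = star B a b"
  by (auto simp: mulf_def dual_hopf_def star_def cm_def hopf_A_simps tens_def fun_eq_iff)

lemma linop_star_left: "linop (\<lambda>a. star B a b)" and linop_star_right: "linop (star B a)"
  unfolding star_def
  by (rule linop_comp[OF fdep_linop[OF fdep_cm] linop_tens_left], rule linop_comp[OF fdep_linop[OF fdep_cm] linop_tens_right])

lemmas star_lin = linop_add[OF linop_star_left] linop_add[OF linop_star_right] linop_scl[OF linop_star_left] linop_scl[OF linop_star_right]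
  linop_minus[OF linop_star_left] linop_minus[OF linop_star_right] linop_diff[OF linop_star_left] linop_diff[OF linop_star_right]
  linop_sum[OF linop_star_left] linop_sum[OF linop_star_right] linop_0[OF linop_star_left] linop_0[OF linop_star_right]

lemma supp_star [simp]: "supp_on Idx (star B a b)"
  by (simp add: star_def)

lemma op1_tens:
  assumes "linop D"
  shows "op1 D (tens a b) = tens (D a) b"
proof -
  have "op1 D (tens a b) (p, q) = tens (D a) b (p, q)" for p q
  proof -
    have e: "(\<lambda>p. tens a b (p, q)) = scl (b q) a" by (auto simp: tens_def scl_apply)
    have "op1 D (tens a b) (p, q) = D (\<lambda>p. tens a b (p, q)) p" by (simp add: op1_def)
    then show ?thesis by (simp only: e linop_scl[OF assms] scl_apply) (simp add: tens_def)
  qed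
  then show ?thesis by auto
qed

lemma op2_tens:
  assumes "linop D"
  shows "op2 D (tens a b) = tens a (D b)"
proof -
  have "op2 D (tens a b) (p, q) = tens a (D b) (p, q)" for p q
  proof -
    have e: "(\<lambda>q. tens a b (p, q)) = scl (a p) b" by (auto simp: tens_def scl_apply)
    have "op2 D (tens a b) (p, q) = D (\<lambda>q. tens a b (p, q)) q" by (simp add: op2_def)
    then show ?thesis by (simp only: e linop_scl[OF assms] scl_apply) (simp add: tens_def)
  qed
  then show ?thesis by auto
qed

lemma linop_taul: "linop taul" and linop_Dl: "linop (Dl r)"
  by (rule fdep_linop[OF fdep_taul], rule fdep_linop[OF fdep_Dl])

lemmas op_lin = linop_add[OF linop_Dr] linop_add[OF linop_taur] linop_add[OF linop_taul] linop_add[OF linop_Dl]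
  linop_scl[OF linop_Dr] linop_scl[OF linop_taur] linop_scl[OF linop_taul] linop_scl[OF linop_Dl]
  linop_minus[OF linop_Dr] linop_minus[OF linop_taur] linop_minus[OF linop_taul] linop_minus[OF linop_Dl]
  linop_diff[OF linop_Dr] linop_diff[OF linop_taur] linop_diff[OF linop_taul] linop_diff[OF linop_Dl]
  linop_sum[OF linop_Dr] linop_sum[OF linop_taur] linop_sum[OF linop_taul] linop_sum[OF linop_Dl]
  linop_0[OF linop_Dr] linop_0[OF linop_taur] linop_0[OF linop_taul] linop_0[OF linop_Dl]

lemma supp_Dr: "supp_on Idx a ==> supp_on Idx (Dr s a)"
  by (auto simp: supp_on_def Dr_def Idx_def)

lemma supp_taur: "supp_on Idx a ==> supp_on Idx (taur a)"
  by (auto simp: supp_on_def taur_def Idx_def)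

lemma supp_taul: "supp_on Idx a ==> supp_on Idx (taul a)"
  by (auto simp: supp_on_def taul_def Idx_def)

lemma supp_Dl: "supp_on Idx a ==> supp_on Idx (Dl r a)"
proof -
  assume a: "supp_on Idx a"
  have "Dr q a (g, S) = 0" if "(g, S) \<notin> Idx" for q g S using supp_Dr[OF a, of q] that by (auto simp: supp_on_def)
  then show ?thesis by (auto simp: supp_on_def Dl_def)
qed

lemma supp_eps: "supp_on Idx eps"
  by (auto simp: supp_on_def eps_def Idx_def)

text \<open>By \<open>Dr_max\<close> the value at \<open>insert s S\<close> is, up to sign, a value
  of \<open>Dr s\<close> at \<open>S\<close>. A supported function is therefore determined by the
  values of its iterated derivatives at the group elements.\<close>

lemma Dr_coinduct:
  assumes "R f h" "supp_on Idx f" "supp_on Idx h"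
    and "\<And>f h g. R f h ==> g \<in> carrier G ==> f (g, {}) = h (g, {})"
    and "\<And>f h s. R f h ==> s < n ==> R (Dr s f) (Dr s h)"
  shows "f = h"
proof
  fix x :: "'a \<times> nat set"
  obtain g S where x: "x = (g, S)" by force
  show "f x = h x"
  proof (cases "x \<in> Idx")
    case True
    then have g: "g \<in> carrier G" and S: "S \<subseteq> {..<n}" by (auto simp: Idx_def x)
    have "finite S" using S by (rule finite_subset) simp
    then have "f (g, S) = h (g, S)" using S assms(1)
    proof (induction S arbitrary: f h rule: finite_induct)
      case empty
      then show ?case using assms(4) g by blast
    next
      case (insert s S)
      then have "Dr s f (g, S) = Dr s h (g, S)" using assms(5) by (intro insert.IH) auto
      then show ?case unfolding Dr_max[OF insert(1,2), of f] Dr_max[OF insert(1,2), of h] by simp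
    qed
    then show ?thesis by (simp add: x)
  next
    case False
    then show ?thesis using assms(2,3) unfolding supp_on_def by metis
  qed
qed

lemma Dr_coinduct_fun:
  assumes "supp_on Idx a"
    and "\<And>a. supp_on Idx a ==> supp_on Idx (F a)" "\<And>a. supp_on Idx a ==> supp_on Idx (H a)"
    and "\<And>a g. supp_on Idx a ==> g \<in> carrier G ==> F a (g, {}) = H a (g, {})"
    and "\<And>a s. supp_on Idx a ==> s < n ==> Dr s (F a) = F (Dr s a)"
    and "\<And>a s. supp_on Idx a ==> s < n ==> Dr s (H a) = H (Dr s a)"
  shows "F a = H a"
proof (rule Dr_coinduct[where R="\<lambda>f h. \<exists>a. supp_on Idx a \<and> f = F a \<and> h = H a"])
  fix f h s assume "\<exists>a. supp_on Idx a \<and> f = F a \<and> h = H a" and s: "s < n"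
  then obtain b where "supp_on Idx b" "f = F b" "h = H b" by blast
  then show "\<exists>a. supp_on Idx a \<and> Dr s f = F a \<and> Dr s h = H a"
    using supp_Dr assms(5,6) s by blast
qed (use assms(1-4) in blast)+

context
  fixes B :: "complex mat" assumes B: "B \<in> carrier_mat n n"
begin

lemma star_assoc: "star B (star B a b) c = star B a (star B b c)"
proof -
  have "star B (star B a b) c = cm B (op1 (cm B) (tens (tens a b) c))"
    by (simp add: star_def op1_tens fdep_linop[OF fdep_cm])
  also have "\<dots> = cm B (op2 (cm B) (tens a (tens b c)))"
    unfolding coassoc_cm[OF B] by (rule arg_cong[of _ _ "\<lambda>x. cm B (op2 (cm B) x)"]) (auto simp: asr_def tens_def)
  also have "\<dots> = star B a (star B b c)" by (simp add: star_def op2_tens fdep_linop[OF fdep_cm])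
  finally show ?thesis .
qed

lemma Dr_star: "s < n ==> Dr s (star B a b) = star B (Dr s a) b + star B (taur a) (Dr s b)"
  by (simp add: star_def Dr_cm[OF B] DD_def op1_tens op2_tens linop_Dr linop_taur linop_add[OF fdep_linop[OF fdep_cm]])

lemma taur_star: "taur (star B a b) = star B (taur a) (taur b)"
  by (simp add: star_def taur_cm[OF B] op1_tens op2_tens linop_taur)

lemma taul_star: "taul (star B a b) = star B (taul a) (taul b)"
  by (simp add: star_def taul_cm[OF B] op1_tens op2_tens linop_taul)

lemma Dl_star: "r < n ==> Dl r (star B a b) = star B (Dl r a) b + star B (taul a) (Dl r b)"
  by (simp add: star_def Dl_cm[OF B] op1_tens op2_tens linop_taul linop_Dl linop_add[OF fdep_linop[OF fdep_cm]])

lemma star_base: "g \<in> carrier G ==> star B a b (g, {}) = fo XO (bet B g) prs (tens a b) ((g, {}), (g, {}))"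
  using comul_formula[OF B, of g "{}" "tens a b"] by (simp add: star_def cm_def Idx_def XE_fo)

lemma XO_tens: "XO (r, s) (tens a b) = tens (Dr r (taur a)) (Dr s b)"
  by (simp add: XO_def op1_tens op2_tens linop_Dr linop_taur)

lemma fo_kill:
  assumes "\<And>p q. X p (X q w) = 0" "\<And>p. linop (X p)"
  shows "fo X c ps w = w + sum_list (map (\<lambda>p. scl (c p) (X p w)) ps)"
proof (induction ps)
  case (Cons p ps)
  have "X p (sum_list (map (\<lambda>p. scl (c p) (X p w)) ps)) = 0"
  proof (induction ps)
    case (Cons q qs)
    then show ?case by (simp add: linop_add[OF assms(2)] linop_scl[OF assms(2)] assms(1))
  qed (simp add: linop_0[OF assms(2)])
  then show ?case by (simp add: fo_Cons Cons linop_add[OF assms(2)] add_ac)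
qed (simp add: fo_Nil)

lemma sum_list_prs: "sum_list (map f prs) = (\<Sum>r<n. \<Sum>s<n. (f (r, s) :: 'k => complex))"
  unfolding prs_def by (subst sum_list_distinct_conv_sum_set)
    (auto simp: distinct_product lessThan_atLeast0 sum.cartesian_product')

lemma tens_zero: "tens 0 b = 0" "tens a 0 = 0"
  by (simp_all add: tens_0_left tens_0_right)

text \<open>Vanishing second derivatives of one factor stop the exponential after its linear
  term.\<close>

lemma star_base1:
  assumes "g \<in> carrier G" "(\<forall>r r'. Dr r (Dr r' a) = 0) \<or> (\<forall>r r'. Dr r (Dr r' b) = 0)"
  shows "star B a b (g, {}) = a (g, {}) * b (g, {}) - (\<Sum>r<n. \<Sum>s<n. bet B g (r, s) * a (g \<otimes> u, {r}) * b (g, {s}))"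
proof -
  have k: "XO p (XO q (tens a b)) = 0" for p q
  proof -
    obtain x y z w where e: "p = (x, y)" "q = (z, w)" by force
    have "Dr x (taur (Dr z (taur a))) = - Dr x (Dr z (taur (taur a)))" by (simp only: Dr_taur op_lin minus_minus)
    then show ?thesis using assms(2) by (auto simp: e XO_tens taur_taur tens_zero)
  qed
  have "star B a b (g, {}) = (tens a b + (\<Sum>r<n. \<Sum>s<n. scl (bet B g (r, s)) (tens (Dr r (taur a)) (Dr s b)))) ((g, {}), (g, {}))"
    unfolding star_base[OF assms(1)] fo_kill[of XO, OF k linop_XO] sum_list_prs XO_tens ..
  also have "\<dots> = a (g, {}) * b (g, {}) - (\<Sum>r<n. \<Sum>s<n. bet B g (r, s) * a (g \<otimes> u, {r}) * b (g, {s}))"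
    using assms(1) by (simp add: plus_fun_apply sum_apply scl_apply tens_def Dr_def taur_def sum_negf[symmetric] mult.assoc)
  finally show ?thesis .
qed

lemma star_base0:
  assumes "g \<in> carrier G" "(\<forall>r. Dr r a = 0) \<or> (\<forall>r. Dr r b = 0)"
  shows "star B a b (g, {}) = a (g, {}) * b (g, {})"
proof -
  have "(\<forall>r r'. Dr r (Dr r' a) = 0) \<or> (\<forall>r r'. Dr r (Dr r' b) = 0)"
    using assms(2) by (auto simp: op_lin)
  note b1 = star_base1[OF assms(1) this]
  have z: "bet B g (r, s) * a (g \<otimes> u, {r}) * b (g, {s}) = 0" for r s
  proof -
    have "Dr r a (g \<otimes> u, {}) = a (g \<otimes> u, {r})" "Dr s b (g, {}) = b (g, {s})" by (simp_all add: Dr_def)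
    then show ?thesis using assms(2) by (auto simp: zero_fun_apply)
  qed
  show ?thesis unfolding b1 z by simp
qed

lemma eps_ops: "Dr s eps = 0" "taur eps = eps" "taul eps = eps" "Dl r eps = 0"
proof -
  show 1: "Dr s eps = 0" for s by (auto simp: Dr_def eps_def fun_eq_iff zero_fun_apply)
  show "taur eps = eps" "taul eps = eps" by (auto simp: taur_def taul_def eps_def fun_eq_iff)
  show "Dl r eps = 0" by (auto simp: Dl_def 1 fun_eq_iff zero_fun_apply)
qed

lemma eps_val: "g \<in> carrier G ==> eps (g, {}) = 1"
  by (simp add: eps_def)

lemma star_eps_left: "supp_on Idx a ==> star B eps a = a"
  by (rule Dr_coinduct_fun[where F="star B eps" and H="\<lambda>a. a"])
     (auto simp: star_base0 eps_ops eps_val Dr_star star_lin)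

lemma star_eps_right: "supp_on Idx a ==> star B a eps = a"
  by (rule Dr_coinduct_fun[where F="\<lambda>a. star B a eps" and H="\<lambda>a. a"])
     (auto simp: star_base0 eps_ops eps_val Dr_star star_lin)

end

section \<open>Blocks of the dual algebra and their Clifford generators\<close>

definition blk :: "'a => ('a \<times> nat set => complex) => ('a \<times> nat set => complex)" where
  "blk g a = (\<lambda>(k, S). if k = g \<or> k = g \<otimes> u then a (k, S) else 0)"
definition eb :: "'a => 'a \<times> nat set => complex" where
  "eb g = (\<lambda>(k, S). if (k = g \<or> k = g \<otimes> u) \<and> S = {} then 1 else 0)"
text \<open>The difference of the two points of the coset of \<open>g\<close>. It squares to
  \<open>eb g\<close>, anticommutes with the \<open>xi g p\<close> and mediates between left and
  right operators on the block.\<close>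

definition om :: "'a => 'a \<times> nat set => complex" where
  "om g = (\<lambda>(k, S). if S = {} then if k = g then 1 else if k = g \<otimes> u then -1 else 0 else 0)"
text \<open>The opposite signs at \<open>g\<close> and \<open>g \<otimes> u\<close> make the
  function invariant under \<open>taur\<close> and make its derivatives \<open>Dl r\<close>
  multiples of the unit \<open>eb g\<close> of the block.\<close>

definition xi :: "'a => nat => 'a \<times> nat set => complex" where
  "xi g p = (\<lambda>(k, S). if S = {p} then if k = g then 1 else if k = g \<otimes> u then -1 else 0 else 0)"

lemma gu_neq: "g \<in> carrier G ==> g \<otimes> u ~= g" "g \<in> carrier G ==> g ~= g \<otimes> u"
  by simp_all

lemma linop_blk: "linop (blk g)"
  by (auto simp: linop_def blk_def plus_fun_apply scl_apply fun_eq_iff)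

lemma mem_gu: "g \<in> carrier G ==> k \<in> carrier G ==> k \<otimes> u = g \<longleftrightarrow> k = g \<otimes> u"
  by (metis mul_u_u)

context
  fixes g assumes g [simp]: "g \<in> carrier G"
begin

lemma supp_blocks: "supp_on Idx (eb g)" "supp_on Idx (om g)" "p < n ==> supp_on Idx (xi g p)" "supp_on Idx a ==> supp_on Idx (blk g a)"
  by (auto simp: supp_on_def eb_def om_def xi_def blk_def Idx_def)

lemma Dr_blk: "Dr s (blk g a) = blk g (Dr s a)"
  by (auto simp: fun_eq_iff Dr_def blk_def)

lemma Dr_block: "Dr s (eb g) = 0" "Dr s (om g) = 0" "Dr s (xi g p) = (if s = p then om g else 0)"
  by (auto simp: fun_eq_iff Dr_def eb_def om_def xi_def zero_fun_apply)

lemma taur_block: "taur (eb g) = eb g" "taur (om g) = - om g" "taur (xi g p) = xi g p"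
  using gu_neq[OF g] by (auto simp: fun_eq_iff taur_def eb_def om_def xi_def uminus_apply mem_gu)

lemma taul_block: "taul (eb g) = eb g" "taul (om g) = - om g" "taul (xi g p) = - xi g p"
  using gu_neq[OF g] by (auto simp: fun_eq_iff taul_def eb_def om_def xi_def uminus_apply mem_gu)

lemma Dl_block: "Dl r (eb g) = 0" "Dl r (om g) = 0" "p < n ==> r < n ==> Dl r (xi g p) = scl (\<rho> (inv g) $$ (p, r)) (eb g)"
proof -
  show "Dl r (eb g) = 0" "Dl r (om g) = 0" by (auto simp: Dl_def Dr_block fun_eq_iff zero_fun_apply)
  show "Dl r (xi g p) = scl (\<rho> (inv g) $$ (p, r)) (eb g)" if pr: "p < n" "r < n"
  proof
    fix x :: "'a \<times> nat set" obtain k S where x: "x = (k, S)" by force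
    have "(\<Sum>q<n. \<rho> (inv k) $$ (q, r) * (if q = p then om g else 0) (k, S)) = \<rho> (inv k) $$ (p, r) * om g (k, S)"
      using pr by (subst sum.remove[of _ p]) (auto intro!: sum.neutral simp: zero_fun_apply)
    then show "Dl r (xi g p) x = scl (\<rho> (inv g) $$ (p, r)) (eb g) x"
      using pr gu_neq[OF g] by (auto simp: x Dl_def Dr_block scl_apply om_def eb_def rho_inv_gu)
  qed
qed

context
  fixes B :: "complex mat" assumes B: "B \<in> carrier_mat n n"
begin

lemma eb_val: "eb g (k, {}) = (if k = g \<or> k = g \<otimes> u then 1 else 0)"
  by (simp add: eb_def)

lemma blk_val: "blk g a (k, S) = (if k = g \<or> k = g \<otimes> u then a (k, S) else 0)"
  by (simp add: blk_def)

lemma star_eb_left: "supp_on Idx a ==> star B (eb g) a = blk g a"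
  by (rule Dr_coinduct_fun[where F="star B (eb g)" and H="blk g"])
     (auto simp: star_base0[OF B] Dr_block supp_blocks eb_val blk_val Dr_star[OF B] taur_block star_lin Dr_blk)

lemma star_eb_right: "supp_on Idx a ==> star B a (eb g) = blk g a"
  by (rule Dr_coinduct_fun[where F="\<lambda>a. star B a (eb g)" and H="blk g"])
     (auto simp: star_base0[OF B] Dr_block supp_blocks eb_val blk_val Dr_star[OF B] taur_block star_lin Dr_blk)

definition omL :: "('a \<times> nat set => complex) => ('a \<times> nat set => complex)" where
  "omL a = (\<lambda>(k, S). (-1) ^ card S * om g (k, {}) * a (k, S))"
definition omR :: "('a \<times> nat set => complex) => ('a \<times> nat set => complex)" where
  "omR a = (\<lambda>(k, S). om g (k, {}) * a (k, S))"

lemma star_om_left: "supp_on Idx a ==> star B (om g) a = omL a"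
\<comment> \<open>The scalar \<open>c\<close> in the relation absorbs the sign that each
  \<open>Dr s\<close> produces on both sides.\<close>
proof (rule Dr_coinduct[where R="\<lambda>f h. \<exists>a c. supp_on Idx a \<and> f = scl c (star B (om g) a) \<and> h = scl c (omL a)"])
  assume a: "supp_on Idx a"
  show "\<exists>a' c. supp_on Idx a' \<and> star B (om g) a = scl c (star B (om g) a') \<and> omL a = scl c (omL a')"
    by (rule exI[of _ a], rule exI[of _ 1]) (simp add: a)
  show "supp_on Idx (omL a)" using a by (auto simp: supp_on_def omL_def)
next
  fix f h :: "'a \<times> nat set => complex" and s
  assume "\<exists>a c. supp_on Idx a \<and> f = scl c (star B (om g) a) \<and> h = scl c (omL a)" and s: "s < n"
  then obtain a c where a: "supp_on Idx a" "f = scl c (star B (om g) a)" "h = scl c (omL a)" by blast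
  have "Dr s (omL a) = - omL (Dr s a)" by (auto simp: fun_eq_iff Dr_def omL_def uminus_apply)
  then show "\<exists>a c. supp_on Idx a \<and> Dr s f = scl c (star B (om g) a) \<and> Dr s h = scl c (omL a)"
    by (intro exI[of _ "Dr s a"] exI[of _ "- c"])
       (simp add: a supp_Dr op_lin Dr_star[OF B s] Dr_block taur_block star_lin scl_minus scl_minus_left)
qed (auto simp: scl_apply star_base0[OF B] Dr_block omL_def)

lemma star_om_right: "supp_on Idx a ==> star B a (om g) = omR a"
proof (rule Dr_coinduct_fun[where F="\<lambda>a. star B a (om g)" and H=omR])
  show "Dr s (omR a) = omR (Dr s a)" for s a by (auto simp: fun_eq_iff Dr_def omR_def)
  show "supp_on Idx (omR a)" if "supp_on Idx a" for a using that by (auto simp: supp_on_def omR_def)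
  show "star B a (om g) (k, {}) = omR a (k, {})" if "k \<in> carrier G" for k a
    using that by (simp add: star_base0[OF B] Dr_block omR_def)
qed (simp_all add: Dr_block Dr_star[OF B] star_lin)

lemma om_om: "star B (om g) (om g) = eb g"
  unfolding star_om_right[OF supp_blocks(2)] using gu_neq[OF g] by (auto simp: omR_def om_def eb_def fun_eq_iff)

lemma xi_om: "p < n ==> star B (xi g p) (om g) = - star B (om g) (xi g p)"
  unfolding star_om_right[OF supp_blocks(3)] star_om_left[OF supp_blocks(3)]
  by (auto simp: omR_def omL_def xi_def fun_eq_iff uminus_apply)

lemma om_taur: "supp_on Idx h ==> star B (om g) (taur h) = star B (taul h) (om g)"
  unfolding star_om_left[OF supp_taur] star_om_right[OF supp_taul]
  by (auto simp: omR_def omL_def taur_def taul_def fun_eq_iff minus_one_power_iff)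

lemma blk_zero: "k ~= g ==> k ~= g \<otimes> u ==> blk g h = h ==> h (k, S) = 0"
proof -
  assume k: "k ~= g" "k ~= g \<otimes> u" and h: "blk g h = h"
  have "h (k, S) = blk g h (k, S)" by (simp only: h)
  then show ?thesis using k by (simp add: blk_val)
qed

lemma Dl_sum:
  assumes h: "blk g h = h" and c: "\<And>l. l < n ==> (\<Sum>q<n. \<rho> (inv g) $$ (l, q) * c q) = d l"
  shows "(\<Sum>q<n. scl (c q) (Dl q h)) (k, S) = (-1) ^ card S * om g (k, {}) * (\<Sum>l<n. d l * Dr l h (k, S))"
proof (cases "k = g \<or> k = g \<otimes> u")
  case True
  then have k: "k \<in> carrier G" by auto
  have s: "(\<Sum>q<n. \<rho> (inv k) $$ (l, q) * c q) = om g (k, {}) * d l" if "l < n" for l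
    using True that c[OF that] gu_neq[OF g] by (auto simp: om_def rho_inv_gu sum_negf)
  have "(\<Sum>q<n. scl (c q) (Dl q h)) (k, S) = (-1) ^ card S * (\<Sum>q<n. \<Sum>l<n. \<rho> (inv k) $$ (l, q) * c q * Dr l h (k, S))"
    using k by (simp add: sum_apply scl_apply Dl_def sum_distrib_left algebra_simps)
  also have "\<dots> = (-1) ^ card S * (\<Sum>l<n. (\<Sum>q<n. \<rho> (inv k) $$ (l, q) * c q) * Dr l h (k, S))"
    by (subst sum.swap) (simp add: sum_distrib_right)
  also have "\<dots> = (-1) ^ card S * om g (k, {}) * (\<Sum>l<n. d l * Dr l h (k, S))"
    by (simp add: s sum_distrib_left mult.assoc)
  finally show ?thesis .
next
  case False
  then have "Dr l h (k, S) = 0" for l S using blk_zero[OF _ _ h] by (auto simp: Dr_def)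
  note z = this
  show ?thesis unfolding sum_apply scl_apply Dl_def prod.case z by (cases "k \<in> carrier G") simp_all
qed

lemma rho_inv_mult: "l < n ==> r < n ==> (\<Sum>q<n. \<rho> (inv g) $$ (l, q) * \<rho> g $$ (q, r)) = (if l = r then 1 else 0)"
proof -
  assume lr: "l < n" "r < n"
  have c: "\<rho> (inv g) \<in> carrier_mat n n" "\<rho> g \<in> carrier_mat n n" by simp_all
  have "(\<rho> (inv g) * \<rho> g) $$ (l, r) = (1\<^sub>m n :: complex mat) $$ (l, r)"
    by (simp add: rho_mult[symmetric] rho_one)
  then show ?thesis using lr carrier_matD[OF c(1)] carrier_matD[OF c(2)] by (simp add: scalar_prod_def lessThan_atLeast0)
qed

text \<open>On a single block \<open>Dl\<close> and \<open>Dr\<close> differ by the matrix of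
  \<open>inv g\<close> and by the sign that left multiplication by \<open>om g\<close>
  supplies.\<close>

lemma Dl_om_Dr: "supp_on Idx h ==> blk g h = h ==> r < n ==> (\<Sum>q<n. scl (\<rho> g $$ (q, r)) (Dl q h)) = star B (om g) (Dr r h)"
proof
  fix x :: "'a \<times> nat set" assume h: "supp_on Idx h" "blk g h = h" "r < n"
  obtain k S where x: "x = (k, S)" by force
  have "(\<Sum>l<n. (if l = r then 1 else 0) * Dr l h (k, S)) = Dr r h (k, S)"
    using h(3) by (subst sum.remove[of _ r]) (auto intro!: sum.neutral)
  moreover have "(\<Sum>q<n. scl (\<rho> g $$ (q, r)) (Dl q h)) (k, S) = (-1) ^ card S * om g (k, {}) * (\<Sum>l<n. (if l = r then 1 else 0) * Dr l h (k, S))"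
    by (rule Dl_sum[OF h(2)]) (rule rho_inv_mult[OF _ h(3)])
  ultimately show "(\<Sum>q<n. scl (\<rho> g $$ (q, r)) (Dl q h)) x = star B (om g) (Dr r h) x"
    unfolding x star_om_left[OF supp_Dr[OF h(1)]] by (simp add: omL_def)
qed

text \<open>The matrix of \<open>g\<close> times the form \<open>bet B g\<close>. Up to the factor 2
  these are the coefficients in \<open>xi_inner\<close>.\<close>

definition gb :: "nat => nat => complex" where
  "gb q r = (\<Sum>l<n. \<rho> g $$ (q, l) * bet B g (l, r))"

lemma rho_inv_gb: "l < n ==> r < n ==> (\<Sum>q<n. \<rho> (inv g) $$ (l, q) * gb q r) = bet B g (l, r)"
proof -
  assume lr: "l < n" "r < n"
  have "(\<Sum>q<n. \<rho> (inv g) $$ (l, q) * gb q r) = (\<Sum>m<n. (\<Sum>q<n. \<rho> (inv g) $$ (l, q) * \<rho> g $$ (q, m)) * bet B g (m, r))"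
    unfolding gb_def sum_distrib_left sum_distrib_right by (subst sum.swap) (simp add: mult.assoc)
  also have "\<dots> = (\<Sum>m<n. if m = l then bet B g (l, r) else 0)"
    using lr by (intro sum.cong refl) (auto simp: rho_inv_mult)
  finally show ?thesis using lr by simp
qed

lemma blk_blocks: "blk g (eb g) = eb g" "blk g (om g) = om g" "blk g (xi g p) = xi g p"
  by (auto simp: blk_def eb_def om_def xi_def fun_eq_iff)

context
  assumes Bsym: "transpose_mat B = B"
begin

lemma bet_sym: "p < n ==> q < n ==> bet B g (p, q) = bet B g (q, p)"
proof -
  assume pq: "p < n" "q < n"
  have Bs: "B $$ (r, s) = B $$ (s, r)" if "r < n" "s < n" for r s
    using that B Bsym by (metis carrier_matD index_transpose_mat(1))
  have "conjB B g $$ (p, q) = (\<Sum>r<n. \<Sum>s<n. B $$ (s, r) * (\<rho> (inv g) $$ (p, r) * \<rho> (inv g) $$ (q, s)))"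
    unfolding conjB_entry[OF B g pq] by (intro sum.cong refl) (simp add: Bs)
  also have "\<dots> = conjB B g $$ (q, p)"
    unfolding conjB_entry[OF B g pq(2) pq(1)] by (subst sum.swap) (simp add: mult.commute)
  finally show ?thesis using Bs[OF pq] by (simp add: bet_def)
qed

text \<open>Both sides are compatible with \<open>Dr s\<close>, so by \<open>Dr_coinduct\<close>
  only values at group elements are compared. There the exponential reduces to its linear term, and
  the two contributions agree because the form is symmetric, whence the factor 2.\<close>

lemma xi_inner:
  assumes h: "supp_on Idx h" "blk g h = h" and r: "r < n"
  shows "star B (xi g r) h - star B (taul h) (xi g r) = (\<Sum>q<n. scl (2 * gb q r) (Dl q h))"
proof (rule Dr_coinduct[where R="\<lambda>f h'. \<exists>h. supp_on Idx h \<and> blk g h = h \<and> f = star B (xi g r) h - star B (taul h) (xi g r) \<and>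
    h' = (\<Sum>q<n. scl (2 * gb q r) (Dl q h))"])
  fix f h' :: "'a \<times> nat set => complex" and s
  assume "\<exists>h. supp_on Idx h \<and> blk g h = h \<and> f = star B (xi g r) h - star B (taul h) (xi g r) \<and>
    h' = (\<Sum>q<n. scl (2 * gb q r) (Dl q h))" and s: "s < n"
  then obtain h where h: "supp_on Idx h" "blk g h = h" and f: "f = star B (xi g r) h - star B (taul h) (xi g r)"
    and h': "h' = (\<Sum>q<n. scl (2 * gb q r) (Dl q h))" by blast
  \<comment> \<open>Makes the two terms with \<open>om g\<close>, which arise when
    \<open>Dr s\<close> hits \<open>xi g r\<close>, cancel.\<close>
  have o: "star B (taur (taul h)) (om g) = star B (om g) h"
    using om_taur[OF supp_taur[OF h(1)]] by (simp add: taur_taur taul_taur)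
  have "Dr s f = star B (xi g r) (Dr s h) - star B (taul (Dr s h)) (xi g r)"
    using o by (auto simp: f op_lin Dr_star[OF B s] Dr_block taur_block star_lin taul_Dr)
  moreover have "Dr s h' = (\<Sum>q<n. scl (2 * gb q r) (Dl q (Dr s h)))" by (simp add: h' op_lin Dl_Dr)
  moreover have "blk g (Dr s h) = Dr s h" using Dr_blk[of s h] h(2) by simp
  ultimately show "\<exists>h. supp_on Idx h \<and> blk g h = h \<and> Dr s f = star B (xi g r) h - star B (taul h) (xi g r) \<and>
    Dr s h' = (\<Sum>q<n. scl (2 * gb q r) (Dl q h))" using supp_Dr[OF h(1)] by blast
next
  fix f h' :: "'a \<times> nat set => complex" and k
  assume "\<exists>h. supp_on Idx h \<and> blk g h = h \<and> f = star B (xi g r) h - star B (taul h) (xi g r) \<and>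
    h' = (\<Sum>q<n. scl (2 * gb q r) (Dl q h))" and k: "k \<in> carrier G"
  then obtain h where h: "supp_on Idx h" "blk g h = h" and f: "f = star B (xi g r) h - star B (taul h) (xi g r)"
    and h': "h' = (\<Sum>q<n. scl (2 * gb q r) (Dl q h))" by blast
  have x2: "Dr a (Dr b (xi g r)) = 0" for a b by (simp add: Dr_block op_lin)
  have d: "(\<Sum>q<n. \<rho> (inv g) $$ (l, q) * (2 * gb q r)) = 2 * bet B g (l, r)" if "l < n" for l
    using rho_inv_gb[OF that r] by (simp add: mult.left_commute sum_distrib_left[symmetric])
  have R: "h' (k, {}) = om g (k, {}) * (\<Sum>l<n. 2 * bet B g (l, r) * h (k, {l}))"
    
  proof -
    have "(\<Sum>q<n. scl (2 * gb q r) (Dl q h)) (k, {}) = (-1) ^ card ({} :: nat set) * om g (k, {}) * (\<Sum>l<n. 2 * bet B g (l, r) * Dr l h (k, {}))"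
      by (rule Dl_sum[OF h(2)]) (rule d)
    then show ?thesis by (simp add: h' Dr_def)
  qed
  have L: "f (k, {}) = - (\<Sum>a<n. \<Sum>s<n. bet B k (a, s) * xi g r (k \<otimes> u, {a}) * h (k, {s}))
     + (\<Sum>a<n. \<Sum>s<n. bet B k (a, s) * h (k, {a}) * xi g r (k, {s}))"
  proof -
    have "xi g r (k, {}) = 0" "\<And>a. taul h (k \<otimes> u, {a}) = h (k, {a})" using k by (simp_all add: xi_def taul_def)
    moreover have "star B (xi g r) h (k, {}) = xi g r (k, {}) * h (k, {}) - (\<Sum>a<n. \<Sum>s<n. bet B k (a, s) * xi g r (k \<otimes> u, {a}) * h (k, {s}))"
      by (rule star_base1[OF B k]) (simp add: x2)
    moreover have "star B (taul h) (xi g r) (k, {}) = taul h (k, {}) * xi g r (k, {}) - (\<Sum>a<n. \<Sum>s<n. bet B k (a, s) * taul h (k \<otimes> u, {a}) * xi g r (k, {s}))"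
      by (rule star_base1[OF B k]) (simp add: x2)
    ultimately show ?thesis unfolding f minus_apply by simp
  qed
  show "f (k, {}) = h' (k, {})"
  proof (cases "k = g \<or> k = g \<otimes> u")
    case True
    have bk: "bet B k (a, s) = bet B g (a, s)" if "a < n" "s < n" for a s using True that bet_gu[OF B g] by auto
    have x1: "xi g r (k \<otimes> u, {a}) = (if a = r then - om g (k, {}) else 0)" "xi g r (k, {a}) = (if a = r then om g (k, {}) else 0)" for a
      using True gu_neq[OF g] by (auto simp: xi_def om_def)
    have a1: "(\<Sum>a<n. \<Sum>s<n. bet B k (a, s) * xi g r (k \<otimes> u, {a}) * h (k, {s})) = - om g (k, {}) * (\<Sum>s<n. bet B g (r, s) * h (k, {s}))"
    proof -
      have "(\<Sum>a<n. \<Sum>s<n. bet B k (a, s) * xi g r (k \<otimes> u, {a}) * h (k, {s})) =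
         (\<Sum>a<n. if a = r then - om g (k, {}) * (\<Sum>s<n. bet B g (r, s) * h (k, {s})) else 0)"
        by (intro sum.cong refl) (auto simp: x1 sum_distrib_left bk sum_negf[symmetric] mult.assoc mult.left_commute intro!: sum.cong)
      then show ?thesis using r by simp
    qed
    have a2: "(\<Sum>a<n. \<Sum>s<n. bet B k (a, s) * h (k, {a}) * xi g r (k, {s})) = om g (k, {}) * (\<Sum>a<n. bet B g (a, r) * h (k, {a}))"
    proof -
      have "(\<Sum>s<n. bet B k (a, s) * h (k, {a}) * xi g r (k, {s})) = om g (k, {}) * (bet B g (a, r) * h (k, {a}))" if "a < n" for a
      proof -
        have "(\<Sum>s<n. bet B k (a, s) * h (k, {a}) * xi g r (k, {s})) = (\<Sum>s<n. if s = r then om g (k, {}) * (bet B g (a, r) * h (k, {a})) else 0)"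
          using that by (intro sum.cong refl) (auto simp: x1 bk)
        then show ?thesis using r by simp
      qed
      then show ?thesis by (simp add: sum_distrib_left)
    qed
    have a3: "(\<Sum>s<n. bet B g (r, s) * h (k, {s})) = (\<Sum>a<n. bet B g (a, r) * h (k, {a}))"
      using r by (intro sum.cong refl) (simp add: bet_sym[of r])
    show ?thesis unfolding L R a1 a2 a3 by (simp add: sum_distrib_left[symmetric] mult.assoc)
  next
    case False
    then have "h (k, S) = 0" for S using blk_zero[OF _ _ h(2)] by blast
    then show ?thesis unfolding L R by simp
  qed
qed (use h r in \<open>auto intro!: supp_on_diff supp_on_sum supp_on_scl supp_Dl\<close>)

text \<open>\<open>taul\<close> changes the sign of \<open>xi g q\<close>, so for this argument the
  twisted commutator of \<open>xi_inner\<close> is an anticommutator.\<close>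

lemma xi_xi:
  assumes "p < n" "q < n"
  shows "star B (xi g p) (xi g q) + star B (xi g q) (xi g p) = scl (2 * bet B g (p, q)) (eb g)"
proof -
  have "star B (xi g p) (xi g q) + star B (xi g q) (xi g p) = (\<Sum>l<n. scl (2 * gb l p) (Dl l (xi g q)))"
    using xi_inner[OF supp_blocks(3)[OF assms(2)] blk_blocks(3) assms(1)] by (simp add: taul_block star_lin)
  also have "\<dots> = scl (2 * (\<Sum>l<n. \<rho> (inv g) $$ (q, l) * gb l p)) (eb g)"
    using assms by (simp add: Dl_block scl_sum_left[symmetric] sum_distrib_left mult_ac)
  finally show ?thesis using assms by (simp add: rho_inv_gb bet_sym[of p q])
qed

end

text \<open>Multiplying \<open>Dl_om_Dr\<close> by \<open>om g\<close> shows that each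
  \<open>Dr r a\<close> is a multiple of \<open>om g\<close>. Subtracting the matching combination
  of the \<open>xi g p\<close> leaves a function with vanishing derivatives, which lives on the two
  group elements of the block.\<close>

lemma linear_block:
  assumes a: "supp_on Idx a" "blk g a = a" and c: "\<And>q. q < n ==> Dl q a = scl (c q) (eb g)"
  shows "\<exists>\<kappa> \<alpha> \<alpha>'. a = (\<Sum>p<n. scl (\<kappa> p) (xi g p)) + scl \<alpha> (eb g) + scl \<alpha>' (om g)"
proof -
  define \<kappa> where "\<kappa> r = (\<Sum>q<n. \<rho> g $$ (q, r) * c q)" for r
  have D: "Dr r a = scl (\<kappa> r) (om g)" if r: "r < n" for r
  proof -
    have sD: "supp_on Idx (Dr r a)" using a supp_Dr by blast
    have "star B (om g) (Dr r a) = scl (\<kappa> r) (eb g)"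
      using Dl_om_Dr[OF a r] c by (simp add: \<kappa>_def scl_sum_left)
    then have "star B (om g) (star B (om g) (Dr r a)) = scl (\<kappa> r) (om g)"
      by (simp add: star_lin star_eb_right supp_blocks blk_blocks)
    moreover have "star B (om g) (star B (om g) (Dr r a)) = Dr r a"
      unfolding star_assoc[OF B, symmetric] om_om star_eb_left[OF sD] using Dr_blk[of r a] a(2) by simp
    ultimately show ?thesis by simp
  qed
  let ?b = "a - (\<Sum>p<n. scl (\<kappa> p) (xi g p))"
  have sb: "supp_on Idx ?b" by (intro supp_on_intros a supp_blocks) auto
  have Db: "Dr r ?b = 0" if r: "r < n" for r
  proof -
    have "(\<Sum>p<n. scl (\<kappa> p) (if r = p then om g else 0)) = (\<Sum>p<n. if p = r then scl (\<kappa> r) (om g) else 0)"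
      by (intro sum.cong) auto
    then show ?thesis using r by (simp add: op_lin D Dr_block)
  qed
  have b0: "?b (k, S) = 0" if S: "S ~= {}" for k S
  proof (cases "(k, S) \<in> Idx")
    case True
    from S obtain s where s: "s \<in> S" by blast
    with True have "s < n" "finite S" by (auto simp: Idx_def intro: finite_subset)
    then have "?b (k, insert s (S - {s})) = (-1) ^ (card (S - {s}) + card {t \<in> S - {s}. t < s}) * Dr s ?b (k, S - {s})"
      by (intro Dr_max) auto
    then show ?thesis using Db[OF \<open>s < n\<close>] s by (simp add: insert_absorb zero_fun_apply)
  qed (use sb in \<open>auto simp: supp_on_def\<close>)
  have bb: "blk g ?b = ?b"
    by (simp add: linop_diff[OF linop_blk] linop_sum[OF linop_blk] linop_scl[OF linop_blk] a(2) blk_blocks)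
  define \<alpha> \<alpha>' where "\<alpha> = (?b (g, {}) + ?b (g \<otimes> u, {})) / 2" and "\<alpha>' = (?b (g, {}) - ?b (g \<otimes> u, {})) / 2"
  have "?b = scl \<alpha> (eb g) + scl \<alpha>' (om g)" (is "_ = ?r")
  proof
    fix x :: "'a \<times> nat set" obtain k S where x: "x = (k, S)" by force
    have "?b (k, S) = 0" if "k ~= g" "k ~= g \<otimes> u" using blk_zero[OF that bb] .
    then show "?b x = ?r x" using b0[of S k] gu_neq[OF g]
      by (cases "S = {}") (auto simp: x plus_fun_apply scl_apply eb_def om_def field_simps \<alpha>_def \<alpha>'_def)
  qed
  then have "a = ?r + (\<Sum>p<n. scl (\<kappa> p) (xi g p))" by (simp only: diff_eq_eq)
  then have "a = (\<Sum>p<n. scl (\<kappa> p) (xi g p)) + scl \<alpha> (eb g) + scl \<alpha>' (om g)" by (simp only: ac_simps)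
  then show ?thesis by (intro exI)
qed

end

end

text \<open>The form vanishes at \<open>1\<close> and \<open>u\<close>, so on the block of
  \<open>1\<close> multiplication by \<open>xi\<close> is that of an exterior algebra. Inserting the
  largest element of the set costs no sign, whence the order of the induction.\<close>

lemma xi_one_formula:
  assumes B: "B \<in> carrier_mat n n" and p: "p < n" and k: "k = \<one> \<or> k = u" and S: "finite S" "S \<subseteq> {..<n}"
  shows "\<exists>c\<in>{1, -1}. \<forall>b. supp_on Idx b --> star B (xi \<one> p) b (k, S) = (if p \<in> S then c * b (k, S - {p}) else 0)"
  using S
proof (induction S rule: finite_linorder_max_induct)
  case empty
  have kG: "k \<in> carrier G" using k by auto
  have z: "bet B k (r, s) = 0" if "r < n" "s < n" for r s
  proof -
    have "conjB B \<one> = B" using B by (simp add: conjB_def rho_one)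
    then have "bet B \<one> (r, s) = 0" by (simp add: bet_def)
    moreover have "bet B (\<one> \<otimes> u) (r, s) = bet B \<one> (r, s)" using that by (intro bet_gu[OF B]) auto
    ultimately show ?thesis using k by auto
  qed
  have "star B (xi \<one> p) b (k, {}) = 0" for b
    using star_base1[OF B kG, of "xi \<one> p" b] by (simp add: z Dr_block op_lin) (simp add: xi_def)
  then show ?case by auto
next
  case (insert s S)
  have s: "s < n" "S \<subseteq> {..<n}" and sS: "s \<notin> S" using insert.prems insert.hyps by auto
  from insert.IH[OF s(2)] obtain c where c: "c \<in> {1, -1}"
    "\<And>b. supp_on Idx b ==> star B (xi \<one> p) b (k, S) = (if p \<in> S then c * b (k, S - {p}) else 0)" by blast
  have ins: "a (k, insert s T) = Dr s a (k, T)" if "T \<subseteq> S" for a :: "'a \<times> nat set => complex" and T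
  proof -
    have "finite T" "s \<notin> T" using that insert.hyps(1) sS finite_subset by auto
    moreover have "{t \<in> T. t < s} = T" using that insert.hyps(2) by auto
    ultimately show ?thesis by (simp add: Dr_def)
  qed
  have st: "star B (xi \<one> p) b (k, insert s S) = (if s = p then star B (om \<one>) b (k, S) else 0) + star B (xi \<one> p) (Dr s b) (k, S)" for b
    unfolding ins[OF subset_refl] Dr_star[OF B s(1)] by (simp add: Dr_block taur_block plus_fun_apply star_lin zero_fun_apply)
  show ?case
  proof (cases "s = p")
    case True
    define d where "d = (-1) ^ card S * om \<one> (k, {})"
    have "d \<in> {1, -1}" using k gu_neq[OF one_closed] by (auto simp: d_def om_def minus_one_power_iff)
    moreover have "star B (xi \<one> p) b (k, insert s S) = d * b (k, S)" if "supp_on Idx b" for b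
      using that True sS unfolding st c(2)[OF supp_Dr[OF that]] by (simp add: star_om_left[OF one_closed B] omL_def[OF one_closed B] d_def)
    ultimately show ?thesis using True sS by (auto intro!: bexI[of _ d])
  next
    case False
    have "star B (xi \<one> p) b (k, insert s S) = (if p \<in> insert s S then c * b (k, insert s S - {p}) else 0)" if "supp_on Idx b" for b
      using False unfolding st c(2)[OF supp_Dr[OF that]] by (auto simp: ins[symmetric] insert_Diff_if)
    then show ?thesis using c(1) by blast
  qed
qed

end

section \<open>Twist data\<close>

text \<open>\<open>s\<close> and \<open>t r\<close> stand for the twist with first argument
  \<open>u\<close> and \<open>e r\<close>, \<open>sr\<close> and \<open>tr r\<close> for the twist
  with second argument \<open>u\<close> and \<open>e r\<close>, and \<open>\<sigma>\<close> for its
  value at \<open>(u, u)\<close>. The axioms \<open>F1\<close> to \<open>F4\<close> express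
  compatibility of \<open>f\<close> with the coproducts; those named \<open>T\<close>,
  \<open>R\<close> and \<open>M\<close> are the twist equation with special indices in the first
  two, the last two and the two outer places. The slices \<open>t\<close> and \<open>tr\<close> are
  normalised so that \<open>f\<close> acts on derivations by \<open>\<eta>\<close> alone.\<close>

locale twist_data = grepu G n \<rho> u for G :: "('a, 'x) monoid_scheme" (structure) and n \<rho> u +
  fixes B B' :: "complex mat" and f :: "('a \<times> nat set => complex) => ('a \<times> nat set => complex)"
    and s s' sr :: "'a \<times> nat set => complex" and t tr :: "nat => 'a \<times> nat set => complex"
    and \<eta> \<eta>i :: "nat => nat => complex" and \<sigma> :: complex and b :: "nat => nat => complex" and c :: "nat => complex"
  assumes n_pos: "0 < n"
    and B [simp]: "B \<in> carrier_mat n n" "B' \<in> carrier_mat n n"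
    and B_sym: "transpose_mat B = B" "transpose_mat B' = B'"
    and f_lin: "linop f" and supp_f [simp]: "supp_on Idx (f a)"
    and f_star: "f (star B' x y) = star B (f x) (f y)"
    and f_inj: "supp_on Idx x ==> f x = 0 ==> x = 0"
    and f_surj: "supp_on Idx x ==> \<exists>y. supp_on Idx y \<and> f y = x"
    and f_eps: "f eps = eps"
    and supp_st [simp]: "supp_on Idx s" "supp_on Idx s'" "supp_on Idx sr" "supp_on Idx (t r)" "supp_on Idx (tr r)"
    and s_inv: "star B s s' = eps" "star B s' s = eps"
    and eta_inv: "p < n ==> q < n ==> (\<Sum>r<n. \<eta> p r * \<eta>i r q) = (if p = q then 1 else 0)"
      "p < n ==> q < n ==> (\<Sum>r<n. \<eta>i p r * \<eta> r q) = (if p = q then 1 else 0)"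
    and b_sym: "q < n ==> r < n ==> b r q = b q r"
    and F1: "supp_on Idx a ==> star B (taul (f a)) s = star B s (f (taul a))"
    and F2: "r < n ==> supp_on Idx a ==> Dl r (f a) + star B (taul (f a)) (t r) =
        star B (t r) (f a) + star B s (f (\<Sum>q<n. scl (\<eta> q r) (Dl q a)))"
    and F3: "supp_on Idx a ==> star B (taur (f a)) sr = star B sr (f (taur a))"
    and F4: "r < n ==> supp_on Idx a ==> Dr r (f a) + star B (taur (f a)) (tr r) =
        star B (tr r) (f a) + star B sr (f (\<Sum>q<n. scl (\<eta> q r) (Dr q a)))"
    and T1: "star B (taul s) s = scl \<sigma> eps"
    and T2: "r < n ==> Dl r s + star B (taul s) (t r) + star B (taul (t r)) s = scl (c r) eps"
    and T3: "r < n ==> q < n ==> Dl q (t r) + star B (taul (t r)) (t q) + (Dl r (t q) + star B (taul (t q)) (t r)) = scl (b r q) eps"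
    and M1: "star B (taul sr) s = star B (taur s) sr"
    and M3: "r < n ==> star B (taul (tr r)) s = Dr r s + star B (taur s) (tr r)"
    and M4: "r < n ==> q < n ==> Dl q (tr r) + star B (taul (tr r)) (t q) = Dr r (t q) + star B (taur (t q)) (tr r)"
    and R1: "star B (taur sr) sr = scl \<sigma> eps"
    and R3: "r < n ==> q < n ==> Dr q (tr r) + star B (taur (tr r)) (tr q) + (Dr r (tr q) + star B (taur (tr q)) (tr r)) = scl (b r q) eps"
begin

abbreviation st (infixl "\<star>" 70) where "x \<star> y \<equiv> star B x y"
abbreviation st' (infixl "\<diamondop>" 70) where "x \<diamondop> y \<equiv> star B' x y"

lemmas f_lins = linop_add[OF f_lin] linop_scl[OF f_lin] linop_minus[OF f_lin] linop_diff[OF f_lin] linop_sum[OF f_lin] linop_0[OF f_lin]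
lemmas as = star_assoc[OF B(1)] star_assoc[OF B(2)]
lemmas one = star_eps_left[OF B(1)] star_eps_right[OF B(1)] star_eps_left[OF B(2)] star_eps_right[OF B(2)]

lemma f_cancel: "supp_on Idx x ==> supp_on Idx y ==> f x = f y ==> x = y"
proof -
  assume s: "supp_on Idx x" "supp_on Idx y" and e: "f x = f y"
  have "f (x - y) = 0" by (simp add: f_lins e)
  then have "x - y = 0" by (rule f_inj[OF supp_on_diff[OF s]])
  then show "x = y" by simp
qed

lemma s_cancel: "supp_on Idx x ==> supp_on Idx y ==> s \<star> x = s \<star> y ==> x = y"
proof -
  assume s: "supp_on Idx x" "supp_on Idx y" and e: "s \<star> x = s \<star> y"
  have "s' \<star> (s \<star> x) = s' \<star> (s \<star> y)" by (simp only: e)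
  then show "x = y" by (simp only: as[symmetric] s_inv one s)
qed

lemma s_cancel_right: "supp_on Idx x ==> supp_on Idx y ==> x \<star> s = y \<star> s ==> x = y"
proof -
  assume s: "supp_on Idx x" "supp_on Idx y" and e: "x \<star> s = y \<star> s"
  have "x \<star> s \<star> s' = y \<star> s \<star> s'" by (simp only: e)
  then show "x = y" by (simp only: as s_inv one s)
qed

lemma eps_nz: "eps ~= 0"
  using eps_val[OF B(1) one_closed] by (auto simp: zero_fun_apply)

lemma eb_nz: "g \<in> carrier G ==> eb g ~= 0"
proof
  assume "g \<in> carrier G" "eb g = 0"
  then have "eb g (g, {}) = 0" by (simp add: zero_fun_apply)
  then show False by (simp add: eb_def)
qed

lemma om_nz: "g \<in> carrier G ==> om g ~= 0"
proof
  assume "g \<in> carrier G" "om g = 0"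
  then have "om g (g, {}) = 0" by (simp add: zero_fun_apply)
  then show False by (simp add: om_def)
qed

lemma scl_cancel: "x ~= 0 ==> scl k x = scl l x ==> k = l"
proof -
  assume "x ~= 0" and e: "scl k x = scl l x"
  then obtain i where "x i ~= 0" by (auto simp: fun_eq_iff zero_fun_apply)
  moreover have "k * x i = l * x i" using fun_cong[OF e, of i] by (simp add: scl_apply)
  ultimately show "k = l" by simp
qed

lemma sigma_nz: "\<sigma> ~= 0"
proof
  assume "\<sigma> = 0"
  then have "taul s \<star> s = 0 \<star> s" using T1 by (simp add: star_lin)
  then have "taul s = 0" by (rule s_cancel_right[OF supp_taul[OF supp_st(1)] supp_on_0])
  then have "taul (taul s) = 0" by (simp add: op_lin)
  then have "s = 0" by (simp only: taul_taul)
  then have "eps = 0" using s_inv by (simp add: star_lin)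
  then show False using eps_nz by simp
qed

definition Pu where "Pu h = taul h \<star> s"
text \<open>The derivation \<open>Dl r\<close> corrected by the twist. On \<open>f a\<close> it is
  \<open>De r\<close> up to multiplication by slices (\<open>P_f\<close>), and products with
  \<open>f a\<close> on the right obey the Leibniz rule \<open>P_star_f\<close>; \<open>Q\<close>
  does the same for \<open>Dr\<close>.\<close>

definition P where "P r h = Dl r h + taul h \<star> t r"
definition Qu where "Qu h = taur h \<star> sr"
definition Q where "Q r h = Dr r h + taur h \<star> tr r"
definition De where "De r a = (\<Sum>q<n. scl (\<eta> q r) (Dl q a))"
definition Dre where "Dre r a = (\<Sum>q<n. scl (\<eta> q r) (Dr q a))"

lemma supp_De: "supp_on Idx a ==> supp_on Idx (De r a)"
  unfolding De_def by (intro supp_on_intros supp_Dl)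

lemma P_star: "r < n ==> P r (x \<star> y) = Dl r x \<star> y + taul x \<star> P r y"
  by (simp add: P_def Dl_star[OF B(1)] taul_star[OF B(1)] as star_lin add.assoc)

lemma Q_star: "r < n ==> Q r (x \<star> y) = Dr r x \<star> y + taur x \<star> Q r y"
  by (simp add: Q_def Dr_star[OF B(1)] taur_star[OF B(1)] as star_lin add.assoc)

lemma P_f: "r < n ==> supp_on Idx a ==> P r (f a) = t r \<star> f a + s \<star> f (De r a)"
  unfolding P_def De_def by (rule F2)

lemma Q_f: "r < n ==> supp_on Idx a ==> Q r (f a) = tr r \<star> f a + sr \<star> f (Dre r a)"
  unfolding Q_def Dre_def by (rule F4)

lemma P_star_f: "r < n ==> supp_on Idx a ==> P r (x \<star> f a) = P r x \<star> f a + Pu x \<star> f (De r a)"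
  by (simp add: P_star P_f star_lin) (simp add: P_def Pu_def star_lin as add.assoc)

lemma Q_star_f: "r < n ==> supp_on Idx a ==> Q r (x \<star> f a) = Q r x \<star> f a + Qu x \<star> f (Dre r a)"
  by (simp add: Q_star Q_f star_lin) (simp add: Q_def Qu_def star_lin as add.assoc)

lemma linop_P: "linop (P r)" and linop_Q: "linop (Q r)" 
  by (auto simp: linop_def P_def Q_def op_lin star_lin scl_add)

lemma Dl_Dl_self: "Dl r (Dl r a) = 0"
  by (rule selfneg) (rule Dl_anti)

lemma De_De_self: "De r (De r a) = 0"
proof (rule selfneg)
  have "De r (De r a) = (\<Sum>q<n. \<Sum>p<n. scl (\<eta> q r * \<eta> p r) (Dl q (Dl p a)))"
    by (simp add: De_def op_lin scl_sum)
  also have "\<dots> = (\<Sum>p<n. \<Sum>q<n. - scl (\<eta> p r * \<eta> q r) (Dl p (Dl q a)))"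
  proof (subst sum.swap, intro sum.cong refl)
    fix p q
    show "scl (\<eta> q r * \<eta> p r) (Dl q (Dl p a)) = - scl (\<eta> p r * \<eta> q r) (Dl p (Dl q a))"
      by (subst Dl_anti) (simp only: scl_minus mult.commute)
  qed
  also have "\<dots> = - De r (De r a)"
    by (simp add: De_def op_lin scl_sum sum_negf)
  finally show "De r (De r a) = - De r (De r a)" .
qed

lemma half: "x + x = scl k y ==> x = scl (k / 2) y"
  by (auto simp: fun_eq_iff scl_apply plus_fun_apply field_simps)

lemma P_t: "r < n ==> P r (t r) = scl (b r r / 2) eps"
  using T3[of r r] unfolding P_def by (intro half) simp

lemma P_P: "r < n ==> supp_on Idx h ==> P r (P r h) = scl (b r r / 2) h"
proof -
  assume r: "r < n" and h: "supp_on Idx h"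
  have "P r (P r h) = h \<star> P r (t r)"
    by (simp add: P_def op_lin Dl_star[OF B(1) r] taul_star[OF B(1)] taul_taul star_lin Dl_Dl_self Dl_taul[OF r] as)
  then show ?thesis by (simp add: P_t[OF r] star_lin one h)
qed

text \<open>\<open>P r\<close> squares to a scalar by \<open>P_P\<close>, while computing
  \<open>P r (P r (f a))\<close> through \<open>P_f\<close> leaves the additional term
  \<open>c r\<close> times \<open>f (De r a)\<close>. A nonzero \<open>c r\<close> would thus force
  \<open>De r = 0\<close>, contrary to the invertibility of \<open>\<eta>\<close>.\<close>

lemma c_zero: "r < n ==> c r = 0"
proof (rule ccontr)
  assume r: "r < n" and c: "c r ~= 0"
  have De0: "De r a = 0" if a: "supp_on Idx a" for a
  proof -
    have "P r (P r (f a)) = P r (t r) \<star> f a + Pu (t r) \<star> f (De r a) + (P r s \<star> f (De r a) + Pu s \<star> f (De r (De r a)))"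
      by (simp add: P_f r a linop_add[OF linop_P] P_star_f supp_De)
    also have "\<dots> = scl (b r r / 2) (f a) + scl (c r) (f (De r a))"
    proof -
      have "Pu (t r) + P r s = scl (c r) eps" using T2[OF r] by (simp add: Pu_def P_def add_ac)
      then have "Pu (t r) \<star> f (De r a) + P r s \<star> f (De r a) = scl (c r) (f (De r a))"
        unfolding star_lin(1)[symmetric] by (simp add: star_lin one)
      then show ?thesis by (simp add: P_t[OF r] star_lin one De_De_self f_lins add.assoc)
    qed
    finally have "scl (c r) (f (De r a)) = 0" by (simp add: P_P[OF r])
    then have "f (scl (c r) (De r a)) = 0" by (simp only: f_lins)
    then have "scl (c r) (De r a) = 0" by (rule f_inj[OF supp_on_scl[OF supp_De[OF a]]])
    then have "scl (1 / c r) (scl (c r) (De r a)) = 0" by (simp only: scl_zero)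
    then show ?thesis using c by simp
  qed
  have "\<eta> p r = 0" if p: "p < n" for p
  proof -
    have e: "scl (\<eta> q r) (Dl q (xi \<one> p)) = (if q = p then scl (\<eta> p r) (eb \<one>) else 0)" if "q < n" for q
      using p that by (auto simp: Dl_block rho_one)
    have "De r (xi \<one> p) = scl (\<eta> p r) (eb \<one>)"
      unfolding De_def using p by (subst sum.cong[OF refl e]) auto
    then have "scl (\<eta> p r) (eb \<one>) = scl 0 (eb \<one>)" using De0[OF supp_blocks(3)[OF one_closed p]] by simp
    then show ?thesis by (rule scl_cancel[OF eb_nz[OF one_closed]])
  qed
  then have "(\<Sum>p<n. \<eta>i r p * \<eta> p r) = 0" by simp
  then show False using eta_inv(2)[OF r r] by simp
qed

lemma Dl_De:
  assumes q: "q < n"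
  shows "Dl q a = (\<Sum>r<n. scl (\<eta>i r q) (De r a))"
proof -
  have "(\<Sum>r<n. scl (\<eta>i r q) (De r a)) = (\<Sum>p<n. scl (\<Sum>r<n. \<eta> p r * \<eta>i r q) (Dl p a))"
    unfolding De_def scl_sum scl_sum_left by (subst sum.swap) (simp add: mult.commute)
  also have "\<dots> = (\<Sum>p<n. if p = q then Dl q a else 0)"
    using q by (intro sum.cong refl) (auto simp: eta_inv)
  finally show ?thesis using q by simp
qed

end

section \<open>The isomorphism permutes the idempotents of the blocks\<close>

context twist_data
begin

lemma scl_diff_left: "scl (k - l) x = scl k x - scl l x"
  using scl_add_left[of k "- l" x] by (simp add: scl_minus_left)

lemma blkb: "blk g (eb g) = eb g" "blk g (om g) = om g" "blk g (xi g p) = xi g p"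
  by (auto simp: blk_def eb_def om_def xi_def fun_eq_iff)

text \<open>Through \<open>om g\<close>, vanishing of the \<open>Dl q\<close> entails vanishing of
  the \<open>Dr p\<close> on the block, so the block of \<open>a\<close> lives on its two group
  elements; invariance under \<open>taul\<close> identifies the two values.\<close>

lemma Fun_apply:
  assumes a: "supp_on Idx a" "taul a = a" "\<And>q. q < n ==> Dl q a = 0" and g: "g \<in> carrier G"
  shows "blk g a = scl (a (g, {})) (eb g)"
proof -
  have h: "supp_on Idx (blk g a)" "blk g (blk g a) = blk g a"
    using supp_blocks(4)[OF g a(1)] by (auto simp: blk_def fun_eq_iff)
  have D0: "Dl q (blk g a) = scl 0 (eb g)" if q: "q < n" for q
  proof -
    have "eb g \<star> a = blk g a" by (rule star_eb_left[OF g B(1) a(1)])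
    then have "Dl q (blk g a) = Dl q (eb g \<star> a)" by simp
    also have "\<dots> = 0" by (simp add: Dl_star[OF B(1) q] Dl_block[OF g] a(3)[OF q] star_lin)
    finally show ?thesis by simp
  qed
  obtain \<kappa> \<alpha> \<alpha>' where e: "blk g a = (\<Sum>p<n. scl (\<kappa> p) (xi g p)) + scl \<alpha> (eb g) + scl \<alpha>' (om g)"
    using linear_block[OF g B(1) h D0] by blast
  have z: "blk g a (k, S) = 0" if "S ~= {}" for k S
  proof (cases "(k, S) \<in> Idx")
    case True
    then have S: "S \<subseteq> {..<n}" "finite S" by (auto simp: Idx_def intro: finite_subset)
    have Dr0: "Dr p (blk g a) = 0" if p: "p < n" for p
    proof -
      have "om g \<star> Dr p (blk g a) = 0"
        using Dl_om_Dr[OF g B(1) h p] D0 by simp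
      then have "om g \<star> (om g \<star> Dr p (blk g a)) = 0" by (simp add: star_lin)
      then have "eb g \<star> Dr p (blk g a) = 0" by (simp only: as(1)[symmetric] om_om[OF g B(1)])
      then show ?thesis using star_eb_left[OF g B(1) supp_Dr[OF h(1)]] Dr_blk[OF g, of p "blk g a"] h(2) by simp
    qed
    from that obtain p where p: "p \<in> S" by blast
    then have pn: "p < n" using S by auto
    have "blk g a (k, insert p (S - {p})) = (-1) ^ (card (S - {p}) + card {t \<in> S - {p}. t < p}) * Dr p (blk g a) (k, S - {p})"
      using S by (intro Dr_max) auto
    then show ?thesis using Dr0[OF pn] p by (simp add: insert_absorb zero_fun_apply)
  qed (use h in \<open>auto simp: supp_on_def\<close>)
  have gu: "a (g \<otimes> u, {}) = a (g, {})" using fun_cong[OF a(2), of "(g, {})"] g by (simp add: taul_apply)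
  show ?thesis
  proof
    fix x :: "'a \<times> nat set" obtain k S where x: "x = (k, S)" by force
    show "blk g a x = scl (a (g, {})) (eb g) x"
      using z[of S k] gu by (cases "S = {}") (auto simp: x blk_val[OF g B(1)] scl_apply eb_def)
  qed
qed

text \<open>For central \<open>f a\<close> the factors \<open>s\<close> and \<open>t r\<close> in
  \<open>F1\<close> and \<open>F2\<close> can be moved to one side and cancelled, so
  \<open>f\<close> transports invariance under \<open>taul\<close> and vanishing of derivatives in
  both directions.\<close>

lemma central_Fun:
  assumes a: "supp_on Idx a" and c: "\<And>x. supp_on Idx x ==> f a \<star> x = x \<star> f a"
  shows "taul a = a \<longleftrightarrow> taul (f a) = f a" "taul a = a ==> r < n ==> De r a = 0 \<longleftrightarrow> Dl r (f a) = 0"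
proof -
  show t: "taul a = a \<longleftrightarrow> taul (f a) = f a"
  proof
    assume "taul a = a"
    then have "taul (f a) \<star> s = f a \<star> s" using F1[OF a] c[of s] by simp
    then show "taul (f a) = f a" by (rule s_cancel_right[OF supp_taul[OF supp_f] supp_f])
  next
    assume "taul (f a) = f a"
    then have "s \<star> f (taul a) = s \<star> f a" using F1[OF a] c[of s] by simp
    then have "f (taul a) = f a" by (rule s_cancel[OF supp_f supp_f])
    then show "taul a = a" by (rule f_cancel[OF supp_taul[OF a] a])
  qed
  assume ta: "taul a = a" and r: "r < n"
  then have e: "Dl r (f a) = s \<star> f (De r a)" using F2[OF r a] t c[of "t r"] by (simp add: De_def)
  show "De r a = 0 \<longleftrightarrow> Dl r (f a) = 0"
  proof
    assume "Dl r (f a) = 0"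
    then have "s \<star> f (De r a) = s \<star> 0" using e by (simp add: star_lin)
    then have "f (De r a) = 0" by (rule s_cancel[OF supp_f supp_on_0])
    then show "De r a = 0" by (rule f_inj[OF supp_De[OF a]])
  qed (simp add: e f_lins star_lin)
qed

lemma f_eb_Fun:
  assumes h: "h \<in> carrier G"
  shows "taul (f (eb h)) = f (eb h)" "r < n ==> Dl r (f (eb h)) = 0"
proof -
  have c: "f (eb h) \<star> x = x \<star> f (eb h)" if x: "supp_on Idx x" for x
  proof -
    obtain y where y: "supp_on Idx y" "f y = x" using f_surj[OF x] by blast
    then show ?thesis
      by (simp add: y(2)[symmetric] f_star[symmetric] star_eb_left[OF h B(2)] star_eb_right[OF h B(2)])
  qed
  note cf = central_Fun[OF supp_blocks(1)[OF h] c]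
  show "taul (f (eb h)) = f (eb h)" using cf(1) by (simp add: taul_block[OF h])
  have "De r (eb h) = 0" for r by (simp add: De_def Dl_block[OF h])
  then show "r < n ==> Dl r (f (eb h)) = 0" using cf(2) by (simp add: taul_block[OF h])
qed

lemma f_eb_idem: "h \<in> carrier G ==> f (eb h) \<star> f (eb h) = f (eb h)"
  using blkb[of h] by (simp add: f_star[symmetric] star_eb_left[OF _ B(2)] supp_blocks)

lemma f_eb_blk:
  assumes h: "h \<in> carrier G" and g: "g \<in> carrier G" and nz: "blk g (f (eb h)) ~= 0"
  shows "blk g (f (eb h)) = eb g"
proof -
  let ?v = "f (eb h) (g, {})"
  have e: "blk g (f (eb h)) = scl ?v (eb g)"
    by (rule Fun_apply[OF supp_f f_eb_Fun[OF h] g])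
  then have v: "?v ~= 0" using nz by auto
  have k: "eb g \<star> f (eb h) = scl ?v (eb g)" "f (eb h) \<star> eb g = scl ?v (eb g)"
    using e by (simp_all add: star_eb_left[OF g B(1)] star_eb_right[OF g B(1)])
  have "eb g \<star> (f (eb h) \<star> f (eb h)) = scl ?v (eb g) \<star> f (eb h)" by (simp only: as(1)[symmetric] k)
  then have "scl ?v (eb g) = scl (?v * ?v) (eb g)" by (simp add: f_eb_idem[OF h] k star_lin)
  then have "?v = ?v * ?v" by (rule scl_cancel[OF eb_nz[OF g]])
  then show ?thesis using v e by simp
qed

text \<open>The preimage of \<open>eb g\<close> is central and therefore constant on blocks by
  \<open>central_Fun\<close>. A block where it does not vanish gives an \<open>f (eb h)\<close>
  proportional to \<open>eb g\<close>, and idempotency fixes the factor.\<close>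

lemma eb_preimage:
  assumes g: "g \<in> carrier G"
  shows "\<exists>h\<in>carrier G. f (eb h) = eb g"
proof -
  obtain a where a: "supp_on Idx a" "f a = eb g" using f_surj[OF supp_blocks(1)[OF g]] by blast
  have "f a \<star> x = x \<star> f a" if "supp_on Idx x" for x
    using that by (simp add: a(2) star_eb_left[OF g B(1)] star_eb_right[OF g B(1)])
  note cf = central_Fun[OF a(1) this]
  have ta: "taul a = a" using cf(1) by (simp add: a(2) taul_block[OF g])
  have De0: "De r a = 0" if "r < n" for r using cf(2)[OF _ ta that] by (simp add: a(2) Dl_block[OF g])
  have Da: "Dl q a = 0" if "q < n" for q
    unfolding Dl_De[OF that] using De0 by simp
  have ba: "blk k a = scl (a (k, {})) (eb k)" if "k \<in> carrier G" for k by (rule Fun_apply[OF a(1) ta Da that])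
  have "a ~= 0" using eb_nz[OF g] a(2) by (auto simp: f_lins)
  then obtain h S where hS: "a (h, S) ~= 0" by (force simp: fun_eq_iff zero_fun_apply)
  then have h: "h \<in> carrier G" using a(1) by (auto simp: supp_on_def Idx_def)
  have "blk h a (h, S) ~= 0" using hS by (simp add: blk_def)
  then have nz: "a (h, {}) ~= 0" using ba[OF h] by (auto simp: scl_apply)
  let ?v = "a (h, {})"
  have k: "a \<diamondop> eb h = scl ?v (eb h)" using ba[OF h] by (simp add: star_eb_right[OF h B(2) a(1)])
  have "blk g (f (eb h)) = eb g \<star> f (eb h)" by (rule star_eb_left[OF g B(1) supp_f, symmetric])
  also have "\<dots> = f (a \<diamondop> eb h)" by (simp only: f_star a)
  also have "\<dots> = scl ?v (f (eb h))" by (simp add: k f_lins)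
  finally have e: "blk g (f (eb h)) = scl ?v (f (eb h))" .
  have fnz: "f (eb h) ~= 0" using f_inj[OF supp_blocks(1)[OF h]] eb_nz[OF h] by blast
  have "blk g (f (eb h)) ~= 0"
  proof
    assume "blk g (f (eb h)) = 0"
    then have "scl ?v (f (eb h)) = scl 0 (f (eb h))" using e by simp
    then show False using scl_cancel[OF fnz] nz by blast
  qed
  then have eg: "eb g = scl ?v (f (eb h))" using f_eb_blk[OF h g] e by simp
  have "eb g \<star> eb g = eb g" using blkb[of g] by (simp add: star_eb_left[OF g B(1)] supp_blocks(1)[OF g])
  then have "scl (?v * ?v) (f (eb h)) = scl ?v (f (eb h))" by (simp add: eg star_lin f_eb_idem[OF h])
  then have "?v * ?v = ?v" by (rule scl_cancel[OF fnz])
  then show ?thesis using h nz eg by auto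
qed

lemma eb_image:
  assumes h: "h \<in> carrier G"
  shows "\<exists>g\<in>carrier G. f (eb h) = eb g"
proof -
  have "f (eb h) ~= 0" using f_inj[OF supp_blocks(1)[OF h]] eb_nz[OF h] by blast
  then obtain g S where gS: "f (eb h) (g, S) ~= 0" by (force simp: fun_eq_iff zero_fun_apply)
  then have g: "g \<in> carrier G" using supp_f[of "eb h"] by (auto simp: supp_on_def Idx_def)
  have "blk g (f (eb h)) (g, S) ~= 0" using gS by (simp add: blk_def)
  then have "blk g (f (eb h)) ~= 0" by (auto simp: zero_fun_apply)
  then have e: "blk g (f (eb h)) = eb g" by (rule f_eb_blk[OF h g])
  obtain k where k: "k \<in> carrier G" "f (eb k) = eb g" using eb_preimage[OF g] by blast
  have "f (blk k (eb h)) = f (eb k \<diamondop> eb h)" by (simp add: star_eb_left[OF k(1) B(2)] supp_blocks(1)[OF h])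
  also have "\<dots> = eb g" by (simp add: f_star k(2) star_eb_left[OF g B(1)] e)
  finally have "f (blk k (eb h)) = f (eb k)" using k by simp
  then have b: "blk k (eb h) = eb k" using supp_blocks[OF k(1)] supp_blocks[OF h] f_cancel by blast
  then have "blk k (eb h) (k, {}) = 1" by (simp add: eb_def)
  then have "k = h \<or> k = h \<otimes> u" by (simp add: blk_def eb_def split: if_splits)
  then have "eb k = eb h" using h k(1) by (auto simp: eb_def fun_eq_iff m_assoc)
  then show ?thesis using k g by auto
qed

section \<open>Relations between the block of \<open>h\<close> and its image, the block of
  \<open>g\<close>\<close>

context
  fixes g h assumes g: "g \<in> carrier G" and h: "h \<in> carrier G" and gh: "f (eb h) = eb g"
begin

lemma blk_blk: "blk k (blk k a) = blk k a"
  by (auto simp: blk_def fun_eq_iff)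

lemma st_blk: "supp_on Idx x ==> supp_on Idx y ==> x \<star> blk g y = blk g (x \<star> y)"
  "supp_on Idx x ==> supp_on Idx y ==> blk g x \<star> y = blk g (x \<star> y)"
proof -
  assume xy: "supp_on Idx x" "supp_on Idx y"
  have "x \<star> blk g y = x \<star> y \<star> eb g" using xy by (simp only: star_eb_right[OF g B(1), symmetric] as)
  then show "x \<star> blk g y = blk g (x \<star> y)" by (simp only: star_eb_right[OF g B(1) supp_star])
  have "blk g x \<star> y = eb g \<star> (x \<star> y)" using xy by (simp only: star_eb_left[OF g B(1), symmetric] as)
  then show "blk g x \<star> y = blk g (x \<star> y)" by (simp only: star_eb_left[OF g B(1) supp_star])
qed

lemma f_blk: "supp_on Idx y ==> f (blk h y) = blk g (f y)"
  by (simp add: star_eb_left[OF g B(1), symmetric] star_eb_left[OF h B(2), symmetric] f_star gh)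

lemma ops_blk: "supp_on Idx y ==> taul (blk g y) = blk g (taul y)" "supp_on Idx y ==> q < n ==> Dl q (blk g y) = blk g (Dl q y)"
  "supp_on Idx y ==> taur (blk g y) = blk g (taur y)" "supp_on Idx y ==> q < n ==> Dr q (blk g y) = blk g (Dr q y)"
  by (simp_all add: star_eb_left[OF g B(1), symmetric] taul_star[OF B(1)] taur_star[OF B(1)] Dl_star[OF B(1)] Dr_star[OF B(1)]
      taul_block[OF g] taur_block[OF g] Dl_block[OF g] Dr_block[OF g] star_lin supp_taul supp_taur supp_Dl supp_Dr)

text \<open>Write \<open>y = s \<star> f k\<close>. In the Leibniz rules for \<open>P\<close> and
  \<open>Q\<close> the terms with \<open>t\<close> and \<open>tr\<close> cancel against those of the
  hypotheses. What remains says that \<open>De q k\<close> is a multiple of \<open>eb h\<close>, so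
  that \<open>k\<close> is affine by \<open>linear_block\<close>, and that the same coefficients
  \<open>\<kappa>\<close> govern \<open>Dre q k\<close>.\<close>

lemma step:
  assumes y: "supp_on Idx y" "blk g y = y"
    and Py: "\<And>q. q < n ==> P q y = scl (\<beta> q) (eb g) - taul (t q) \<star> y"
    and Qy: "\<And>q. q < n ==> Q q y = scl (\<gamma> q) (om g) + taul (tr q) \<star> y"
  shows "\<exists>\<kappa> \<alpha> \<alpha>'. y = s \<star> f ((\<Sum>p<n. scl (\<kappa> p) (xi h p)) + scl \<alpha> (eb h) + scl \<alpha>' (om h)) \<and>
    (\<forall>q<n. \<sigma> * (\<Sum>p<n. \<kappa> p * (\<Sum>l<n. \<rho> (inv h) $$ (p, l) * \<eta> l q)) = \<beta> q) \<and>
    (\<forall>q<n. scl (\<Sum>p<n. \<kappa> p * \<eta> p q) (Qu s \<star> f (om h)) = scl (\<gamma> q) (om g))"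
proof -
  obtain k where k: "supp_on Idx k" "f k = s' \<star> y" using f_surj[OF supp_star] by blast
  then have yk: "y = s \<star> f k" by (simp only: as(1)[symmetric] s_inv one y)
  have kb: "blk h k = k"
  proof (rule f_cancel[OF supp_blocks(4)[OF h k(1)] k(1)])
    show "f (blk h k) = f k" by (simp add: f_blk[OF k(1)] k(2) st_blk(1)[OF _ y(1), symmetric] y(2))
  qed
  have Dek: "De q k = scl (\<beta> q / \<sigma>) (eb h)" if q: "q < n" for q
  proof -
    have "P q y = P q s \<star> f k + Pu s \<star> f (De q k)" unfolding yk by (rule P_star_f[OF q k(1)])
    \<comment> \<open>\<open>c_zero\<close> enters here: it removes the multiple of
      \<open>eps\<close> in \<open>T2\<close>.\<close>
    also have "P q s = - (taul (t q) \<star> s)" using T2[OF q] c_zero[OF q] by (simp add: P_def eq_neg_iff_add_eq_0)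
    also have "Pu s = scl \<sigma> eps" by (simp add: Pu_def T1)
    finally have "P q y = - (taul (t q) \<star> y) + scl \<sigma> (f (De q k))" by (simp add: star_lin as yk one)
    then have "scl \<sigma> (f (De q k)) = scl (\<beta> q) (eb g)" using Py[OF q] by (simp add: algebra_simps)
    then have "scl (1 / \<sigma>) (scl \<sigma> (f (De q k))) = scl (1 / \<sigma>) (scl (\<beta> q) (eb g))" by (simp only:)
    then have "f (De q k) = f (scl (\<beta> q / \<sigma>) (eb h))" using sigma_nz by (simp add: f_lins gh)
    then show ?thesis by (rule f_cancel[OF supp_De[OF k(1)] supp_on_scl[OF supp_blocks(1)[OF h]]])
  qed
  have Dlk: "Dl q k = scl (\<Sum>r<n. \<eta>i r q * (\<beta> r / \<sigma>)) (eb h)" if q: "q < n" for q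
    unfolding Dl_De[OF q] by (simp add: Dek scl_sum_left)
  obtain \<kappa> \<alpha> \<alpha>' where ke: "k = (\<Sum>p<n. scl (\<kappa> p) (xi h p)) + scl \<alpha> (eb h) + scl \<alpha>' (om h)"
    using linear_block[OF h B(2) k(1) kb Dlk] by blast
  have "\<sigma> * (\<Sum>p<n. \<kappa> p * (\<Sum>l<n. \<rho> (inv h) $$ (p, l) * \<eta> l q)) = \<beta> q" if q: "q < n" for q
  proof -
    have "De q k = (\<Sum>l<n. scl (\<eta> l q) (\<Sum>p<n. scl (\<kappa> p * \<rho> (inv h) $$ (p, l)) (eb h)))"
      unfolding De_def ke by (intro sum.cong refl) (simp add: op_lin Dl_block[OF h])
    also have "\<dots> = scl (\<Sum>p<n. \<kappa> p * (\<Sum>l<n. \<rho> (inv h) $$ (p, l) * \<eta> l q)) (eb h)"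
      unfolding scl_sum sum_distrib_left scl_sum_left by (subst sum.swap) (simp add: mult_ac)
    finally have "scl (\<Sum>p<n. \<kappa> p * (\<Sum>l<n. \<rho> (inv h) $$ (p, l) * \<eta> l q)) (eb h) = scl (\<beta> q / \<sigma>) (eb h)"
      using Dek[OF q] by simp
    then have "(\<Sum>p<n. \<kappa> p * (\<Sum>l<n. \<rho> (inv h) $$ (p, l) * \<eta> l q)) = \<beta> q / \<sigma>" by (rule scl_cancel[OF eb_nz[OF h]])
    then show ?thesis using sigma_nz by simp
  qed
  moreover have "scl (\<Sum>p<n. \<kappa> p * \<eta> p q) (Qu s \<star> f (om h)) = scl (\<gamma> q) (om g)" if q: "q < n" for q
  proof -
    have e: "scl (\<eta> l q) (Dr l k) = scl (\<kappa> l * \<eta> l q) (om h)" if l: "l < n" for l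
    proof -
      have "(\<Sum>p<n. scl (\<kappa> p) (if l = p then om h else 0)) = (\<Sum>p<n. if p = l then scl (\<kappa> l) (om h) else 0)"
        by (intro sum.cong) auto
      then show ?thesis using l by (simp add: ke op_lin Dr_block[OF h] mult.commute)
    qed
    have "Dre q k = scl (\<Sum>p<n. \<kappa> p * \<eta> p q) (om h)"
      unfolding Dre_def scl_sum_left by (intro sum.cong refl e) simp
    moreover have "Q q y = Q q s \<star> f k + Qu s \<star> f (Dre q k)" unfolding yk by (rule Q_star_f[OF q k(1)])
    moreover have "Q q s = taul (tr q) \<star> s" using M3[OF q] by (simp add: Q_def)
    ultimately have "Q q y = taul (tr q) \<star> y + scl (\<Sum>p<n. \<kappa> p * \<eta> p q) (Qu s \<star> f (om h))"
      by (simp add: as yk f_lins star_lin)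
    then show ?thesis using Qy[OF q] by (simp add: add.commute)
  qed
  ultimately show ?thesis using yk ke by blast
qed

lemma blk_eps: "blk g eps = eb g"
  using g by (auto simp: eps_def eb_def blk_def fun_eq_iff)

lemma PQ_blk: "supp_on Idx x ==> q < n ==> P q (blk g x) = blk g (P q x)"
  "supp_on Idx x ==> q < n ==> Q q (blk g x) = blk g (Q q x)"
  by (simp_all add: P_def Q_def ops_blk st_blk supp_taul supp_taur linop_add[OF linop_blk])

lemma P_tt: "l < n ==> q < n ==> P q (t l) = scl (b l q) eps - (Dl l (t q) + taul (t q) \<star> t l)"
  using T3[of l q] by (simp add: P_def algebra_simps)

lemma Q_tt: "l < n ==> q < n ==> Q q (t l) = Dl l (tr q) + taul (tr q) \<star> t l"
  using M4[of q l] by (simp add: Q_def)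

lemma Q_trtr: "l < n ==> q < n ==> Q q (tr l) = scl (b l q) eps - (Dr l (tr q) + taur (tr q) \<star> tr l)"
  using R3[of l q] by (simp add: Q_def algebra_simps)

lemma P_trt: "l < n ==> q < n ==> P q (tr l) = Dr l (t q) + taur (t q) \<star> tr l"
  using M4[of l q] by (simp add: P_def)

lemmas blk_lin = linop_add[OF linop_blk] linop_diff[OF linop_blk] linop_scl[OF linop_blk] linop_sum[OF linop_blk] linop_minus[OF linop_blk]

lemma xi_comm:
  assumes h: "supp_on Idx x" and r: "r < n"
  shows "xi g r \<star> x = taul x \<star> xi g r + (\<Sum>l<n. scl (2 * gb g B l r) (blk g (Dl l x)))"
proof -
  have "xi g r \<star> x = xi g r \<star> blk g x"
    using st_blk[OF supp_blocks(3)[OF g r] h] by (simp add: blkb)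
  moreover have "taul x \<star> xi g r = taul (blk g x) \<star> xi g r"
    using st_blk[OF supp_taul[OF h] supp_blocks(3)[OF g r]] by (simp add: blkb ops_blk h)
  moreover have "xi g r \<star> blk g x - taul (blk g x) \<star> xi g r = (\<Sum>l<n. scl (2 * gb g B l r) (Dl l (blk g x)))"
    by (rule xi_inner[OF g B(1) B_sym(1) supp_blocks(4)[OF g h] blk_blk r])
  ultimately show ?thesis by (simp add: ops_blk h algebra_simps)
qed

lemma om_comm: "supp_on Idx x ==> r < n ==> (\<Sum>l<n. scl (\<rho> g $$ (l, r)) (blk g (Dl l x))) = om g \<star> Dr r x"
proof -
  assume x: "supp_on Idx x" and r: "r < n"
  have "(\<Sum>l<n. scl (\<rho> g $$ (l, r)) (Dl l (blk g x))) = om g \<star> Dr r (blk g x)"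
    by (rule Dl_om_Dr[OF g B(1) supp_blocks(4)[OF g x] blk_blk r])
  moreover have "om g \<star> blk g (Dr r x) = om g \<star> Dr r x"
    using st_blk[OF supp_blocks(2)[OF g] supp_Dr[OF x]] by (simp add: blkb)
  ultimately show ?thesis by (simp add: ops_blk x r)
qed

text \<open>The slices \<open>t l\<close>, weighted by column \<open>r\<close> of
  \<open>\<rho> g\<close>, are corrected by \<open>om g \<star> tr r\<close>. By
  \<open>om_comm\<close> both parts produce the same terms with \<open>Dr r (t q)\<close> and
  \<open>Dr r (tr q)\<close>, which cancel, and the hypotheses of \<open>step\<close>
  remain.\<close>

lemma X_step:
  assumes r: "r < n"
  shows "\<exists>\<kappa>. (\<forall>q<n. \<sigma> * (\<Sum>p<n. \<kappa> p * (\<Sum>l<n. \<rho> (inv h) $$ (p, l) * \<eta> l q)) = (\<Sum>l<n. \<rho> g $$ (l, r) * b l q)) \<and>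
    (\<forall>q<n. scl (\<Sum>p<n. \<kappa> p * \<eta> p q) (Qu s \<star> f (om h)) = scl (b r q) (om g))"
proof -
  define V where "V l = \<rho> g $$ (l, r)" for l
  define T where "T = (\<Sum>l<n. scl (V l) (t l))"
  have sT: "supp_on Idx T" unfolding T_def by (intro supp_on_intros supp_st)
  let ?y = "blk g T - om g \<star> tr r"
  have PT: "P q (blk g T) = scl (\<Sum>l<n. V l * b l q) (eb g) - om g \<star> Dr r (t q) - taul (t q) \<star> blk g T" if q: "q < n" for q
  proof -
    have "P q (blk g T) = (\<Sum>l<n. scl (V l) (blk g (P q (t l))))"
      unfolding PQ_blk[OF sT q] by (simp add: T_def linop_sum[OF linop_P] linop_scl[OF linop_P] blk_lin)
    also have "\<dots> = (\<Sum>l<n. scl (V l * b l q) (eb g) - scl (V l) (blk g (Dl l (t q))) - scl (V l) (blk g (taul (t q) \<star> t l)))"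
      using q by (intro sum.cong refl) (simp add: P_tt blk_lin blk_eps scl_diff scl_add algebra_simps)
    also have "\<dots> = scl (\<Sum>l<n. V l * b l q) (eb g) - om g \<star> Dr r (t q) - (\<Sum>l<n. scl (V l) (blk g (taul (t q) \<star> t l)))"
      using om_comm[of "t q" r] r by (simp add: sum_subtractf scl_sum_left V_def)
    also have "(\<Sum>l<n. scl (V l) (blk g (taul (t q) \<star> t l))) = taul (t q) \<star> blk g T"
      by (simp add: T_def star_lin blk_lin st_blk supp_taul)
    finally show ?thesis .
  qed
  have Po: "P q (om g \<star> tr r) = - (om g \<star> Dr r (t q)) - taul (t q) \<star> (om g \<star> tr r)" if q: "q < n" for q
  proof -
    have "P q (om g \<star> tr r) = - (om g \<star> P q (tr r))"
      by (simp add: P_star q Dl_block[OF g] taul_block[OF g] star_lin)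
    also have "\<dots> = - (om g \<star> Dr r (t q)) - om g \<star> taur (t q) \<star> tr r"
      using P_trt[OF r q] by (simp add: star_lin as)
    finally show ?thesis by (simp only: om_taur[OF g B(1) supp_st(4)] as)
  qed
  have QT: "Q q (blk g T) = om g \<star> Dr r (tr q) + taul (tr q) \<star> blk g T" if q: "q < n" for q
  proof -
    have "Q q (blk g T) = (\<Sum>l<n. scl (V l) (blk g (Q q (t l))))"
      unfolding PQ_blk[OF sT q] by (simp add: T_def linop_sum[OF linop_Q] linop_scl[OF linop_Q] blk_lin)
    also have "\<dots> = (\<Sum>l<n. scl (V l) (blk g (Dl l (tr q))) + scl (V l) (blk g (taul (tr q) \<star> t l)))"
      using q by (intro sum.cong refl) (simp add: Q_tt blk_lin scl_add)
    also have "\<dots> = om g \<star> Dr r (tr q) + (\<Sum>l<n. scl (V l) (blk g (taul (tr q) \<star> t l)))"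
      using om_comm[of "tr q" r] r by (simp add: sum.distrib V_def)
    also have "(\<Sum>l<n. scl (V l) (blk g (taul (tr q) \<star> t l))) = taul (tr q) \<star> blk g T"
      by (simp add: T_def star_lin blk_lin st_blk supp_taul)
    finally show ?thesis .
  qed
  have Qo: "Q q (om g \<star> tr r) = - scl (b r q) (om g) + om g \<star> Dr r (tr q) + taul (tr q) \<star> (om g \<star> tr r)" if q: "q < n" for q
  proof -
    have "Q q (om g \<star> tr r) = - (om g \<star> Q q (tr r))"
      by (simp add: Q_star q Dr_block[OF g] taur_block[OF g] star_lin)
    also have "\<dots> = - scl (b r q) (om g) + om g \<star> Dr r (tr q) + om g \<star> taur (tr q) \<star> tr r"
      using Q_trtr[OF r q] by (simp add: star_lin as one supp_blocks[OF g])
    finally show ?thesis by (simp only: om_taur[OF g B(1) supp_st(5)] as)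
  qed
  have y: "supp_on Idx ?y" "blk g ?y = ?y"
    using sT by (auto intro!: supp_on_diff supp_blocks[OF g] simp: blk_lin blk_blk st_blk(2)[OF supp_blocks(2)[OF g] supp_st(5), symmetric] blkb)
  have "\<exists>\<kappa> \<alpha> \<alpha>'. ?y = s \<star> f ((\<Sum>p<n. scl (\<kappa> p) (xi h p)) + scl \<alpha> (eb h) + scl \<alpha>' (om h)) \<and>
    (\<forall>q<n. \<sigma> * (\<Sum>p<n. \<kappa> p * (\<Sum>l<n. \<rho> (inv h) $$ (p, l) * \<eta> l q)) = (\<Sum>l<n. V l * b l q)) \<and>
    (\<forall>q<n. scl (\<Sum>p<n. \<kappa> p * \<eta> p q) (Qu s \<star> f (om h)) = scl (b r q) (om g))"
    by (rule step[OF y]) (simp_all add: linop_diff[OF linop_P] linop_diff[OF linop_Q] PT Po QT Qo star_lin algebra_simps)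
  then show ?thesis unfolding V_def by blast
qed

text \<open>The generator \<open>xi g r\<close> is corrected by slices \<open>t l\<close> with the
  coefficients of \<open>xi_inner\<close>, so that the derivatives of \<open>t q\<close> and
  \<open>tr q\<close> cancel and \<open>step\<close> applies. The commutation rule of
  \<open>xi g r\<close> is then transported to \<open>k\<close>; tested on \<open>om h\<close> it
  removes the constant part of \<open>k\<close>, tested on \<open>xi h p\<close> it gives the third
  relation.\<close>

lemma Y_step:
  assumes r: "r < n"
  shows "\<exists>\<kappa>. (\<forall>q<n. \<sigma> * (\<Sum>p<n. \<kappa> p * (\<Sum>l<n. \<rho> (inv h) $$ (p, l) * \<eta> l q)) =
      \<rho> (inv g) $$ (r, q) - (\<Sum>l<n. 2 * gb g B l r * b l q)) \<and>
    (\<forall>q<n. scl (\<Sum>p<n. \<kappa> p * \<eta> p q) (Qu s \<star> f (om h)) = scl (if q = r then 1 else 0) (om g)) \<and>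
    (\<forall>p<n. 2 * (\<Sum>l<n. \<kappa> l * bet B' h (l, p)) = (\<Sum>q<n. 2 * gb g B q r * (\<Sum>l<n. \<rho> (inv h) $$ (p, l) * \<eta> l q)))"
proof -
  define V where "V l = 2 * gb g B l r" for l
  define T where "T = (\<Sum>l<n. scl (V l) (t l))"
  have sT: "supp_on Idx T" unfolding T_def by (intro supp_on_intros supp_st)
  note xc = xi_comm[OF _ r, folded V_def]
  let ?y = "xi g r - blk g T"
  have PT: "P q (blk g T) = scl (\<Sum>l<n. V l * b l q) (eb g) - (\<Sum>l<n. scl (V l) (blk g (Dl l (t q)))) - taul (t q) \<star> blk g T" if q: "q < n" for q
  proof -
    have "P q (blk g T) = (\<Sum>l<n. scl (V l) (blk g (P q (t l))))"
      unfolding PQ_blk[OF sT q] by (simp add: T_def linop_sum[OF linop_P] linop_scl[OF linop_P] blk_lin)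
    also have "\<dots> = (\<Sum>l<n. scl (V l * b l q) (eb g) - scl (V l) (blk g (Dl l (t q))) - scl (V l) (blk g (taul (t q) \<star> t l)))"
      using q by (intro sum.cong refl) (simp add: P_tt blk_lin blk_eps scl_diff scl_add algebra_simps)
    also have "\<dots> = scl (\<Sum>l<n. V l * b l q) (eb g) - (\<Sum>l<n. scl (V l) (blk g (Dl l (t q)))) - (\<Sum>l<n. scl (V l) (blk g (taul (t q) \<star> t l)))"
      by (simp add: sum_subtractf scl_sum_left)
    also have "(\<Sum>l<n. scl (V l) (blk g (taul (t q) \<star> t l))) = taul (t q) \<star> blk g T"
      by (simp add: T_def star_lin blk_lin st_blk supp_taul)
    finally show ?thesis .
  qed
  have QT: "Q q (blk g T) = (\<Sum>l<n. scl (V l) (blk g (Dl l (tr q)))) + taul (tr q) \<star> blk g T" if q: "q < n" for q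
  proof -
    have "Q q (blk g T) = (\<Sum>l<n. scl (V l) (blk g (Q q (t l))))"
      unfolding PQ_blk[OF sT q] by (simp add: T_def linop_sum[OF linop_Q] linop_scl[OF linop_Q] blk_lin)
    also have "\<dots> = (\<Sum>l<n. scl (V l) (blk g (Dl l (tr q))) + scl (V l) (blk g (taul (tr q) \<star> t l)))"
      using q by (intro sum.cong refl) (simp add: Q_tt blk_lin scl_add)
    also have "\<dots> = (\<Sum>l<n. scl (V l) (blk g (Dl l (tr q)))) + (\<Sum>l<n. scl (V l) (blk g (taul (tr q) \<star> t l)))"
      by (simp add: sum.distrib)
    also have "(\<Sum>l<n. scl (V l) (blk g (taul (tr q) \<star> t l))) = taul (tr q) \<star> blk g T"
      by (simp add: T_def star_lin blk_lin st_blk supp_taul)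
    finally show ?thesis .
  qed
  have Px: "P q (xi g r) = scl (\<rho> (inv g) $$ (r, q)) (eb g) - taul (t q) \<star> xi g r - (\<Sum>l<n. scl (V l) (blk g (Dl l (t q))))" if q: "q < n" for q
    using xc[of "t q"] by (simp add: P_def Dl_block[OF g] taul_block[OF g] q r star_lin algebra_simps)
  have Qx: "Q q (xi g r) = scl (if q = r then 1 else 0) (om g) + taul (tr q) \<star> xi g r + (\<Sum>l<n. scl (V l) (blk g (Dl l (tr q))))" if q: "q < n" for q
    using xc[of "tr q"] by (simp add: Q_def Dr_block[OF g] taur_block[OF g] q r star_lin algebra_simps)
  have y: "supp_on Idx ?y" "blk g ?y = ?y"
    using sT r by (auto intro!: supp_on_diff supp_blocks[OF g] simp: blk_lin blk_blk blkb)
  have "\<exists>\<kappa> \<alpha> \<alpha>'. ?y = s \<star> f ((\<Sum>p<n. scl (\<kappa> p) (xi h p)) + scl \<alpha> (eb h) + scl \<alpha>' (om h)) \<and>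
    (\<forall>q<n. \<sigma> * (\<Sum>p<n. \<kappa> p * (\<Sum>l<n. \<rho> (inv h) $$ (p, l) * \<eta> l q)) = \<rho> (inv g) $$ (r, q) - (\<Sum>l<n. V l * b l q)) \<and>
    (\<forall>q<n. scl (\<Sum>p<n. \<kappa> p * \<eta> p q) (Qu s \<star> f (om h)) = scl (if q = r then 1 else 0) (om g))"
    by (rule step[OF y]) (simp_all add: linop_diff[OF linop_P] linop_diff[OF linop_Q] PT Px QT Qx star_lin scl_diff_left algebra_simps)
  then obtain \<kappa> \<alpha> \<alpha>' where yk: "?y = s \<star> f ((\<Sum>p<n. scl (\<kappa> p) (xi h p)) + scl \<alpha> (eb h) + scl \<alpha>' (om h))"
    and 1: "\<forall>q<n. \<sigma> * (\<Sum>p<n. \<kappa> p * (\<Sum>l<n. \<rho> (inv h) $$ (p, l) * \<eta> l q)) = \<rho> (inv g) $$ (r, q) - (\<Sum>l<n. V l * b l q)"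
    and 2: "\<forall>q<n. scl (\<Sum>p<n. \<kappa> p * \<eta> p q) (Qu s \<star> f (om h)) = scl (if q = r then 1 else 0) (om g)" by blast
  define k where "k = (\<Sum>p<n. scl (\<kappa> p) (xi h p)) + scl \<alpha> (eb h) + scl \<alpha>' (om h)"
  \<comment> \<open>Both sides are compared after applying \<open>f\<close> and multiplying by
    \<open>s\<close>: \<open>F1\<close> moves \<open>taul\<close> past \<open>s\<close>, and
    \<open>F2\<close> expresses the twisted commutator of \<open>t l\<close> with \<open>f a\<close>
    by derivations, which cancel those from \<open>xi_comm\<close>.\<close>
  have comm: "k \<diamondop> a - taul a \<diamondop> k = (\<Sum>l<n. scl (V l) (blk h (De l a)))" if a: "supp_on Idx a" for a
  proof -
    have "s \<star> f (k \<diamondop> a - taul a \<diamondop> k) = ?y \<star> f a - taul (f a) \<star> ?y"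
      unfolding yk k_def[symmetric] by (simp add: f_lins f_star star_lin F1[OF a, symmetric] as(1)[symmetric])
    also have "\<dots> = (\<Sum>l<n. scl (V l) (blk g (Dl l (f a)))) - (blk g T \<star> f a - taul (f a) \<star> blk g T)"
      using xc[of "f a"] by (simp add: star_lin algebra_simps)
    also have "blk g T \<star> f a - taul (f a) \<star> blk g T = (\<Sum>l<n. scl (V l) (blk g (t l \<star> f a - taul (f a) \<star> t l)))"
      by (simp add: st_blk sT supp_taul) (simp add: T_def star_lin blk_lin sum_subtractf scl_diff)
    also have "\<dots> = (\<Sum>l<n. scl (V l) (blk g (Dl l (f a)) - s \<star> f (blk h (De l a))))"
    proof (intro sum.cong refl)
      fix l assume "l \<in> {..<n}"
      then have "t l \<star> f a - taul (f a) \<star> t l = Dl l (f a) - s \<star> f (De l a)"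
        using F2[of l a] a by (simp add: De_def algebra_simps)
      then show "scl (V l) (blk g (t l \<star> f a - taul (f a) \<star> t l)) = scl (V l) (blk g (Dl l (f a)) - s \<star> f (blk h (De l a)))"
        by (simp add: blk_lin f_blk supp_De[OF a] st_blk)
    qed
    finally have "s \<star> f (k \<diamondop> a - taul a \<diamondop> k) = s \<star> f (\<Sum>l<n. scl (V l) (blk h (De l a)))"
      by (simp add: scl_diff sum_subtractf f_lins star_lin)
    then have "f (k \<diamondop> a - taul a \<diamondop> k) = f (\<Sum>l<n. scl (V l) (blk h (De l a)))"
      by (rule s_cancel[OF supp_f supp_f])
    then show ?thesis
      by (rule f_cancel[rotated 2]) (intro supp_on_intros supp_star supp_blocks(4)[OF h] supp_De a)+
  qed
  \<comment> \<open>All derivatives \<open>Dl\<close> of \<open>om h\<close> vanish, so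
    \<open>k\<close> anticommutes with \<open>om h\<close>. So does each \<open>xi h p\<close>,
    whereas \<open>eb h\<close> and \<open>om h\<close> commute with it and cannot occur.\<close>
  have \<alpha>: "\<alpha> = 0 \<and> \<alpha>' = 0"
  proof -
    have "De l (om h) = 0" for l by (simp add: De_def Dl_block[OF h])
    moreover have "blk h 0 = 0" by (auto simp: blk_def fun_eq_iff zero_fun_apply)
    ultimately have "k \<diamondop> om h + om h \<diamondop> k = 0" using comm[OF supp_blocks(2)[OF h]]
      by (simp add: taul_block[OF h] star_lin)
    moreover have "k \<diamondop> om h = - (\<Sum>p<n. scl (\<kappa> p) (om h \<diamondop> xi h p)) + scl \<alpha> (om h) + scl \<alpha>' (eb h)"
    proof -
      have "(\<Sum>p<n. scl (\<kappa> p) (xi h p \<diamondop> om h)) = (\<Sum>p<n. - scl (\<kappa> p) (om h \<diamondop> xi h p))"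
        by (intro sum.cong refl) (simp add: xi_om[OF h B(2)] scl_minus)
      then show ?thesis
        by (simp add: k_def star_lin om_om[OF h B(2)] star_eb_left[OF h B(2)] supp_blocks[OF h] blkb sum_negf)
    qed
    moreover have "om h \<diamondop> k = (\<Sum>p<n. scl (\<kappa> p) (om h \<diamondop> xi h p)) + scl \<alpha> (om h) + scl \<alpha>' (eb h)"
      by (simp add: k_def star_lin om_om[OF h B(2)] star_eb_right[OF h B(2)] supp_blocks[OF h] blkb)
    ultimately have e: "scl \<alpha> (om h) + scl \<alpha>' (eb h) + (scl \<alpha> (om h) + scl \<alpha>' (eb h)) = 0" by (simp add: algebra_simps)
    show ?thesis using fun_cong[OF e, of "(h, {})"] fun_cong[OF e, of "(h \<otimes> u, {})"] gu_neq[OF h]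
      by (auto simp: plus_fun_apply scl_apply zero_fun_apply om_def eb_def)
  qed
  have "2 * (\<Sum>l<n. \<kappa> l * bet B' h (l, p)) = (\<Sum>q<n. V q * (\<Sum>l<n. \<rho> (inv h) $$ (p, l) * \<eta> l q))" if p: "p < n" for p
  proof -
    have "k = (\<Sum>p<n. scl (\<kappa> p) (xi h p))" using \<alpha> by (simp add: k_def)
    then have "k \<diamondop> xi h p - taul (xi h p) \<diamondop> k = (\<Sum>l<n. scl (\<kappa> l) (xi h l \<diamondop> xi h p + xi h p \<diamondop> xi h l))"
      by (simp add: taul_block[OF h] star_lin scl_add sum.distrib scl_minus sum_negf)
    also have "\<dots> = scl (\<Sum>l<n. \<kappa> l * (2 * bet B' h (l, p))) (eb h)"
      using p by (simp add: xi_xi[OF h B(2) B_sym(2)] scl_sum_left)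
    finally have L: "k \<diamondop> xi h p - taul (xi h p) \<diamondop> k = scl (\<Sum>l<n. \<kappa> l * (2 * bet B' h (l, p))) (eb h)" .
    have d: "De q (xi h p) = scl (\<Sum>l<n. \<rho> (inv h) $$ (p, l) * \<eta> l q) (eb h)" for q
      using p by (simp add: De_def Dl_block[OF h] scl_sum_left mult.commute)
    have "(\<Sum>q<n. scl (V q) (blk h (De q (xi h p)))) = scl (\<Sum>q<n. V q * (\<Sum>l<n. \<rho> (inv h) $$ (p, l) * \<eta> l q)) (eb h)"
      by (simp only: d linop_scl[OF linop_blk] blkb scl_scl) (rule scl_sum_left[symmetric])
    then have "scl (\<Sum>l<n. \<kappa> l * (2 * bet B' h (l, p))) (eb h) = scl (\<Sum>q<n. V q * (\<Sum>l<n. \<rho> (inv h) $$ (p, l) * \<eta> l q)) (eb h)"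
      using comm[OF supp_blocks(3)[OF h p]] L by simp
    from scl_cancel[OF eb_nz[OF h] this] show ?thesis by (simp add: sum_distrib_left mult_ac)
  qed
  then show ?thesis using 1 2 unfolding V_def by blast
qed

lemma Pu_star_f: "supp_on Idx a ==> Pu (x \<star> f a) = Pu x \<star> f (taul a)"
  by (simp add: Pu_def taul_star[OF B(1)] as F1)

lemma Qu_star_f: "supp_on Idx a ==> Qu (x \<star> f a) = Qu x \<star> f (taur a)"
  by (simp add: Qu_def taur_star[OF B(1)] as F3)

text \<open>Applying \<open>Pu\<close> and then \<open>Qu\<close> to the hypothesis replaces the
  slices by \<open>\<sigma>\<close> through \<open>M1\<close>, \<open>T1\<close> and
  \<open>R1\<close>. A final product with \<open>f (om h)\<close> produces \<open>w\<close> a second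
  time, since \<open>om\<close> squares to the idempotent of its block.\<close>

lemma scalar_square:
  assumes w: "Qu s \<star> f (om h) = scl w (om g)"
  shows "w\<^sup>2 = \<sigma>\<^sup>2"
proof -
  have so: "supp_on Idx (om h)" "supp_on Idx (om g)" using supp_blocks g h by auto

  have Qs: "Qu s = taul sr \<star> s" by (simp add: Qu_def M1)
  have "Pu (Qu s) = scl \<sigma> sr"
    by (simp add: Qs) (simp add: Pu_def taul_star[OF B(1)] taul_taul as T1 star_lin one)
  then have "Pu (Qu s \<star> f (om h)) = - scl \<sigma> (sr \<star> f (om h))"
    by (simp add: Pu_star_f so taul_block[OF h] f_lins star_lin)
  moreover have "Pu (scl w (om g)) = - scl w (om g \<star> s)"
    by (simp add: Pu_def op_lin taul_block[OF g] star_lin scl_minus)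
  ultimately have e1: "scl \<sigma> (sr \<star> f (om h)) = scl w (om g \<star> s)" using w by simp
  have "Qu (sr \<star> f (om h)) = - scl \<sigma> (f (om h))"
    by (simp add: Qu_star_f so taur_block[OF h] f_lins star_lin) (simp add: Qu_def R1 star_lin one)
  moreover have "Qu (om g \<star> s) = - (om g \<star> Qu s)"
    by (simp add: Qu_def taur_star[OF B(1)] taur_block[OF g] star_lin as)
  moreover have "Qu (scl \<sigma> (sr \<star> f (om h))) = scl \<sigma> (Qu (sr \<star> f (om h)))"
    "Qu (scl w (om g \<star> s)) = scl w (Qu (om g \<star> s))" by (simp_all add: Qu_def op_lin star_lin)
  ultimately have e2: "scl (\<sigma>\<^sup>2) (f (om h)) = scl w (om g \<star> Qu s)"
    using e1 by (simp add: scl_minus power2_eq_square)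
  have "f (om h) \<star> f (om h) = eb g" by (simp add: f_star[symmetric] om_om[OF h B(2)] gh)
  then have "scl (\<sigma>\<^sup>2) (eb g) = scl w (om g \<star> Qu s) \<star> f (om h)" by (simp add: e2[symmetric] star_lin)
  also have "\<dots> = scl (w * w) (eb g)" by (simp add: star_lin as w om_om[OF g B(1)])
  finally have "\<sigma>\<^sup>2 = w * w" by (rule scl_cancel[OF eb_nz[OF g]])
  then show ?thesis by (simp add: power2_eq_square)
qed

text \<open>The column vectors of \<open>Y_step\<close> and \<open>X_step\<close> form
  \<open>K\<close> and \<open>K2\<close>. The factor \<open>Qu s \<star> f (om h)\<close> does not
  depend on \<open>r\<close> and is \<open>1 / z\<close> times \<open>om g\<close>; the sign
  \<open>z * \<sigma>\<close> becomes the sign in the symplectic relation.\<close>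

lemma relations:
  "\<exists>z K K2. (z * \<sigma>)\<^sup>2 = 1 \<and> (\<forall>r<n. \<forall>q<n.
    \<sigma> * (\<Sum>p<n. K p r * (\<Sum>l<n. \<rho> (inv h) $$ (p, l) * \<eta> l q)) = \<rho> (inv g) $$ (r, q) - (\<Sum>l<n. 2 * gb g B l r * b l q) \<and>
    (\<Sum>p<n. K p r * \<eta> p q) = (if q = r then z else 0) \<and>
    2 * (\<Sum>l<n. K l r * bet B' h (l, q)) = (\<Sum>p<n. 2 * gb g B p r * (\<Sum>l<n. \<rho> (inv h) $$ (q, l) * \<eta> l p)) \<and>
    \<sigma> * (\<Sum>p<n. K2 p r * (\<Sum>l<n. \<rho> (inv h) $$ (p, l) * \<eta> l q)) = (\<Sum>l<n. \<rho> g $$ (l, r) * b l q) \<and>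
    (\<Sum>p<n. K2 p r * \<eta> p q) = z * b r q)"
proof -
  define X where "X = Qu s \<star> f (om h)"
  have "\<forall>r. \<exists>\<kappa>. r < n --> (\<forall>q<n. \<sigma> * (\<Sum>p<n. \<kappa> p * (\<Sum>l<n. \<rho> (inv h) $$ (p, l) * \<eta> l q)) =
      \<rho> (inv g) $$ (r, q) - (\<Sum>l<n. 2 * gb g B l r * b l q)) \<and>
    (\<forall>q<n. scl (\<Sum>p<n. \<kappa> p * \<eta> p q) X = scl (if q = r then 1 else 0) (om g)) \<and>
    (\<forall>p<n. 2 * (\<Sum>l<n. \<kappa> l * bet B' h (l, p)) = (\<Sum>q<n. 2 * gb g B q r * (\<Sum>l<n. \<rho> (inv h) $$ (p, l) * \<eta> l q)))"
    using Y_step unfolding X_def by blast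
  then obtain K where K: "\<And>r q. r < n ==> q < n ==> \<sigma> * (\<Sum>p<n. K r p * (\<Sum>l<n. \<rho> (inv h) $$ (p, l) * \<eta> l q)) =
      \<rho> (inv g) $$ (r, q) - (\<Sum>l<n. 2 * gb g B l r * b l q)"
    "\<And>r q. r < n ==> q < n ==> scl (\<Sum>p<n. K r p * \<eta> p q) X = scl (if q = r then 1 else 0) (om g)"
    "\<And>r p. r < n ==> p < n ==> 2 * (\<Sum>l<n. K r l * bet B' h (l, p)) = (\<Sum>q<n. 2 * gb g B q r * (\<Sum>l<n. \<rho> (inv h) $$ (p, l) * \<eta> l q))"
    unfolding choice_iff by blast
  have "\<forall>r. \<exists>\<kappa>. r < n --> (\<forall>q<n. \<sigma> * (\<Sum>p<n. \<kappa> p * (\<Sum>l<n. \<rho> (inv h) $$ (p, l) * \<eta> l q)) = (\<Sum>l<n. \<rho> g $$ (l, r) * b l q)) \<and>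
    (\<forall>q<n. scl (\<Sum>p<n. \<kappa> p * \<eta> p q) X = scl (b r q) (om g))"
    using X_step unfolding X_def by blast
  then obtain K2 where K2: "\<And>r q. r < n ==> q < n ==> \<sigma> * (\<Sum>p<n. K2 r p * (\<Sum>l<n. \<rho> (inv h) $$ (p, l) * \<eta> l q)) = (\<Sum>l<n. \<rho> g $$ (l, r) * b l q)"
    "\<And>r q. r < n ==> q < n ==> scl (\<Sum>p<n. K2 r p * \<eta> p q) X = scl (b r q) (om g)"
    unfolding choice_iff by blast
  \<comment> \<open>Each diagonal entry has this value; index \<open>0\<close> is available because
    \<open>0 < n\<close>.\<close>
  define z where "z = (\<Sum>p<n. K 0 p * \<eta> p 0)"
  have zX: "scl z X = om g" using K(2)[OF n_pos n_pos] by (simp add: z_def)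
  then have z: "z ~= 0" using om_nz[OF g] by auto
  have X: "X = scl (1 / z) (om g)" unfolding zX[symmetric] using z by simp
  have c: "k = z * l" if "scl k X = scl l (om g)" for k l
  proof -
    have "scl (k / z) (om g) = scl l (om g)" using that by (simp add: X)
    then have "k / z = l" by (rule scl_cancel[OF om_nz[OF g]])
    then show ?thesis using z by (simp add: field_simps)
  qed
  have "(1 / z)\<^sup>2 = \<sigma>\<^sup>2" by (rule scalar_square) (use X in \<open>simp add: X_def\<close>)
  then have "(z * \<sigma>)\<^sup>2 = 1" using z by (simp add: power2_eq_square field_simps)
  moreover have "(\<Sum>p<n. K r p * \<eta> p q) = (if q = r then z else 0)" if "r < n" "q < n" for r q
    using c[OF K(2)[OF that]] by simp
  moreover have "(\<Sum>p<n. K2 r p * \<eta> p q) = z * b r q" if "r < n" "q < n" for r q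
    using c[OF K2(2)[OF that]] .
  ultimately show ?thesis
    by (intro exI[of _ z] exI[of _ "\<lambda>p r. K r p"] exI[of _ "\<lambda>p r. K2 r p"]) (simp add: K(1,3) K2(1))
qed

end

end

section \<open>Twists of the dual algebra\<close>

lemma mulf_tensor:
  assumes "a \<in> idx A" "c \<in> idx C" "finite (idx A)" "finite (idx C)"
  shows "mulf (tensor_alg A C) X Y (a, c) =
    (\<Sum>i\<in>idx A. \<Sum>j\<in>idx A. mulf C (\<lambda>x. X (i, x)) (\<lambda>x. Y (j, x)) c * mulc A i j a)"
proof -
  have "mulf (tensor_alg A C) X Y (a, c) =
    (\<Sum>i\<in>idx A. \<Sum>x\<in>idx C. \<Sum>j\<in>idx A. \<Sum>y\<in>idx C. X (i, x) * Y (j, y) * (mulc A i j a * mulc C x y c))"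
    using assms by (simp add: mulf_def tensor_alg_def sum.cartesian_product')
  also have "\<dots> = (\<Sum>i\<in>idx A. \<Sum>j\<in>idx A. \<Sum>x\<in>idx C. \<Sum>y\<in>idx C. X (i, x) * Y (j, y) * (mulc A i j a * mulc C x y c))"
    by (intro sum.cong refl) (rule sum.swap)
  also have "\<dots> = (\<Sum>i\<in>idx A. \<Sum>j\<in>idx A. mulf C (\<lambda>x. X (i, x)) (\<lambda>x. Y (j, x)) c * mulc A i j a)"
    using assms(2) by (intro sum.cong refl) (simp add: mulf_def sum_distrib_right sum_distrib_left mult_ac)
  finally show ?thesis .
qed

text \<open>The ordinary tensor square is the super tensor square for the trivial grading.\<close>

lemma tensor_super:
  assumes "finite (idx A)" "assoc_alg A" "unital_alg A"
  shows "assoc_alg (tensor_alg A A)" "unital_alg (tensor_alg A A)"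
proof -
  define A' :: "'a super_hopf" where "A' = \<lparr>idx = idx A, mulc = mulc A, unitc = unitc A, comulc = (\<lambda>_ _ _. 0), counitc = (\<lambda>_. 0), parity = (\<lambda>_. 0)\<rparr>"
  have e: "super_tensor A' = tensor_alg A A"
    by (auto simp: super_tensor_def tensor_alg_def A'_def fun_eq_iff)
  have m: "mulf A' = mulf A" by (auto simp: mulf_def A'_def fun_eq_iff)
  have s: "idx A' = idx A" "unitc A' = unitc A" by (simp_all add: A'_def)
  have p: "parity A' i = 0" for i by (simp add: A'_def)
  have h: "homg (parity A') 0 x" for x by (simp add: homg_def p)
  show "assoc_alg (tensor_alg A A)"
    unfolding e[symmetric] by (rule assoc_super) (use assms in \<open>auto simp: s assoc_alg_def m p h\<close>)
  show "unital_alg (tensor_alg A A)"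
    unfolding e[symmetric] by (rule unital_super) (use assms in \<open>auto simp: s unital_alg_def m h simp del: restrict_mulf_restrict\<close>)
qed

section \<open>Evaluating products, coproducts and the twist equation at \<open>1\<close>,
  \<open>u\<close> and vectors\<close>

context grepu
begin

definition c1 :: "'a \<times> nat set" where "c1 = (\<one>, {})"
definition cu :: "'a \<times> nat set" where "cu = (u, {})"
definition cr :: "nat => 'a \<times> nat set" where "cr r = (\<one>, {r})"

lemma special_Idx [simp]: "c1 \<in> Idx" "cu \<in> Idx" "r < n ==> cr r \<in> Idx"
  by (auto simp: c1_def cu_def cr_def Idx_def)

lemma bet_one:
  assumes "B \<in> carrier_mat n n" "k = \<one> \<or> k = u" "r < n" "s < n"
  shows "bet B k (r, s) = 0"
proof -
  have "conjB B \<one> = B" using assms by (simp add: conjB_def rho_one)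
  then have "bet B \<one> (r, s) = 0" by (simp add: bet_def)
  moreover have "bet B (\<one> \<otimes> u) (r, s) = bet B \<one> (r, s)" using assms by (intro bet_gu) auto
  ultimately show ?thesis using assms by auto
qed

lemma XE_0: "XE (\<lambda>_. 0) w = w"
proof -
  have "foldr (\<lambda>p v. v + scl 0 (XO p v)) ps w = w" for ps by (induction ps) auto
  then show ?thesis by (simp add: XE_def)
qed

lemma Dr_sing: "Dr r a (k, {}) = a (k, {r})"
  by (simp add: Dr_def)

lemma Dl_sing: "r < n ==> Dl r a (\<one>, {}) = a (\<one>, {r})" "r < n ==> Dl r a (u, {}) = - a (u, {r})"
proof -
  assume r: "r < n"
  have "(\<Sum>q<n. (if q = r then 1 else 0) * a (\<one>, {q})) = a (\<one>, {r})"
    using r by (subst sum.remove[of _ r]) (auto intro!: sum.neutral)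
  then show "Dl r a (\<one>, {}) = a (\<one>, {r})" using r by (simp add: Dl_def Dr_sing rho_one)
  have "(\<Sum>q<n. (if q = r then - 1 else 0) * a (u, {q})) = - a (u, {r})"
    using r by (subst sum.remove[of _ r]) (auto intro!: sum.neutral)
  moreover have "\<rho> (inv u) $$ (q, r) = (if q = r then - 1 else 0)" if "q < n" for q using that r by (simp add: rho_u)
  ultimately show "Dl r a (u, {}) = - a (u, {r})" by (simp add: Dl_def Dr_sing)
qed

text \<open>The coproduct of the dual algebra, \<open>a\<close> composed with multiplication. Its
  slices at the special indices are \<open>a\<close> itself, \<open>taul\<close>,
  \<open>taur\<close>, \<open>Dl\<close> and \<open>Dr\<close>.\<close>

definition pr :: "('a \<times> nat set => complex) => ('a \<times> nat set) \<times> ('a \<times> nat set) => complex" where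
  "pr a = (\<lambda>(j, k). dot Idx a (mA (sng j) (sng k)))"

lemma pr_scl: "pr (scl k a) jk = k * pr a jk"
  by (cases jk) (simp add: pr_def dot_scl_left)

lemma pr_sum: "j \<in> Idx ==> k \<in> Idx ==> pr a (j, k) = (\<Sum>i\<in>Idx. a i * mulc AA j k i)"
  by (simp add: pr_def dot_def mulf_sng zext_def mult.commute)

lemma pr_c1: "k \<in> Idx ==> pr a (c1, k) = a k" "k \<in> Idx ==> pr a (k, c1) = a k"
  using mA_one[of "sng k"] by (simp_all add: pr_def c1_def gam_def supp_on_sng dot_sng)

lemma mA_gam_left: "g \<in> carrier G ==> k \<in> carrier G ==> S \<subseteq> {..<n} ==> mA (gam k) (sng (g, S)) = sng (k \<otimes> g, S)"
  using gam_vec1[of g S] gam_vec1[of "k \<otimes> g" S] mA_assoc[of "gam k" "gam g" "sng (\<one>, S)"] by (simp add: gam_gam)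

lemma mA_gam_u: "g \<in> carrier G ==> finite S ==> S \<subseteq> {..<n} ==> mA (sng (g, S)) (gam u) = scl ((-1) ^ card S) (sng (g \<otimes> u, S))"
proof (rotate_tac 1, induction S rule: finite_linorder_max_induct)
  case empty
  then show ?case using gam_gam[of g u] by (simp add: gam_def)
next
  case (insert s S)
  have s: "s < n" "S \<subseteq> {..<n}" "s \<notin> S" "{t \<in> S. s < t} = {}" using insert by force+
  have e: "sng (k, insert s S) = mA (sng (k, S)) (vec1 s)" if "k \<in> carrier G" for k
    using sng_vec1[OF that s(2,1)] s(3,4) by simp
  have v: "mA (vec1 s) (gam u) = - mA (gam u) (vec1 s)"
  proof -
    have "(\<Sum>r<n. scl (\<rho> (inv u) $$ (r, s)) (vec1 r)) = (\<Sum>r<n. if r = s then - vec1 s else 0)"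
      using s by (intro sum.cong refl) (auto simp: rho_u scl_minus_1)
    also have "\<dots> = - vec1 s" using s by simp
    finally show ?thesis using vec1_gam[OF u_in s(1)] by (simp add: mulf_minus_right)
  qed
  have "mA (sng (g, insert s S)) (gam u) = - mA (mA (sng (g, S)) (gam u)) (vec1 s)"
    using insert.prems by (simp add: e mA_assoc v mulf_minus_right)
  also have "\<dots> = scl ((-1) ^ card (insert s S)) (sng (g \<otimes> u, insert s S))"
    using insert s by (simp add: mulf_scl_left e scl_minus_left)
  finally show ?case .
qed

lemma pr_cu: "k \<in> Idx ==> pr a (cu, k) = taul a k" "k \<in> Idx ==> pr a (k, cu) = taur a k"
proof -
  assume k: "k \<in> Idx"
  obtain g S where e: "k = (g, S)" "g \<in> carrier G" "S \<subseteq> {..<n}" using k by (auto simp: Idx_def)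
  have f: "finite S" using e(3) by (rule finite_subset) simp
  have i: "(g \<otimes> u, S) \<in> Idx" using e by (auto simp: Idx_def)
  show "pr a (cu, k) = taul a k"
    using mA_gam_left[OF e(2) u_in e(3)] e i u_central[OF e(2)] by (simp add: pr_def cu_def gam_def[symmetric] dot_sng taul_apply)
  show "pr a (k, cu) = taur a k"
    using mA_gam_u[OF e(2) f e(3)] e i by (simp add: pr_def cu_def gam_def[symmetric] dot_sng dot_scl taur_apply)
qed

lemma pr_cr: "r < n ==> k \<in> Idx ==> pr a (cr r, k) = Dl r a k" "r < n ==> k \<in> Idx ==> pr a (k, cr r) = Dr r a k"
proof -
  assume r: "r < n" and k: "k \<in> Idx"
  obtain g S where e: "k = (g, S)" "g \<in> carrier G" "S \<subseteq> {..<n}" using k by (auto simp: Idx_def)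
  have f: "finite S" using e(3) by (rule finite_subset) simp
  have i: "(g, insert q S) \<in> Idx" if "q < n" for q using e that by (auto simp: Idx_def)
  have d: "dot Idx a (if q \<in> S then 0 else scl c (sng (g, insert q S))) = (if q \<in> S then 0 else c * a (g, insert q S))" if "q < n" for q c
    using i[OF that] by (simp add: dot_sng dot_scl dot_0)
  have sg: "x * ((-1) ^ card S * ((-1) ^ (card S + m) * y)) = x * ((-1) ^ m * y)" for x y :: complex and m
    by (simp add: power_add)
  have "pr a (cr r, k) = (\<Sum>q<n. \<rho> (inv g) $$ (q, r) * (if q \<in> S then 0 else (-1) ^ card {t \<in> S. t < q} * a (g, insert q S)))"
    unfolding pr_def cr_def vec1_def[symmetric] prod.case e(1) vec1_sng[OF e(2,3) r] dot_sum dot_scl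
    by (intro sum.cong refl) (simp add: d)
  then show "pr a (cr r, k) = Dl r a k"
    using e f unfolding Dl_def Dr_def by (auto simp: sum_distrib_left power_add intro!: sum.cong)
  show "pr a (k, cr r) = Dr r a k"
    unfolding pr_def cr_def vec1_def[symmetric] prod.case e(1) sng_vec1[OF e(2,3) r] d[OF r]
    using f by (simp add: Dr_def sign_gt)
qed

context
  fixes B :: "complex mat" assumes B: "B \<in> carrier_mat n n"
begin

lemma cm_unit: "k = \<one> \<or> k = u ==> cm B w (k, {}) = w ((k, {}), (k, {}))"
proof -
  assume k: "k = \<one> \<or> k = u"
  then have "(k, {}) \<in> Idx" by (auto simp: Idx_def)
  then have "cm B w (k, {}) = XE (bet B k) w ((k, {}), (k, {}))" using comul_formula[OF B, of k "{}" w] k by (auto simp: cm_def Idx_def)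
  also have "XE (bet B k) = XE (\<lambda>_. 0)" by (rule XE_cong[OF B]) (simp add: bet_one[OF B k])
  finally show ?thesis by (simp add: XE_0)
qed

text \<open>The form vanishes at \<open>1\<close> and \<open>u\<close>. Hence evaluation at
  \<open>c1\<close> and \<open>cu\<close> is multiplicative, and evaluation at \<open>cr r\<close>
  is a skew derivation between these two characters.\<close>

lemma cm_special: "cm B w c1 = w (c1, c1)" "cm B w cu = w (cu, cu)" "r < n ==> cm B w (cr r) = w (cr r, c1) + w (cu, cr r)"
proof -
  show "cm B w c1 = w (c1, c1)" "cm B w cu = w (cu, cu)" by (simp_all add: c1_def cu_def cm_unit)
  assume r: "r < n"
  have "cm B w (cr r) = cm B (DD r w) (\<one>, {})"
    using Dr_cm[OF B r, of w] Dr_sing[of r "cm B w" \<one>] by (simp add: cr_def)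
  also have "\<dots> = DD r w ((\<one>, {}), (\<one>, {}))" by (simp add: cm_unit)
  also have "\<dots> = w (cr r, c1) + w (cu, cr r)"
    by (simp add: DD_def plus_fun_apply op1_def op2_def Dr_sing taur_apply cr_def c1_def cu_def)
  finally show "cm B w (cr r) = w (cr r, c1) + w (cu, cr r)" .
qed

lemma star_special: "star B a b c1 = a c1 * b c1" "star B a b cu = a cu * b cu"
  "r < n ==> star B a b (cr r) = a (cr r) * b c1 + a cu * b (cr r)"
  by (simp_all add: star_def cm_special tens_def)

abbreviation "H \<equiv> dual_hopf (HA B)"

lemma dual_simps: "idx H = Idx" "mulc H i j k = comulc (HA B) k i j"
  "zext Idx (unitc H) = eps" "comulc H i j k = mulc AA j k i" "counitc H = unitc AA"
  by (auto simp: dual_hopf_def hopf_A_simps zext_def eps_def group_ext_alg_def Idx_def fun_eq_iff)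

lemma assoc_H: "assoc_alg H" and unital_H: "unital_alg H"
  using star_assoc[OF B] star_eps_left[OF B] star_eps_right[OF B]
  by (auto simp: assoc_alg_def unital_alg_def mulf_dual dual_simps(1,3) simp del: restrict_mulf_restrict)

lemma mulf_H2: "mulf (tensor_alg H H) X Y (a, b) = (if b \<in> Idx then cm B (\<lambda>(i, j). star B (\<lambda>x. X (i, x)) (\<lambda>x. Y (j, x)) b) a else 0)"
proof (cases "a \<in> Idx \<and> b \<in> Idx")
  case True
  then show ?thesis by (simp add: mulf_tensor dual_simps(1,2) mulf_dual cm_def)
next
  case False
  then show ?thesis by (auto simp: mulf_def dual_simps(1) cm_def)
qed

lemma H2_left: "mulf (tensor_alg H H) X Y (c1, b) = star B (\<lambda>x. X (c1, x)) (\<lambda>x. Y (c1, x)) b"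
  "mulf (tensor_alg H H) X Y (cu, b) = star B (\<lambda>x. X (cu, x)) (\<lambda>x. Y (cu, x)) b"
  "r < n ==> mulf (tensor_alg H H) X Y (cr r, b) = star B (\<lambda>x. X (cr r, x)) (\<lambda>x. Y (c1, x)) b + star B (\<lambda>x. X (cu, x)) (\<lambda>x. Y (cr r, x)) b"
  by (auto simp: mulf_H2 cm_special star_def cm_outside)

lemma H2_right: "mulf (tensor_alg H H) X Y (b, c1) = star B (\<lambda>x. X (x, c1)) (\<lambda>x. Y (x, c1)) b"
  "mulf (tensor_alg H H) X Y (b, cu) = star B (\<lambda>x. X (x, cu)) (\<lambda>x. Y (x, cu)) b"
  "r < n ==> mulf (tensor_alg H H) X Y (b, cr r) = star B (\<lambda>x. X (x, cr r)) (\<lambda>x. Y (x, c1)) b + star B (\<lambda>x. X (x, cu)) (\<lambda>x. Y (x, cr r)) b"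
proof -
  show "mulf (tensor_alg H H) X Y (b, c1) = star B (\<lambda>x. X (x, c1)) (\<lambda>x. Y (x, c1)) b"
    "mulf (tensor_alg H H) X Y (b, cu) = star B (\<lambda>x. X (x, cu)) (\<lambda>x. Y (x, cu)) b"
    by (simp_all add: mulf_H2 star_special) (simp_all add: star_def tens_def)
  assume r: "r < n"
  have "mulf (tensor_alg H H) X Y (b, cr r) = cm B (tens (\<lambda>x. X (x, cr r)) (\<lambda>x. Y (x, c1)) + tens (\<lambda>x. X (x, cu)) (\<lambda>x. Y (x, cr r))) b"
    using r by (simp add: mulf_H2 star_special) (auto intro!: arg_cong[where f="\<lambda>w. cm B w b"] simp: fun_eq_iff plus_fun_apply tens_def)
  then show "mulf (tensor_alg H H) X Y (b, cr r) = star B (\<lambda>x. X (x, cr r)) (\<lambda>x. Y (x, c1)) b + star B (\<lambda>x. X (x, cu)) (\<lambda>x. Y (x, cr r)) b"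
    by (simp add: star_def linop_add[OF fdep_linop[OF fdep_cm]] plus_fun_apply)
qed

lemma mulf_H3:
  assumes "a \<in> Idx" "b \<in> Idx" "c \<in> Idx"
  shows "mulf (tensor_alg H (tensor_alg H H)) X Y (a, b, c) =
    cm B (\<lambda>(i, j). cm B (\<lambda>(k, l). star B (\<lambda>x. X (i, k, x)) (\<lambda>x. Y (j, l, x)) c) b) a"
  using assms by (simp add: mulf_tensor dual_simps(1,2) mulf_H2 cm_def)

lemma cm_cong: "(\<And>i j. i \<in> Idx ==> j \<in> Idx ==> v (i, j) = w (i, j)) ==> cm B v = cm B w"
  by (auto simp: cm_def fun_eq_iff intro!: sum.cong)

lemma cm_cong_at: "(\<And>i j. i \<in> Idx ==> j \<in> Idx ==> v (i, j) = w (i, j)) ==> cm B v a = cm B w a"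
  using cm_cong[of v w] by simp

lemma star_cong: "(\<And>i. i \<in> Idx ==> a i = a' i) ==> (\<And>i. i \<in> Idx ==> b i = b' i) ==> star B a b = star B a' b'"
  unfolding star_def by (rule cm_cong) (simp add: tens_def)

text \<open>The factors \<open>F \<otimes> 1\<close> and \<open>1 \<otimes> F\<close> contain the
  unit in the third and in the first place, so on each side one of the three nested products
  disappears.\<close>

lemma twist_equation:
  assumes tw: "hopf_twist H F" and abc: "a \<in> Idx" "b \<in> Idx" "c \<in> Idx"
  defines "\<Phi> \<equiv> zext I2 F"
  shows "cm B (\<lambda>(i, j). cm B (\<lambda>(k, l). pr (\<lambda>x. \<Phi> (x, c)) (i, k) * \<Phi> (j, l)) b) a =
    cm B (\<lambda>(k, l). cm B (\<lambda>(x, y). pr (\<lambda>z. \<Phi> (a, z)) (k, x) * \<Phi> (l, y)) c) b"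
proof -
  let ?T = "tensor_alg H (tensor_alg H H)"
  define I3 where "I3 = Idx \<times> Idx \<times> Idx"
  define X1 where "X1 = (\<lambda>(a, b, c)\<in>I3. \<Sum>i\<in>Idx. F (i, c) * comulc H i a b)"
  define Y1 where "Y1 = (\<lambda>(a, b, c)\<in>I3. F (a, b) * unitc H c)"
  define X2 where "X2 = (\<lambda>(a, b, c)\<in>I3. \<Sum>i\<in>Idx. F (a, i) * comulc H i b c)"
  define Y2 where "Y2 = (\<lambda>(a, b, c)\<in>I3. unitc H a * F (b, c))"
  have idx3: "idx ?T = I3" by (simp add: I3_def dual_simps)
  have "X1 \<otimes>\<^bsub>elems ?T\<^esub> Y1 = X2 \<otimes>\<^bsub>elems ?T\<^esub> Y2"
    using tw unfolding hopf_twist_def Let_def X1_def X2_def Y1_def Y2_def I3_def dual_simps(1) by blast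
  from fun_cong[OF this[unfolded elems_mult idx3], of "(a, b, c)"]
  have e: "mulf ?T X1 Y1 (a, b, c) = mulf ?T X2 Y2 (a, b, c)" using abc by (simp add: I3_def)
  have un: "unitc H k = eps k" if "k \<in> Idx" for k using that fun_cong[OF dual_simps(3), of k] by (simp add: zext_def)
  have x1: "X1 (i, k, x) = pr (\<lambda>y. \<Phi> (y, x)) (i, k)" if "i \<in> Idx" "k \<in> Idx" "x \<in> Idx" for i k x
    using that by (simp add: X1_def I3_def pr_sum dual_simps \<Phi>_def zext_def)
  have x2: "X2 (i, k, x) = pr (\<lambda>y. \<Phi> (i, y)) (k, x)" if "i \<in> Idx" "k \<in> Idx" "x \<in> Idx" for i k x
    using that by (simp add: X2_def I3_def pr_sum dual_simps \<Phi>_def zext_def)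
  have "mulf ?T X1 Y1 (a, b, c) = cm B (\<lambda>(i, j). cm B (\<lambda>(k, l). star B (\<lambda>x. X1 (i, k, x)) (\<lambda>x. Y1 (j, l, x)) c) b) a"
    by (rule mulf_H3[OF abc])
  also have "\<dots> = cm B (\<lambda>(i, j). cm B (\<lambda>(k, l). pr (\<lambda>x. \<Phi> (x, c)) (i, k) * \<Phi> (j, l)) b) a"
  proof (rule cm_cong_at, unfold prod.case, rule cm_cong_at, unfold prod.case)
    fix i j k l assume m: "i \<in> Idx" "j \<in> Idx" "k \<in> Idx" "l \<in> Idx"
    have "star B (\<lambda>x. X1 (i, k, x)) (\<lambda>x. Y1 (j, l, x)) = star B (zext Idx (\<lambda>x. X1 (i, k, x))) (scl (\<Phi> (j, l)) eps)"
      by (rule star_cong) (use m in \<open>simp_all add: Y1_def I3_def un scl_apply \<Phi>_def zext_def\<close>)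
    also have "\<dots> = scl (\<Phi> (j, l)) (zext Idx (\<lambda>x. X1 (i, k, x)))" by (simp add: star_lin star_eps_right[OF B])
    finally show "star B (\<lambda>x. X1 (i, k, x)) (\<lambda>x. Y1 (j, l, x)) c = pr (\<lambda>x. \<Phi> (x, c)) (i, k) * \<Phi> (j, l)"
      using m abc by (simp add: scl_apply x1 zext_def)
  qed
  finally have L: "mulf ?T X1 Y1 (a, b, c) = cm B (\<lambda>(i, j). cm B (\<lambda>(k, l). pr (\<lambda>x. \<Phi> (x, c)) (i, k) * \<Phi> (j, l)) b) a" .
  define W where "W i = cm B (\<lambda>(k, l). cm B (\<lambda>(x, y). pr (\<lambda>z. \<Phi> (i, z)) (k, x) * \<Phi> (l, y)) c) b" for i
  have "mulf ?T X2 Y2 (a, b, c) = cm B (\<lambda>(i, j). cm B (\<lambda>(k, l). star B (\<lambda>x. X2 (i, k, x)) (\<lambda>x. Y2 (j, l, x)) c) b) a"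
    by (rule mulf_H3[OF abc])
  also have "\<dots> = cm B (tens W eps) a"
  proof (rule cm_cong_at, unfold prod.case)
    fix i j assume m: "i \<in> Idx" "j \<in> Idx"
    have "cm B (\<lambda>(k, l). star B (\<lambda>x. X2 (i, k, x)) (\<lambda>x. Y2 (j, l, x)) c) =
      cm B (scl (eps j) (\<lambda>(k, l). cm B (\<lambda>(x, y). pr (\<lambda>z. \<Phi> (i, z)) (k, x) * \<Phi> (l, y)) c))"
    proof (rule cm_cong, unfold scl_apply prod.case)
      fix k l assume m': "k \<in> Idx" "l \<in> Idx"
      have "star B (\<lambda>x. X2 (i, k, x)) (\<lambda>x. Y2 (j, l, x)) = star B (\<lambda>x. pr (\<lambda>z. \<Phi> (i, z)) (k, x)) (scl (eps j) (\<lambda>x. \<Phi> (l, x)))"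
        by (rule star_cong) (use m m' in \<open>simp_all add: Y2_def I3_def un scl_apply \<Phi>_def zext_def x2\<close>)
      then show "star B (\<lambda>x. X2 (i, k, x)) (\<lambda>x. Y2 (j, l, x)) c = eps j * cm B (\<lambda>(x, y). pr (\<lambda>z. \<Phi> (i, z)) (k, x) * \<Phi> (l, y)) c"
        by (simp add: star_lin scl_apply) (simp add: star_def tens_def)
    qed
    then show "cm B (\<lambda>(k, l). star B (\<lambda>x. X2 (i, k, x)) (\<lambda>x. Y2 (j, l, x)) c) b = tens W eps (i, j)"
      by (simp add: linop_scl[OF fdep_linop[OF fdep_cm]] scl_apply tens_def W_def mult.commute)
  qed
  also have "\<dots> = W a"
  proof -
    have "cm B (tens W eps) = star B (zext Idx W) eps"
      unfolding star_def by (rule cm_cong) (simp add: tens_def zext_def)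
    also have "\<dots> = zext Idx W" by (rule star_eps_right[OF B supp_zext])
    finally show ?thesis using abc by (simp add: zext_def)
  qed
  finally show ?thesis using e L by (simp add: W_def)
qed

lemma Idx_eqI: "supp_on Idx a ==> supp_on Idx b ==> (\<And>z. z \<in> Idx ==> a z = b z) ==> a = b"
  unfolding supp_on_def by (rule ext) metis

lemma pr_special: "pr a (cu, cu) = a c1" "r < n ==> pr a (cr r, cu) = - a (u, {r})" "r < n ==> pr a (cu, cr r) = a (u, {r})"
  using pr_cu(1)[OF special_Idx(2), of a] pr_cr(1)[OF _ special_Idx(2), of r a] pr_cu(1)[OF special_Idx(3), of r a]
  by (simp_all add: taul_apply cu_def Dl_sing cr_def c1_def)

text \<open>At the unit of the group \<open>Dl\<close> and \<open>Dr\<close> agree, so this is the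
  anticommutation of \<open>Dr\<close>. It removes the values of slices at pairs of vectors from the
  symmetrised twist equation.\<close>

lemma pr_anti: "r < n ==> q < n ==> pr a (cr r, cr q) = - pr a (cr q, cr r)"
proof -
  have "pr a (cr r, cr q) = Dr r (Dr q a) (\<one>, {})" if "r < n" "q < n" for r q
  proof -
    have "pr a (cr r, cr q) = Dr q (Dl r a) (\<one>, {})" using pr_cr(1)[OF that(1) special_Idx(3)[OF that(2)], of a] by (simp add: cr_def Dr_sing)
    then show ?thesis using that by (simp add: Dl_Dr[symmetric] Dl_sing Dr_sing)
  qed
  then show "r < n ==> q < n ==> pr a (cr r, cr q) = - pr a (cr q, cr r)"
    using Dr_anti[of r q a] by (simp add: uminus_apply)
qed

context
  fixes \<Phi> :: "('a \<times> nat set) \<times> ('a \<times> nat set) => complex"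
  assumes supp: "supp_on I2 \<Phi>"
    and TW_ball: "\<forall>a\<in>Idx. \<forall>b\<in>Idx. \<forall>c\<in>Idx.
    cm B (\<lambda>(i, j). cm B (\<lambda>(k, l). pr (\<lambda>x. \<Phi> (x, c)) (i, k) * \<Phi> (j, l)) b) a =
    cm B (\<lambda>(k, l). cm B (\<lambda>(x, y). pr (\<lambda>z. \<Phi> (a, z)) (k, x) * \<Phi> (l, y)) c) b"
begin

abbreviation (input) "fl x \<equiv> (\<lambda>y. \<Phi> (x, y))"
abbreviation (input) "fr y \<equiv> (\<lambda>x. \<Phi> (x, y))"

lemmas TW = TW_ball[rule_format]

lemma supp_slices: "supp_on Idx (fl x)" "supp_on Idx (fr y)"
  using supp unfolding supp_on_def by blast+

lemma cL: "cm B (\<lambda>(p, q). pr a (cu, p) * \<Phi> (x, q)) = star B (taul a) (fl x)"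
  "cm B (\<lambda>(p, q). pr a (c1, p) * \<Phi> (x, q)) = star B a (fl x)"
  "r < n ==> supp_on Idx a ==> cm B (\<lambda>(p, q). pr a (cr r, p) * eps q) = Dl r a"
  "cm B (\<lambda>(p, q). pr a (p, cu) * \<Phi> (q, x)) = star B (taur a) (fr x)"
  "cm B (\<lambda>(p, q). pr a (p, c1) * \<Phi> (q, x)) = star B a (fr x)"
  "r < n ==> supp_on Idx a ==> cm B (\<lambda>(p, q). pr a (p, cr r) * eps q) = Dr r a"
proof -
  show "cm B (\<lambda>(p, q). pr a (cu, p) * \<Phi> (x, q)) = star B (taul a) (fl x)"
    "cm B (\<lambda>(p, q). pr a (c1, p) * \<Phi> (x, q)) = star B a (fl x)"
    "cm B (\<lambda>(p, q). pr a (p, cu) * \<Phi> (q, x)) = star B (taur a) (fr x)"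
    "cm B (\<lambda>(p, q). pr a (p, c1) * \<Phi> (q, x)) = star B a (fr x)"
    unfolding star_def by (rule cm_cong, simp add: tens_def pr_cu pr_c1)+
  assume r: "r < n" and a: "supp_on Idx a"
  have "cm B (\<lambda>(p, q). pr a (cr r, p) * eps q) = star B (Dl r a) eps" "cm B (\<lambda>(p, q). pr a (p, cr r) * eps q) = star B (Dr r a) eps"
    unfolding star_def using r by (rule_tac cm_cong, simp add: tens_def pr_cr)+
  then show "cm B (\<lambda>(p, q). pr a (cr r, p) * eps q) = Dl r a" "cm B (\<lambda>(p, q). pr a (p, cr r) * eps q) = Dr r a"
    using a by (simp_all add: star_eps_right[OF B] supp_Dl supp_Dr)
qed

lemma eps_special: "eps c1 = 1" "eps cu = 1" "eps (cr r) = 0"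
  by (simp_all add: eps_def c1_def cu_def cr_def)

lemma cm_plus: "cm B (\<lambda>(i, j). v i j + w i j) = cm B (\<lambda>(i, j). v i j) + cm B (\<lambda>(i, j). w i j)"
  unfolding linop_add[OF fdep_linop[OF fdep_cm], symmetric] by (rule arg_cong[where f="cm B"]) (simp add: fun_eq_iff plus_fun_apply)

lemma op_special: "taul a c1 = a cu" "taul a cu = a c1" "taul a (cr r) = a (u, {r})" "taur a c1 = a cu" "taur a cu = a c1" "taur a (cr r) = - a (u, {r})"
  "Dr r a c1 = a (cr r)" "Dr r a cu = a (u, {r})" "r < n ==> Dl r a c1 = a (cr r)" "r < n ==> Dl r a cu = - a (u, {r})"
  by (simp_all add: taul_apply taur_apply c1_def cu_def cr_def Dr_sing Dl_sing)

lemma op_special2: "r < n ==> q < n ==> Dr q a (cr r) = pr a (cr r, cr q)" "r < n ==> q < n ==> Dl q a (cr r) = pr a (cr q, cr r)"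
  by (simp add: pr_cr(2), simp add: pr_cr(1))

text \<open>The slice is idempotent up to a scalar; invertibility will force it to be a multiple of
  \<open>eps\<close>, which allows the twist to be normalised.\<close>

lemma slices_one:
  "star B (fl c1) (fl c1) = scl (\<Phi> (c1, c1)) (fl c1)" "star B (fr c1) (fr c1) = scl (\<Phi> (c1, c1)) (fr c1)"
proof (rule_tac [!] Idx_eqI)
  fix z assume z: "z \<in> Idx"
  show "star B (fl c1) (fl c1) z = scl (\<Phi> (c1, c1)) (fl c1) z"
    using TW[OF special_Idx(1,1) z] by (simp add: cm_special star_special pr_c1 cL scl_apply; simp add: mult.commute)
  show "star B (fr c1) (fr c1) z = scl (\<Phi> (c1, c1)) (fr c1) z"
    using TW[OF z special_Idx(1,1)] by (simp add: cm_special star_special pr_c1 cL scl_apply; simp add: mult.commute)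
qed (auto intro: supp_on_scl supp_slices)

context
  assumes n1: "\<And>y. \<Phi> (c1, y) = eps y" and n2: "\<And>x. \<Phi> (x, c1) = eps x"
begin

lemmas ev = cm_special cm_plus star_special op_special op_special2 pr_special cL scl_apply plus_fun_apply n1 n2 supp_slices eps_special
lemmas si = supp_on_scl supp_on_add supp_slices supp_star supp_Dl supp_Dr supp_eps

text \<open>For two different special indices the twist equation still contains a value of
  \<open>pr\<close>. It changes sign when the indices are exchanged, so the sum of the two equations
  is free of it.\<close>

lemma T_relations:
  "star B (taul (fl cu)) (fl cu) = scl (\<Phi> (cu, cu)) eps"
  "r < n ==> Dl r (fl cu) + star B (taul (fl cu)) (fl (cr r)) + star B (taul (fl (cr r))) (fl cu) = scl (\<Phi> (cr r, cu) + \<Phi> (cu, cr r)) eps"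
  "r < n ==> q < n ==> Dl q (fl (cr r)) + star B (taul (fl (cr r))) (fl (cr q)) + (Dl r (fl (cr q)) + star B (taul (fl (cr q))) (fl (cr r))) =
    scl (\<Phi> (cr r, cr q) + \<Phi> (cr q, cr r)) eps"
proof -
  show "star B (taul (fl cu)) (fl cu) = scl (\<Phi> (cu, cu)) eps"
  proof (rule Idx_eqI)
    fix z assume z: "z \<in> Idx"
    show "star B (taul (fl cu)) (fl cu) z = scl (\<Phi> (cu, cu)) eps z"
      using TW[OF special_Idx(2,2) z] by (simp add: ev; simp add: algebra_simps)
  qed (intro si)+
  assume r: "r < n"
  show "Dl r (fl cu) + star B (taul (fl cu)) (fl (cr r)) + star B (taul (fl (cr r))) (fl cu) = scl (\<Phi> (cr r, cu) + \<Phi> (cu, cr r)) eps"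
  proof (rule Idx_eqI)
    fix z assume z: "z \<in> Idx"
    show "(Dl r (fl cu) + star B (taul (fl cu)) (fl (cr r)) + star B (taul (fl (cr r))) (fl cu)) z = scl (\<Phi> (cr r, cu) + \<Phi> (cu, cr r)) eps z"
      using TW[OF special_Idx(3)[OF r] special_Idx(2) z] TW[OF special_Idx(2) special_Idx(3)[OF r] z] r
      by (simp add: ev; simp add: algebra_simps)
  qed (intro si)+
  assume q: "q < n"
  show "Dl q (fl (cr r)) + star B (taul (fl (cr r))) (fl (cr q)) + (Dl r (fl (cr q)) + star B (taul (fl (cr q))) (fl (cr r))) =
    scl (\<Phi> (cr r, cr q) + \<Phi> (cr q, cr r)) eps"
  proof (rule Idx_eqI)
    fix z assume z: "z \<in> Idx"
    show "(Dl q (fl (cr r)) + star B (taul (fl (cr r))) (fl (cr q)) + (Dl r (fl (cr q)) + star B (taul (fl (cr q))) (fl (cr r)))) z =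
      scl (\<Phi> (cr r, cr q) + \<Phi> (cr q, cr r)) eps z"
      using TW[OF special_Idx(3)[OF r] special_Idx(3)[OF q] z] TW[OF special_Idx(3)[OF q] special_Idx(3)[OF r] z] r q
        pr_anti[OF r q, of "fr z"]
      by (simp add: ev; simp add: algebra_simps)
  qed (intro si)+
qed

lemma R_relations:
  "star B (taur (fr cu)) (fr cu) = scl (\<Phi> (cu, cu)) eps"
  "r < n ==> Dr r (fr cu) + star B (taur (fr cu)) (fr (cr r)) + star B (taur (fr (cr r))) (fr cu) = scl (\<Phi> (cr r, cu) + \<Phi> (cu, cr r)) eps"
  "r < n ==> q < n ==> Dr q (fr (cr r)) + star B (taur (fr (cr r))) (fr (cr q)) + (Dr r (fr (cr q)) + star B (taur (fr (cr q))) (fr (cr r))) =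
    scl (\<Phi> (cr r, cr q) + \<Phi> (cr q, cr r)) eps"
proof -
  show "star B (taur (fr cu)) (fr cu) = scl (\<Phi> (cu, cu)) eps"
  proof (rule Idx_eqI)
    fix z assume z: "z \<in> Idx"
    show "star B (taur (fr cu)) (fr cu) z = scl (\<Phi> (cu, cu)) eps z"
      using TW[OF z special_Idx(2,2)] by (simp add: ev; simp add: algebra_simps)
  qed (intro si)+
  assume r: "r < n"
  show "Dr r (fr cu) + star B (taur (fr cu)) (fr (cr r)) + star B (taur (fr (cr r))) (fr cu) = scl (\<Phi> (cr r, cu) + \<Phi> (cu, cr r)) eps"
  proof (rule Idx_eqI)
    fix z assume z: "z \<in> Idx"
    show "(Dr r (fr cu) + star B (taur (fr cu)) (fr (cr r)) + star B (taur (fr (cr r))) (fr cu)) z = scl (\<Phi> (cr r, cu) + \<Phi> (cu, cr r)) eps z"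
      using TW[OF z special_Idx(3)[OF r] special_Idx(2)] TW[OF z special_Idx(2) special_Idx(3)[OF r]] r
      by (simp add: ev; simp add: algebra_simps)
  qed (intro si)+
  assume q: "q < n"
  show "Dr q (fr (cr r)) + star B (taur (fr (cr r))) (fr (cr q)) + (Dr r (fr (cr q)) + star B (taur (fr (cr q))) (fr (cr r))) =
    scl (\<Phi> (cr r, cr q) + \<Phi> (cr q, cr r)) eps"
  proof (rule Idx_eqI)
    fix z assume z: "z \<in> Idx"
    show "(Dr q (fr (cr r)) + star B (taur (fr (cr r))) (fr (cr q)) + (Dr r (fr (cr q)) + star B (taur (fr (cr q))) (fr (cr r)))) z =
      scl (\<Phi> (cr r, cr q) + \<Phi> (cr q, cr r)) eps z"
      using TW[OF z special_Idx(3)[OF r] special_Idx(3)[OF q]] TW[OF z special_Idx(3)[OF q] special_Idx(3)[OF r]] r q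
        pr_anti[OF r q, of "fl z"]
      by (simp add: ev; simp add: algebra_simps)
  qed (intro si)+
qed

lemma M_relations:
  "star B (taul (fr cu)) (fl cu) = star B (taur (fl cu)) (fr cu)"
  "r < n ==> Dl r (fr cu) + star B (taul (fr cu)) (fl (cr r)) = star B (taur (fl (cr r))) (fr cu)"
  "r < n ==> star B (taul (fr (cr r))) (fl cu) = Dr r (fl cu) + star B (taur (fl cu)) (fr (cr r))"
  "r < n ==> q < n ==> Dl q (fr (cr r)) + star B (taul (fr (cr r))) (fl (cr q)) = Dr r (fl (cr q)) + star B (taur (fl (cr q))) (fr (cr r))"
proof -
  show "star B (taul (fr cu)) (fl cu) = star B (taur (fl cu)) (fr cu)"
  proof (rule Idx_eqI)
    fix z assume z: "z \<in> Idx"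
    show "star B (taul (fr cu)) (fl cu) z = star B (taur (fl cu)) (fr cu) z"
      using TW[OF special_Idx(2) z special_Idx(2)] by (simp add: ev; simp add: algebra_simps)
  qed (intro si)+
  assume r: "r < n"
  show "Dl r (fr cu) + star B (taul (fr cu)) (fl (cr r)) = star B (taur (fl (cr r))) (fr cu)"
  proof (rule Idx_eqI)
    fix z assume z: "z \<in> Idx"
    show "(Dl r (fr cu) + star B (taul (fr cu)) (fl (cr r))) z = star B (taur (fl (cr r))) (fr cu) z"
      using TW[OF special_Idx(3)[OF r] z special_Idx(2)] r by (simp add: ev; simp add: algebra_simps)
  qed (intro si)+
  show "star B (taul (fr (cr r))) (fl cu) = Dr r (fl cu) + star B (taur (fl cu)) (fr (cr r))"
  proof (rule Idx_eqI)
    fix z assume z: "z \<in> Idx"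
    show "star B (taul (fr (cr r))) (fl cu) z = (Dr r (fl cu) + star B (taur (fl cu)) (fr (cr r))) z"
      using TW[OF special_Idx(2) z special_Idx(3)[OF r]] r by (simp add: ev; simp add: algebra_simps)
  qed (intro si)+
  assume q: "q < n"
  show "Dl q (fr (cr r)) + star B (taul (fr (cr r))) (fl (cr q)) = Dr r (fl (cr q)) + star B (taur (fl (cr q))) (fr (cr r))"
  proof (rule Idx_eqI)
    fix z assume z: "z \<in> Idx"
    show "(Dl q (fr (cr r)) + star B (taul (fr (cr r))) (fl (cr q))) z = (Dr r (fl (cr q)) + star B (taur (fl (cr q))) (fr (cr r))) z"
      using TW[OF special_Idx(3)[OF q] z special_Idx(3)[OF r]] r q by (simp add: ev; simp add: algebra_simps)
  qed (intro si)+
qed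

end

end

end

end

section \<open>Twist data from a twist equivalence\<close>

context grepu
begin

lemma dual0: "idx (dual_hopf (HA B)) = Idx" "mulc (dual_hopf (HA B)) i j k = comulc (HA B) k i j"
  "zext Idx (unitc (dual_hopf (HA B))) = eps" "comulc (dual_hopf (HA B)) i j k = mulc AA j k i" "counitc (dual_hopf (HA B)) = unitc AA"
  by (auto simp: dual_hopf_def hopf_A_simps zext_def eps_def group_ext_alg_def Idx_def fun_eq_iff)

lemma Idx_eqI0: "supp_on Idx a ==> supp_on Idx b ==> (\<And>z. z \<in> Idx ==> a z = b z) ==> a = b"
  unfolding supp_on_def by (rule ext) metis

lemma sum_sng: "p \<in> Idx ==> (\<Sum>i\<in>Idx. x i * sng p i) = x p"
proof -
  assume p: "p \<in> Idx"
  have "(\<Sum>i\<in>Idx. x i * sng p i) = (\<Sum>i\<in>Idx. if i = p then x p else 0)"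
    by (intro sum.cong refl) (auto simp: sng_def)
  then show ?thesis using p by simp
qed

lemma unitc_AA: "i \<in> Idx ==> unitc AA i = sng c1 i"
  using fun_cong[OF unit_AA, of i] by (simp add: zext_def gam_def c1_def)

text \<open>On the block of \<open>1\<close>, basis functions with nonempty \<open>S\<close> have a
  factor \<open>xi\<close>. This determines characters and skew derivations there from their values
  on few elements.\<close>

lemma xi_sng:
  assumes B: "B \<in> carrier_mat n n" and S: "p \<in> S" "S \<subseteq> {..<n}" and k: "k = \<one> \<or> k = u"
  shows "\<exists>c. sng (k, S) = scl c (star B (xi \<one> p) (sng (k, S - {p})))"
proof -
  have p: "p < n" and f: "finite S" using S by (auto intro: finite_subset)
  have kG: "k \<in> carrier G" using k by auto
  let ?b = "sng (k, S - {p})"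
  have sb: "supp_on Idx ?b" using S kG by (intro supp_on_sng) (auto simp: Idx_def)
  obtain c where c: "c \<in> {1, -1}" "star B (xi \<one> p) ?b (k, S) = c"
    using xi_one_formula[OF B p k f S(2)] sb S(1) by (auto simp: sng_def)
  have bl: "star B (xi \<one> p) ?b = blk \<one> (star B (xi \<one> p) ?b)"
  proof -
    have "star B (eb \<one>) (star B (xi \<one> p) ?b) = star B (blk \<one> (xi \<one> p)) ?b"
      by (simp add: star_assoc[OF B, symmetric] star_eb_left[OF one_closed B] supp_blocks(3)[OF one_closed p])
    moreover have "blk \<one> (xi \<one> p) = xi \<one> p" by (auto simp: blk_def xi_def fun_eq_iff)
    ultimately show ?thesis by (simp add: star_eb_left[OF one_closed B])
  qed
  have "star B (xi \<one> p) ?b x = c * sng (k, S) x" for x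
  proof -
    obtain l T where x: "x = (l, T)" by force
    show ?thesis
    proof (cases "x \<in> Idx \<and> (l = \<one> \<or> l = u) \<and> x ~= (k, S)")
      case True
      then have T: "T \<subseteq> {..<n}" "finite T" by (auto simp: x Idx_def intro: finite_subset)
      have "\<not> (p \<in> T \<and> l = k \<and> T - {p} = S - {p})" using True S(1) x by blast
      moreover obtain d where "star B (xi \<one> p) ?b (l, T) = (if p \<in> T then d * ?b (l, T - {p}) else 0)"
        using xi_one_formula[OF B p _ T(2,1), of l] True sb by blast
      ultimately show ?thesis using True by (auto simp: x sng_def)
    next
      case False
      consider "x = (k, S)" | "x ~= (k, S)" "x \<notin> Idx" | "x ~= (k, S)" "l ~= \<one>" "l ~= u" using False by blast
      then show ?thesis
      proof cases
        case 1
        then show ?thesis using c(2) by (simp add: sng_def)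
      next
        case 2
        then have "star B (xi \<one> p) ?b x = 0" using supp_star[of B "xi \<one> p" ?b] unfolding supp_on_def by blast
        then show ?thesis using 2 by (simp add: sng_def)
      next
        case 3
        have "blk \<one> (star B (xi \<one> p) ?b) x = 0" using 3 by (simp add: blk_def x)
        then show ?thesis using 3 bl by (simp add: sng_def)
      qed
    qed
  qed
  then have "star B (xi \<one> p) ?b = scl c (sng (k, S))" by (auto simp: scl_apply fun_eq_iff)
  moreover have "c * c = 1" using c(1) by auto
  ultimately have "sng (k, S) = scl c (star B (xi \<one> p) ?b)" by simp
  then show ?thesis by blast
qed

lemma eb_one: "eb \<one> = sng c1 + sng cu" and om_one: "om \<one> = sng c1 - sng cu"
  by (auto simp: eb_def om_def sng_def c1_def cu_def fun_eq_iff plus_fun_apply minus_apply)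

text \<open>The last condition is compatibility with counits: the counit of the dual is evaluation
  at the unit index \<open>c1\<close>.\<close>

definition algebra_iso :: "complex mat => complex mat => (('a \<times> nat set => complex) => ('a \<times> nat set => complex)) => bool" where
  "algebra_iso B' B f \<longleftrightarrow> linop f \<and> (\<forall>a. supp_on Idx (f a)) \<and> (\<forall>x y. f (star B' x y) = star B (f x) (f y)) \<and>
    (\<forall>x. supp_on Idx x --> f x = 0 --> x = 0) \<and> (\<forall>x. supp_on Idx x --> (\<exists>y. supp_on Idx y \<and> f y = x)) \<and>
    f eps = eps \<and> (\<forall>a. f a c1 = a c1)"

context
  fixes B B' :: "complex mat" and f
  assumes B: "B \<in> carrier_mat n n" and B': "B' \<in> carrier_mat n n" and f: "algebra_iso B' B f" and n0: "0 < n"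
begin

lemma f_props: "linop f" "supp_on Idx (f a)" "f (star B' x y) = star B (f x) (f y)"
  "supp_on Idx x ==> f x = 0 ==> x = 0" "supp_on Idx x ==> \<exists>y. supp_on Idx y \<and> f y = x" "f eps = eps" "f a c1 = a c1"
  using f unfolding algebra_iso_def by blast+

lemma f_expand: "supp_on Idx h ==> f h x = (\<Sum>j\<in>Idx. h j * f (sng j) x)"
proof -
  assume h: "supp_on Idx h"
  have "f h = f (\<Sum>j\<in>Idx. scl (h j) (sng j))" using supp_expand[OF finite_Idx h] by (rule arg_cong)
  then show ?thesis by (simp add: linop_sum[OF f_props(1)] linop_scl[OF f_props(1)] sum_apply scl_apply)
qed

lemma chi_mult: "f (star B' x y) cu = f x cu * f y cu"
  by (simp add: f_props(3) star_special[OF B])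

lemma delta_mult: "r < n ==> f (star B' x y) (cr r) = f x (cr r) * y c1 + f x cu * f y (cr r)"
  by (simp add: f_props(3,7) star_special[OF B])

lemma om_one_c1: "om \<one> c1 = 1" "eb \<one> c1 = 1"
  by (simp_all add: om_def eb_def c1_def)

text \<open>\<open>f (eb \<one>)\<close> is central because \<open>eb \<one>\<close> is. Applying
  \<open>Dr 0\<close> to its commutator with \<open>xi \<one> 0\<close> and evaluating at
  \<open>c1\<close> compares its values at \<open>cu\<close> and \<open>c1\<close>, and the latter
  is known.\<close>

lemma chi_eb: "f (eb \<one>) cu = 1"
proof -
  let ?c = "f (eb \<one>)"
  have sx: "supp_on Idx (xi \<one> 0)" by (rule supp_blocks(3)[OF one_closed n0])
  obtain y where y: "supp_on Idx y" "f y = xi \<one> 0" using f_props(5)[OF sx] by blast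
  have "star B ?c (xi \<one> 0) = star B (xi \<one> 0) ?c"
    by (simp add: y(2)[symmetric] f_props(3)[symmetric] star_eb_left[OF one_closed B'] star_eb_right[OF one_closed B'] y(1))
  then have "Dr 0 (star B ?c (xi \<one> 0)) c1 = Dr 0 (star B (xi \<one> 0) ?c) c1" by simp
  moreover have "xi \<one> 0 c1 = 0" by (simp add: xi_def c1_def)
  moreover have "taur ?c c1 = ?c cu" by (simp add: taur_apply c1_def cu_def)
  ultimately have "?c cu = ?c c1"
    by (simp add: Dr_star[OF B n0] Dr_block[OF one_closed] taur_block[OF one_closed] plus_fun_apply star_special[OF B] om_one_c1)
  then show ?thesis by (simp add: f_props(7) om_one_c1)
qed

lemma chi_om: "f (om \<one>) cu * f (om \<one>) cu = 1"
  using chi_mult[of "om \<one>" "om \<one>"] by (simp add: om_om[OF one_closed B'] chi_eb)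

lemma chi_xi: "p < n ==> f (xi \<one> p) cu = 0"
proof -
  assume p: "p < n"
  have "f (star B' (xi \<one> p) (om \<one>)) cu = - f (star B' (om \<one>) (xi \<one> p)) cu"
    by (simp add: xi_om[OF one_closed B' p] linop_minus[OF f_props(1)] uminus_apply)
  moreover have "f (om \<one>) cu ~= 0" using chi_om by auto
  ultimately show ?thesis by (simp add: chi_mult)
qed

lemma delta_eb: "r < n ==> f (eb \<one>) (cr r) = 0"
proof -
  assume r: "r < n"
  have "star B' (eb \<one>) (eb \<one>) = eb \<one>"
    by (simp add: star_eb_left[OF one_closed B'] supp_blocks[OF one_closed]) (auto simp: blk_def eb_def fun_eq_iff)
  then show ?thesis using delta_mult[OF r, of "eb \<one>" "eb \<one>"] by (simp add: om_one_c1 chi_eb)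
qed

text \<open>Multiplication by \<open>eb \<one>\<close> shows that both functionals ignore the other
  blocks. Within the block a factor \<open>xi\<close> can be split off, and the character kills it
  since \<open>xi\<close> anticommutes with \<open>om\<close>, whose value is nonzero.\<close>

lemma sng_values:
  assumes i: "i \<in> Idx" "i ~= c1" "i ~= cu"
  shows "f (sng i) cu = 0" "r < n ==> (\<And>q. q < n ==> i ~= cr q) ==> f (sng i) (cr r) = 0"
proof -
  obtain k S where e: "i = (k, S)" "k \<in> carrier G" "S \<subseteq> {..<n}" using i by (auto simp: Idx_def)
  have bl: "f (blk \<one> (sng i)) cu = f (sng i) cu" "r < n ==> f (blk \<one> (sng i)) (cr r) = f (sng i) (cr r)"
    using chi_mult[of "eb \<one>" "sng i"] delta_mult[of r "eb \<one>" "sng i"]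
    by (simp_all add: star_eb_left[OF one_closed B'] supp_on_sng i(1) chi_eb delta_eb)
  show "f (sng i) cu = 0" "r < n ==> (\<And>q. q < n ==> i ~= cr q) ==> f (sng i) (cr r) = 0"
  proof -
    show "f (sng i) cu = 0"
    proof (cases "k = \<one> \<or> k = u")
      case False
      then have "blk \<one> (sng i) = 0" by (auto simp: blk_def sng_def e fun_eq_iff zero_fun_apply)
      then show ?thesis using bl by (simp add: linop_0[OF f_props(1)] zero_fun_apply)
    next
      case True
      then have "S ~= {}" using i(2,3) by (auto simp: e c1_def cu_def)
      then obtain p where p: "p \<in> S" by blast
      then have "p < n" using e by auto
      then show ?thesis using xi_sng[OF B' p e(3) True]
        by (auto simp: e linop_scl[OF f_props(1)] scl_apply chi_mult chi_xi)
    qed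
    assume r: "r < n" and ne: "\<And>q. q < n ==> i ~= cr q"
    show "f (sng i) (cr r) = 0"
    proof (cases "k = \<one> \<or> k = u")
      case False
      then have "blk \<one> (sng i) = 0" by (auto simp: blk_def sng_def e fun_eq_iff zero_fun_apply)
      then show ?thesis using bl(2)[OF r] by (simp add: linop_0[OF f_props(1)] zero_fun_apply)
    next
      case True
      then have "S ~= {}" using i(2,3) by (auto simp: e c1_def cu_def)
      then obtain p where p: "p \<in> S" by blast
      then have pn: "p < n" using e by auto
      have "(k, S - {p}) ~= c1"
      proof
        assume "(k, S - {p}) = c1"
        then have "i = cr p" using p by (auto simp: e c1_def cr_def)
        then show False using ne[OF pn] by blast
      qed
      then have "sng (k, S - {p}) c1 = 0" by (simp add: sng_def)
      then show ?thesis using xi_sng[OF B' p e(3) True] pn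
        by (auto simp: e linop_scl[OF f_props(1)] scl_apply delta_mult[OF r] chi_xi)
    qed
  qed
qed

text \<open>The sum of the two values is \<open>1\<close> and their difference squares to
  \<open>1\<close>, so the character is evaluation at \<open>c1\<close> or at \<open>cu\<close>. In
  the first case all \<open>f a\<close> would agree at \<open>c1\<close> and \<open>cu\<close>,
  contrary to surjectivity.\<close>

lemma chi_c1_cu: "f (sng c1) cu = 0" "f (sng cu) cu = 1"
proof -
  let ?x = "f (sng c1) cu" and ?y = "f (sng cu) cu"
  have 1: "?x + ?y = 1" using chi_eb by (simp add: eb_one linop_add[OF f_props(1)] plus_fun_apply)
  have "(?x - ?y) * (?x - ?y) = 1" using chi_om by (simp add: om_one linop_diff[OF f_props(1)] minus_apply)
  moreover have "?x - ?y ~= 1"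
  proof
    assume "?x - ?y = 1"
    then have "?x + ?y + (?x - ?y) = 1 + 1" using 1 by simp
    then have x: "?x = 1" by simp
    then have y: "?y = 0" using 1 by simp
    obtain a where a: "supp_on Idx a" "f a = sng cu" using f_props(5)[OF supp_on_sng[OF special_Idx(2)]] by blast
    have "a j * f (sng j) cu = a j * sng c1 j" if "j \<in> Idx" for j
      using that x y sng_values(1)[OF that] by (cases "j = c1"; cases "j = cu") (auto simp: sng_def c1_def cu_def)
    then have "f a cu = (\<Sum>j\<in>Idx. a j * sng c1 j)" unfolding f_expand[OF a(1)] by (intro sum.cong refl)
    also have "\<dots> = f a c1" by (simp add: sum_sng f_props(7))
    finally show False unfolding a(2) using u_neq_one by (auto simp: sng_def c1_def cu_def)
  qed
  ultimately have "?x - ?y = - 1" using square_eq_1_iff by blast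
  then have "?x + ?y + (?x - ?y) = 0" using 1 by simp
  then show "?x = 0" by simp
  then show "?y = 1" using 1 by simp
qed

definition eta :: "nat => nat => complex" where "eta q r = f (sng (cr q)) (cr r)"
text \<open>Coefficient of the inner part \<open>a c1 - a cu\<close> of the skew derivation
  \<open>f a (cr r)\<close> in \<open>f_cr\<close>; it is later absorbed into the slices
  \<open>t\<close> and \<open>tr\<close>.\<close>

definition lam :: "nat => complex" where "lam r = f (sng c1) (cr r)"

lemma f_sng_cu: "i \<in> Idx ==> f (sng i) cu = sng cu i"
  using sng_values(1)[of i] chi_c1_cu by (cases "i = c1"; cases "i = cu") (auto simp: sng_def)

lemma f_sng_cr:
  assumes i: "i \<in> Idx" and r: "r < n"
  shows "f (sng i) (cr r) = (\<Sum>q<n. eta q r * sng (cr q) i) + lam r * (sng c1 i - sng cu i)"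
proof -
  have ne: "c1 ~= cu" "c1 ~= cr q" "cu ~= cr q" for q by (auto simp: c1_def cu_def cr_def)
  have cu: "f (sng cu) (cr r) = - lam r"
    using delta_eb[OF r] by (simp add: eb_one linop_add[OF f_props(1)] plus_fun_apply lam_def eq_neg_iff_add_eq_0 add.commute)
  consider "i = c1" | "i = cu" | q where "q < n" "i = cr q" | "i ~= c1" "i ~= cu" "\<And>q. q < n ==> i ~= cr q" by blast
  then show ?thesis
  proof cases
    case 1
    then show ?thesis using ne by (simp add: lam_def sng_def)
  next
    case 2
    then show ?thesis using ne ne(1)[symmetric] cu by (simp add: sng_def)
  next
    case 3
    have "(\<Sum>p<n. eta p r * sng (cr p) i) = (\<Sum>p<n. if p = q then eta q r else 0)"
      by (intro sum.cong refl) (auto simp: 3 sng_def cr_def)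
    then show ?thesis using 3 ne ne[symmetric] by (simp add: eta_def sng_def)
  next
    case 4
    have "(\<Sum>q<n. eta q r * sng (cr q) i) = 0" using 4 by (intro sum.neutral) (auto simp: sng_def)
    then show ?thesis using 4 sng_values(2)[OF i _ _ r] by (simp add: sng_def)
  qed
qed

lemma f_cr: "supp_on Idx a ==> r < n ==> f a (cr r) = (\<Sum>q<n. eta q r * a (cr q)) + lam r * (a c1 - a cu)"
proof -
  assume a: "supp_on Idx a" and r: "r < n"
  have "f a (cr r) = (\<Sum>j\<in>Idx. (\<Sum>q<n. eta q r * (a j * sng (cr q) j)) + lam r * (a j * sng c1 j - a j * sng cu j))"
    unfolding f_expand[OF a] by (intro sum.cong refl) (simp add: f_sng_cr r sum_distrib_left algebra_simps)
  also have "\<dots> = (\<Sum>q<n. \<Sum>j\<in>Idx. eta q r * (a j * sng (cr q) j)) + (\<Sum>j\<in>Idx. lam r * (a j * sng c1 j - a j * sng cu j))"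
    unfolding sum.distrib by (subst sum.swap) (rule refl)
  also have "\<dots> = (\<Sum>q<n. eta q r * a (cr q)) + lam r * (a c1 - a cu)"
    by (simp add: sum_distrib_left[symmetric] sum_subtractf sum_sng)
  finally show ?thesis .
qed

lemma f_cu: "supp_on Idx a ==> f a cu = a cu"
  by (simp add: f_expand f_sng_cu sum_sng)

text \<open>Choose \<open>a\<close> with \<open>f a\<close> concentrated at \<open>cr r0\<close>;
  its values at \<open>c1\<close> and \<open>cu\<close> vanish, so \<open>f_cr\<close> expresses the
  components of a kernel vector as zero.\<close>

lemma eta_inverse:
  "\<exists>\<eta>i. \<forall>p<n. \<forall>q<n. (\<Sum>r<n. eta p r * \<eta>i r q) = (if p = q then 1 else 0) \<and> (\<Sum>r<n. \<eta>i p r * eta r q) = (if p = q then 1 else 0)"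
proof -
  define M where "M = mat n n (\<lambda>(q, r). eta q r)"
  have M: "M \<in> carrier_mat n n" by (simp add: M_def)
  have "det M ~= 0"
  proof
    assume "det M = 0"
    then obtain v where v: "v \<in> carrier_vec n" "v ~= 0\<^sub>v n" "M *\<^sub>v v = 0\<^sub>v n"
      using det_0_iff_vec_prod_zero[OF M] by blast
    have z: "(\<Sum>r<n. eta q r * v $ r) = 0" if "q < n" for q
    proof -
      have "(M *\<^sub>v v) $ q = 0" using v(3) that by simp
      then show ?thesis using that v(1) by (simp add: M_def scalar_prod_def lessThan_atLeast0)
    qed
    have "v $ r0 = 0" if r0: "r0 < n" for r0
    proof -
      obtain a where a: "supp_on Idx a" "f a = sng (cr r0)" using f_props(5)[OF supp_on_sng[OF special_Idx(3)[OF r0]]] by blast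
      have c: "a c1 = 0" "a cu = 0" using f_props(7)[of a] f_cu[OF a(1)] by (auto simp: a(2) sng_def cr_def c1_def cu_def)
      have "v $ r0 = (\<Sum>r<n. if r = r0 then v $ r0 else 0)" using r0 by simp
      also have "\<dots> = (\<Sum>r<n. v $ r * f a (cr r))"
        by (intro sum.cong refl) (auto simp: a(2) sng_def cr_def)
      also have "\<dots> = (\<Sum>r<n. \<Sum>q<n. a (cr q) * (eta q r * v $ r))"
        by (intro sum.cong refl) (simp add: f_cr[OF a(1)] c sum_distrib_left mult_ac)
      also have "\<dots> = (\<Sum>q<n. a (cr q) * (\<Sum>r<n. eta q r * v $ r))"
        by (subst sum.swap) (simp add: sum_distrib_left)
      finally show ?thesis by (simp add: z)
    qed
    then have "v = 0\<^sub>v n" using v(1) by (intro eq_vecI) auto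
    then show False using v(2) by blast
  qed
  from det_non_zero_imp_unit[OF M this, of "()"] obtain N where N: "N \<in> carrier_mat n n" "N * M = 1\<^sub>m n" "M * N = 1\<^sub>m n"
    unfolding Units_def by (auto simp: ring_mat_def)
  have "(\<Sum>r<n. eta p r * N $$ (r, q)) = (if p = q then 1 else 0) \<and> (\<Sum>r<n. N $$ (p, r) * eta r q) = (if p = q then 1 else 0)"
    if pq: "p < n" "q < n" for p q
  proof -
    have "(M * N) $$ (p, q) = (if p = q then 1 else 0)" "(N * M) $$ (p, q) = (if p = q then 1 else 0)"
      using N(2,3) pq by simp_all
    then show ?thesis using pq N(1) by (simp add: M_def scalar_prod_def lessThan_atLeast0)
  qed
  then show ?thesis by (intro exI[of _ "\<lambda>r q. N $$ (r, q)"]) blast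
qed

text \<open>The operator \<open>f \<otimes> f\<close> applied to the coproduct of
  \<open>a\<close>.\<close>

definition TT :: "('a \<times> nat set => complex) => ('a \<times> nat set) \<times> ('a \<times> nat set) => complex" where
  "TT a = zext I2 (\<lambda>(k, l). \<Sum>i\<in>Idx. \<Sum>j\<in>Idx. pr a (i, j) * f (sng i) k * f (sng j) l)"

lemma TT_left:
  assumes k: "k \<in> Idx" and h: "supp_on Idx h" "\<And>j. j \<in> Idx ==> (\<Sum>i\<in>Idx. pr a (i, j) * f (sng i) k) = h j"
  shows "(\<lambda>x. TT a (k, x)) = f h"
proof (rule Idx_eqI0)
  fix z assume z: "z \<in> Idx"
  have "TT a (k, z) = (\<Sum>j\<in>Idx. (\<Sum>i\<in>Idx. pr a (i, j) * f (sng i) k) * f (sng j) z)"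
    using k z unfolding TT_def zext_def by (simp add: sum_distrib_right) (rule sum.swap)
  also have "\<dots> = f h z" unfolding f_expand[OF h(1)] by (intro sum.cong refl) (simp add: h(2))
  finally show "TT a (k, z) = f h z" .
qed (auto simp: supp_on_def TT_def zext_def f_props(2)[unfolded supp_on_def])

lemma TT_right:
  assumes k: "k \<in> Idx" and h: "supp_on Idx h" "\<And>i. i \<in> Idx ==> (\<Sum>j\<in>Idx. pr a (i, j) * f (sng j) k) = h i"
  shows "(\<lambda>x. TT a (x, k)) = f h"
proof (rule Idx_eqI0)
  fix z assume z: "z \<in> Idx"
  have "TT a (z, k) = (\<Sum>i\<in>Idx. (\<Sum>j\<in>Idx. pr a (i, j) * f (sng j) k) * f (sng i) z)"
    using k z unfolding TT_def zext_def by (simp add: sum_distrib_right sum_distrib_left mult_ac)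
  also have "\<dots> = f h z" unfolding f_expand[OF h(1)] by (intro sum.cong refl) (simp add: h(2))
  finally show "TT a (z, k) = f h z" .
qed (auto simp: supp_on_def TT_def zext_def f_props(2)[unfolded supp_on_def])

lemma sum_cr: "r < n ==> (\<Sum>i\<in>Idx. x i * f (sng i) (cr r)) = (\<Sum>q<n. eta q r * x (cr q)) + lam r * (x c1 - x cu)"
proof -
  assume r: "r < n"
  have "(\<Sum>i\<in>Idx. x i * f (sng i) (cr r)) = (\<Sum>i\<in>Idx. zext Idx x i * f (sng i) (cr r))"
    by (intro sum.cong refl) (simp add: zext_def)
  also have "\<dots> = f (zext Idx x) (cr r)" by (rule f_expand[symmetric]) simp
  finally show ?thesis using f_cr[OF supp_zext r, of x] by (simp add: zext_def)
qed

lemma f_sng_c1: "i \<in> Idx ==> f (sng i) c1 = sng c1 i"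
  by (auto simp: f_props(7) sng_def)

lemma TT_slices:
  assumes a: "supp_on Idx a"
  shows "(\<lambda>x. TT a (c1, x)) = f a" "(\<lambda>x. TT a (cu, x)) = f (taul a)"
    "r < n ==> (\<lambda>x. TT a (cr r, x)) = f ((\<Sum>q<n. scl (eta q r) (Dl q a)) + scl (lam r) (a - taul a))"
    "(\<lambda>x. TT a (x, c1)) = f a" "(\<lambda>x. TT a (x, cu)) = f (taur a)"
    "r < n ==> (\<lambda>x. TT a (x, cr r)) = f ((\<Sum>q<n. scl (eta q r) (Dr q a)) + scl (lam r) (a - taur a))"
proof -
  note si = supp_on_add supp_on_scl supp_on_diff supp_on_sum a supp_taul supp_taur supp_Dl supp_Dr
  show "(\<lambda>x. TT a (c1, x)) = f a" by (rule TT_left) (simp_all add: a f_sng_c1 sum_sng pr_c1)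
  show "(\<lambda>x. TT a (x, c1)) = f a" by (rule TT_right) (simp_all add: a f_sng_c1 sum_sng pr_c1)
  show "(\<lambda>x. TT a (cu, x)) = f (taul a)" by (rule TT_left) (simp_all add: a supp_taul f_sng_cu sum_sng pr_cu)
  show "(\<lambda>x. TT a (x, cu)) = f (taur a)" by (rule TT_right) (simp_all add: a supp_taur f_sng_cu sum_sng pr_cu)
  assume r: "r < n"
  show "(\<lambda>x. TT a (cr r, x)) = f ((\<Sum>q<n. scl (eta q r) (Dl q a)) + scl (lam r) (a - taul a))"
    by (rule TT_left) (use r in \<open>auto intro!: si simp: sum_cr pr_c1 pr_cu pr_cr plus_fun_apply scl_apply sum_apply minus_apply intro: sum.cong\<close>)
  show "(\<lambda>x. TT a (x, cr r)) = f ((\<Sum>q<n. scl (eta q r) (Dr q a)) + scl (lam r) (a - taur a))"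
    by (rule TT_right) (use r in \<open>auto intro!: si simp: sum_cr pr_c1 pr_cu pr_cr plus_fun_apply scl_apply sum_apply minus_apply intro: sum.cong\<close>)
qed

lemma D_slices:
  assumes a: "supp_on Idx a"
  shows "(\<lambda>x. zext I2 (pr a) (c1, x)) = a" "(\<lambda>x. zext I2 (pr a) (cu, x)) = taul a" "r < n ==> (\<lambda>x. zext I2 (pr a) (cr r, x)) = Dl r a"
    "(\<lambda>x. zext I2 (pr a) (x, c1)) = a" "(\<lambda>x. zext I2 (pr a) (x, cu)) = taur a" "r < n ==> (\<lambda>x. zext I2 (pr a) (x, cr r)) = Dr r a"
proof -
  have L: "(\<lambda>x. zext I2 (pr a) (k, x)) = h" if "k \<in> Idx" "supp_on Idx h" "\<And>z. z \<in> Idx ==> pr a (k, z) = h z" for k h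
    by (rule Idx_eqI0) (use that in \<open>simp_all add: supp_on_def zext_def\<close>)
  have R: "(\<lambda>x. zext I2 (pr a) (x, k)) = h" if "k \<in> Idx" "supp_on Idx h" "\<And>z. z \<in> Idx ==> pr a (z, k) = h z" for k h
    by (rule Idx_eqI0) (use that in \<open>simp_all add: supp_on_def zext_def\<close>)
  show "(\<lambda>x. zext I2 (pr a) (c1, x)) = a" by (rule L) (simp_all add: a pr_c1)
  show "(\<lambda>x. zext I2 (pr a) (cu, x)) = taul a" by (rule L) (simp_all add: a supp_taul pr_cu)
  show "(\<lambda>x. zext I2 (pr a) (x, c1)) = a" by (rule R) (simp_all add: a pr_c1)
  show "(\<lambda>x. zext I2 (pr a) (x, cu)) = taur a" by (rule R) (simp_all add: a supp_taur pr_cu)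
  show "r < n ==> (\<lambda>x. zext I2 (pr a) (cr r, x)) = Dl r a" by (rule L) (simp_all add: a supp_Dl pr_cr(1))
  show "r < n ==> (\<lambda>x. zext I2 (pr a) (x, cr r)) = Dr r a" by (rule R) (simp_all add: a supp_Dr pr_cr(2))
qed

end

lemma iso_extract:
  assumes iso: "hopf_iso (dual_hopf (HA B')) (twisted_hopf (dual_hopf (HA B)) F) f0"
  shows "algebra_iso B' B (\<lambda>a. zext Idx (f0 (restrict a Idx)))"
proof -
  let ?H = "dual_hopf (HA B)" and ?H' = "dual_hopf (HA B')" and ?T = "twisted_hopf (dual_hopf (HA B)) F"
  define f where "f a = zext Idx (f0 (restrict a Idx))" for a
  have iH: "idx ?H = Idx" "idx ?H' = Idx" "idx ?T = Idx" by (simp_all add: dual0(1) twisted_hopf_def Let_def)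
  have eT: "elems ?T = elems ?H" by (simp add: twisted_hopf_def elems_def Let_def)
  have car: "carrier (elems ?H') = Idx \<rightarrow>\<^sub>E UNIV" "carrier (elems ?H) = Idx \<rightarrow>\<^sub>E UNIV" by (simp_all add: elems_carrier iH)
  have rc: "restrict a Idx \<in> carrier (elems ?H')" "restrict a Idx \<in> carrier (elems ?H)" for a by (simp_all add: car)
  have i: "f0 \<in> hom (elems ?H') (elems ?H)" "bij_betw f0 (carrier (elems ?H')) (carrier (elems ?H))"
    and one: "f0 \<one>\<^bsub>elems ?H'\<^esub> = \<one>\<^bsub>elems ?H\<^esub>"
    and lin: "\<And>a b c. a \<in> carrier (elems ?H') ==> b \<in> carrier (elems ?H') ==>
      f0 (\<lambda>i\<in>Idx. a i + c * b i) = (\<lambda>j\<in>Idx. f0 a j + c * f0 b j)"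
    and cou: "\<And>a. a \<in> carrier (elems ?H') ==> counit ?T (f0 a) = counit ?H' a"
    using iso unfolding hopf_iso_def iso_def eT iH by blast+
  \<comment> \<open>Linearity is available as preservation of \<open>a + c b\<close>; with
    \<open>c = -1\<close> and both arguments zero it gives \<open>f0 0 = 0\<close>.\<close>
  have z0: "f0 (restrict (\<lambda>_. 0) Idx) = restrict (\<lambda>_. 0) Idx"
  proof -
    have "(\<lambda>i\<in>Idx. restrict (\<lambda>_. 0) Idx i + (-1) * restrict (\<lambda>_. 0) Idx i) = (restrict (\<lambda>_. 0) Idx :: 'a \<times> nat set => complex)" by auto
    then show ?thesis using lin[OF rc(1) rc(1), of "\<lambda>_. 0" "-1" "\<lambda>_. 0"] by (auto simp: fun_eq_iff)
  qed
  have "linop f"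
  proof (rule linopI)
    fix x y :: "'a \<times> nat set => complex" and c
    have e1: "(\<lambda>i\<in>Idx. restrict x Idx i + 1 * restrict y Idx i) = restrict (x + y) Idx" by (auto simp: plus_fun_apply)
    have "f0 (restrict (x + y) Idx) = (\<lambda>j\<in>Idx. f0 (restrict x Idx) j + 1 * f0 (restrict y Idx) j)"
      using lin[OF rc(1) rc(1), of x 1 y] by (simp only: e1)
    then show "f (x + y) = f x + f y" by (auto simp: f_def zext_def fun_eq_iff plus_fun_apply)
    have e2: "(\<lambda>i\<in>Idx. restrict (\<lambda>_. 0) Idx i + c * restrict x Idx i) = restrict (scl c x) Idx" by (auto simp: scl_apply)
    have "f0 (restrict (scl c x) Idx) = (\<lambda>j\<in>Idx. f0 (restrict (\<lambda>_. 0) Idx) j + c * f0 (restrict x Idx) j)"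
      using lin[OF rc(1) rc(1), of "\<lambda>_. 0" c x] by (simp only: e2)
    then show "f (scl c x) = scl c (f x)" by (auto simp: f_def zext_def fun_eq_iff scl_apply z0)
  qed
  moreover have "f (star B' x y) = star B (f x) (f y)" for x y
  proof -
    have "restrict (star B' x y) Idx = restrict x Idx \<otimes>\<^bsub>elems ?H'\<^esub> restrict y Idx"
      unfolding elems_mult mulf_dual[symmetric] iH using restrict_mulf_restrict(1,2)[of ?H'] by (simp add: iH)
    then have "f0 (restrict (star B' x y) Idx) = f0 (restrict x Idx) \<otimes>\<^bsub>elems ?H\<^esub> f0 (restrict y Idx)"
      using hom_mult[OF i(1) rc(1) rc(1)] by simp
    then show ?thesis using zext_mult[of ?H "f0 (restrict x Idx)" "f0 (restrict y Idx)"] by (simp add: f_def iH mulf_dual)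
  qed
  moreover have "x = 0" if x: "supp_on Idx x" "f x = 0" for x
  proof -
    have "f0 (restrict x Idx) = f0 (restrict (\<lambda>_. 0) Idx)"
    proof (rule elems_eqI[of _ ?H])
      show "f0 (restrict x Idx) \<in> carrier (elems ?H)" "f0 (restrict (\<lambda>_. 0) Idx) \<in> carrier (elems ?H)"
        using i(2) rc(1) by (auto simp: bij_betw_def)
      show "zext (idx ?H) (f0 (restrict x Idx)) = zext (idx ?H) (f0 (restrict (\<lambda>_. 0) Idx))"
        using x(2) by (auto simp: f_def iH z0 zext_def fun_eq_iff zero_fun_apply)
    qed
    then have "restrict x Idx = restrict (\<lambda>_. 0) Idx" using i(2) rc(1) by (auto simp: bij_betw_def dest: inj_onD)
    then have r: "restrict x Idx i = restrict (\<lambda>_. 0) Idx i" for i by simp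
    show ?thesis
    proof
      fix i
      have "i \<notin> Idx ==> x i = 0" using x(1) unfolding supp_on_def by blast
      then show "x i = 0 i" using r[of i] by (cases "i \<in> Idx") (simp_all add: zero_fun_apply)
    qed
  qed
  moreover have "\<exists>y. supp_on Idx y \<and> f y = x" if x: "supp_on Idx x" for x
  proof -
    have "restrict x Idx \<in> f0 ` carrier (elems ?H')" using i(2) rc(2)[of x] by (simp add: bij_betw_def)
    then obtain y where y: "y \<in> carrier (elems ?H')" "f0 y = restrict x Idx" by auto
    have "restrict y Idx = y" using restrict_carrier[OF y(1)] by (simp add: iH)
    then have "f (zext Idx y) = x" using zext_supp[OF x] by (simp add: f_def y(2))
    then show ?thesis by blast
  qed
  moreover have "f eps = eps"
  proof -
    have "restrict eps Idx = \<one>\<^bsub>elems ?H'\<^esub>" "zext Idx \<one>\<^bsub>elems ?H\<^esub> = eps"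
      using dual0(3) by (simp_all add: elems_one iH dual0(3)[of B', symmetric])
    then show ?thesis by (simp add: f_def one)
  qed
  moreover have "f a c1 = a c1" for a
  proof -
    have c: "(\<Sum>i\<in>Idx. h i * unitc AA i) = h c1" for h :: "'a \<times> nat set => complex"
    proof -
      have "(\<Sum>i\<in>Idx. h i * unitc AA i) = (\<Sum>i\<in>Idx. h i * sng c1 i)" by (intro sum.cong refl) (simp add: unitc_AA)
      then show ?thesis by (simp add: sum_sng)
    qed
    have "counit ?T h = h c1" "counit ?H' h = h c1" for h
      using c[of h] by (simp_all add: counit_def iH twisted_hopf_def Let_def dual0)
    then show ?thesis using cou[OF rc(1), of a] by (simp add: f_def zext_def)
  qed
  moreover have "supp_on Idx (f a)" for a by (simp add: f_def)
  ultimately show ?thesis unfolding algebra_iso_def f_def by blast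
qed

text \<open>The twisted coproduct of \<open>f a\<close> is its coproduct conjugated by
  \<open>F\<close>. Multiplying by \<open>F\<close> from the left removes the inverse, so that only
  products with \<open>F\<close> itself have to be sliced.\<close>

lemma comul_extract:
  assumes B: "B \<in> carrier_mat n n" and B': "B' \<in> carrier_mat n n" and n0: "0 < n"
    and tw: "hopf_twist (dual_hopf (HA B)) F" and iso: "hopf_iso (dual_hopf (HA B')) (twisted_hopf (dual_hopf (HA B)) F) f0"
  defines "f \<equiv> \<lambda>a. zext Idx (f0 (restrict a Idx))" and "T2 \<equiv> tensor_alg (dual_hopf (HA B)) (dual_hopf (HA B))"
  assumes a: "supp_on Idx a"
  shows "mulf T2 (zext I2 (pr (f a))) (zext I2 F) = mulf T2 (zext I2 F) (TT f a)"
    and "\<exists>Fi. mulf T2 F Fi = tens eps eps \<and> mulf T2 Fi F = tens eps eps"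
proof -
  let ?H = "dual_hopf (HA B)" and ?H' = "dual_hopf (HA B')" and ?T = "twisted_hopf (dual_hopf (HA B)) F"
  have fi: "algebra_iso B' B f" unfolding f_def by (rule iso_extract[OF iso])
  note TT_def = TT_def[OF B B' fi n0]
  have iH: "idx ?H = Idx" "idx ?H' = Idx" "idx ?T = Idx" "idx T2 = I2" by (simp_all add: dual0(1) twisted_hopf_def Let_def T2_def)
  have fin: "finite (idx ?H)" by (simp add: iH)
  note t2 = tensor_super[OF fin assoc_H[OF B] unital_H[OF B], folded T2_def]
  interpret monoid "elems T2" by (rule monoid_elems[OF t2])
  have F: "F \<in> Units (elems T2)" using tw unfolding hopf_twist_def T2_def by blast
  define Fi where "Fi = inv\<^bsub>elems T2\<^esub> F"
  have un: "zext I2 \<one>\<^bsub>elems T2\<^esub> = tens eps eps"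
  proof -
    have "unitc ?H k = eps k" if "k \<in> Idx" for k using that fun_cong[OF dual0(3)[of B], of k] by (simp add: zext_def)
    then show ?thesis by (auto simp: elems_one zext_def fun_eq_iff tens_def iH T2_def tensor_alg_def eps_def Idx_def)
  qed
  have mz: "zext I2 (x \<otimes>\<^bsub>elems T2\<^esub> y) = mulf T2 x y" for x y
    using zext_mult[of T2 x y] restrict_mulf_restrict(3,4)[of T2] by (simp add: iH)
  have inv: "mulf T2 F Fi = tens eps eps" "mulf T2 Fi F = tens eps eps"
    using Units_r_inv[OF F] Units_l_inv[OF F] mz un unfolding Fi_def by metis+
  then show "\<exists>Fi. mulf T2 F Fi = tens eps eps \<and> mulf T2 Fi F = tens eps eps" by blast
  have un2: "mulf T2 (tens eps eps) x = x" if "supp_on I2 x" for x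
  proof -
    have "zext (idx T2) (unitc T2) = tens eps eps" using un by (simp add: elems_one iH)
    then show ?thesis using t2(2) that unfolding unital_alg_def iH by metis
  qed
  have as: "mulf T2 (mulf T2 x y) z = mulf T2 x (mulf T2 y z)" for x y z using t2(1) by (simp add: assoc_alg_def)
  define De where "De i = zext I2 (\<lambda>(j, k). mulc AA j k i)" for i
  have com: "comul ?T (f0 (restrict a Idx)) = tensor_map ?H' ?T f0 (comul ?H' (restrict a Idx))"
    using iso unfolding hopf_iso_def by (simp add: elems_carrier iH)
  have cb: "comul ?H (basis ?H i) = restrict (De i) I2" if i: "i \<in> Idx" for i
  proof -
    have "(\<Sum>m\<in>Idx. basis ?H i m * mulc AA j k m) = mulc AA j k i" for j k
    proof -
      have "(\<Sum>m\<in>Idx. basis ?H i m * mulc AA j k m) = (\<Sum>m\<in>Idx. mulc AA j k m * sng i m)"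
        by (intro sum.cong refl) (simp add: basis_sng iH)
      then show ?thesis by (simp add: sum_sng[OF i])
    qed
    then show ?thesis by (auto simp: comul_def iH dual0 De_def zext_def)
  qed
  have "zext I2 (pr (f a)) = (\<Sum>i\<in>Idx. scl (f a i) (De i))"
    by (auto simp: fun_eq_iff sum_apply scl_apply De_def zext_def pr_sum)
  then have 1: "mulf T2 Fi (mulf T2 (zext I2 (pr (f a))) F) = (\<Sum>i\<in>Idx. scl (f a i) (mulf T2 (mulf T2 Fi (De i)) F))"
    by (simp add: mulf_sum_left mulf_sum_right mulf_scl_left mulf_scl_right as)
  have "TT f a = mulf T2 Fi (mulf T2 (zext I2 (pr (f a))) F)"
  proof
    fix x :: "('a \<times> nat set) \<times> 'a \<times> nat set"
    obtain k l where x: "x = (k, l)" by (metis surj_pair)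
    show "TT f a x = mulf T2 Fi (mulf T2 (zext I2 (pr (f a))) F) x"
    proof (cases "k \<in> Idx \<and> l \<in> Idx")
      case True
      have "comul ?T (f0 (restrict a Idx)) (k, l) = (\<Sum>i\<in>Idx. f a i * mulf T2 (mulf T2 Fi (De i)) F (k, l))"
      proof -
        have "comulc ?T i k l = mulf T2 (mulf T2 Fi (De i)) F (k, l)" if i: "i \<in> Idx" for i
        proof -
          have "comulc ?T i k l = (Fi \<otimes>\<^bsub>elems T2\<^esub> restrict (De i) I2 \<otimes>\<^bsub>elems T2\<^esub> F) (k, l)"
            by (simp add: twisted_hopf_def Let_def Fi_def T2_def cb[OF i])
          also have "\<dots> = zext I2 (Fi \<otimes>\<^bsub>elems T2\<^esub> restrict (De i) I2 \<otimes>\<^bsub>elems T2\<^esub> F) (k, l)" using True by (simp add: zext_def)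
          also have "\<dots> = mulf T2 (mulf T2 Fi (De i)) F (k, l)"
            unfolding mz unfolding elems_mult using restrict_mulf_restrict(1,2)[of T2] by (simp add: iH)
          finally show ?thesis .
        qed
        then show ?thesis using True by (auto simp: comul_def iH f_def zext_def intro!: sum.cong)
      qed
      moreover have "tensor_map ?H' ?T f0 (comul ?H' (restrict a Idx)) (k, l) = TT f a (k, l)"
      proof -
        have c: "comul ?H' (restrict a Idx) (i, j) = pr a (i, j)" if "i \<in> Idx" "j \<in> Idx" for i j
          using that by (auto simp: comul_def iH dual0 pr_sum intro!: sum.cong)
        have b: "f0 (basis ?H' i) m = f (sng i) m" if "m \<in> Idx" for i m
          using that by (simp add: basis_sng iH f_def zext_def)
        show ?thesis using True by (auto simp: tensor_map_def iH TT_def zext_def c b intro!: sum.cong)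
      qed
      ultimately show ?thesis by (simp add: x com 1 sum_apply scl_apply)
    next
      case False
      have "mulf T2 Fi (mulf T2 (zext I2 (pr (f a))) F) (k, l) = 0"
        using supp_mulf[of T2 Fi "mulf T2 (zext I2 (pr (f a))) F"] False unfolding supp_on_def iH by blast
      moreover have "TT f a (k, l) = 0" using False by (auto simp: TT_def zext_def)
      ultimately show ?thesis by (simp only: x)
    qed
  qed
  then have "mulf T2 F (TT f a) = mulf T2 (mulf T2 F Fi) (mulf T2 (zext I2 (pr (f a))) F)" by (simp add: as)
  also have "\<dots> = mulf T2 (zext I2 (pr (f a))) F"
    unfolding inv by (rule un2) (use supp_mulf[of T2] iH in simp)
  finally show "mulf T2 (zext I2 (pr (f a))) (zext I2 F) = mulf T2 (zext I2 F) (TT f a)"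
    using restrict_mulf_restrict(3,4)[of T2] by (simp add: iH)
qed

lemma pr_mult: "pr (\<lambda>x. k * g x) jk = k * pr g jk"
  using pr_scl[of k g jk] by (simp add: scl_def)

lemma cm_scale:
  "cm B (\<lambda>(i, j). cm B (\<lambda>(k, l). (\<kappa> * v i j k l) * (\<kappa> * w i j k l)) y) x =
    \<kappa> * \<kappa> * cm B (\<lambda>(i, j). cm B (\<lambda>(k, l). v i j k l * w i j k l) y) x"
  by (cases "x \<in> Idx"; cases "y \<in> Idx"; simp add: cm_def sum_distrib_left sum_distrib_right mult_ac)

theorem exists_twist_data:
  assumes B: "B \<in> carrier_mat n n" "transpose_mat B = B" and B': "B' \<in> carrier_mat n n" "transpose_mat B' = B'"
    and n0: "0 < n" and te: "twist_equivalent (dual_hopf (HA B)) (dual_hopf (HA B'))"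
  shows "\<exists>f s s' sr t tr \<eta> \<eta>i \<sigma> b c. twist_data G n \<rho> u B B' f s s' sr t tr \<eta> \<eta>i \<sigma> b c"
proof -
  obtain F f0 where tw: "hopf_twist (dual_hopf (HA B)) F" and iso: "hopf_iso (dual_hopf (HA B')) (twisted_hopf (dual_hopf (HA B)) F) f0"
    using te unfolding twist_equivalent_def by blast
  define f where "f = (\<lambda>a. zext Idx (f0 (restrict a Idx)))"
  define T2 where "T2 = tensor_alg (dual_hopf (HA B)) (dual_hopf (HA B))"
  have i2: "idx T2 = I2" by (simp add: T2_def dual0(1))
  have f: "algebra_iso B' B f" unfolding f_def by (rule iso_extract[OF iso])
  note fp = f_props[OF B(1) B'(1) f n0]
  define \<Phi>0 where "\<Phi>0 = zext I2 F"
  have E0: "mulf T2 (zext I2 (pr (f a))) \<Phi>0 = mulf T2 \<Phi>0 (TT f a)" if "supp_on Idx a" for a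
    using comul_extract(1)[OF B(1) B'(1) n0 tw iso that] by (simp add: f_def T2_def \<Phi>0_def)
  obtain Fi where "mulf T2 F Fi = tens eps eps" "mulf T2 Fi F = tens eps eps"
    using comul_extract(2)[OF B(1) B'(1) n0 tw iso supp_eps] by (auto simp: T2_def)
  then have inv0: "mulf T2 \<Phi>0 Fi = tens eps eps" "mulf T2 Fi \<Phi>0 = tens eps eps"
    using restrict_mulf_restrict(3,4)[of T2] by (simp_all add: \<Phi>0_def i2)
  have s0: "supp_on I2 \<Phi>0" by (simp add: \<Phi>0_def)
  have TW0: "\<forall>a\<in>Idx. \<forall>b\<in>Idx. \<forall>c\<in>Idx.
    cm B (\<lambda>(i, j). cm B (\<lambda>(k, l). pr (\<lambda>x. \<Phi>0 (x, c)) (i, k) * \<Phi>0 (j, l)) b) a =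
    cm B (\<lambda>(k, l). cm B (\<lambda>(x, y). pr (\<lambda>z. \<Phi>0 (a, z)) (k, x) * \<Phi>0 (l, y)) c) b"
    unfolding \<Phi>0_def by (intro ballI) (rule twist_equation[OF B(1) tw])
  note one0 = slices_one[OF B(1) s0 TW0]
  define \<phi> where "\<phi> = \<Phi>0 (c1, c1)"
  have e0: "eps c1 = 1" "eps cu = 1" by (simp_all add: eps_def c1_def cu_def)
  have se: "(\<lambda>x. tens eps eps (c1, x)) = eps" "(\<lambda>x. tens eps eps (cu, x)) = eps" "(\<lambda>x. tens eps eps (x, c1)) = eps" "(\<lambda>x. tens eps eps (x, cu)) = eps"
    by (simp_all add: tens_def e0)
  have H2 [simp]: "mulf T2 X Y (c1, z) = star B (\<lambda>x. X (c1, x)) (\<lambda>x. Y (c1, x)) z"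
    "mulf T2 X Y (cu, z) = star B (\<lambda>x. X (cu, x)) (\<lambda>x. Y (cu, x)) z"
    "mulf T2 X Y (z, c1) = star B (\<lambda>x. X (x, c1)) (\<lambda>x. Y (x, c1)) z" 
    "mulf T2 X Y (z, cu) = star B (\<lambda>x. X (x, cu)) (\<lambda>x. Y (x, cu)) z" for X Y z
    using H2_left(1,2)[OF B(1)] H2_right(1,2)[OF B(1)] by (simp_all add: T2_def)
  have iv: "star B (\<lambda>x. \<Phi>0 (c1, x)) (\<lambda>x. Fi (c1, x)) = eps" "star B (\<lambda>x. \<Phi>0 (cu, x)) (\<lambda>x. Fi (cu, x)) = eps"
    "star B (\<lambda>x. Fi (cu, x)) (\<lambda>x. \<Phi>0 (cu, x)) = eps" "star B (\<lambda>x. \<Phi>0 (x, c1)) (\<lambda>x. Fi (x, c1)) = eps"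
  proof -
    have "(\<lambda>z. mulf T2 \<Phi>0 Fi (c1, z)) = eps" "(\<lambda>z. mulf T2 \<Phi>0 Fi (cu, z)) = eps"
      "(\<lambda>z. mulf T2 Fi \<Phi>0 (cu, z)) = eps" unfolding inv0 se by (rule refl)+
    then show "star B (\<lambda>x. \<Phi>0 (c1, x)) (\<lambda>x. Fi (c1, x)) = eps" "star B (\<lambda>x. \<Phi>0 (cu, x)) (\<lambda>x. Fi (cu, x)) = eps"
      "star B (\<lambda>x. Fi (cu, x)) (\<lambda>x. \<Phi>0 (cu, x)) = eps" by simp_all
    have "(\<lambda>z. mulf T2 \<Phi>0 Fi (z, c1)) = eps" unfolding inv0 se by (rule refl)
    then show "star B (\<lambda>x. \<Phi>0 (x, c1)) (\<lambda>x. Fi (x, c1)) = eps" by (simp only: H2)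
  qed
  have cancel: "a = scl \<phi> eps" if a: "star B a a = scl \<phi> a" "star B a a' = eps" "supp_on Idx a" for a a'
  proof -
    have "star B (star B a a) a' = star B a (star B a a')" by (rule star_assoc[OF B(1)])
    then show ?thesis using a by (simp add: star_lin star_eps_right[OF B(1)])
  qed
  have p1: "(\<lambda>y. \<Phi>0 (c1, y)) = scl \<phi> eps" "(\<lambda>x. \<Phi>0 (x, c1)) = scl \<phi> eps"
  proof -
    show "(\<lambda>y. \<Phi>0 (c1, y)) = scl \<phi> eps"
      by (rule cancel[OF one0(1)[folded \<phi>_def] iv(1) supp_slices(1)[OF B(1) s0 TW0]])
    show "(\<lambda>x. \<Phi>0 (x, c1)) = scl \<phi> eps"
      by (rule cancel[OF one0(2)[folded \<phi>_def] iv(4) supp_slices(2)[OF B(1) s0 TW0]])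
  qed
  have \<phi>: "\<phi> ~= 0"
  proof
    assume "\<phi> = 0"
    then have "eps = 0" using iv(1) by (simp add: p1 star_lin)
    then show False using e0(1) by (simp add: zero_fun_apply)
  qed
  \<comment> \<open>Rescaled so that the slices at \<open>c1\<close> become \<open>eps\<close>. Both
    sides of the twist equation are quadratic in the twist, so the factor drops out.\<close>
  define \<Phi> where "\<Phi> x = (1 / \<phi>) * \<Phi>0 x" for x
  have \<Phi>: "\<Phi> = scl (1 / \<phi>) \<Phi>0" by (auto simp: \<Phi>_def scl_apply)
  have supp: "supp_on I2 \<Phi>" unfolding \<Phi> by (rule supp_on_scl[OF s0])
  have TW: "\<forall>a\<in>Idx. \<forall>b\<in>Idx. \<forall>c\<in>Idx.
    cm B (\<lambda>(i, j). cm B (\<lambda>(k, l). pr (\<lambda>x. \<Phi> (x, c)) (i, k) * \<Phi> (j, l)) b) a =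
    cm B (\<lambda>(k, l). cm B (\<lambda>(x, y). pr (\<lambda>z. \<Phi> (a, z)) (k, x) * \<Phi> (l, y)) c) b"
    using TW0 unfolding \<Phi>_def pr_mult cm_scale by simp
  have n1: "\<Phi> (c1, y) = eps y" and n2: "\<Phi> (x, c1) = eps x" for x y
    using fun_cong[OF p1(1), of y] fun_cong[OF p1(2), of x] \<phi> by (simp_all add: \<Phi>_def scl_apply)
  note Tr = T_relations[OF B(1) supp TW n1 n2]
  note Rr = R_relations[OF B(1) supp TW n1 n2]
  note Mr = M_relations[OF B(1) supp TW n1 n2]
  have E: "mulf T2 (zext I2 (pr (f a))) \<Phi> = mulf T2 \<Phi> (TT f a)" if "supp_on Idx a" for a
    using E0[OF that] by (simp add: \<Phi> mulf_scl_left mulf_scl_right)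
  define s sr where "s = (\<lambda>y. \<Phi> (cu, y))" and "sr = (\<lambda>x. \<Phi> (x, cu))"
  define t0 tr0 where "t0 r = (\<lambda>y. \<Phi> (cr r, y))" and "tr0 r = (\<lambda>x. \<Phi> (x, cr r))" for r
  define l where "l r = lam f r" for r
  \<comment> \<open>A multiple of the slice at \<open>u\<close> absorbs the inner part
    \<open>lam\<close> of the skew derivation, leaving \<open>eta\<close> alone; the constants
    \<open>c\<close> and \<open>b\<close> below record the effect on the relations.\<close>
  define t tr where "t r = t0 r + scl (l r) s" and "tr r = tr0 r + scl (l r) sr" for r
  define \<sigma> where "\<sigma> = \<Phi> (cu, cu)"
  define c0 where "c0 r = \<Phi> (cr r, cu) + \<Phi> (cu, cr r)" for r
  define b0 where "b0 r q = \<Phi> (cr r, cr q) + \<Phi> (cr q, cr r)" for r q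
  define c where "c r = c0 r + l r * \<sigma> + l r * \<sigma>" for r
  define b where "b r q = b0 r q + l r * c0 q + l q * c0 r + l r * l q * \<sigma> + l r * l q * \<sigma>" for r q
  note fold = s_def[symmetric] sr_def[symmetric] t0_def[symmetric] tr0_def[symmetric]
  note Tr' = Tr[unfolded fold, folded \<sigma>_def c0_def b0_def] and Rr' = Rr[unfolded fold, folded \<sigma>_def c0_def b0_def] and Mr' = Mr[unfolded fold]
  have ss: "supp_on Idx s" "supp_on Idx sr" "supp_on Idx (t0 r)" "supp_on Idx (tr0 r)" for r
    using supp_slices[OF B(1) supp TW] by (simp_all add: s_def sr_def t0_def tr0_def)
  have ss': "supp_on Idx (t r)" "supp_on Idx (tr r)" for r
    by (simp_all add: t_def tr_def supp_on_add supp_on_scl ss)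
  obtain \<eta>i where \<eta>i: "\<forall>p<n. \<forall>q<n. (\<Sum>r<n. eta f p r * \<eta>i r q) = (if p = q then 1 else 0) \<and> (\<Sum>r<n. \<eta>i p r * eta f r q) = (if p = q then 1 else 0)"
    using eta_inverse[OF B(1) B'(1) f n0] by blast
  have sl: "star B (\<lambda>x. zext I2 (pr (f a)) (cu, x)) s = star B s (\<lambda>x. TT f a (cu, x))"
    "star B (\<lambda>x. zext I2 (pr (f a)) (x, cu)) sr = star B sr (\<lambda>x. TT f a (x, cu))"
    "r < n ==> star B (\<lambda>x. zext I2 (pr (f a)) (cr r, x)) eps + star B (\<lambda>x. zext I2 (pr (f a)) (cu, x)) (t0 r) = star B (t0 r) (\<lambda>x. TT f a (c1, x)) + star B s (\<lambda>x. TT f a (cr r, x))"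
    "r < n ==> star B (\<lambda>x. zext I2 (pr (f a)) (x, cr r)) eps + star B (\<lambda>x. zext I2 (pr (f a)) (x, cu)) (tr0 r) = star B (tr0 r) (\<lambda>x. TT f a (x, c1)) + star B sr (\<lambda>x. TT f a (x, cr r))"
    if a: "supp_on Idx a" for a r
  proof -
    note e = fun_cong[OF E[OF a]]
    show "star B (\<lambda>x. zext I2 (pr (f a)) (cu, x)) s = star B s (\<lambda>x. TT f a (cu, x))"
      unfolding s_def by (rule ext) (use e[of "(cu, z)" for z] in simp)
    show "star B (\<lambda>x. zext I2 (pr (f a)) (x, cu)) sr = star B sr (\<lambda>x. TT f a (x, cu))"
      unfolding sr_def by (rule ext) (use e[of "(z, cu)" for z] in \<open>simp only: H2\<close>)
    have e1: "(\<lambda>x. \<Phi> (c1, x)) = eps" "(\<lambda>x. \<Phi> (x, c1)) = eps" using n1 n2 by auto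
    assume r: "r < n"
    show "star B (\<lambda>x. zext I2 (pr (f a)) (cr r, x)) eps + star B (\<lambda>x. zext I2 (pr (f a)) (cu, x)) (t0 r) = star B (t0 r) (\<lambda>x. TT f a (c1, x)) + star B s (\<lambda>x. TT f a (cr r, x))"
    proof (rule ext)
      fix z
      show "(star B (\<lambda>x. zext I2 (pr (f a)) (cr r, x)) eps + star B (\<lambda>x. zext I2 (pr (f a)) (cu, x)) (t0 r)) z = (star B (t0 r) (\<lambda>x. TT f a (c1, x)) + star B s (\<lambda>x. TT f a (cr r, x))) z"
        using e[of "(cr r, z)"] unfolding T2_def H2_left(3)[OF B(1) r] e1 fold plus_fun_apply .
    qed
    show "star B (\<lambda>x. zext I2 (pr (f a)) (x, cr r)) eps + star B (\<lambda>x. zext I2 (pr (f a)) (x, cu)) (tr0 r) = star B (tr0 r) (\<lambda>x. TT f a (x, c1)) + star B sr (\<lambda>x. TT f a (x, cr r))"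
    proof (rule ext)
      fix z
      show "(star B (\<lambda>x. zext I2 (pr (f a)) (x, cr r)) eps + star B (\<lambda>x. zext I2 (pr (f a)) (x, cu)) (tr0 r)) z = (star B (tr0 r) (\<lambda>x. TT f a (x, c1)) + star B sr (\<lambda>x. TT f a (x, cr r))) z"
        using e[of "(z, cr r)"] unfolding T2_def H2_right(3)[OF B(1) r] e1 fold plus_fun_apply .
    qed
  qed
  note TTs = TT_slices[OF B(1) B'(1) f n0] and Ds = D_slices[OF B(1) B'(1) f n0, OF fp(2)]
  have F1: "star B (taul (f a)) s = star B s (f (taul a))" and F3: "star B (taur (f a)) sr = star B sr (f (taur a))"
    if a: "supp_on Idx a" for a
    using sl(1,2)[OF a] by (simp_all only: TTs[OF a] Ds)
  note fl = linop_add[OF fp(1)] linop_scl[OF fp(1)] linop_diff[OF fp(1)]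
  have F2: "Dl r (f a) + star B (taul (f a)) (t r) = star B (t r) (f a) + star B s (f (\<Sum>q<n. scl (eta f q r) (Dl q a)))"
    if r: "r < n" and a: "supp_on Idx a" for r a
  proof -
    have "Dl r (f a) + star B (taul (f a)) (t0 r) = star B (t0 r) (f a) + star B s (f ((\<Sum>q<n. scl (eta f q r) (Dl q a)) + scl (l r) (a - taul a)))"
      using sl(3)[OF a r] by (simp only: TTs(1,2)[OF a] TTs(3)[OF a r] Ds(1,2) Ds(3)[OF r] star_eps_right[OF B(1) supp_Dl[OF fp(2)]] l_def)
    then show ?thesis by (simp add: t_def star_lin F1[OF a] fl scl_diff algebra_simps)
  qed
  have F4: "Dr r (f a) + star B (taur (f a)) (tr r) = star B (tr r) (f a) + star B sr (f (\<Sum>q<n. scl (eta f q r) (Dr q a)))"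
    if r: "r < n" and a: "supp_on Idx a" for r a
  proof -
    have "Dr r (f a) + star B (taur (f a)) (tr0 r) = star B (tr0 r) (f a) + star B sr (f ((\<Sum>q<n. scl (eta f q r) (Dr q a)) + scl (l r) (a - taur a)))"
      using sl(4)[OF a r] by (simp only: TTs(4,5)[OF a] TTs(6)[OF a r] Ds(4,5) Ds(6)[OF r] star_eps_right[OF B(1) supp_Dr[OF fp(2)]] l_def)
    then show ?thesis by (simp add: tr_def star_lin F3[OF a] fl scl_diff algebra_simps)
  qed
  have T2': "Dl r s + star B (taul s) (t r) + star B (taul (t r)) s = scl (c r) eps" if r: "r < n" for r
  proof -
    have "scl (c r) eps = scl (c0 r) eps + scl (l r) (scl \<sigma> eps) + scl (l r) (scl \<sigma> eps)" by (simp only: c_def scl_add_left scl_scl)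
    then show ?thesis unfolding Tr'(2)[OF r, symmetric] Tr'(1)[symmetric] by (simp add: t_def op_lin star_lin scl_add algebra_simps)
  qed
  have T3': "Dl q (t r) + star B (taul (t r)) (t q) + (Dl r (t q) + star B (taul (t q)) (t r)) = scl (b r q) eps" if r: "r < n" and q: "q < n" for r q
  proof -
    have "scl (b r q) eps = scl (b0 r q) eps + scl (l r) (scl (c0 q) eps) + scl (l q) (scl (c0 r) eps) + scl (l r * l q) (scl \<sigma> eps) + scl (l r * l q) (scl \<sigma> eps)"
      by (simp only: b_def scl_add_left scl_scl)
    then show ?thesis unfolding Tr'(2)[OF r, symmetric] Tr'(2)[OF q, symmetric] Tr'(1)[symmetric] Tr'(3)[OF r q, symmetric]
      by (simp add: t_def op_lin star_lin scl_add algebra_simps)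
  qed
  have R3': "Dr q (tr r) + star B (taur (tr r)) (tr q) + (Dr r (tr q) + star B (taur (tr q)) (tr r)) = scl (b r q) eps" if r: "r < n" and q: "q < n" for r q
  proof -
    have "scl (b r q) eps = scl (b0 r q) eps + scl (l r) (scl (c0 q) eps) + scl (l q) (scl (c0 r) eps) + scl (l r * l q) (scl \<sigma> eps) + scl (l r * l q) (scl \<sigma> eps)"
      by (simp only: b_def scl_add_left scl_scl)
    then show ?thesis unfolding Rr'(2)[OF r, symmetric] Rr'(2)[OF q, symmetric] Rr'(1)[symmetric] Rr'(3)[OF r q, symmetric]
      by (simp add: tr_def op_lin star_lin scl_add algebra_simps)
  qed
  have M3': "star B (taul (tr r)) s = Dr r s + star B (taur s) (tr r)" if r: "r < n" for r
    using Mr'(3)[OF r] Mr'(1) by (simp add: tr_def op_lin star_lin algebra_simps)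
  have M4': "Dl q (tr r) + star B (taul (tr r)) (t q) = Dr r (t q) + star B (taur (t q)) (tr r)" if r: "r < n" and q: "q < n" for r q
  proof -
    have "Dl q (tr r) + star B (taul (tr r)) (t q) = (Dl q (tr0 r) + star B (taul (tr0 r)) (t0 q)) + scl (l r) (Dl q sr + star B (taul sr) (t0 q))
       + scl (l q) (star B (taul (tr0 r)) s) + scl (l r * l q) (star B (taul sr) s)"
      by (simp add: t_def tr_def op_lin star_lin scl_add algebra_simps)
    also have "\<dots> = Dr r (t q) + star B (taur (t q)) (tr r)"
      unfolding Mr'(4)[OF r q] Mr'(2)[OF q] Mr'(3)[OF r] Mr'(1) by (simp add: t_def tr_def op_lin star_lin scl_add algebra_simps)
    finally show ?thesis .
  qed
  define s' where "s' = zext Idx (\<lambda>x. \<phi> * Fi (cu, x))"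
  have sinv: "star B s s' = eps" "star B s' s = eps"
  proof -
    have "star B s s' = star B (scl (1 / \<phi>) (\<lambda>x. \<Phi>0 (cu, x))) (scl \<phi> (\<lambda>x. Fi (cu, x)))"
      by (rule star_cong[OF B(1)]) (simp_all add: s_def \<Phi>_def s'_def zext_def scl_apply)
    then show "star B s s' = eps" using \<phi> by (simp add: star_lin iv)
    have "star B s' s = star B (scl \<phi> (\<lambda>x. Fi (cu, x))) (scl (1 / \<phi>) (\<lambda>x. \<Phi>0 (cu, x)))"
      by (rule star_cong[OF B(1)]) (simp_all add: s_def \<Phi>_def s'_def zext_def scl_apply)
    then show "star B s' s = eps" using \<phi> by (simp add: star_lin iv)
  qed
  have ss'': "supp_on Idx s'" by (simp add: s'_def)
  have bs: "b r q = b q r" if "q < n" "r < n" for q r by (simp add: b_def b0_def algebra_simps)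
  have e1: "(\<Sum>r<n. eta f p r * \<eta>i r q) = (if p = q then 1 else 0)" "(\<Sum>r<n. \<eta>i p r * eta f r q) = (if p = q then 1 else 0)"
    if "p < n" "q < n" for p q using \<eta>i that by auto
  have "twist_data G n \<rho> u B B' f s s' sr t tr (eta f) \<eta>i \<sigma> b c"
    by unfold_locales (fact n0 B B' fp ss ss' ss'' sinv e1 bs F1 F2 F3 F4 Tr'(1) T2' T3' Mr'(1) M3' M4' Rr'(1) R3')+
  then show ?thesis by blast
qed

end

section \<open>Commuting idempotent matrices\<close>

text \<open>A nonzero column of \<open>e i\<close> is fixed by \<open>e i\<close> and killed by the
  other idempotents, so \<open>n + 1\<close> of them would give independent vectors in dimension
  \<open>n\<close>.\<close>

lemma no_orthogonal_idempotents:
  fixes e :: "nat => complex mat"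
  assumes c: "\<And>i. e i \<in> carrier_mat n n"
    and o: "\<And>i j. i \<le> n ==> j \<le> n ==> e i * e j = (if i = j then e i else 0\<^sub>m n n)"
    and nz: "\<And>i. i \<le> n ==> e i ~= 0\<^sub>m n n"
  shows False
proof -
  have ex: "\<exists>b. b < n \<and> (\<exists>a<n. e i $$ (a, b) ~= 0)" if "i \<le> n" for i
  proof (rule ccontr)
    assume "\<not> (\<exists>b. b < n \<and> (\<exists>a<n. e i $$ (a, b) ~= 0))"
    then have "e i = 0\<^sub>m n n" using c[of i] by (intro eq_matI) auto
    then show False using nz that by blast
  qed
  then obtain J where J: "\<And>i. i \<le> n ==> J i < n \<and> (\<exists>a<n. e i $$ (a, J i) ~= 0)" by metis
  define V where "V i a = e i $$ (a, J i)" for i a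
  \<comment> \<open>The columns together with a zero row form a singular square matrix, whose kernel
    vector is the linear relation sought.\<close>
  define P where "P = mat (Suc n) (Suc n) (\<lambda>(a, i). if a < n then V i a else 0)"
  have P: "P \<in> carrier_mat (Suc n) (Suc n)" by (simp add: P_def)
  have "det P = 0"
  proof -
    have "transpose_mat P *\<^sub>v unit_vec (Suc n) n = 0\<^sub>v (Suc n)"
      by (rule eq_vecI) (simp_all add: P_def)
    moreover have "unit_vec (Suc n) n ~= (0\<^sub>v (Suc n) :: complex vec)"
    proof
      assume "unit_vec (Suc n) n = (0\<^sub>v (Suc n) :: complex vec)"
      then have "unit_vec (Suc n) n $ n = (0\<^sub>v (Suc n) :: complex vec) $ n" by simp
      then show False by simp
    qed
    moreover have "transpose_mat P \<in> carrier_mat (Suc n) (Suc n)" using P by simp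
    ultimately have "det (transpose_mat P) = 0"
      using det_0_iff_vec_prod_zero[of "transpose_mat P" "Suc n"] by (meson unit_vec_carrier)
    then show ?thesis using det_transpose[OF P] by simp
  qed
  then obtain v where v: "v \<in> carrier_vec (Suc n)" "v ~= 0\<^sub>v (Suc n)" "P *\<^sub>v v = 0\<^sub>v (Suc n)"
    using det_0_iff_vec_prod_zero[OF P] by blast
  have z: "(\<Sum>i<Suc n. V i a * v $ i) = 0" if "a < n" for a
  proof -
    have "(P *\<^sub>v v) $ a = 0" using v(3) that by simp
    then show ?thesis using that v(1) by (simp add: P_def scalar_prod_def lessThan_atLeast0)
  qed
  have "v $ k = 0" if k: "k \<le> n" for k
  proof -
    obtain a where a: "a < n" "V k a ~= 0" using J[OF k] by (auto simp: V_def)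
    have m: "(\<Sum>b<n. e k $$ (a, b) * V i b) = (if i = k then V k a else 0)" if "i \<le> n" for i
    proof -
      have "(e k * e i) $$ (a, J i) = (\<Sum>b<n. e k $$ (a, b) * V i b)"
        using a J[OF that] carrier_matD[OF c[of k]] carrier_matD[OF c[of i]] by (simp add: V_def scalar_prod_def lessThan_atLeast0)
      then show ?thesis using o[OF k that] a J[OF that] by (auto simp: V_def)
    qed
    have "0 = (\<Sum>b<n. e k $$ (a, b) * (\<Sum>i<Suc n. V i b * v $ i))" using z by simp
    also have "\<dots> = (\<Sum>i<Suc n. (\<Sum>b<n. e k $$ (a, b) * V i b) * v $ i)"
      unfolding sum_distrib_left sum_distrib_right by (subst sum.swap) (simp only: mult.assoc)
    also have "\<dots> = (\<Sum>i<Suc n. if i = k then V k a * v $ k else 0)" by (intro sum.cong refl) (auto simp: m)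
    also have "\<dots> = V k a * v $ k" using k by (simp add: sum.delta del: sum.lessThan_Suc)
    finally show ?thesis using a by simp
  qed
  then have "v = 0\<^sub>v (Suc n)" using v(1) by (intro eq_vecI) auto
  then show False using v(2) by blast
qed

text \<open>If \<open>e\<close> has infinitely many products with an infinite family, so has one of
  the parts of a splitting \<open>e = e f + (e - e f)\<close>. This yields an infinite strictly
  decreasing chain of idempotents, whose successive differences are nonzero and orthogonal.\<close>

lemma finite_commuting_idempotents:
  fixes F :: "complex mat set"
  assumes F: "F \<subseteq> carrier_mat n n" and id: "\<And>f. f \<in> F ==> f * f = f" and co: "\<And>f g. f \<in> F ==> g \<in> F ==> f * g = g * f"
  shows "finite F"
proof (rule ccontr)
  assume inf: "infinite F"
  define good where "good e \<longleftrightarrow> e \<in> carrier_mat n n \<and> e * e = e \<and> (\<forall>f\<in>F. e * f = f * e) \<and> infinite ((\<lambda>f. e * f) ` F)" for e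
  have "(\<lambda>f. 1\<^sub>m n * f) ` F = (\<lambda>f. f) ` F" by (rule image_cong) (use F in auto)
  then have g1: "good (1\<^sub>m n)" using inf F by (auto simp: good_def)
  have step: "\<exists>e'. good e' \<and> (e * e' = e' \<and> e' * e = e' \<and> e' ~= e)" if "good e" for e
  proof -
    have ce: "e \<in> carrier_mat n n" and ee: "e * e = e" and ec: "\<And>f. f \<in> F ==> e * f = f * e" and ei: "infinite ((\<lambda>f. e * f) ` F)"
      using that by (auto simp: good_def)
    \<comment> \<open>Excluding the products \<open>0\<close> and \<open>e\<close> makes both parts
      of the splitting proper.\<close>
    have "infinite ((\<lambda>f. e * f) ` F - {0\<^sub>m n n, e})" using ei by simp
    then obtain y where "y \<in> (\<lambda>f. e * f) ` F - {0\<^sub>m n n, e}" using infinite_imp_nonempty by blast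
    then obtain f where f: "f \<in> F" "e * f ~= 0\<^sub>m n n" "e * f ~= e" by blast
    have cf: "f \<in> carrier_mat n n" using f F by blast
    define p where "p = e * f"
    have cp: "p \<in> carrier_mat n n" using ce cf by (simp add: p_def)
    define q where "q = e - p"
    have cq: "q \<in> carrier_mat n n" unfolding q_def by (rule minus_carrier_mat[OF cp])
    have ep: "e * p = p" unfolding p_def by (metis assoc_mult_mat ce cf ee)
    have pe: "p * e = p" unfolding p_def by (metis assoc_mult_mat ce cf ee ec f(1))
    have pf: "p * f = p" unfolding p_def by (metis assoc_mult_mat ce cf id f(1))
    have pp: "p * p = p" by (metis assoc_mult_mat ce cf cp pe pf p_def)
    have mm: "(e - p) - (p - p) = e - p" using ce cp by (intro eq_matI) auto
    have eq: "e * q = q" "q * e = q"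
      unfolding q_def mult_minus_distrib_mat[OF ce ce cp] minus_mult_distrib_mat[OF ce cp ce] ee ep pe by (rule refl)+
    have qq: "q * q = q"
    proof -
      have "q * q = q * e - q * p" unfolding q_def by (rule mult_minus_distrib_mat) (use ce cp in auto)
      also have "q * p = e * p - p * p" unfolding q_def by (rule minus_mult_distrib_mat[OF ce cp cp])
      finally have "q * q = q - (p - p)" by (simp only: eq ep pp)
      then show ?thesis by (simp only: mm[folded q_def])
    qed
    have pc: "p * g = g * p" if g: "g \<in> F" for g
    proof -
      have cg: "g \<in> carrier_mat n n" using g F by blast
      have "p * g = e * (g * f)" using co[OF f(1) g] by (simp add: p_def assoc_mult_mat[OF ce cf cg])
      also have "\<dots> = (g * e) * f" using ec[OF g] by (simp add: assoc_mult_mat[OF ce cg cf, symmetric] del: assoc_mult_mat)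
      finally show ?thesis by (simp add: p_def assoc_mult_mat[OF cg ce cf])
    qed
    have qc: "q * g = g * q" if g: "g \<in> F" for g
    proof -
      have cg: "g \<in> carrier_mat n n" using g F by blast
      show ?thesis unfolding q_def mult_minus_distrib_mat[OF cg ce cp] minus_mult_distrib_mat[OF ce cp cg] ec[OF g] pc[OF g] ..
    qed
    have "q ~= e"
    proof
      assume "q = e"
      then have "e $$ (i, j) - p $$ (i, j) = e $$ (i, j)" if "i < n" "j < n" for i j
        using that ce cp unfolding q_def by (metis carrier_matD(1,2) index_minus_mat(1))
      then have "p = 0\<^sub>m n n" using cp by (intro eq_matI) auto
      then show False using f(2) by (simp add: p_def)
    qed
    moreover have "p ~= e" using f(3) by (simp add: p_def)
    moreover have "infinite ((\<lambda>f. p * f) ` F) \<or> infinite ((\<lambda>f. q * f) ` F)"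
    proof (rule ccontr)
      assume "\<not> ?thesis"
      then have "finite ((\<lambda>(x, y). x + y) ` (((\<lambda>f. p * f) ` F) \<times> ((\<lambda>f. q * f) ` F)))" by simp
      moreover have "(\<lambda>f. e * f) ` F \<subseteq> (\<lambda>(x, y). x + y) ` (((\<lambda>f. p * f) ` F) \<times> ((\<lambda>f. q * f) ` F))"
      proof
        fix y assume "y \<in> (\<lambda>f. e * f) ` F"
        then obtain g where g: "g \<in> F" "y = e * g" by blast
        have cg: "g \<in> carrier_mat n n" using g F by blast
        have "Q + (U - Q) = U" if "U \<in> carrier_mat n n" "Q \<in> carrier_mat n n" for U Q :: "complex mat"
          using that by (intro eq_matI) auto
        from this[OF mult_carrier_mat[OF ce cg] mult_carrier_mat[OF cp cg]] have "p * g + (e * g - p * g) = e * g" .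
        then have "y = p * g + q * g" unfolding q_def minus_mult_distrib_mat[OF ce cp cg] g(2) by simp
        then show "y \<in> (\<lambda>(x, y). x + y) ` (((\<lambda>f. p * f) ` F) \<times> ((\<lambda>f. q * f) ` F))" using g(1) by force
      qed
      ultimately show False using ei finite_subset by blast
    qed
    ultimately show ?thesis
      using cp cq pp qq pc qc ep pe eq unfolding good_def by blast
  qed
  have "\<exists>E. \<forall>k. good (E k) \<and> (E k * E (Suc k) = E (Suc k) \<and> E (Suc k) * E k = E (Suc k) \<and> E (Suc k) ~= E k)"
  proof (rule dependent_nat_choice)
    show "\<exists>e. good e" using g1 by blast
  qed (use step in blast)
  then obtain E where E: "\<And>k. good (E k)" "\<And>k. E k * E (Suc k) = E (Suc k)" "\<And>k. E (Suc k) * E k = E (Suc k)" "\<And>k. E (Suc k) ~= E k" by blast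
  have cE: "E k \<in> carrier_mat n n" and iE: "E k * E k = E k" for k using E(1)[of k] by (auto simp: good_def)
  have mono: "E k * E (k + j) = E (k + j) \<and> E (k + j) * E k = E (k + j)" for k j
  proof (induction j)
    case (Suc j)
    have "E k * E (Suc (k + j)) = (E k * E (k + j)) * E (Suc (k + j))"
      unfolding assoc_mult_mat[OF cE cE cE] E(2) ..
    moreover have "E (Suc (k + j)) * E k = E (Suc (k + j)) * (E (k + j) * E k)"
      unfolding assoc_mult_mat[OF cE cE cE, symmetric] E(3) ..
    ultimately show ?case using Suc E(2,3)[of "k + j"] by simp
  qed (simp add: iE)
  have le: "E i * E j = E j" "E j * E i = E j" if "i \<le> j" for i j
    using mono[of i "j - i"] that by simp_all
  define d where "d i = E i - E (Suc i)" for i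
  have cd: "d i \<in> carrier_mat n n" for i unfolding d_def by (rule minus_carrier_mat[OF cE])
  have dd: "d i * d j = (E i * E j - E i * E (Suc j)) - (E (Suc i) * E j - E (Suc i) * E (Suc j))" for i j
  proof -
    have "d i * d j = E i * d j - E (Suc i) * d j" unfolding d_def[of i] by (rule minus_mult_distrib_mat[OF cE cE cd])
    then show ?thesis unfolding d_def mult_minus_distrib_mat[OF cE cE cE] .
  qed
  show False
  proof (rule no_orthogonal_idempotents[of d n])
    show "d i \<in> carrier_mat n n" for i by (rule cd)
    show "d i ~= 0\<^sub>m n n" for i
    proof
      assume "d i = 0\<^sub>m n n"
      then have "E i $$ (a, b) - E (Suc i) $$ (a, b) = 0" if "a < n" "b < n" for a b
        using that cE[of i] cE[of "Suc i"] unfolding d_def by (metis carrier_matD(1,2) index_minus_mat(1) index_zero_mat(1))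
      then have "E (Suc i) = E i" using cE[of i] cE[of "Suc i"] by (intro eq_matI) auto
      then show False using E(4) by blast
    qed
    show "d i * d j = (if i = j then d i else 0\<^sub>m n n)" for i j
    proof -
      consider "i = j" | "i < j" | "j < i" by linarith
      then show ?thesis
      proof cases
        case 1
        have "(E j - E (Suc j)) - (E (Suc j) - E (Suc j)) = E j - E (Suc j)" using cE[of j] cE[of "Suc j"] by (intro eq_matI) auto
        then have "d j * d j = d j" unfolding dd iE E(2,3) unfolding d_def .
        then show ?thesis using 1 by simp
      next
        case 2
        have "(E j - E (Suc j)) - (E j - E (Suc j)) = 0\<^sub>m n n" using cd[of j] by (simp add: d_def)
        then show ?thesis using 2 by (simp add: dd le(1))
      next
        case 3
        have "(E i - E i) - (E (Suc i) - E (Suc i)) = 0\<^sub>m n n" using cE[of i] cE[of "Suc i"] by (intro eq_matI) auto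
        then show ?thesis using 3 by (simp add: dd le(2))
      qed
    qed
  qed
qed

section \<open>Symplectic intertwiners\<close>

lemma mat_neg_add: "X \<in> carrier_mat n n ==> Y \<in> carrier_mat n n ==> - X + Y = 0\<^sub>m n n ==> Y = (X :: complex mat)"
proof (rule eq_matI)
  fix i j assume c: "X \<in> carrier_mat n n" "Y \<in> carrier_mat n n" and e: "- X + Y = 0\<^sub>m n n" and "i < dim_row X" "j < dim_col X"
  then have "(- X + Y) $$ (i, j) = 0" by simp
  then show "Y $$ (i, j) = X $$ (i, j)" using c \<open>i < dim_row X\<close> \<open>j < dim_col X\<close> by simp
qed auto

lemma mat_self_neg: "X \<in> carrier_mat n n ==> X = - X ==> X = (0\<^sub>m n n :: complex mat)"
proof (rule eq_matI)
  fix i j assume c: "X \<in> carrier_mat n n" and e: "X = - X" and ij: "i < dim_row (0\<^sub>m n n :: complex mat)" "j < dim_col (0\<^sub>m n n :: complex mat)"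
  have "X $$ (i, j) = (- X) $$ (i, j)" using e by simp
  then show "X $$ (i, j) = 0\<^sub>m n n $$ (i, j)" using c ij by simp
qed auto

lemma mat_neg_eq: "X \<in> carrier_mat n n ==> Y \<in> carrier_mat n n ==> - X = - Y ==> X = (Y :: complex mat)"
  using uminus_uminus_mat by metis

lemma mat_uminus_uminus: "X \<in> carrier_mat n n ==> - (- X) = (X :: complex mat)"
  by (intro eq_matI) auto

lemma conj_entry:
  assumes "A \<in> carrier_mat n n" "X \<in> carrier_mat n n" "i < n" "j < n"
  shows "(A * X * transpose_mat A) $$ (i, j) = (\<Sum>a<n. \<Sum>b<n. A $$ (i, a) * X $$ (a, b) * A $$ (j, b) :: complex)"
proof -
  have "(A * X * transpose_mat A) $$ (i, j) = (\<Sum>b<n. (A * X) $$ (i, b) * A $$ (j, b))"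
    using assms by (simp add: scalar_prod_def lessThan_atLeast0 del: assoc_mult_mat)
  also have "\<dots> = (\<Sum>b<n. \<Sum>a<n. A $$ (i, a) * X $$ (a, b) * A $$ (j, b))"
    using assms by (intro sum.cong refl) (simp add: scalar_prod_def lessThan_atLeast0 sum_distrib_right)
  finally show ?thesis by (subst sum.swap)
qed

lemma smult_rules: "k \<cdot>\<^sub>m (l \<cdot>\<^sub>m A) = (k * l) \<cdot>\<^sub>m (A :: complex mat)" "1 \<cdot>\<^sub>m A = A"
  by (auto intro!: eq_matI)

lemma finite_image_factor:
  assumes "finite (F ` S)" "\<And>x y. x \<in> S ==> y \<in> S ==> F x = F y ==> orb x = orb y"
  shows "finite (orb ` S)"
proof (rule finite_subset)
  show "orb ` S \<subseteq> (\<lambda>v. orb (SOME x. x \<in> S \<and> F x = v)) ` (F ` S)"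
  proof
    fix y assume "y \<in> orb ` S"
    then obtain x where x: "x \<in> S" "y = orb x" by blast
    then have "\<exists>x'. x' \<in> S \<and> F x' = F x" by blast
    from someI_ex[OF this] have "orb (SOME x'. x' \<in> S \<and> F x' = F x) = y" using assms(2) x by blast
    then show "y \<in> (\<lambda>v. orb (SOME x. x \<in> S \<and> F x = v)) ` (F ` S)" using x by blast
  qed
qed (use assms(1) in simp)

context grepu
begin

abbreviation "MM \<equiv> carrier_mat n n :: complex mat set"
abbreviation "MN \<equiv> carrier_mat (n + n) (n + n) :: complex mat set"
abbreviation "fb \<equiv> four_block_mat :: complex mat => complex mat => complex mat => complex mat => complex mat"
abbreviation "tp \<equiv> transpose_mat :: complex mat => complex mat"

lemma uminus_mat_rules [simp]:
  fixes A B :: "complex mat"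
  shows "A \<in> carrier_mat n n ==> B \<in> carrier_mat n n ==> - A * B = - (A * B)"
    "A \<in> carrier_mat n n ==> B \<in> carrier_mat n n ==> A * - B = - (A * B)"
    "A \<in> carrier_mat n n ==> - (- A) = A" "- 0\<^sub>m n n = (0\<^sub>m n n :: complex mat)"
  by (auto simp: mat_uminus_uminus intro!: eq_matI)

lemmas mat_rules [simp] = assoc_mult_mat[of _ n n _ n _ n] assoc_mult_mat[of _ "n + n" "n + n" _ "n + n" _ "n + n"]
  mult_carrier_mat[of _ n n _ n] mult_carrier_mat[of _ "n + n" "n + n" _ "n + n"] add_carrier_mat[of _ n n] minus_carrier_mat[of _ n n]
  right_mult_one_mat[of _ n n] left_mult_one_mat[of _ n n] right_mult_one_mat[of _ "n + n" "n + n"] left_mult_one_mat[of _ "n + n" "n + n"]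
  right_mult_zero_mat[of _ n n] left_mult_zero_mat[of _ n n] right_add_zero_mat[of _ n n] left_add_zero_mat[of _ n n]

lemma rho_inv [simp]: "h \<in> carrier G ==> \<rho> h * \<rho> (inv h) = 1\<^sub>m n" "h \<in> carrier G ==> \<rho> (inv h) * \<rho> h = 1\<^sub>m n"
  by (simp_all add: rho_mult[symmetric] rho_one)

lemma rho_tp [simp]: "h \<in> carrier G ==> tp (\<rho> h) * tp (\<rho> (inv h)) = 1\<^sub>m n" "h \<in> carrier G ==> tp (\<rho> (inv h)) * tp (\<rho> h) = 1\<^sub>m n"
  by (simp_all add: transpose_mult[of _ n n _ n, symmetric])

lemma fb_mult: "a \<in> MM ==> b \<in> MM ==> c \<in> MM ==> d \<in> MM ==> a' \<in> MM ==> b' \<in> MM ==> c' \<in> MM ==> d' \<in> MM ==>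
   fb a b c d * fb a' b' c' d' = fb (a * a' + b * c') (a * b' + b * d') (c * a' + d * c') (c * b' + d * d')"
  by (rule mult_four_block_mat)

lemma fb_tp: "a \<in> MM ==> b \<in> MM ==> c \<in> MM ==> d \<in> MM ==> tp (fb a b c d) = fb (tp a) (tp c) (tp b) (tp d)"
  by (rule transpose_four_block_mat)

lemma fb_carrier [simp]: "a \<in> MM ==> d \<in> MM ==> fb a b c d \<in> MN"
  by (rule four_block_carrier_mat)

lemma fb_inj:
  assumes "a \<in> MM" "b \<in> MM" "c \<in> MM" "d \<in> MM" "a' \<in> MM" "b' \<in> MM" "c' \<in> MM" "d' \<in> MM" "fb a b c d = fb a' b' c' d'"
  shows "a = a'" "b = b'" "c = c'" "d = d'"
proof -
  have e: "fb a b c d $$ ij = fb a' b' c' d' $$ ij" for ij using assms(9) by simp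
  show "a = a'" using assms(1-8) e[of "(i, j)" for i j] by (intro eq_matI) (auto, metis (no_types, lifting) add.commute carrier_matD index_mat_four_block(1) trans_less_add1)
  have "b $$ (i, j) = b' $$ (i, j)" if "i < n" "j < n" for i j using assms(1-8) that e[of "(i, j + n)"] by simp
  then show "b = b'" using assms(2,6) by (intro eq_matI) auto
  have "c $$ (i, j) = c' $$ (i, j)" if "i < n" "j < n" for i j using assms(1-8) that e[of "(i + n, j)"] by simp
  then show "c = c'" using assms(3,7) by (intro eq_matI) auto
  have "d $$ (i, j) = d' $$ (i, j)" if "i < n" "j < n" for i j using assms(1-8) that e[of "(i + n, j + n)"] by simp
  then show "d = d'" using assms(4,8) by (intro eq_matI) auto
qed

lemma fb_split:
  assumes "M \<in> MN"
  shows "\<exists>a b c d. a \<in> MM \<and> b \<in> MM \<and> c \<in> MM \<and> d \<in> MM \<and> M = fb a b c d"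
proof -
  have "M = fb (mat n n (\<lambda>(i, j). M $$ (i, j))) (mat n n (\<lambda>(i, j). M $$ (i, j + n)))
     (mat n n (\<lambda>(i, j). M $$ (i + n, j))) (mat n n (\<lambda>(i, j). M $$ (i + n, j + n)))"
    using assms by (intro eq_matI) auto
  then show ?thesis by (intro exI conjI) auto
qed

text \<open>The standard symplectic form on the sum of \<open>V\<close> and its dual;
  \<open>Om'\<close> is its inverse.\<close>

definition Om where "Om = fb (0\<^sub>m n n) (1\<^sub>m n) (- 1\<^sub>m n) (0\<^sub>m n n)"
definition Om' where "Om' = fb (0\<^sub>m n n) (- 1\<^sub>m n) (1\<^sub>m n) (0\<^sub>m n n)"
definition Dg where "Dg h = fb (\<rho> h) (0\<^sub>m n n) (0\<^sub>m n n) (tp (\<rho> (inv h)))"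
text \<open>The shear that carries the second summand to the graph of \<open>X\<close>; it is
  symplectic for symmetric \<open>X\<close>.\<close>

definition Uu where "Uu X = fb (1\<^sub>m n) X (0\<^sub>m n n) (1\<^sub>m n)"
text \<open>For symplectic \<open>x\<close> the equation \<open>x Om x^T = Om\<close> gives the
  inverse \<open>Om x^T Om^-1\<close>.\<close>

definition xinv where "xinv x = Om * (tp x * Om')"
definition sp where "sp x \<longleftrightarrow> x \<in> MN \<and> x * (Om * tp x) = Om"

lemma car2 [simp]: "Om \<in> MN" "Om' \<in> MN" "h \<in> carrier G ==> Dg h \<in> MN" "Uu X \<in> MN" "x \<in> MN ==> xinv x \<in> MN"
proof -
  show 1: "Om \<in> MN" "Om' \<in> MN" "h \<in> carrier G ==> Dg h \<in> MN" "Uu X \<in> MN" by (simp_all add: Om_def Om'_def Dg_def Uu_def)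
  show "x \<in> MN ==> xinv x \<in> MN" using 1 by (simp add: xinv_def)
qed

lemma Om_Om': "Om * Om' = 1\<^sub>m (n + n)"
proof -
  have "Om * Om' = fb (1\<^sub>m n) (0\<^sub>m n n) (0\<^sub>m n n) (1\<^sub>m n)"
    unfolding Om_def Om'_def by (subst fb_mult) (auto intro!: cong_four_block_mat eq_matI)
  then show ?thesis by simp
qed

lemma sp_inv: "sp x ==> x * xinv x = 1\<^sub>m (n + n)" "sp x ==> xinv x * x = 1\<^sub>m (n + n)"
proof -
  assume x: "sp x"
  then have c: "x \<in> MN" and e: "x * (Om * tp x) = Om" by (auto simp: sp_def)
  have ct: "tp x \<in> MN" using c by simp
  have "x * xinv x = (x * (Om * tp x)) * Om'" using c ct by (simp add: xinv_def)
  then show r: "x * xinv x = 1\<^sub>m (n + n)" by (simp only: e Om_Om')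
  show "xinv x * x = 1\<^sub>m (n + n)" by (rule mat_mult_left_right_inverse[OF c _ r]) (simp add: c)
qed

lemma sp_xinv: "sp x ==> sp (xinv x)"
proof -
  assume x: "sp x"
  then have c: "x \<in> MN" and e: "x * (Om * tp x) = Om" by (auto simp: sp_def)
  let ?y = "xinv x"
  have cy: "?y \<in> MN" "tp ?y \<in> MN" "tp x \<in> MN" using c by simp_all
  have t: "tp x * tp ?y = 1\<^sub>m (n + n)" using sp_inv(2)[OF x] by (simp add: transpose_mult[OF cy(1) c, symmetric])
  have "?y * (Om * tp ?y) = ?y * (x * (Om * tp x) * tp ?y)" by (simp only: e)
  also have "\<dots> = (?y * x) * (Om * (tp x * tp ?y))" using c cy by simp
  also have "\<dots> = Om" by (simp add: sp_inv(2)[OF x] t)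
  finally show ?thesis using cy by (simp add: sp_def)
qed

lemma sp_mult: "sp x ==> sp y ==> sp (x * y)"
proof -
  assume "sp x" "sp y"
  then have c: "x \<in> MN" "y \<in> MN" and e: "x * (Om * tp x) = Om" "y * (Om * tp y) = Om" by (auto simp: sp_def)
  have ct: "tp x \<in> MN" "tp y \<in> MN" using c by simp_all
  have "x * y * (Om * tp (x * y)) = x * ((y * (Om * tp y)) * tp x)"
    unfolding transpose_mult[OF c] using c ct by simp
  then show ?thesis using c by (simp add: sp_def e)
qed

definition commD where "commD x \<longleftrightarrow> (\<forall>h\<in>carrier G. x * Dg h = Dg h * x)"

lemma commD_mult: "x \<in> MN ==> y \<in> MN ==> commD x ==> commD y ==> commD (x * y)"
  unfolding commD_def
proof
  fix h assume c: "x \<in> MN" "y \<in> MN" and x: "\<forall>h\<in>carrier G. x * Dg h = Dg h * x" and y: "\<forall>h\<in>carrier G. y * Dg h = Dg h * y" and h: "h \<in> carrier G"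
  have "x * y * Dg h = x * (Dg h * y)" using c h y by simp
  also have "\<dots> = (x * Dg h) * y" using c h by simp
  also have "\<dots> = Dg h * (x * y)" using c h x by simp
  finally show "x * y * Dg h = Dg h * (x * y)" .
qed

lemma commD_xinv: "sp x ==> commD x ==> commD (xinv x)"
  unfolding commD_def
proof
  fix h assume x: "sp x" and co: "\<forall>h\<in>carrier G. x * Dg h = Dg h * x" and h: "h \<in> carrier G"
  have c: "x \<in> MN" using x by (simp add: sp_def)
  let ?y = "xinv x"
  have cy: "?y \<in> MN" using c by simp
  have "?y * Dg h = ?y * (Dg h * (x * ?y))" using h cy by (simp add: sp_inv(1)[OF x])
  also have "\<dots> = ?y * ((Dg h * x) * ?y)" using c cy h by simp
  also have "\<dots> = ?y * ((x * Dg h) * ?y)" using co h by simp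
  also have "\<dots> = (?y * x) * (Dg h * ?y)" using c cy h by simp
  also have "\<dots> = Dg h * ?y" using cy h by (simp add: sp_inv(2)[OF x])
  finally show "?y * Dg h = Dg h * ?y" .
qed

definition EndG where "EndG m \<longleftrightarrow> m \<in> MM \<and> (\<forall>h\<in>carrier G. m * \<rho> h = \<rho> h * m)"

definition Rel :: "complex mat => ('a \<times> 'a \<times> complex) set" where
  "Rel x = {(g, h, \<zeta>). g \<in> carrier G \<and> h \<in> carrier G \<and> \<zeta> \<in> {1, -1} \<and> x * Dg g = \<zeta> \<cdot>\<^sub>m (Dg h * x)}"

text \<open>A lower triangular matrix preserves the second summand, so the equation with the shears
  says that \<open>x\<close> maps the graph of \<open>B\<close> onto that of \<open>B1\<close>;
  \<open>Di\<close> records that the diagonal block is invertible.\<close>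

definition sdat :: "complex mat => complex mat => complex mat => bool" where
  "sdat B B1 x \<longleftrightarrow> sp x \<and> (\<exists>A C D Di. A \<in> MM \<and> C \<in> MM \<and> D \<in> MM \<and> Di \<in> MM \<and> D * Di = 1\<^sub>m n \<and> x * Uu B = Uu B1 * fb A (0\<^sub>m n n) C D) \<and>
    (\<forall>h\<in>carrier G. \<exists>g \<zeta>. (g, h, \<zeta>) \<in> Rel x)"

section \<open>Equivariant symplectic matrices when \<open>S^2 V\<close> has no invariants\<close>

context
  assumes inv0: "\<And>S. S \<in> MM ==> tp S = S ==> (\<And>h. h \<in> carrier G ==> \<rho> h * S * tp (\<rho> h) = S) ==> S = 0\<^sub>m n n"
begin

lemma antisym_of_sym_zero:
  assumes T: "T \<in> MM" and z: "T + tp T = 0\<^sub>m n n"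
  shows "tp T = - T"
proof (rule eq_matI)
  fix i j assume ij: "i < dim_row (- T)" "j < dim_col (- T)"
  have "(T + tp T) $$ (i, j) = 0" using z T ij by simp
  then have "T $$ (i, j) + T $$ (j, i) = 0" using T ij by simp
  then show "tp T $$ (i, j) = (- T) $$ (i, j)" using T ij by (simp add: eq_neg_iff_add_eq_0 add.commute)
qed (use T in auto)

lemma tp_add_sym: "T \<in> MM ==> tp (T + tp T) = T + tp T"
  by (intro eq_matI) auto

text \<open>The symmetrisation \<open>T + tp T\<close> is an invariant of \<open>S^2 V\<close>,
  hence zero.\<close>

lemma inv_antisym:
  assumes T: "T \<in> MM" and i: "\<And>h. h \<in> carrier G ==> \<rho> h * T * tp (\<rho> h) = T"
  shows "tp T = - T"
proof (rule antisym_of_sym_zero[OF T], rule inv0[OF _ tp_add_sym[OF T]])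
  show "T + tp T \<in> MM" using T by simp
  fix h assume h: "h \<in> carrier G"
  have c: "\<rho> h \<in> MM" "tp (\<rho> h) \<in> MM" "tp T \<in> MM" "\<rho> h * T \<in> MM" using h T by simp_all
  have t: "\<rho> h * tp T * tp (\<rho> h) = tp T"
  proof -
    have "tp (\<rho> h * T * tp (\<rho> h)) = \<rho> h * (tp T * tp (\<rho> h))"
      using transpose_mult[OF c(4,2)] transpose_mult[OF c(1) T] by simp
    then show ?thesis using i[OF h] c T by simp
  qed
  show "\<rho> h * (T + tp T) * tp (\<rho> h) = T + tp T"
    unfolding mult_add_distrib_mat[OF c(1) T c(3)] using add_mult_distrib_mat[OF c(4) _ c(2), of "\<rho> h * tp T"] c i[OF h] t by simp
qed

text \<open>The hypothesis concerns \<open>V\<close>, the claim its dual. Summing the translates of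
  the complex conjugate of \<open>S\<close> over the group gives an invariant of
  \<open>S^2 V\<close>, which vanishes; its pairing with \<open>S\<close> is the order of the group
  times the sum of the squared absolute values of the entries of \<open>S\<close>.\<close>

lemma dual_inv_zero:
  assumes S: "S \<in> MM" and i: "\<And>h. h \<in> carrier G ==> tp (\<rho> h) * S * \<rho> h = S" and sy: "tp S = S"
  shows "S = 0\<^sub>m n n"
proof -
  define C where "C = mat n n (\<lambda>(k, l). cnj (S $$ (k, l)))"
  have C: "C \<in> MM" by (simp add: C_def)
  have Ss: "S $$ (i, j) = S $$ (j, i)" if "i < n" "j < n" for i j
    using that S sy by (metis carrier_matD index_transpose_mat(1))
  define kk where "kk h i j = (\<rho> h * C * tp (\<rho> h)) $$ (i, j)" for h i j
  define K where "K = mat n n (\<lambda>(i, j). \<Sum>h\<in>carrier G. kk h i j)"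
  have kke: "kk h i j = (\<Sum>a<n. \<Sum>b<n. \<rho> h $$ (i, a) * cnj (S $$ (a, b)) * \<rho> h $$ (j, b))" if "h \<in> carrier G" "i < n" "j < n" for h i j
    using that conj_entry[OF rho_carrier[OF that(1)] C that(2,3)] by (simp add: kk_def C_def)
  have "K = 0\<^sub>m n n"
  proof (rule inv0)
    show K: "K \<in> MM" by (simp add: K_def)
    have "kk h i j = kk h j i" if "h \<in> carrier G" "i < n" "j < n" for h i j
      unfolding kke[OF that] kke[OF that(1,3,2)] using Ss by (subst sum.swap) (auto intro!: sum.cong)
    then show "tp K = K" by (intro eq_matI) (auto simp: K_def)
    fix g assume g: "g \<in> carrier G"
    show "\<rho> g * K * tp (\<rho> g) = K"
    proof (rule eq_matI)
      fix i j assume "i < dim_row K" "j < dim_col K"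
      then have ij: "i < n" "j < n" by (simp_all add: K_def)
      have "(\<rho> g * K * tp (\<rho> g)) $$ (i, j) = (\<Sum>a<n. \<Sum>b<n. \<rho> g $$ (i, a) * (\<Sum>h\<in>carrier G. kk h a b) * \<rho> g $$ (j, b))"
        unfolding conj_entry[OF rho_carrier[OF g] K ij] by (intro sum.cong refl) (simp add: K_def)
      also have "\<dots> = (\<Sum>h\<in>carrier G. \<Sum>a<n. \<Sum>b<n. \<rho> g $$ (i, a) * kk h a b * \<rho> g $$ (j, b))"
        unfolding sum_distrib_left sum_distrib_right by (simp only: sum.swap[of _ "carrier G" "{..<n}"])
      also have "\<dots> = (\<Sum>h\<in>carrier G. kk (g \<otimes> h) i j)"
      proof (intro sum.cong refl)
        fix h assume h: "h \<in> carrier G"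
        have ch: "\<rho> h * C * tp (\<rho> h) \<in> MM" using h C by simp
        have "(\<Sum>a<n. \<Sum>b<n. \<rho> g $$ (i, a) * kk h a b * \<rho> g $$ (j, b)) = (\<rho> g * (\<rho> h * C * tp (\<rho> h)) * tp (\<rho> g)) $$ (i, j)"
          unfolding conj_entry[OF rho_carrier[OF g] ch ij] kk_def ..
        also have "\<rho> g * (\<rho> h * C * tp (\<rho> h)) * tp (\<rho> g) = \<rho> (g \<otimes> h) * C * tp (\<rho> (g \<otimes> h))"
          unfolding rho_mult[OF g h] transpose_mult[OF rho_carrier[OF g] rho_carrier[OF h]] using g h C by simp
        finally show "(\<Sum>a<n. \<Sum>b<n. \<rho> g $$ (i, a) * kk h a b * \<rho> g $$ (j, b)) = kk (g \<otimes> h) i j" unfolding kk_def .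
      qed
      also have "\<dots> = (\<Sum>h\<in>carrier G. kk h i j)"
        by (rule sum.reindex_bij_witness[of _ "\<lambda>h. inv g \<otimes> h" "\<lambda>h. g \<otimes> h"]) (use g in \<open>auto simp: m_assoc[symmetric]\<close>)
      finally show "(\<rho> g * K * tp (\<rho> g)) $$ (i, j) = K $$ (i, j)" using ij by (simp add: K_def)
    qed (use carrier_matD[OF rho_carrier[OF g]] in \<open>auto simp: K_def\<close>)
  qed
  then have K0: "(\<Sum>h\<in>carrier G. kk h i j) = 0" if "i < n" "j < n" for i j
    using that by (metis K_def index_mat(1) index_zero_mat(1) case_prod_conv)
  have dual: "(\<Sum>i<n. \<Sum>j<n. S $$ (i, j) * kk h i j) = (\<Sum>k<n. \<Sum>l<n. cnj (S $$ (k, l)) * S $$ (k, l))" if h: "h \<in> carrier G" for h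
  proof -
    have "(\<Sum>i<n. \<Sum>j<n. S $$ (i, j) * kk h i j) = (\<Sum>i<n. \<Sum>j<n. \<Sum>k<n. \<Sum>l<n. S $$ (i, j) * (\<rho> h $$ (i, k) * cnj (S $$ (k, l)) * \<rho> h $$ (j, l)))"
      by (intro sum.cong refl) (simp add: kke h sum_distrib_left)
    also have "\<dots> = (\<Sum>k<n. \<Sum>l<n. \<Sum>i<n. \<Sum>j<n. S $$ (i, j) * (\<rho> h $$ (i, k) * cnj (S $$ (k, l)) * \<rho> h $$ (j, l)))"
    proof -
      have s: "(\<Sum>x<n. \<Sum>k<n. \<Sum>l<n. (g x k l :: complex)) = (\<Sum>k<n. \<Sum>l<n. \<Sum>x<n. g x k l)" for g
        by (subst sum.swap) (intro sum.cong refl sum.swap)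
      show ?thesis by (subst s) (rule s)
    qed
    also have "\<dots> = (\<Sum>k<n. \<Sum>l<n. cnj (S $$ (k, l)) * S $$ (k, l))"
    proof (intro sum.cong refl)
      fix k l assume "k \<in> {..<n}" "l \<in> {..<n}"
      then have kl: "k < n" "l < n" by auto
      have ct: "tp (\<rho> h) \<in> MM" using h by simp
      have "S $$ (k, l) = (\<Sum>i<n. \<Sum>j<n. \<rho> h $$ (i, k) * S $$ (i, j) * \<rho> h $$ (j, l))"
        using conj_entry[OF ct S kl] i[OF h] kl rho_carrier[OF h] by simp
      then have "cnj (S $$ (k, l)) * S $$ (k, l) = cnj (S $$ (k, l)) * (\<Sum>i<n. \<Sum>j<n. \<rho> h $$ (i, k) * S $$ (i, j) * \<rho> h $$ (j, l))" by simp
      then show "(\<Sum>i<n. \<Sum>j<n. S $$ (i, j) * (\<rho> h $$ (i, k) * cnj (S $$ (k, l)) * \<rho> h $$ (j, l))) = cnj (S $$ (k, l)) * S $$ (k, l)"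
        by (simp add: sum_distrib_left mult_ac)
    qed
    finally show ?thesis .
  qed
  have "of_nat (card (carrier G)) * (\<Sum>k<n. \<Sum>l<n. cnj (S $$ (k, l)) * S $$ (k, l)) = (\<Sum>h\<in>carrier G. \<Sum>i<n. \<Sum>j<n. S $$ (i, j) * kk h i j)"
    by (simp add: dual)
  also have "\<dots> = (\<Sum>i<n. \<Sum>j<n. S $$ (i, j) * (\<Sum>h\<in>carrier G. kk h i j))"
    unfolding sum_distrib_left by (subst sum.swap) (intro sum.cong refl sum.swap)
  also have "\<dots> = 0" by (simp add: K0)
  finally have "(\<Sum>k<n. \<Sum>l<n. cnj (S $$ (k, l)) * S $$ (k, l)) = 0"
    using fin by (auto simp: card_eq_0_iff)
  moreover have "(\<Sum>k<n. \<Sum>l<n. cnj (S $$ (k, l)) * S $$ (k, l)) = of_real (\<Sum>k<n. \<Sum>l<n. (cmod (S $$ (k, l)))\<^sup>2)"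
    unfolding of_real_sum by (intro sum.cong refl) (metis complex_norm_square mult.commute)
  ultimately have "(\<Sum>k<n. \<Sum>l<n. (cmod (S $$ (k, l)))\<^sup>2) = 0" by (simp only: of_real_eq_0_iff)
  then have "\<forall>k\<in>{..<n}. (\<Sum>l<n. (cmod (S $$ (k, l)))\<^sup>2) = 0" by (subst (asm) sum_nonneg_eq_0_iff) (auto intro: sum_nonneg)
  then have "S $$ (k, l) = 0" if "k < n" "l < n" for k l
    using that by (auto simp: sum_nonneg_eq_0_iff)
  then show ?thesis using S by (intro eq_matI) auto
qed

lemma dual_inv_antisym:
  assumes T: "T \<in> MM" and i: "\<And>h. h \<in> carrier G ==> tp (\<rho> h) * T * \<rho> h = T"
  shows "tp T = - T"
proof (rule antisym_of_sym_zero[OF T], rule dual_inv_zero[OF _ _ tp_add_sym[OF T]])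
  show "T + tp T \<in> MM" using T by simp
  fix h assume h: "h \<in> carrier G"
  have c: "\<rho> h \<in> MM" "tp (\<rho> h) \<in> MM" "tp T \<in> MM" "tp (\<rho> h) * T \<in> MM" using h T by simp_all
  have t: "tp (\<rho> h) * tp T * \<rho> h = tp T"
  proof -
    have "tp (tp (\<rho> h) * T * \<rho> h) = tp (\<rho> h) * (tp T * \<rho> h)"
      using transpose_mult[OF c(4,1)] transpose_mult[OF c(2) T] by simp
    then show ?thesis using i[OF h] c T by simp
  qed
  show "tp (\<rho> h) * (T + tp T) * \<rho> h = T + tp T"
    unfolding mult_add_distrib_mat[OF c(2) T c(3)] using add_mult_distrib_mat[OF c(4) _ c(1), of "tp (\<rho> h) * tp T"] c i[OF h] t by simp
qed

text \<open>For equivariant \<open>m\<close> the products \<open>m c\<close> and \<open>b m\<close>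
  are invariant forms, hence antisymmetric, which gives \<open>m c = c m^T\<close> and
  \<open>b m = m^T b\<close>. With \<open>m = d^T\<close> and the symplectic relation
  \<open>b d^T = d b^T\<close> the matrix \<open>b d^T\<close> equals its own negative and vanishes;
  multiplying \<open>a d^T + c b = 1\<close> by \<open>b\<close> then yields
  \<open>b c b = b\<close>.\<close>

lemma core:
  assumes c4: "a \<in> MM" "c \<in> MM" "b \<in> MM" "d \<in> MM" and Z: "sp (fb a c b d)" "commD (fb a c b d)"
  shows "EndG a" "EndG (tp d)" "tp b = - b" "EndG (c * b)" "c * b * (c * b) = c * b"
    "EndG m ==> m * (c * b) = c * b * m" "b * (c * b) = b" "c * b * tp d = 0\<^sub>m n n" "EndG m ==> b * m = tp m * b"
    "a * tp d + c * b = 1\<^sub>m n" "a * tp c = c * tp a" "\<And>h. h \<in> carrier G ==> c * tp (\<rho> (inv h)) = \<rho> h * c"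
proof -
  note ct = transpose_carrier_mat[THEN iffD2, OF c4(1)] transpose_carrier_mat[THEN iffD2, OF c4(2)] transpose_carrier_mat[THEN iffD2, OF c4(3)] transpose_carrier_mat[THEN iffD2, OF c4(4)]
  have D: "a * \<rho> h = \<rho> h * a" "c * tp (\<rho> (inv h)) = \<rho> h * c" "b * \<rho> h = tp (\<rho> (inv h)) * b" "d * tp (\<rho> (inv h)) = tp (\<rho> (inv h)) * d"
    if h: "h \<in> carrier G" for h
  proof -
    have cc: "\<rho> h \<in> MM" "tp (\<rho> (inv h)) \<in> MM" using h by simp_all
    have "fb a c b d * Dg h = fb (a * \<rho> h) (c * tp (\<rho> (inv h))) (b * \<rho> h) (d * tp (\<rho> (inv h)))"
      unfolding Dg_def by (subst fb_mult) (use cc c4 in simp_all)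
    moreover have "Dg h * fb a c b d = fb (\<rho> h * a) (\<rho> h * c) (tp (\<rho> (inv h)) * b) (tp (\<rho> (inv h)) * d)"
      unfolding Dg_def by (subst fb_mult) (use cc c4 in simp_all)
    ultimately have "fb (a * \<rho> h) (c * tp (\<rho> (inv h))) (b * \<rho> h) (d * tp (\<rho> (inv h))) = fb (\<rho> h * a) (\<rho> h * c) (tp (\<rho> (inv h)) * b) (tp (\<rho> (inv h)) * d)"
      using Z(2) h unfolding commD_def by simp
    from fb_inj[OF _ _ _ _ _ _ _ _ this]
    show "a * \<rho> h = \<rho> h * a" "c * tp (\<rho> (inv h)) = \<rho> h * c" "b * \<rho> h = tp (\<rho> (inv h)) * b" "d * tp (\<rho> (inv h)) = tp (\<rho> (inv h)) * d"
      using cc c4 by simp_all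
  qed
  show Ea: "EndG a" using c4 D by (simp add: EndG_def)
  show "\<And>h. h \<in> carrier G ==> c * tp (\<rho> (inv h)) = \<rho> h * c" by (rule D)
  show Ed: "EndG (tp d)"
    unfolding EndG_def
  proof (intro conjI ballI)
    fix h assume h: "h \<in> carrier G"
    have cc: "tp (\<rho> h) \<in> MM" "\<rho> h \<in> MM" using h by simp_all
    have "tp (d * tp (\<rho> h)) = tp (tp (\<rho> h) * d)" using D(4)[of "inv h"] h by simp
    then show "tp d * \<rho> h = \<rho> h * tp d" using transpose_mult[OF c4(4) cc(1)] transpose_mult[OF cc(1) c4(4)] by simp
  qed (rule ct)
  have mc: "m * c = c * tp m" and bm: "b * m = tp m * b" if m: "EndG m" and anti: "tp c = - c" "tp b = - b" for m
  proof -
    have cm: "m \<in> MM" "tp m \<in> MM" using m by (simp_all add: EndG_def)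
    have "tp (m * c) = - (m * c)"
    proof (rule inv_antisym)
      show "m * c \<in> MM" using cm c4 by simp
      fix h assume h: "h \<in> carrier G"
      have cc: "tp (\<rho> h) \<in> MM" "\<rho> h \<in> MM" "tp (\<rho> (inv h)) \<in> MM" using h by simp_all
      have "\<rho> h * (m * c) * tp (\<rho> h) = (\<rho> h * m) * (c * tp (\<rho> h))" using cc cm c4 by simp
      also have "\<dots> = (m * \<rho> h) * (c * tp (\<rho> h))" using m h by (simp add: EndG_def)
      also have "\<dots> = m * ((\<rho> h * c) * tp (\<rho> h))" using cc cm c4 by simp
      also have "\<dots> = m * ((c * tp (\<rho> (inv h))) * tp (\<rho> h))" by (simp only: D(2)[OF h])
      also have "\<dots> = m * (c * (tp (\<rho> (inv h)) * tp (\<rho> h)))" using cc cm c4 by simp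
      finally show "\<rho> h * (m * c) * tp (\<rho> h) = m * c" using h c4 by simp
    qed
    then have "- (c * tp m) = - (m * c)" using transpose_mult[OF cm(1) c4(2)] anti(1) cm c4 by simp
    then show "m * c = c * tp m" using mat_neg_eq[of "c * tp m" n "m * c"] cm c4 by simp
    have "tp (b * m) = - (b * m)"
    proof (rule dual_inv_antisym)
      show "b * m \<in> MM" using cm c4 by simp
      fix h assume h: "h \<in> carrier G"
      have cc: "tp (\<rho> h) \<in> MM" "\<rho> h \<in> MM" "tp (\<rho> (inv h)) \<in> MM" using h by simp_all
      have "tp (\<rho> h) * (b * m) * \<rho> h = tp (\<rho> h) * (b * (m * \<rho> h))" using cc cm c4 by simp
      also have "\<dots> = tp (\<rho> h) * ((b * \<rho> h) * m)" using m h cc cm c4 by (simp add: EndG_def)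
      also have "\<dots> = (tp (\<rho> h) * tp (\<rho> (inv h))) * (b * m)" using cc cm c4 D(3)[OF h] by simp
      finally show "tp (\<rho> h) * (b * m) * \<rho> h = b * m" using h cm c4 by simp
    qed
    then have "- (tp m * b) = - (b * m)" using transpose_mult[OF c4(3) cm(1)] anti(2) cm c4 by simp
    then show "b * m = tp m * b" using mat_neg_eq[of "tp m * b" n "b * m"] cm c4 by simp
  qed
  have anti: "tp c = - c" "tp b = - b"
  proof -
    show "tp c = - c"
    proof (rule inv_antisym[OF c4(2)])
      fix h assume h: "h \<in> carrier G"
      have cc: "tp (\<rho> h) \<in> MM" "tp (\<rho> (inv h)) \<in> MM" using h by simp_all
      have "\<rho> h * c * tp (\<rho> h) = c * (tp (\<rho> (inv h)) * tp (\<rho> h))" unfolding D(2)[OF h, symmetric] using c4 cc by simp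
      then show "\<rho> h * c * tp (\<rho> h) = c" using h c4 by simp
    qed
    show "tp b = - b"
    proof (rule dual_inv_antisym[OF c4(3)])
      fix h assume h: "h \<in> carrier G"
      have cc: "tp (\<rho> h) \<in> MM" "tp (\<rho> (inv h)) \<in> MM" "\<rho> h \<in> MM" using h by simp_all
      have "tp (\<rho> h) * b * \<rho> h = tp (\<rho> h) * (b * \<rho> h)" using c4 cc by simp
      also have "\<dots> = (tp (\<rho> h) * tp (\<rho> (inv h))) * b" using c4 cc by (simp add: D(3)[OF h])
      finally show "tp (\<rho> h) * b * \<rho> h = b" using h c4 by simp
    qed
  qed
  show "tp b = - b" by (rule anti)
  note mc = mc[OF _ anti] and bm = bm[OF _ anti]
  have S: "a * tp c = c * tp a" "- (c * tp b) + a * tp d = 1\<^sub>m n" "b * tp d = d * tp b"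
  proof -
    have Ot: "Om * tp (fb a c b d) = fb (tp c) (tp d) (- tp a) (- tp b)"
      unfolding fb_tp[OF c4] Om_def by (subst fb_mult) (use ct c4 in simp_all)
    have "fb a c b d * (Om * tp (fb a c b d)) = fb (a * tp c + - (c * tp a)) (a * tp d + - (c * tp b)) (b * tp c + - (d * tp a)) (b * tp d + - (d * tp b))"
      unfolding Ot by (subst fb_mult) (use ct c4 in simp_all)
    then have e: "fb (a * tp c + - (c * tp a)) (a * tp d + - (c * tp b)) (b * tp c + - (d * tp a)) (b * tp d + - (d * tp b)) = fb (0\<^sub>m n n) (1\<^sub>m n) (- 1\<^sub>m n) (0\<^sub>m n n)"
      using Z(1) by (simp add: sp_def Om_def)
    from fb_inj[OF _ _ _ _ _ _ _ _ e] have r: "a * tp c + - (c * tp a) = 0\<^sub>m n n" "a * tp d + - (c * tp b) = 1\<^sub>m n" "b * tp d + - (d * tp b) = 0\<^sub>m n n"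
      using c4 ct by simp_all
    have cm: "X + Y = Y + X" if "X \<in> MM" "Y \<in> MM" for X Y using comm_add_mat that by blast
    show "a * tp c = c * tp a" by (rule mat_neg_add[of _ n]) (use r(1) cm[of "a * tp c" "- (c * tp a)"] c4 ct in simp_all)
    show "b * tp d = d * tp b" by (rule mat_neg_add[of _ n]) (use r(3) cm[of "b * tp d" "- (d * tp b)"] c4 ct in simp_all)
    show "- (c * tp b) + a * tp d = 1\<^sub>m n" using r(2) cm[of "a * tp d" "- (c * tp b)"] c4 ct by simp
  qed
  show "a * tp c = c * tp a" by (rule S)
  have one: "c * b + a * tp d = 1\<^sub>m n" using S(2) anti(2) c4 mat_uminus_uminus[of "c * b" n] by simp
  then show "a * tp d + c * b = 1\<^sub>m n" using comm_add_mat[of "a * tp d" n n "c * b"] c4 ct by simp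
  have bd: "b * tp d = 0\<^sub>m n n"
  proof (rule mat_self_neg)
    show "b * tp d \<in> MM" using c4 ct by simp
    have "b * tp d = d * b" using bm[OF Ed] by simp
    moreover have "b * tp d = - (d * b)" using S(3) anti(2) c4 by simp
    ultimately show "b * tp d = - (b * tp d)" by simp
  qed
  show bf: "b * (c * b) = b"
  proof -
    have "b = b * (c * b + a * tp d)" using one c4 by simp
    also have "\<dots> = b * (c * b) + b * (a * tp d)" by (rule mult_add_distrib_mat[of _ n n _ n]) (use c4 ct in simp_all)
    also have "b * (a * tp d) = (b * a) * tp d" using c4 ct by simp
    also have "\<dots> = tp a * (b * tp d)" unfolding bm[OF Ea] using c4 ct by simp
    finally show ?thesis using c4 ct by (simp add: bd)
  qed
  show Ef: "EndG (c * b)"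
    unfolding EndG_def
  proof (intro conjI ballI)
    fix h assume h: "h \<in> carrier G"
    have cc: "\<rho> h \<in> MM" "tp (\<rho> (inv h)) \<in> MM" using h by simp_all
    have "c * b * \<rho> h = c * (tp (\<rho> (inv h)) * b)" using c4 cc D(3)[OF h] by simp
    also have "\<dots> = (c * tp (\<rho> (inv h))) * b" using c4 cc by simp
    also have "\<dots> = \<rho> h * (c * b)" unfolding D(2)[OF h] using c4 cc by simp
    finally show "c * b * \<rho> h = \<rho> h * (c * b)" .
  qed (use c4 in simp)
  show "c * b * (c * b) = c * b" using c4 bf by simp
  show "c * b * tp d = 0\<^sub>m n n" using c4 ct by (simp add: bd)
  assume m: "EndG m"
  then have cm: "m \<in> MM" "tp m \<in> MM" by (simp_all add: EndG_def)
  show "b * m = tp m * b" by (rule bm[OF m])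
  have "m * (c * b) = (m * c) * b" using cm c4 by simp
  also have "\<dots> = c * (tp m * b)" unfolding mc[OF m] using cm c4 by simp
  also have "\<dots> = c * b * m" unfolding bm[OF m, symmetric] using cm c4 by simp
  finally show "m * (c * b) = c * b * m" .
qed

lemma xinv_blocks:
  assumes "a \<in> MM" "c \<in> MM" "b \<in> MM" "d \<in> MM"
  shows "xinv (fb a c b d) = fb (tp d) (- tp c) (- tp b) (tp a)"
proof -
  have "tp (fb a c b d) * Om' = fb (tp b) (- tp a) (tp d) (- tp c)"
    unfolding fb_tp[OF assms] Om'_def by (subst fb_mult) (use assms in simp_all)
  then show ?thesis unfolding xinv_def Om_def by simp (subst fb_mult, use assms in simp_all)
qed

text \<open>The lower left block of the quotient is \<open>b2 d1^T + d2 b1\<close>. Each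
  \<open>b\<close> reproduces itself under its idempotent \<open>c b\<close>, while that idempotent
  kills \<open>d^T\<close>; if the idempotents agree, both terms vanish.\<close>

lemma pair_lower_zero:
  fixes a1 c1 b1 d1 a2 c2 b2 d2 :: "complex mat"
  assumes c4: "a1 \<in> MM" "c1 \<in> MM" "b1 \<in> MM" "d1 \<in> MM" "a2 \<in> MM" "c2 \<in> MM" "b2 \<in> MM" "d2 \<in> MM"
    and Z1: "sp (fb a1 c1 b1 d1)" "commD (fb a1 c1 b1 d1)" and Z2: "sp (fb a2 c2 b2 d2)" "commD (fb a2 c2 b2 d2)"
    and eq: "c1 * b1 = c2 * b2"
  shows "\<exists>a c d. a \<in> MM \<and> c \<in> MM \<and> d \<in> MM \<and> fb a2 c2 b2 d2 * xinv (fb a1 c1 b1 d1) = fb a c (0\<^sub>m n n) d"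
proof -
  note K1 = core[OF c4(1-4) Z1] and K2 = core[OF c4(5-8) Z2]
  have ct: "tp a1 \<in> MM" "tp c1 \<in> MM" "tp b1 \<in> MM" "tp d1 \<in> MM" "tp d2 \<in> MM" using c4 by simp_all
  have "b2 * tp d1 = (b2 * (c2 * b2)) * tp d1" by (simp only: K2(7))
  also have "\<dots> = b2 * (c2 * b2 * tp d1)" using c4 ct by simp
  also have "\<dots> = 0\<^sub>m n n" unfolding eq[symmetric] K1(8) using c4 by simp
  finally have 1: "b2 * tp d1 = 0\<^sub>m n n" .
  have "d2 * b1 = b1 * tp d2" using K1(9)[OF K2(2)] by simp
  also have "\<dots> = (b1 * (c1 * b1)) * tp d2" by (simp only: K1(7))
  also have "\<dots> = b1 * (c1 * b1 * tp d2)" using c4 ct by simp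
  also have "\<dots> = 0\<^sub>m n n" unfolding eq K2(8) using c4 by simp
  finally have 2: "d2 * b1 = 0\<^sub>m n n" .
  have "fb a2 c2 b2 d2 * xinv (fb a1 c1 b1 d1) = fb (a2 * tp d1 + c2 * b1) (a2 * (- tp c1) + c2 * tp a1) (b2 * tp d1 + d2 * b1) (b2 * (- tp c1) + d2 * tp a1)"
    unfolding xinv_blocks[OF c4(1-4)] by (subst fb_mult) (use c4 ct K1(3) in simp_all)
  moreover have "b2 * tp d1 + d2 * b1 = 0\<^sub>m n n" by (simp add: 1 2)
  ultimately show ?thesis using c4 ct by (intro exI[of _ "a2 * tp d1 + c2 * b1"] exI[of _ "a2 * (- tp c1) + c2 * tp a1"] exI[of _ "b2 * (- tp c1) + d2 * tp a1"]) simp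
qed

text \<open>Comparing the right-hand blocks gives \<open>B2 d = a B1 + c\<close>. Multiplying by
  \<open>a^T\<close>, the inverse of \<open>d\<close>, leaves the extra term \<open>c a^T\<close>, a
  symmetric invariant of \<open>V\<close> and hence zero.\<close>

lemma upper_orbit:
  fixes a c d A1 C1 D1 Di A2 C2 D2 :: "complex mat"
  assumes c4: "a \<in> MM" "c \<in> MM" "d \<in> MM" and W: "sp (fb a c (0\<^sub>m n n) d)" "commD (fb a c (0\<^sub>m n n) d)"
    and B: "B1 \<in> MM" "B2 \<in> MM" and L: "A1 \<in> MM" "C1 \<in> MM" "D1 \<in> MM" "Di \<in> MM" "A2 \<in> MM" "C2 \<in> MM" "D2 \<in> MM" "D1 * Di = 1\<^sub>m n"
    and eq: "fb a c (0\<^sub>m n n) d * (Uu B1 * fb A1 (0\<^sub>m n n) C1 D1) = Uu B2 * fb A2 (0\<^sub>m n n) C2 D2"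
  shows "EndG a" "a * tp d = 1\<^sub>m n" "tp d * a = 1\<^sub>m n" "B2 = a * B1 * tp a"
proof -
  have z: "0\<^sub>m n n \<in> MM" by simp
  note K = core[OF c4(1,2) z c4(3) W]
  have ct: "tp a \<in> MM" "tp c \<in> MM" "tp d \<in> MM" using c4 by simp_all
  show "EndG a" by (rule K)
  show ad: "a * tp d = 1\<^sub>m n" using K(10) c4 ct by simp
  then show "tp d * a = 1\<^sub>m n" by (rule mat_mult_left_right_inverse[OF c4(1) ct(3)])
  have da: "d * tp a = 1\<^sub>m n" using arg_cong[OF ad, of tp] transpose_mult[OF c4(1) ct(3)] by simp
  have "Uu X * fb A (0\<^sub>m n n) C D = fb (A + X * C) (X * D) C D" if "X \<in> MM" "A \<in> MM" "C \<in> MM" "D \<in> MM" for X A C D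
    unfolding Uu_def by (subst fb_mult) (use that in simp_all)
  then have e: "fb a c (0\<^sub>m n n) d * fb (A1 + B1 * C1) (B1 * D1) C1 D1 = fb (A2 + B2 * C2) (B2 * D2) C2 D2" using eq B L by simp
  have "fb a c (0\<^sub>m n n) d * fb (A1 + B1 * C1) (B1 * D1) C1 D1 = fb (a * (A1 + B1 * C1) + c * C1) (a * (B1 * D1) + c * D1) (d * C1) (d * D1)"
    by (subst fb_mult) (use c4 B L in simp_all)
  then have e2: "fb (a * (A1 + B1 * C1) + c * C1) (a * (B1 * D1) + c * D1) (d * C1) (d * D1) = fb (A2 + B2 * C2) (B2 * D2) C2 D2" using e by simp
  from fb_inj[OF _ _ _ _ _ _ _ _ e2] have r: "a * (B1 * D1) + c * D1 = B2 * D2" "d * D1 = D2" using c4 B L by simp_all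
  have "(a * (B1 * D1) + c * D1) * Di = a * (B1 * D1) * Di + c * D1 * Di" by (rule add_mult_distrib_mat[of _ n n _ _ n]) (use c4 B L in simp_all)
  also have "\<dots> = a * B1 + c" using c4 B L by simp
  finally have "a * B1 + c = B2 * (d * D1) * Di" unfolding r by simp
  also have "\<dots> = B2 * d" using c4 B L by simp
  finally have Bd: "B2 * d = a * B1 + c" ..
  have "B2 = B2 * d * tp a" using c4 ct B da by simp
  also have "\<dots> = a * B1 * tp a + c * tp a" unfolding Bd by (rule add_mult_distrib_mat[of _ n n _ _ n]) (use c4 ct B in simp_all)
  also have "c * tp a = 0\<^sub>m n n"
  proof (rule inv0)
    show "c * tp a \<in> MM" using c4 by simp
    show "tp (c * tp a) = c * tp a" using transpose_mult[OF c4(2) ct(1)] K(11) by simp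
    fix k assume k: "k \<in> carrier G"
    have cc: "\<rho> k \<in> MM" "tp (\<rho> k) \<in> MM" "tp (\<rho> (inv k)) \<in> MM" using k by simp_all
    have t: "tp a * tp (\<rho> k) = tp (\<rho> k) * tp a"
      using transpose_mult[OF cc(1) c4(1)] transpose_mult[OF c4(1) cc(1)] K(1) k by (simp add: EndG_def)
    have "\<rho> k * (c * tp a) * tp (\<rho> k) = (\<rho> k * c) * (tp a * tp (\<rho> k))" using cc c4 ct by simp
    also have "\<dots> = c * (tp (\<rho> (inv k)) * tp (\<rho> k)) * tp a" unfolding t K(12)[OF k, symmetric] using cc c4 ct by simp
    finally show "\<rho> k * (c * tp a) * tp (\<rho> k) = c * tp a" using k c4 ct by simp
  qed
  finally show "B2 = a * B1 * tp a" using c4 ct B by simp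
qed

text \<open>Both matrices carry the same \<open>g\<close> to \<open>h\<close> with the same sign, so
  \<open>g\<close> and the sign cancel in the quotient; every \<open>h\<close> is reached by
  assumption.\<close>

lemma same_Rel_commD:
  assumes x0: "sp x0" and x: "sp x" and R: "Rel x = Rel x0" and ex: "\<forall>h\<in>carrier G. \<exists>g \<zeta>. (g, h, \<zeta>) \<in> Rel x0"
  shows "commD (x * xinv x0)"
  unfolding commD_def
proof
  fix h assume h: "h \<in> carrier G"
  then obtain g \<zeta> where m: "(g, h, \<zeta>) \<in> Rel x0" using ex by blast
  then have g: "g \<in> carrier G" and z: "\<zeta> * \<zeta> = 1" and e0: "x0 * Dg g = \<zeta> \<cdot>\<^sub>m (Dg h * x0)" by (auto simp: Rel_def)
  have e: "x * Dg g = \<zeta> \<cdot>\<^sub>m (Dg h * x)" using m unfolding R[symmetric] by (auto simp: Rel_def)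
  let ?y = "xinv x0"
  have c: "x0 \<in> MN" "x \<in> MN" using x0 x by (auto simp: sp_def)
  have cc: "?y \<in> MN" "Dg g \<in> MN" "Dg h \<in> MN" using c g h by simp_all
  note sm = mult_smult_distrib[of _ "n + n" "n + n" _ "n + n"] mult_smult_assoc_mat[of _ "n + n" "n + n" _ "n + n"]
  have "Dg g * ?y = (?y * x0) * Dg g * ?y" using c cc by (simp add: sp_inv(2)[OF x0])
  also have "\<dots> = ?y * (x0 * Dg g) * ?y" using c cc by simp
  also have "\<dots> = \<zeta> \<cdot>\<^sub>m (?y * (Dg h * (x0 * ?y)))" unfolding e0 using c cc by (simp add: sm)
  also have "\<dots> = \<zeta> \<cdot>\<^sub>m (?y * Dg h)" using cc by (simp add: sp_inv(1)[OF x0])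
  finally have y: "\<zeta> \<cdot>\<^sub>m (Dg g * ?y) = ?y * Dg h" using z by (simp add: smult_rules)
  have "x * ?y * Dg h = x * (\<zeta> \<cdot>\<^sub>m (Dg g * ?y))" unfolding y using c cc by simp
  also have "\<dots> = \<zeta> \<cdot>\<^sub>m ((x * Dg g) * ?y)" using c cc by (simp add: sm)
  also have "\<dots> = Dg h * (x * ?y)" unfolding e using c cc z by (simp add: sm smult_rules)
  finally show "x * ?y * Dg h = Dg h * (x * ?y)" .
qed

theorem finite_orbits:
  assumes Bs: "\<And>B1. B1 \<in> Bs ==> B1 \<in> MM \<and> (\<exists>x. sdat B B1 x)"
    and orb: "\<And>B1 B2 w wi. B1 \<in> Bs ==> B2 \<in> Bs ==> EndG w ==> wi \<in> MM ==> w * wi = 1\<^sub>m n ==> wi * w = 1\<^sub>m n ==>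
      B2 = w * B1 * tp w ==> orb B1 = orb B2"
  shows "finite (orb ` Bs)"
proof -
  define X where "X B1 = (SOME x. sdat B B1 x)" for B1
  have X: "sdat B B1 (X B1)" if "B1 \<in> Bs" for B1 unfolding X_def using Bs[OF that] by (metis someI_ex)
  define U where "U = carrier G \<times> carrier G \<times> {1, -1 :: complex}"
  have fU: "finite (Pow U)" using fin by (simp add: U_def)
  have RU: "Rel x \<in> Pow U" for x by (auto simp: Rel_def U_def)
  have fR: "finite (orb ` {B1 \<in> Bs. Rel (X B1) = R})" for R
  proof (cases "{B1 \<in> Bs. Rel (X B1) = R} = {}")
    case False
    define S where "S = {B1 \<in> Bs. Rel (X B1) = R}"
    obtain B0 where B0: "B0 \<in> S" using False by (auto simp: S_def)
    \<comment> \<open>One solution per value of \<open>Rel\<close> serves as base point; the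
      quotients by it commute with \<open>G\<close> and are subject to \<open>core\<close>.\<close>
    define x0 where "x0 = X B0"
    have s0: "sp x0" and ex: "\<forall>h\<in>carrier G. \<exists>g \<zeta>. (g, h, \<zeta>) \<in> Rel x0"
      using X[of B0] B0 by (auto simp: S_def sdat_def x0_def)
    have cx0: "x0 \<in> MN" using s0 by (simp add: sp_def)
    define Z where "Z B1 = X B1 * xinv x0" for B1
    have sX: "sp (X B1)" if "B1 \<in> S" for B1 using X[of B1] that by (auto simp: S_def sdat_def)
    have RR: "Rel (X B1) = Rel x0" if "B1 \<in> S" for B1 using that B0 by (simp add: S_def x0_def)
    have Z: "sp (Z B1)" "commD (Z B1)" if "B1 \<in> S" for B1
      unfolding Z_def by (rule sp_mult[OF sX[OF that] sp_xinv[OF s0]]) (rule same_Rel_commD[OF s0 sX[OF that] RR[OF that] ex])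
    have "\<forall>B1\<in>S. \<exists>q. fst q \<in> MM \<and> fst (snd q) \<in> MM \<and> fst (snd (snd q)) \<in> MM \<and> snd (snd (snd q)) \<in> MM \<and>
      Z B1 = fb (fst q) (fst (snd q)) (fst (snd (snd q))) (snd (snd (snd q)))"
    proof
      fix B1 assume "B1 \<in> S"
      then have "Z B1 \<in> MN" using Z by (simp add: sp_def)
      from fb_split[OF this] obtain a b c d where "a \<in> MM \<and> b \<in> MM \<and> c \<in> MM \<and> d \<in> MM \<and> Z B1 = fb a b c d" by blast
      then show "\<exists>q. fst q \<in> MM \<and> fst (snd q) \<in> MM \<and> fst (snd (snd q)) \<in> MM \<and> snd (snd (snd q)) \<in> MM \<and>
        Z B1 = fb (fst q) (fst (snd q)) (fst (snd (snd q))) (snd (snd (snd q)))" by (intro exI[of _ "(a, b, c, d)"]) simp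
    qed
    from bchoice[OF this] obtain q where q: "\<And>B1. B1 \<in> S ==> fst (q B1) \<in> MM \<and> fst (snd (q B1)) \<in> MM \<and> fst (snd (snd (q B1))) \<in> MM \<and> snd (snd (snd (q B1))) \<in> MM \<and>
      Z B1 = fb (fst (q B1)) (fst (snd (q B1))) (fst (snd (snd (q B1)))) (snd (snd (snd (q B1))))" by blast
    define a c b d where "a B1 = fst (q B1)" and "c B1 = fst (snd (q B1))" and "b B1 = fst (snd (snd (q B1)))" and "d B1 = snd (snd (snd (q B1)))" for B1
    have q4: "a B1 \<in> MM" "c B1 \<in> MM" "b B1 \<in> MM" "d B1 \<in> MM" "Z B1 = fb (a B1) (c B1) (b B1) (d B1)" if "B1 \<in> S" for B1
      using q[OF that] by (simp_all add: a_def b_def c_def d_def)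
    have ZZ: "sp (fb (a B1) (c B1) (b B1) (d B1))" "commD (fb (a B1) (c B1) (b B1) (d B1))" if "B1 \<in> S" for B1
      using Z[OF that] q4(5)[OF that] by simp_all
    note cores = core[OF q4(1-4) ZZ]
    define F where "F B1 = c B1 * b B1" for B1
    have "finite (F ` S)"
    proof (rule finite_commuting_idempotents)
      show "F ` S \<subseteq> carrier_mat n n" using q4 by (auto simp: F_def)
      show "f * f = f" if "f \<in> F ` S" for f using that cores(5) by (auto simp: F_def)
      show "f * g = g * f" if "f \<in> F ` S" "g \<in> F ` S" for f g
        using that cores(4) cores(6) unfolding F_def by blast
    qed
    moreover have "orb B1 = orb B2" if B: "B1 \<in> S" "B2 \<in> S" and e: "F B1 = F B2" for B1 B2
    proof -
      obtain a' c' d' where W: "a' \<in> MM" "c' \<in> MM" "d' \<in> MM" "Z B2 * xinv (Z B1) = fb a' c' (0\<^sub>m n n) d'"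
        using pair_lower_zero[OF q4(1-4)[OF B(1)] q4(1-4)[OF B(2)] ZZ[OF B(1)] ZZ[OF B(2)]] e
        unfolding q4(5)[OF B(1), symmetric] q4(5)[OF B(2), symmetric] F_def by blast
      have cZ: "Z B1 \<in> MN" "Z B2 \<in> MN" "X B1 \<in> MN" "X B2 \<in> MN" "xinv x0 \<in> MN" "xinv (Z B1) \<in> MN"
        using Z(1)[OF B(1)] Z(1)[OF B(2)] sX[OF B(1)] sX[OF B(2)] cx0 by (simp_all add: sp_def)
      have sW: "sp (fb a' c' (0\<^sub>m n n) d')" "commD (fb a' c' (0\<^sub>m n n) d')"
        unfolding W(4)[symmetric] using Z[OF B(1)] Z[OF B(2)] cZ by (auto intro!: sp_mult sp_xinv commD_mult commD_xinv)
      have Zx: "Z B' * x0 = X B'" if "X B' \<in> MN" for B'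
        unfolding Z_def using that cx0 cZ(5) by (simp add: sp_inv(2)[OF s0])
      have "fb a' c' (0\<^sub>m n n) d' * X B1 = Z B2 * (xinv (Z B1) * Z B1) * x0"
        unfolding W(4)[symmetric] using Zx[OF cZ(3)] cZ cx0 by simp
      also have "\<dots> = X B2" using cZ cx0 by (simp add: sp_inv(2)[OF Z(1)[OF B(1)]] Zx)
      finally have WX: "fb a' c' (0\<^sub>m n n) d' * X B1 = X B2" .
      have Bm: "B1 \<in> Bs" "B2 \<in> Bs" "B1 \<in> MM" "B2 \<in> MM" using B Bs by (auto simp: S_def)
      obtain A1 C1 D1 Di where 1: "A1 \<in> MM" "C1 \<in> MM" "D1 \<in> MM" "Di \<in> MM" "D1 * Di = 1\<^sub>m n" "X B1 * Uu B = Uu B1 * fb A1 (0\<^sub>m n n) C1 D1"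
        using X[OF Bm(1)] unfolding sdat_def by blast
      obtain A2 C2 D2 where 2: "A2 \<in> MM" "C2 \<in> MM" "D2 \<in> MM" "X B2 * Uu B = Uu B2 * fb A2 (0\<^sub>m n n) C2 D2"
        using X[OF Bm(2)] unfolding sdat_def by blast
      have "fb a' c' (0\<^sub>m n n) d' * (Uu B1 * fb A1 (0\<^sub>m n n) C1 D1) = fb a' c' (0\<^sub>m n n) d' * X B1 * Uu B"
        unfolding 1(6)[symmetric] using W cZ by simp
      also have "\<dots> = Uu B2 * fb A2 (0\<^sub>m n n) C2 D2" unfolding WX by (rule 2)
      finally have eq: "fb a' c' (0\<^sub>m n n) d' * (Uu B1 * fb A1 (0\<^sub>m n n) C1 D1) = Uu B2 * fb A2 (0\<^sub>m n n) C2 D2" .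
      note uo = upper_orbit[OF W(1-3) sW Bm(3,4) 1(1-4) 2(1-3) 1(5) eq]
      show "orb B1 = orb B2" by (rule orb[OF Bm(1,2) uo(1) _ uo(2,3,4)]) (use W in simp)
    qed
    ultimately have "finite (orb ` S)" by (rule finite_image_factor)
    then show ?thesis by (simp add: S_def)
  next
    case True
    then show ?thesis by (simp only: image_empty finite.emptyI)
  qed
  have "orb ` Bs = (\<Union>R\<in>Pow U. orb ` {B1 \<in> Bs. Rel (X B1) = R})" using RU by blast
  then show ?thesis using fU fR by simp
qed

end

lemma mm_entry: "X \<in> MM ==> Y \<in> MM ==> i < n ==> j < n ==> (X * Y) $$ (i, j) = (\<Sum>k<n. X $$ (i, k) * Y $$ (k, j))"
  by (simp add: scalar_prod_def lessThan_atLeast0)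

lemma sp_Uu: "S \<in> MM ==> tp S = S ==> sp (Uu S)"
proof -
  assume S: "S \<in> MM" "tp S = S"
  have n: "S + - S = 0\<^sub>m n n" using S by (intro eq_matI) auto
  have "tp (Uu S) = fb (1\<^sub>m n) (0\<^sub>m n n) S (1\<^sub>m n)" unfolding Uu_def by (subst fb_tp) (use S in simp_all)
  then have "Om * tp (Uu S) = fb S (1\<^sub>m n) (- 1\<^sub>m n) (0\<^sub>m n n)" unfolding Om_def by simp (subst fb_mult, use S in simp_all)
  then have "Uu S * (Om * tp (Uu S)) = Om" unfolding Uu_def Om_def by simp (subst fb_mult, use S n in simp_all)
  then show ?thesis by (simp add: sp_def)
qed

end

lemma mat_group_rules:
  fixes X Y W :: "complex mat"
  shows "X \<in> carrier_mat n n ==> Y \<in> carrier_mat n n ==> - X + (X - Y) = - Y"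
    "X \<in> carrier_mat n n ==> Y \<in> carrier_mat n n ==> (X - Y) + Y = X"
    "X \<in> carrier_mat n n ==> Y \<in> carrier_mat n n ==> X - Y = X + - Y"
    "X \<in> carrier_mat n n ==> X + - X = 0\<^sub>m n n"
    "X \<in> carrier_mat n n ==> Y \<in> carrier_mat n n ==> (X + Y) + - Y = X"
    "X \<in> carrier_mat n n ==> Y \<in> carrier_mat n n ==> (X + - Y) + Y = X"
  by (auto intro!: eq_matI)

section \<open>The symplectic matrix attached to twist data\<close>

context twist_data
begin

text \<open>In matrix form \<open>relations\<close> becomes the identities \<open>I1\<close> to
  \<open>I6\<close>. They say that the triangular matrix \<open>y\<close> intertwines the conjugates
  of \<open>Dg g\<close> and of the signed \<open>Dg h\<close> by the shears of \<open>B\<close> and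
  \<open>B'\<close>.\<close>

theorem sdat_exists: "\<exists>x. sdat B B' x"
proof -
  define E where "E = mat n n (\<lambda>(l, q). \<eta> l q)"
  define Ei where "Ei = mat n n (\<lambda>(l, q). \<eta>i l q)"
  define b2 where "b2 = mat n n (\<lambda>(r, q). 2 * b r q)"
  \<comment> \<open>The relations compare \<open>E\<close> with the transposed inverse of
    \<open>E\<close> up to a factor \<open>\<sigma>\<close>; a square root distributes it evenly
    over \<open>A\<close> and \<open>Ai\<close>.\<close>
  define \<tau> where "\<tau> = csqrt \<sigma>"
  have \<tau>: "\<tau> * \<tau> = \<sigma>" "\<tau> ~= 0" using sigma_nz by (simp_all add: \<tau>_def power2_eq_square[symmetric])
  define A where "A = \<tau> \<cdot>\<^sub>m E"
  define Ai where "Ai = (1 / \<tau>) \<cdot>\<^sub>m Ei"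
  have c [simp]: "E \<in> MM" "Ei \<in> MM" "b2 \<in> MM" "A \<in> MM" "Ai \<in> MM" by (simp_all add: E_def Ei_def b2_def A_def Ai_def)
  have ct [simp]: "tp A \<in> MM" "tp Ai \<in> MM" by simp_all
  note sm = mult_smult_distrib[of _ n n _ n] mult_smult_assoc_mat[of _ n n _ n] smult_rules
  have b2s [simp]: "tp b2 = b2" using b_sym by (intro eq_matI) (auto simp: b2_def)
  have EE: "E * Ei = 1\<^sub>m n" "Ei * E = 1\<^sub>m n"
  proof -
    have ent: "(E * Ei) $$ (p, q) = (1\<^sub>m n :: complex mat) $$ (p, q)" "(Ei * E) $$ (p, q) = (1\<^sub>m n :: complex mat) $$ (p, q)" if "p < n" "q < n" for p q
      using that eta_inv[OF that] by (simp_all add: mm_entry E_def Ei_def del: index_mult_mat)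
    show "E * Ei = 1\<^sub>m n" "Ei * E = 1\<^sub>m n"
      using carrier_matD[OF c(1)] carrier_matD[OF c(2)] ent by (auto intro!: eq_matI simp del: index_mult_mat(1) index_one_mat(1))
  qed
  have AA: "A * Ai = 1\<^sub>m n" "Ai * A = 1\<^sub>m n" using \<tau> by (simp_all add: A_def Ai_def sm EE)
  have AAt: "tp Ai * tp A = 1\<^sub>m n" "tp A * tp Ai = 1\<^sub>m n"
    using arg_cong[OF AA(1), of tp] arg_cong[OF AA(2), of tp] by (simp_all add: transpose_mult[of _ n n _ n])
  have cancA: "Ai * (A * M) = M" "A * (Ai * M) = M" "tp Ai * (tp A * M) = M" if "M \<in> MM" for M
    using that AA AAt assoc_mult_mat[OF c(5,4) that] assoc_mult_mat[OF c(4,5) that] assoc_mult_mat[OF ct(2,1) that] by simp_all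
  \<comment> \<open>\<open>b2\<close> is symmetric because \<open>b\<close> is, and this makes the
    lower triangular \<open>y\<close> below symplectic.\<close>
  define C where "C = - (tp Ai * b2)"
  have cC [simp]: "C \<in> MM" by (simp add: C_def)
  define y where "y = fb A (0\<^sub>m n n) C (tp Ai)"
  have cy [simp]: "y \<in> MN" by (simp add: y_def)
  define x where "x = Uu B' * (y * Uu (- B))"
  have nB: "- B \<in> MM" "tp (- B) = - B" using B B_sym by (simp_all add: transpose_uminus)
  have sy: "sp y"
  proof -
    have tC: "tp C = - (b2 * Ai)" by (simp add: C_def transpose_uminus transpose_mult[of _ n n _ n])
    have "tp y = fb (tp A) (tp C) (0\<^sub>m n n) Ai" unfolding y_def by (subst fb_tp) simp_all
    then have "Om * tp y = fb (0\<^sub>m n n) Ai (- tp A) (b2 * Ai)" unfolding Om_def by simp (subst fb_mult, simp_all add: tC)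
    moreover have "C * Ai + tp Ai * (b2 * Ai) = 0\<^sub>m n n"
      using comm_add_mat[of "- (tp Ai * (b2 * Ai))" n n "tp Ai * (b2 * Ai)"] by (simp add: C_def mat_group_rules(4))
    ultimately have "y * (Om * tp y) = Om" unfolding y_def Om_def by simp (subst fb_mult, simp_all add: AA AAt)
    then show ?thesis by (simp add: sp_def)
  qed
  have sx: "sp x" unfolding x_def by (intro sp_mult sp_Uu sy B B_sym nB)
  have U1: "Uu (- B) * Uu B = 1\<^sub>m (n + n)"
  proof -
    have "B + - B = 0\<^sub>m n n" using B by (rule_tac mat_group_rules(4))
    then have "Uu (- B) * Uu B = fb (1\<^sub>m n) (0\<^sub>m n n) (0\<^sub>m n n) (1\<^sub>m n)" unfolding Uu_def by (subst fb_mult) (use B nB in simp_all)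
    then show ?thesis by simp
  qed
  have xU: "x * Uu B = Uu B' * y" unfolding x_def by (simp add: U1)
  have rel: "\<exists>g \<zeta>. (g, h, \<zeta>) \<in> Rel x" if h: "h \<in> carrier G" for h
  proof -
    obtain g where g: "g \<in> carrier G" "f (eb h) = eb g" using eb_image[OF h] by blast
    from relations[OF g(1) h g(2)] obtain z K K2 where zz: "(z * \<sigma>)\<^sup>2 = 1" and rr: "\<And>r q. r < n ==> q < n ==>
      \<sigma> * (\<Sum>p<n. K p r * (\<Sum>l<n. \<rho> (inv h) $$ (p, l) * \<eta> l q)) = \<rho> (inv g) $$ (r, q) - (\<Sum>l<n. 2 * gb g B l r * b l q) \<and>
      (\<Sum>p<n. K p r * \<eta> p q) = (if q = r then z else 0) \<and>
      2 * (\<Sum>l<n. K l r * bet B' h (l, q)) = (\<Sum>p<n. 2 * gb g B p r * (\<Sum>l<n. \<rho> (inv h) $$ (q, l) * \<eta> l p)) \<and>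
      \<sigma> * (\<Sum>p<n. K2 p r * (\<Sum>l<n. \<rho> (inv h) $$ (p, l) * \<eta> l q)) = (\<Sum>l<n. \<rho> g $$ (l, r) * b l q) \<and>
      (\<Sum>p<n. K2 p r * \<eta> p q) = z * b r q" by blast
    define \<zeta> where "\<zeta> = z * \<sigma>"
    have \<zeta>: "\<zeta> = 1 \<or> \<zeta> = - 1" using zz by (simp add: \<zeta>_def power2_eq_1_iff)
    then have z1: "\<zeta> * \<zeta> = 1" by auto
    define gm gi hm hi where "gm = \<rho> g" and "gi = \<rho> (inv g)" and "hm = \<rho> h" and "hi = \<rho> (inv h)"
    have cg [simp]: "gm \<in> MM" "gi \<in> MM" "hm \<in> MM" "hi \<in> MM" using g h by (simp_all add: gm_def gi_def hm_def hi_def)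
    have gg: "gm * gi = 1\<^sub>m n" "gi * gm = 1\<^sub>m n" "hm * hi = 1\<^sub>m n" "hi * hm = 1\<^sub>m n" using g h by (simp_all add: gm_def gi_def hm_def hi_def)
    define \<Gamma> where "\<Gamma> = mat n n (bet B g)"
    define \<Gamma>' where "\<Gamma>' = mat n n (bet B' h)"
    have cG [simp]: "\<Gamma> \<in> MM" "\<Gamma>' \<in> MM" by (simp_all add: \<Gamma>_def \<Gamma>'_def)
    have Gs [simp]: "tp \<Gamma> = \<Gamma>" "tp \<Gamma>' = \<Gamma>'"
      using bet_sym[OF g(1) B(1) B_sym(1)] bet_sym[OF h B(2) B_sym(2)] by (auto intro!: eq_matI simp: \<Gamma>_def \<Gamma>'_def)
    \<comment> \<open>By \<open>\<gamma>e\<close> this is the upper right block of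
      \<open>Dg g\<close> conjugated by the shear of \<open>B\<close>.\<close>
    define \<gamma> where "\<gamma> = gm * \<Gamma>"
    have c\<gamma> [simp]: "\<gamma> \<in> MM" by (simp add: \<gamma>_def)
    have conv: "\<rho> k * mat n n (bet S k) = \<rho> k * S - S * tp (\<rho> (inv k))" if k: "k \<in> carrier G" and S: "S \<in> MM" for k S
    proof -
      have ck: "\<rho> k \<in> MM" "\<rho> (inv k) \<in> MM" "tp (\<rho> (inv k)) \<in> MM" "\<rho> (inv k) * S * tp (\<rho> (inv k)) \<in> MM" using k S by simp_all
      have "mat n n (bet S k) = S - \<rho> (inv k) * S * tp (\<rho> (inv k))"
        using S ck by (intro eq_matI) (simp_all add: bet_def conjB_def del: index_mult_mat(1) assoc_mult_mat mat_rules(1))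
      then have "\<rho> k * mat n n (bet S k) = \<rho> k * S - \<rho> k * (\<rho> (inv k) * S * tp (\<rho> (inv k)))"
        using mult_minus_distrib_mat[OF ck(1) S ck(4)] by simp
      also have "\<rho> k * (\<rho> (inv k) * S * tp (\<rho> (inv k))) = (\<rho> k * \<rho> (inv k)) * S * tp (\<rho> (inv k))" using ck S by simp
      finally show ?thesis using k S by simp
    qed
    have \<gamma>e: "\<gamma> = gm * B - B * tp gi" using conv[OF g(1) B(1)] by (simp add: \<gamma>_def \<Gamma>_def gm_def gi_def)
    \<comment> \<open>The sign is attached to \<open>h\<close> and to its inverse at once; as its
      square is \<open>1\<close>, the two remain inverse to each other.\<close>
    define Hz Hi where "Hz = \<zeta> \<cdot>\<^sub>m hm" and "Hi = \<zeta> \<cdot>\<^sub>m hi"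
    have cH [simp]: "Hz \<in> MM" "Hi \<in> MM" by (simp_all add: Hz_def Hi_def)
    have HH: "Hz * Hi = 1\<^sub>m n" "Hi * Hz = 1\<^sub>m n" by (simp_all add: Hz_def Hi_def sm gg z1)
    define \<gamma>' where "\<gamma>' = Hz * \<Gamma>'"
    have c\<gamma>' [simp]: "\<gamma>' \<in> MM" by (simp add: \<gamma>'_def)
    have smm: "k \<cdot>\<^sub>m (X - Y) = k \<cdot>\<^sub>m X - k \<cdot>\<^sub>m Y" if "X \<in> MM" "Y \<in> MM" for k :: complex and X Y
      using that by (intro eq_matI) (auto simp: algebra_simps)
    have tsm: "tp (k \<cdot>\<^sub>m X) = k \<cdot>\<^sub>m tp X" for k X by (intro eq_matI) auto
    have \<gamma>'e: "\<gamma>' = Hz * B' - B' * tp Hi"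
      using conv[OF h B(2)] B by (simp add: \<gamma>'_def \<Gamma>'_def Hz_def Hi_def hm_def[symmetric] hi_def[symmetric] sm smm tsm)
    have gbe: "gb g B l r = \<gamma> $$ (l, r)" if "l < n" "r < n" for l r
      using that by (simp add: gb_def[OF g(1) B(1)] \<gamma>_def mm_entry \<Gamma>_def gm_def[symmetric] del: index_mult_mat)
    have hE: "(\<Sum>l<n. \<rho> (inv h) $$ (p, l) * \<eta> l q) = (hi * E) $$ (p, q)" if "p < n" "q < n" for p q
      using that by (simp add: mm_entry E_def hi_def[symmetric] del: index_mult_mat)
    define Km where "Km = mat n n (\<lambda>(r, p). K p r)"
    define K2m where "K2m = mat n n (\<lambda>(r, p). K2 p r)"
    have cK [simp]: "Km \<in> MM" "K2m \<in> MM" by (simp_all add: Km_def K2m_def)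
    have "Km * E = z \<cdot>\<^sub>m 1\<^sub>m n"
    proof (rule eq_matI)
      fix i j assume "i < dim_row (z \<cdot>\<^sub>m 1\<^sub>m n)" "j < dim_col (z \<cdot>\<^sub>m 1\<^sub>m n)"
      then show "(Km * E) $$ (i, j) = (z \<cdot>\<^sub>m 1\<^sub>m n) $$ (i, j)" using rr[of i j] by (simp add: mm_entry Km_def E_def del: index_mult_mat(1))
    qed (simp_all add: Km_def E_def)
    then have "Km * (E * Ei) = z \<cdot>\<^sub>m Ei" using assoc_mult_mat[OF cK(1) c(1,2)] by (simp add: sm)
    then have Ke: "Km = z \<cdot>\<^sub>m Ei" by (simp add: EE)
    have "K2m * E = (z / 2) \<cdot>\<^sub>m b2"
    proof (rule eq_matI)
      fix i j assume "i < dim_row ((z / 2) \<cdot>\<^sub>m b2)" "j < dim_col ((z / 2) \<cdot>\<^sub>m b2)"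
      then show "(K2m * E) $$ (i, j) = ((z / 2) \<cdot>\<^sub>m b2) $$ (i, j)" using rr[of i j] by (simp add: mm_entry K2m_def E_def b2_def del: index_mult_mat(1))
    qed (simp_all add: K2m_def E_def b2_def)
    then have "K2m * (E * Ei) = (z / 2) \<cdot>\<^sub>m (b2 * Ei)" using assoc_mult_mat[OF cK(2) c(1,2)] by (simp add: sm)
    then have K2e: "K2m = (z / 2) \<cdot>\<^sub>m (b2 * Ei)" by (simp add: EE)
    \<comment> \<open>The signed inverse of \<open>h\<close> in the basis given by \<open>A\<close>.
      The relations for \<open>K\<close> and \<open>K2\<close> express it and its product with
      \<open>b2\<close> (\<open>I1\<close>, \<open>I4\<close>); transposing these gives
      \<open>I2\<close> and \<open>I5\<close>.\<close>
    define J where "J = Ai * (Hi * A)"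
    have cJ [simp]: "J \<in> MM" by (simp add: J_def)
    have Je: "J = \<zeta> \<cdot>\<^sub>m (Ei * (hi * E))" using \<tau> by (simp add: J_def Ai_def A_def Hi_def sm)
    have tg [simp]: "tp gm \<in> MM" "tp gi \<in> MM" "tp \<gamma> \<in> MM" "tp Hi \<in> MM" "tp hi \<in> MM" "hi * E \<in> MM" "tp (hi * E) \<in> MM" by simp_all
    have I1: "J = gi - tp \<gamma> * b2"
    proof -
      have "\<sigma> \<cdot>\<^sub>m (Km * (hi * E)) = gi - tp \<gamma> * b2"
      proof (rule eq_matI)
        fix i j assume "i < dim_row (gi - tp \<gamma> * b2)" "j < dim_col (gi - tp \<gamma> * b2)"
        then have ij: "i < n" "j < n" using carrier_matD[OF tg(3)] carrier_matD[OF c(3)] by auto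
        have "(\<sigma> \<cdot>\<^sub>m (Km * (hi * E))) $$ (i, j) = \<sigma> * (\<Sum>p<n. K p i * (\<Sum>l<n. \<rho> (inv h) $$ (p, l) * \<eta> l j))"
          using ij mm_entry[OF cK(1) tg(6) ij] carrier_matD[OF cK(1)] carrier_matD[OF c(1)] by (simp add: hE Km_def del: index_mult_mat(1) mat_rules)
        also have "\<dots> = gi $$ (i, j) - (\<Sum>l<n. \<gamma> $$ (l, i) * (2 * b l j))"
          using rr[OF ij] ij by (simp add: gbe gi_def mult_ac)
        also have "\<dots> = (gi - tp \<gamma> * b2) $$ (i, j)"
          using ij mm_entry[OF tg(3) c(3) ij] carrier_matD[OF c\<gamma>] by (simp add: b2_def del: index_mult_mat(1))
        finally show "(\<sigma> \<cdot>\<^sub>m (Km * (hi * E))) $$ (i, j) = (gi - tp \<gamma> * b2) $$ (i, j)" .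
      qed (use carrier_matD[OF c(3)] carrier_matD[OF c(1)] carrier_matD[OF cK(1)] carrier_matD[OF c\<gamma>] in simp_all)
      then show ?thesis by (simp add: Je Ke sm \<zeta>_def mult.commute)
    qed
    have I4: "b2 * J = tp gm * b2"
    proof -
      have "(2 * \<sigma>) \<cdot>\<^sub>m (K2m * (hi * E)) = tp gm * b2"
      proof (rule eq_matI)
        fix i j assume "i < dim_row (tp gm * b2)" "j < dim_col (tp gm * b2)"
        then have ij: "i < n" "j < n" using carrier_matD[OF tg(1)] carrier_matD[OF c(3)] by auto
        have "((2 * \<sigma>) \<cdot>\<^sub>m (K2m * (hi * E))) $$ (i, j) = 2 * (\<sigma> * (\<Sum>p<n. K2 p i * (\<Sum>l<n. \<rho> (inv h) $$ (p, l) * \<eta> l j)))"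
          using ij mm_entry[OF cK(2) tg(6) ij] carrier_matD[OF cK(2)] carrier_matD[OF c(1)] by (simp add: hE K2m_def del: index_mult_mat(1) mat_rules)
        also have "\<dots> = (\<Sum>l<n. gm $$ (l, i) * (2 * b l j))"
          using rr[OF ij] by (simp add: gm_def sum_distrib_left mult_ac)
        also have "\<dots> = (tp gm * b2) $$ (i, j)"
          using ij mm_entry[OF tg(1) c(3) ij] carrier_matD[OF cg(1)] by (simp add: b2_def del: index_mult_mat(1))
        finally show "((2 * \<sigma>) \<cdot>\<^sub>m (K2m * (hi * E))) $$ (i, j) = (tp gm * b2) $$ (i, j)" .
      qed (use carrier_matD[OF c(3)] carrier_matD[OF c(1)] carrier_matD[OF cK(2)] carrier_matD[OF cg(1)] in simp_all)
      then show ?thesis by (simp add: Je K2e sm \<zeta>_def mult.commute)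
    qed
    have I3: "A * \<gamma> = \<gamma>' * tp Ai"
    proof -
      have "Km * \<Gamma>' = tp \<gamma> * tp (hi * E)"
      proof (rule eq_matI)
        fix i j assume "i < dim_row (tp \<gamma> * tp (hi * E))" "j < dim_col (tp \<gamma> * tp (hi * E))"
        then have ij: "i < n" "j < n" by (simp_all only: carrier_matD[OF mult_carrier_mat[OF tg(3) tg(7)]])
        have "2 * (Km * \<Gamma>') $$ (i, j) = 2 * (\<Sum>l<n. K l i * bet B' h (l, j))"
          using ij mm_entry[OF cK(1) cG(2) ij] by (simp add: Km_def \<Gamma>'_def del: index_mult_mat(1))
        also have "\<dots> = (\<Sum>p<n. 2 * gb g B p i * (\<Sum>l<n. \<rho> (inv h) $$ (j, l) * \<eta> l p))" using rr[OF ij] by blast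
        also have "\<dots> = (\<Sum>p<n. 2 * \<gamma> $$ (p, i) * (hi * E) $$ (j, p))"
        proof (intro sum.cong refl)
          fix p assume "p \<in> {..<n}"
          then have p: "p < n" by simp
          show "2 * gb g B p i * (\<Sum>l<n. \<rho> (inv h) $$ (j, l) * \<eta> l p) = 2 * \<gamma> $$ (p, i) * (hi * E) $$ (j, p)"
            by (simp only: gbe[OF p ij(1)] hE[OF ij(2) p])
        qed
        also have "\<dots> = 2 * (\<Sum>p<n. \<gamma> $$ (p, i) * (hi * E) $$ (j, p))"
          by (simp only: sum_distrib_left mult.assoc)
        also have "\<dots> = 2 * (tp \<gamma> * tp (hi * E)) $$ (i, j)"
          using ij mm_entry[OF tg(3) tg(7) ij] carrier_matD[OF c\<gamma>] carrier_matD[OF tg(6)] by (simp del: index_mult_mat mat_rules)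
        finally show "(Km * \<Gamma>') $$ (i, j) = (tp \<gamma> * tp (hi * E)) $$ (i, j)" by simp
      qed (use carrier_matD[OF c(1)] carrier_matD[OF cK(1)] carrier_matD[OF c\<gamma>] carrier_matD[OF cG(2)] carrier_matD[OF cg(4)] in simp_all)
      then have "tp (z \<cdot>\<^sub>m (Ei * \<Gamma>')) = tp (tp \<gamma> * tp (hi * E))" by (simp add: Ke sm)
      then have t: "z \<cdot>\<^sub>m (\<Gamma>' * tp Ei) = hi * (E * \<gamma>)"
        using transpose_mult[OF tg(3) tg(7)] transpose_mult[OF c(2) cG(2)] by (simp add: tsm)
      have tE: "tp Ei \<in> MM" by simp
      have "A * \<gamma> = \<tau> \<cdot>\<^sub>m (hm * (hi * (E * \<gamma>)))"
        using assoc_mult_mat[OF cg(3,4) mult_carrier_mat[OF c(1) c\<gamma>]] by (simp add: A_def sm gg)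
      also have "\<dots> = (\<tau> * z) \<cdot>\<^sub>m (hm * (\<Gamma>' * tp Ei))" unfolding t[symmetric] using tE by (simp add: sm)
      also have "\<dots> = \<gamma>' * tp Ai"
      proof -
        have "\<zeta> * (1 / \<tau>) = \<tau> * z" using \<tau> by (simp add: \<zeta>_def field_simps \<tau>(1)[symmetric])
        then show ?thesis using tE by (simp add: \<gamma>'_def Hz_def Ai_def sm tsm)
      qed
      finally show ?thesis .
    qed
    have I2: "tp Hi * tp Ai = C * \<gamma> + tp Ai * tp gi"
    proof -
      have "tp J = tp A * (tp Hi * tp Ai)" unfolding J_def by (simp add: transpose_mult[of _ n n _ n])
      moreover have "tp J = tp gi - b2 * \<gamma>" unfolding I1 using transpose_minus[OF cg(2) mult_carrier_mat[OF tg(3) c(3)]] transpose_mult[OF tg(3) c(3)] by simp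
      ultimately have "tp Ai * (tp A * (tp Hi * tp Ai)) = tp Ai * (tp gi - b2 * \<gamma>)" by simp
      then have "tp Hi * tp Ai = tp Ai * (tp gi - b2 * \<gamma>)" by (simp add: cancA)
      also have "\<dots> = tp Ai * tp gi - tp Ai * (b2 * \<gamma>)" by (rule mult_minus_distrib_mat[of _ n n _ n]) simp_all
      also have "\<dots> = - (tp Ai * (b2 * \<gamma>)) + tp Ai * tp gi"
        using comm_add_mat[of "- (tp Ai * (b2 * \<gamma>))" n n "tp Ai * tp gi"] by (simp add: mat_group_rules(3)[of _ n])
      finally show ?thesis by (simp add: C_def)
    qed
    have I5: "tp Hi * C = C * gm"
    proof -
      have "tp (b2 * J) = tp A * (tp Hi * (tp Ai * b2))" unfolding J_def by (simp add: transpose_mult[of _ n n _ n])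
      moreover have "tp (b2 * J) = b2 * gm" unfolding I4 by (simp add: transpose_mult[of _ n n _ n])
      ultimately have "tp Ai * (tp A * (tp Hi * (tp Ai * b2))) = tp Ai * (b2 * gm)" by simp
      then have "tp Hi * (tp Ai * b2) = tp Ai * (b2 * gm)" by (simp add: cancA)
      then show ?thesis by (simp add: C_def)
    qed
    have I6: "A * gm = Hz * A + \<gamma>' * C"
    proof -
      define Ji where "Ji = Ai * (Hz * A)"
      have cJi: "Ji \<in> MM" by (simp add: Ji_def)
      have "J * Ji = Ai * (Hi * (A * (Ai * (Hz * A))))" by (simp add: J_def Ji_def)
      also have "\<dots> = Ai * ((Hi * Hz) * A)" by (simp add: cancA)
      also have "\<dots> = 1\<^sub>m n" by (simp add: HH AA)
      finally have JJ: "J * Ji = 1\<^sub>m n" .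
      have gt: "gm * tp \<gamma> = \<gamma> * tp gm" by (simp add: \<gamma>_def transpose_mult[of _ n n _ n])
      have cgb: "\<gamma> * b2 \<in> MM" "gm + \<gamma> * b2 \<in> MM" by simp_all
      \<comment> \<open>By \<open>I1\<close> and \<open>I4\<close> this sum is a left inverse of
        \<open>J\<close> and therefore equal to \<open>Ji\<close>.\<close>
      have "(gm + \<gamma> * b2) * J = gm * J + \<gamma> * b2 * J" by (rule add_mult_distrib_mat[of _ n n _ _ n]) simp_all
      also have "gm * J = gm * gi - gm * (tp \<gamma> * b2)" unfolding I1 by (rule mult_minus_distrib_mat[of _ n n _ n]) simp_all
      also have "gm * (tp \<gamma> * b2) = \<gamma> * (tp gm * b2)" using assoc_mult_mat[OF cg(1) tg(3) c(3)] gt by simp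
      also have "\<gamma> * b2 * J = \<gamma> * (tp gm * b2)" by (simp add: I4)
      also have "gm * gi - \<gamma> * (tp gm * b2) + \<gamma> * (tp gm * b2) = 1\<^sub>m n" by (simp add: gg mat_group_rules(2)[of _ n])
      finally have one': "(gm + \<gamma> * b2) * J = 1\<^sub>m n" .
      have "gm + \<gamma> * b2 = (gm + \<gamma> * b2) * (J * Ji)" unfolding JJ by simp
      also have "\<dots> = Ji" using assoc_mult_mat[OF cgb(2) cJ cJi] cJi by (simp add: one')
      finally have "A * (gm + \<gamma> * b2) = Hz * A" by (simp add: Ji_def cancA)
      then have s: "A * gm + A * (\<gamma> * b2) = Hz * A" using mult_add_distrib_mat[OF c(4) cg(1) cgb(1)] by simp
      have "A * (\<gamma> * b2) = \<gamma>' * (tp Ai * b2)" using assoc_mult_mat[OF c(4) c\<gamma> c(3)] by (simp add: I3)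
      then show ?thesis unfolding s[symmetric] by (simp add: C_def mat_group_rules(5)[of _ n] del: assoc_add_mat)
    qed
    define DB where "DB = fb gm \<gamma> (0\<^sub>m n n) (tp gi)"
    define DB' where "DB' = fb Hz \<gamma>' (0\<^sub>m n n) (tp Hi)"
    define D' where "D' = fb Hz (0\<^sub>m n n) (0\<^sub>m n n) (tp Hi)"
    have cD: "DB \<in> MN" "DB' \<in> MN" "D' \<in> MN" by (simp_all add: DB_def DB'_def D'_def)
    \<comment> \<open>The intertwining relations of the three factors of \<open>x\<close>, namely
      the shear by \<open>- B\<close>, the matrix \<open>y\<close> and the shear by
      \<open>B'\<close>, compose to the one for \<open>x\<close>.\<close>
    have 1: "Uu (- B) * Dg g = DB * Uu (- B)"
    proof -
      have "Uu (- B) * Dg g = fb gm (- (B * tp gi)) (0\<^sub>m n n) (tp gi)"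
        unfolding Uu_def Dg_def gm_def[symmetric] gi_def[symmetric] by (subst fb_mult) (use B nB in simp_all)
      moreover have "- (gm * B) + \<gamma> = - (B * tp gi)" unfolding \<gamma>e by (rule mat_group_rules(1)[of _ n]) (use B in simp_all)
      moreover have "DB * Uu (- B) = fb gm (- (gm * B) + \<gamma>) (0\<^sub>m n n) (tp gi)"
        unfolding Uu_def DB_def by (subst fb_mult) (use B nB in simp_all)
      ultimately show ?thesis by simp
    qed
    have 2: "y * DB = DB' * y"
    proof -
      have "y * DB = fb (A * gm) (A * \<gamma>) (C * gm) (C * \<gamma> + tp Ai * tp gi)"
        unfolding y_def DB_def by (subst fb_mult) simp_all
      moreover have "DB' * y = fb (Hz * A + \<gamma>' * C) (\<gamma>' * tp Ai) (tp Hi * C) (tp Hi * tp Ai)"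
        unfolding y_def DB'_def by (subst fb_mult) simp_all
      ultimately show ?thesis by (simp only: I2 I3 I5 I6)
    qed
    have 3: "Uu B' * DB' = D' * Uu B'"
    proof -
      have "Uu B' * DB' = fb Hz (\<gamma>' + B' * tp Hi) (0\<^sub>m n n) (tp Hi)"
        unfolding Uu_def DB'_def by (subst fb_mult) (use B in simp_all)
      moreover have "\<gamma>' + B' * tp Hi = Hz * B'" unfolding \<gamma>'e by (rule mat_group_rules(2)[of _ n]) (use B in simp_all)
      moreover have "D' * Uu B' = fb Hz (Hz * B') (0\<^sub>m n n) (tp Hi)"
        unfolding Uu_def D'_def by (subst fb_mult) (use B in simp_all)
      ultimately show ?thesis by simp
    qed
    have D'e: "D' = \<zeta> \<cdot>\<^sub>m Dg h"
      unfolding D'_def Dg_def Hz_def Hi_def hm_def[symmetric] hi_def[symmetric] tsm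
      using carrier_matD[OF cg(3)] carrier_matD[OF cg(4)] by (intro eq_matI) auto
    have cx: "Uu B' \<in> MN" "Uu (- B) \<in> MN" "Dg g \<in> MN" "Dg h \<in> MN" "x \<in> MN" using g h sx by (simp_all add: sp_def)
    have "x * Dg g = Uu B' * (y * (Uu (- B) * Dg g))" unfolding x_def using cx by simp
    also have "\<dots> = Uu B' * ((y * DB) * Uu (- B))" unfolding 1 using cx cD by simp
    also have "\<dots> = (Uu B' * DB') * (y * Uu (- B))" unfolding 2 using cx cD by simp
    also have "\<dots> = D' * x" unfolding 3 x_def using cx cD by simp
    also have "\<dots> = \<zeta> \<cdot>\<^sub>m (Dg h * x)" unfolding D'e by (rule mult_smult_assoc_mat[OF cx(4,5)])
    finally have "(g, h, \<zeta>) \<in> Rel x" using g h \<zeta> by (auto simp: Rel_def)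
    then show ?thesis by blast
  qed
  have "sdat B B' x"
    unfolding sdat_def
    by (intro conjI sx exI[of _ A] exI[of _ C] exI[of _ "tp Ai"] exI[of _ "tp A"] ballI rel) (simp_all add: AAt xU y_def)
  then show ?thesis by blast
qed

end

section \<open>Orbits under the automorphism group of the representation\<close>

lemma auto_inverse:
  fixes G :: "('a, 'b) monoid_scheme"
  assumes "group G" "\<phi> \<in> auto G"
  shows "\<exists>\<psi>\<in>auto G. \<forall>g\<in>carrier G. \<phi> (\<psi> g) = g"
proof -
  interpret A: group "AutoGroup G" by (rule group.AutoGroup[OF assms(1)])
  have c: "carrier (AutoGroup G) = auto G" by (simp add: AutoGroup_def)
  have B: "\<phi> \<in> Bij (carrier G)" if "\<phi> \<in> auto G" for \<phi> using that by (simp add: auto_def)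
  obtain \<psi> where \<psi>: "\<psi> \<in> auto G" "\<phi> \<otimes>\<^bsub>AutoGroup G\<^esub> \<psi> = \<one>\<^bsub>AutoGroup G\<^esub>"
    using A.r_inv_ex[of \<phi>] assms(2) c by auto
  then have "compose (carrier G) \<phi> \<psi> = (\<lambda>x\<in>carrier G. x)"
    using B[OF assms(2)] B[OF \<psi>(1)] by (simp add: AutoGroup_def BijGroup_def)
  then have "\<phi> (\<psi> g) = g" if "g \<in> carrier G" for g using fun_cong[of _ _ g] that by (metis compose_eq restrict_apply')
  then show ?thesis using \<psi>(1) by blast
qed

lemma auto_compose:
  fixes G :: "('a, 'b) monoid_scheme"
  assumes "group G" "\<phi> \<in> auto G" "\<psi> \<in> auto G"
  shows "compose (carrier G) \<phi> \<psi> \<in> auto G"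
proof -
  interpret A: group "AutoGroup G" by (rule group.AutoGroup[OF assms(1)])
  have c: "carrier (AutoGroup G) = auto G" by (simp add: AutoGroup_def)
  have B: "\<phi> \<in> Bij (carrier G)" if "\<phi> \<in> auto G" for \<phi> using that by (simp add: auto_def)
  have "\<phi> \<otimes>\<^bsub>AutoGroup G\<^esub> \<psi> \<in> auto G" using A.m_closed[of \<phi> \<psi>] assms c by simp
  then show ?thesis using B assms by (simp add: AutoGroup_def BijGroup_def)
qed

lemma auto_closed: "\<phi> \<in> auto G ==> g \<in> carrier G ==> \<phi> g \<in> carrier G"
  by (auto simp: auto_def hom_def)

context grepu
begin

text \<open>The linear part of an element of \<open>Aut_rep\<close> together with its inverse. The
  action on \<open>S2 n\<close> does not involve the automorphism of \<open>G\<close>, so that is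
  only required to exist.\<close>

definition twisted_auto :: "complex mat => complex mat => bool" where
  "twisted_auto w wi \<longleftrightarrow> w \<in> MM \<and> wi \<in> MM \<and> w * wi = 1\<^sub>m n \<and> wi * w = 1\<^sub>m n \<and>
    (\<exists>\<phi>\<in>auto G. \<forall>g\<in>carrier G. w * \<rho> g = \<rho> (\<phi> g) * w)"

lemma twisted_auto_mult:
  assumes "twisted_auto w wi" "twisted_auto v vi"
  shows "twisted_auto (w * v) (vi * wi)"
proof -
  obtain \<phi> \<psi> where a: "\<phi> \<in> auto G" "\<psi> \<in> auto G" "\<forall>g\<in>carrier G. w * \<rho> g = \<rho> (\<phi> g) * w" "\<forall>g\<in>carrier G. v * \<rho> g = \<rho> (\<psi> g) * v"
    using assms unfolding twisted_auto_def by blast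
  have c: "w \<in> MM" "wi \<in> MM" "v \<in> MM" "vi \<in> MM" and i: "w * wi = 1\<^sub>m n" "wi * w = 1\<^sub>m n" "v * vi = 1\<^sub>m n" "vi * v = 1\<^sub>m n"
    using assms unfolding twisted_auto_def by blast+
  have "w * v * (vi * wi) = w * ((v * vi) * wi)" "vi * wi * (w * v) = vi * ((wi * w) * v)" using c by simp_all
  then have 1: "w * v * (vi * wi) = 1\<^sub>m n" "vi * wi * (w * v) = 1\<^sub>m n" using c i by simp_all
  have "w * v * \<rho> g = \<rho> (compose (carrier G) \<phi> \<psi> g) * (w * v)" if g: "g \<in> carrier G" for g
  proof -
    have p: "\<psi> g \<in> carrier G" "\<phi> (\<psi> g) \<in> carrier G" using g a auto_closed by metis+
    have cc: "\<rho> g \<in> MM" "\<rho> (\<psi> g) \<in> MM" "\<rho> (\<phi> (\<psi> g)) \<in> MM" using g p by simp_all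
    have "w * v * \<rho> g = w * (\<rho> (\<psi> g) * v)" using c cc a(4) g by simp
    also have "\<dots> = (\<rho> (\<phi> (\<psi> g)) * w) * v" using c cc a(3) p(1) assoc_mult_mat[OF c(1) cc(2) c(3)] by simp
    finally show ?thesis using c cc g by (simp add: compose_eq)
  qed
  then show ?thesis using 1 c auto_compose[OF is_group a(1,2)] unfolding twisted_auto_def by (intro conjI bexI[of _ "compose (carrier G) \<phi> \<psi>"]) auto
qed

lemma twisted_auto_inv:
  assumes "twisted_auto w wi"
  shows "twisted_auto wi w"
proof -
  obtain \<phi> where a: "\<phi> \<in> auto G" "\<forall>g\<in>carrier G. w * \<rho> g = \<rho> (\<phi> g) * w"
    using assms unfolding twisted_auto_def by blast
  have c: "w \<in> MM" "wi \<in> MM" and i: "w * wi = 1\<^sub>m n" "wi * w = 1\<^sub>m n"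
    using assms unfolding twisted_auto_def by blast+
  obtain \<psi> where p: "\<psi> \<in> auto G" "\<forall>g\<in>carrier G. \<phi> (\<psi> g) = g" using auto_inverse[OF is_group a(1)] by blast
  have "wi * \<rho> g = \<rho> (\<psi> g) * wi" if g: "g \<in> carrier G" for g
  proof -
    have pg: "\<psi> g \<in> carrier G" using g p auto_closed by metis
    have cc: "\<rho> g \<in> MM" "\<rho> (\<psi> g) \<in> MM" using g pg by simp_all
    have "wi * \<rho> g = wi * (\<rho> g * (w * wi))" using cc by (simp add: i)
    also have "\<dots> = wi * ((\<rho> g * w) * wi)" using c cc by simp
    also have "\<rho> g * w = w * \<rho> (\<psi> g)" using a(2) pg p(2) g by simp
    also have "wi * (w * \<rho> (\<psi> g) * wi) = (wi * w) * (\<rho> (\<psi> g) * wi)" using c cc by simp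
    finally show ?thesis using c cc by (simp add: i)
  qed
  then show ?thesis using c i p(1) unfolding twisted_auto_def by blast
qed

lemma twisted_auto_one: "EndG w ==> wi \<in> MM ==> w * wi = 1\<^sub>m n ==> wi * w = 1\<^sub>m n ==> twisted_auto w wi"
  unfolding twisted_auto_def EndG_def using id_in_auto by (intro conjI bexI[of _ "\<lambda>x\<in>carrier G. x"]) auto

definition orb :: "complex mat => complex mat set" where
  "orb x = {w * x * tp w | w. \<exists>wi. twisted_auto w wi}"

lemma orb_eq:
  assumes w: "twisted_auto w wi" and x: "x \<in> MM"
  shows "orb (w * x * tp w) = orb x"
proof -
  have c: "w \<in> MM" "wi \<in> MM" and i: "wi * w = 1\<^sub>m n" using w unfolding twisted_auto_def by blast+
  have comp: "v * (w * x * tp w) * tp v = (v * w) * x * tp (v * w)" if "v \<in> MM" "w \<in> MM" "x \<in> MM" for v w x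
    unfolding transpose_mult[OF that(1,2)] using that by simp
  show ?thesis
  proof
    show "orb (w * x * tp w) \<subseteq> orb x"
    proof
      fix y assume "y \<in> orb (w * x * tp w)"
      then obtain v vi where v: "twisted_auto v vi" "y = v * (w * x * tp w) * tp v" unfolding orb_def by blast
      have cv: "v \<in> MM" using v(1) unfolding twisted_auto_def by blast
      show "y \<in> orb x" unfolding v(2) comp[OF cv c(1) x] orb_def using twisted_auto_mult[OF v(1) w] by blast
    qed
    show "orb x \<subseteq> orb (w * x * tp w)"
    proof
      fix y assume "y \<in> orb x"
      then obtain v vi where v: "twisted_auto v vi" "y = v * x * tp v" unfolding orb_def by blast
      have cv: "v \<in> MM" using v(1) unfolding twisted_auto_def by blast
      have cvw: "v * wi \<in> MM" using cv c by simp
      have "v * wi * w = v" using cv c i by simp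
      then have "y = (v * wi) * (w * x * tp w) * tp (v * wi)" unfolding comp[OF cvw c(1) x] v(2) by simp
      then show "y \<in> orb (w * x * tp w)" unfolding orb_def using twisted_auto_mult[OF v(1) twisted_auto_inv[OF w]] by blast
    qed
  qed
qed

lemma orbit_orb:
  assumes x: "x \<in> S2 n"
  shows "orbit (Aut_rep G n \<rho>) (Aut_rep_action n) x = orb x"
proof -
  have "carrier (Aut_rep G n \<rho>) = {(\<phi>, \<eta>). \<phi> \<in> auto G \<and> \<eta> \<in> Units (ring_mat TYPE(complex) n ()) \<and> (\<forall>g\<in>carrier G. \<eta> * \<rho> g = \<rho> (\<phi> g) * \<eta>)}"
    by (simp add: Aut_rep_def units_of_def)
  moreover have "\<eta> \<in> Units (ring_mat TYPE(complex) n ()) \<longleftrightarrow> \<eta> \<in> MM \<and> (\<exists>wi\<in>MM. wi * \<eta> = 1\<^sub>m n \<and> \<eta> * wi = 1\<^sub>m n)" for \<eta>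
    by (auto simp: Units_def ring_mat_def)
  ultimately show ?thesis
    unfolding orbit_def orb_def twisted_auto_def Aut_rep_action_def using x
    by (auto simp: tensor_square_def)
qed

lemma finite_twist_orbits:
  assumes B: "B \<in> S2 n" and inv: "S2_invariants G n \<rho> = {0\<^sub>m n n}"
  shows "finite {X \<in> orbits (Aut_rep G n \<rho>) (S2 n) (Aut_rep_action n).
    \<exists>B'\<in>X. twist_equivalent (dual_hopf (HA B)) (dual_hopf (HA B'))}" (is "finite ?X")
proof -
  define Bs where "Bs = {B' \<in> S2 n. twist_equivalent (dual_hopf (HA B)) (dual_hopf (HA B'))}"
  have S2: "x \<in> MM" "tp x = x" if "x \<in> S2 n" for x using that by (auto simp: S2_def)
  \<comment> \<open>The equivalent element \<open>B'\<close> of an orbit represents it, so it is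
    enough to bound the orbits of the elements of \<open>Bs\<close>.\<close>
  have "?X \<subseteq> orb ` Bs"
  proof
    fix X assume "X \<in> ?X"
    then obtain x B' where x: "x \<in> S2 n" "X = orb x" "B' \<in> X" "twist_equivalent (dual_hopf (HA B)) (dual_hopf (HA B'))"
      unfolding orbits_def using orbit_orb by auto
    then obtain w wi where w: "twisted_auto w wi" "B' = w * x * tp w" unfolding orb_def by blast
    have c: "w \<in> MM" "tp w \<in> MM" using w(1) unfolding twisted_auto_def by auto
    have "tp B' = B'" unfolding w(2) using c S2[OF x(1)] by (simp add: transpose_mult[of _ n n _ n])
    then have "B' \<in> Bs" using x(4) c S2[OF x(1)] unfolding Bs_def S2_def by (simp add: w(2))
    moreover have "X = orb B'" unfolding x(2) w(2) by (rule orb_eq[OF w(1) S2(1)[OF x(1)], symmetric])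
    ultimately show "X \<in> orb ` Bs" by blast
  qed
  moreover have "finite (orb ` Bs)"
  proof (cases "n = 0")
    \<comment> \<open>Twist data need at least one vector; for \<open>n = 0\<close> the set
      \<open>S2 n\<close> has a single element.\<close>
    case True
    have "Bs \<subseteq> {0\<^sub>m 0 0}" using True by (auto simp: Bs_def S2_def)
    then show ?thesis using finite_subset by blast
  next
    case False
    have inv0: "S = 0\<^sub>m n n" if "S \<in> MM" "tp S = S" "\<And>h. h \<in> carrier G ==> \<rho> h * S * tp (\<rho> h) = S" for S
    proof -
      have "S \<in> S2_invariants G n \<rho>" using that by (auto simp: S2_invariants_def S2_def tensor_square_def)
      then show ?thesis using inv by simp
    qed
    show ?thesis
    proof (rule finite_orbits[OF inv0, of Bs B])
      fix B1 assume b: "B1 \<in> Bs"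
      then have s: "B1 \<in> S2 n" and te: "twist_equivalent (dual_hopf (HA B)) (dual_hopf (HA B1))" by (auto simp: Bs_def)
      obtain f s s' sr t tr \<eta> \<eta>i \<sigma> bb c where "twist_data G n \<rho> u B B1 f s s' sr t tr \<eta> \<eta>i \<sigma> bb c"
        using exists_twist_data[OF S2(1)[OF B] S2(2)[OF B] S2(1)[OF s] S2(2)[OF s] _ te] False by blast
      then interpret D: twist_data G n \<rho> u B B1 f s s' sr t tr \<eta> \<eta>i \<sigma> bb c .
      show "B1 \<in> MM \<and> (\<exists>x. sdat B B1 x)" using D.sdat_exists S2(1)[OF s] by blast
    next
      fix B1 B2 w wi assume "B1 \<in> Bs" "EndG w" "wi \<in> MM" "w * wi = 1\<^sub>m n" "wi * w = 1\<^sub>m n" "B2 = w * B1 * tp w"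
      then show "orb B1 = orb B2" using orb_eq[OF twisted_auto_one] S2(1) by (auto simp: Bs_def)
    qed
  qed
  ultimately show ?thesis by (rule finite_subset)
qed

end

theorem theorem3p1:
  fixes G :: "('g, 'x) monoid_scheme" (structure)
    and n :: nat
    and \<rho> :: "'g \<Rightarrow> complex mat"
    and u :: 'g
    and B :: "complex mat"
  assumes "group G" and "finite (carrier G)"
    and "representation G n \<rho>"
    and "u \<in> carrier G" and "\<forall>g\<in>carrier G. u \<otimes> g = g \<otimes> u"
    and "group.ord G u = 2"
    and "\<rho> u = - 1\<^sub>m n"
    and "B \<in> S2 n"
    and "S2_invariants G n \<rho> = {0\<^sub>m n n}"
  shows "finite {X \<in> orbits (Aut_rep G n \<rho>) (S2 n) (Aut_rep_action n).
           \<exists>B'\<in>X. twist_equivalent (dual_hopf (hopf_A G n \<rho> u B)) (dual_hopf (hopf_A G n \<rho> u B'))}"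
proof -
  interpret group G by (rule assms(1))
  interpret grepu G n \<rho> u
    by unfold_locales (use assms in auto)
  show ?thesis by (rule finite_twist_orbits[OF assms(8,9)])
qed

end
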